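(* Let $A\in\mathcal{Y}(p_0,p_1)$ ($1\le p_0\le p_1<\infty$) be a Young function and $T$ an $\overline{A}$-Hörmander operator on $\mathbb{R}^n$. Assume that $A$ is submultiplicative, i.e. $A(xy)\le A(x)A(y)$. Then there is a constant $c_{n,A,T}$ depending only on $n,A,T$ such that for every weight $w$, every Young function $\varphi$, every $\lambda>0$ and every $f\in\mathcal{C}_c^\infty(\mathbb{R}^n)$, $$w\left(\{x\in\mathbb{R}^n:Tf(x)>\lambda\}\right)\le c_{n,A,T}\,\kappa_\varphi\int_{\mathbb{R}^n}A\left(\frac{|f(x)|}\lambda\right)M_\varphi w(x)\,dx,$$ where $$\kappa_\varphi=\int_1^\infty\frac{\varphi^{-1}(t)\,A(\log(e+t)^2)}{t^2\log(e+t)^3}\,dt.$$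
   Context: Cubes $Q\subset\mathbb{R}^n$ have sides parallel to the axes, $l(Q)$ is the side length, $cQ$ is the concentric dilate. A weight is a non-negative locally integrable function and $w(E)=\int_Ew$. A Young function is a continuous, convex, increasing $A:[0,\infty)\to[0,\infty)$ with $A(0)=0$; $\overline{A}(t)=\sup_{s>0}\{st-A(s)\}$; $\|f\|_{A,Q}=\inf\{\lambda>0:\frac1{|Q|}\int_QA(|f|/\lambda)\le1\}$; $M_Af(x)=\sup_{Q\ni x}\|f\|_{A,Q}$; $\varphi^{-1}$ is the inverse function. For $A(t)=t$, $\|\cdot\|_{\overline A,Q}$ is understood as the $L^\infty(Q)$ norm. Powers of logarithms: $\log(e+t)^k=(\log(e+t))^k$. $\mathcal{Y}(p_0,p_1)$: functions $A$ for which there are $c_{A,p_0},c_{A,p_1},t_A\ge1$ with $t^{p_0}\le c_{A,p_0}A(t)$ for $t>t_A$ and $t^{p_1}\le c_{A,p_1}A(t)$ for $t\le t_A$. For a Young function $E$, an $E$-Hörmander operator is a linear operator $T$ bounded on $L^2(\mathbb{R}^n)$ with $Tf(x)=\int K(x,y)f(y)\,dy$ for $f\in\mathcal{C}_c^\infty$, $x\notin\operatorname{supp}f$, where $K:\mathbb{R}^n\times\mathbb{R}^n\setminus\{(x,x)\}\to\mathbb{R}$ is locally integrable away from the diagonal, satisfies $|K(x,y)|\le c_K|x-y|^{-n}$, and $H_{K,E}=\max\{H_{K,E,1},H_{K,E,2}\}<\infty$, with $$H_{K,E,1}=\sup_Q\sup_{x,z\in\frac12Q}\sum_{k=1}^\infty(2^kl(Q))^n\|(K(x,\cdot)-K(z,\cdot))\chi_{2^kQ\setminus2^{k-1}Q}\|_{E,2^kQ}$$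 and $H_{K,E,2}$ the same with $K(\cdot,x)-K(\cdot,z)$. *)

theory Defs
  imports "HOL-Analysis.Analysis"
begin

section \<open>Cubes\<close>

text \<open>Closed cube with centre \<open>c\<close> and side length \<open>l\<close>; its dilate by a factor \<open>a\<close> is
  \<open>cube c (a * l)\<close>. Only cubes with \<open>l > 0\<close> are used.\<close>

definition cube :: "real ^ 'n \<Rightarrow> real \<Rightarrow> (real ^ 'n) set" where
  "cube c l = cbox (c - (\<chi> i. l / 2)) (c + (\<chi> i. l / 2))"


section \<open>Young functions\<close>

text \<open>Functions on \<open>[0,\<infinity>)\<close> are rendered as functions on the reals of which only the values on
  \<open>{0..}\<close> matter. A strictly increasing convex function vanishing at 0 is a bijection of
  \<open>{0..}\<close>, so \<open>the_inv_into {0..} \<phi>\<close> is its inverse function.\<close>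

definition young_function :: "(real \<Rightarrow> real) \<Rightarrow> bool" where
  "young_function A \<longleftrightarrow>
     continuous_on {0..} A \<and> convex_on {0..} A \<and> strict_mono_on {0..} A \<and> A 0 = 0"

definition submultiplicative :: "(real \<Rightarrow> real) \<Rightarrow> bool" where
  "submultiplicative A \<longleftrightarrow> (\<forall>x\<ge>0. \<forall>y\<ge>0. A (x * y) \<le> A x * A y)"

definition class_Y :: "real \<Rightarrow> real \<Rightarrow> (real \<Rightarrow> real) set" where
  "class_Y p0 p1 = {A. \<exists>c0\<ge>1. \<exists>c1\<ge>1. \<exists>tA\<ge>1.
     (\<forall>t>tA. t powr p0 \<le> c0 * A t) \<and>
     (\<forall>t. 0 \<le> t \<and> t \<le> tA \<longrightarrow> t powr p1 \<le> c1 * A t)}"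

text \<open>The complementary function may take the value \<open>\<infinity>\<close>. For \<open>t \<ge> 0\<close> the supremum of
  \<open>s * t - A s\<close> over \<open>s > 0\<close> is never negative (let \<open>s\<close> tend to 0), so truncating the
  individual terms at 0, as \<open>ennreal\<close> does, leaves it unchanged.\<close>

definition complementary :: "(real \<Rightarrow> real) \<Rightarrow> real \<Rightarrow> ennreal" where
  "complementary A t = (SUP s\<in>{0<..}. ennreal (s * t - A s))"

text \<open>The gauge \<open>E\<close> is allowed to be extended-valued so that it can be a complementary function.
  The infimum of the empty set is \<open>\<infinity>\<close>.\<close>

definition luxemburg :: "(real \<Rightarrow> ennreal) \<Rightarrow> (real ^ 'n) set \<Rightarrow> (real ^ 'n \<Rightarrow> real) \<Rightarrow> ennreal" where
  "luxemburg E Q f =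
     Inf {ennreal r | r. 0 < r \<and>
       (\<integral>\<^sup>+ y\<in>Q. E (\<bar>f y\<bar> / r) \<partial>lebesgue) / emeasure lebesgue Q \<le> 1}"

text \<open>For \<open>A(t) = t\<close> the complementary function is 0 on \<open>[0,1]\<close> and \<open>\<infinity>\<close> beyond, and the
  associated norm is the essential supremum over \<open>Q\<close>, so this case needs no separate convention.\<close>

lemma complementary_id: "complementary (\<lambda>t. t) t = (if t \<le> 1 then 0 else \<infinity>)"
proof (cases "t \<le> 1")
  case True
  have "s * t - s \<le> 0" if "0 < s" for s
    using that True by (simp add: mult_left_le)
  then show ?thesis
    using True by (auto simp: complementary_def ennreal_neg intro!: SUP_eq_const)
next
  case False
  have "complementary (\<lambda>t. t) t = \<infinity>"
    unfolding infinity_ennreal_def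
  proof (rule ccontr)
    assume "complementary (\<lambda>t. t) t \<noteq> top"
    then obtain B where B: "0 \<le> B" "complementary (\<lambda>t. t) t = ennreal B"
      by (cases "complementary (\<lambda>t. t) t") auto
    define s where "s = (B + 1) / (t - 1)"
    have s: "0 < s" "s * (t - 1) = B + 1"
      using False B(1) by (auto simp: s_def)
    then have s': "s * t - s = B + 1"
      by (simp add: algebra_simps)
    have "ennreal (s * t - s) \<le> complementary (\<lambda>t. t) t"
      unfolding complementary_def by (rule SUP_upper) (use s in auto)
    then show False
      using B s' by simp
  qed
  then show ?thesis using False by simp
qed

lemma luxemburg_complementary_id:
  fixes Q :: "(real ^ 'n) set"
  assumes Q: "Q \<in> lmeasurable" "emeasure lebesgue Q \<noteq> 0"
    and f: "f \<in> borel_measurable lebesgue"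
  shows "luxemburg (complementary (\<lambda>t. t)) Q f =
    Inf {ennreal r | r. 0 < r \<and> (AE y in lebesgue. y \<in> Q \<longrightarrow> \<bar>f y\<bar> \<le> r)}"
proof -
  have fin: "emeasure lebesgue Q \<noteq> \<infinity>"
    using Q(1) by (auto simp: fmeasurable_def)
  have Qs [measurable]: "Q \<in> sets lebesgue"
    using Q(1) by (simp add: fmeasurableD)
  have "((\<integral>\<^sup>+ y\<in>Q. complementary (\<lambda>t. t) (\<bar>f y\<bar> / r) \<partial>lebesgue) / emeasure lebesgue Q \<le> 1)
      \<longleftrightarrow> (AE y in lebesgue. y \<in> Q \<longrightarrow> \<bar>f y\<bar> \<le> r)" if r: "0 < r" for r
  proof -
    note f [measurable]
    define B where "B = {y \<in> space lebesgue. y \<in> Q \<and> r < \<bar>f y\<bar>}"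
    have B [measurable]: "B \<in> sets lebesgue"
      unfolding B_def by measurable
    have "complementary (\<lambda>t. t) (\<bar>f y\<bar> / r) * indicator Q y = \<infinity> * indicator B y" for y
      using r by (auto simp: complementary_id B_def field_simps split: split_indicator)
    then have "(\<integral>\<^sup>+ y\<in>Q. complementary (\<lambda>t. t) (\<bar>f y\<bar> / r) \<partial>lebesgue)
        = \<infinity> * emeasure lebesgue B"
      by (simp add: nn_integral_cmult_indicator)
    moreover have "(AE y in lebesgue. y \<in> Q \<longrightarrow> \<bar>f y\<bar> \<le> r) \<longleftrightarrow> emeasure lebesgue B = 0"
      by (subst AE_iff_measurable[OF B]) (auto simp: B_def not_le)
    moreover have "(\<infinity> * emeasure lebesgue B) / emeasure lebesgue Q \<le> 1
        \<longleftrightarrow> emeasure lebesgue B = 0"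
      using fin by (auto simp: ennreal_top_mult ennreal_top_divide top_unique)
    ultimately show ?thesis by simp
  qed
  then show ?thesis
    unfolding luxemburg_def by (intro arg_cong[where f = Inf]) blast
qed

definition maximal :: "(real \<Rightarrow> real) \<Rightarrow> (real ^ 'n \<Rightarrow> real) \<Rightarrow> real ^ 'n \<Rightarrow> ennreal" where
  "maximal \<phi> w x =
     (SUP (c, l)\<in>{(c, l). 0 < l \<and> x \<in> cube c l}. luxemburg (\<lambda>t. ennreal (\<phi> t)) (cube c l) w)"


section \<open>Function spaces\<close>

definition weight :: "(real ^ 'n \<Rightarrow> real) \<Rightarrow> bool" where
  "weight w \<longleftrightarrow> (\<forall>x. 0 \<le> w x) \<and> (\<forall>C. compact C \<longrightarrow> set_integrable lebesgue C w)"

text \<open>A function is of class \<open>C\<^sup>k\<^sup>+\<^sup>1\<close> iff it is differentiable and all its directional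
  derivatives are of class \<open>C\<^sup>k\<close>.\<close>

primrec C_k :: "nat \<Rightarrow> ('a::euclidean_space \<Rightarrow> real) \<Rightarrow> bool" where
  "C_k 0 f \<longleftrightarrow> continuous_on UNIV f"
| "C_k (Suc k) f \<longleftrightarrow>
     (\<forall>x. f differentiable (at x)) \<and> (\<forall>v. C_k k (\<lambda>x. frechet_derivative f (at x) v))"

definition supp :: "('a::euclidean_space \<Rightarrow> real) \<Rightarrow> 'a set" where
  "supp f = closure (support_on UNIV f)"

definition Cc_infinity :: "('a::euclidean_space \<Rightarrow> real) set" where
  "Cc_infinity = {f. (\<forall>k. C_k k f) \<and> compact (supp f)}"

definition L2 :: "('a::euclidean_space \<Rightarrow> real) set" where
  "L2 = {f. f \<in> borel_measurable lebesgue \<and> integrable lebesgue (\<lambda>x. (f x)\<^sup>2)}"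

text \<open>Operators on \<open>L\<^sup>2\<close> act on representatives, hence linearity holds almost everywhere.
  Linearity and boundedness make the image of a class independent of its representative.\<close>

definition bounded_linear_L2 :: "(('a::euclidean_space \<Rightarrow> real) \<Rightarrow> 'a \<Rightarrow> real) \<Rightarrow> bool" where
  "bounded_linear_L2 T \<longleftrightarrow>
     (\<forall>f\<in>L2. T f \<in> L2) \<and>
     (\<forall>f\<in>L2. \<forall>g\<in>L2. \<forall>a b. AE x in lebesgue. T (\<lambda>y. a * f y + b * g y) x = a * T f x + b * T g x) \<and>
     (\<exists>C. \<forall>f\<in>L2. (LINT x|lebesgue. (T f x)\<^sup>2) \<le> C * (LINT x|lebesgue. (f x)\<^sup>2))"


section \<open>Hoermander operators\<close>

definition hormander_const1 ::
    "(real \<Rightarrow> ennreal) \<Rightarrow> (real ^ 'n \<Rightarrow> real ^ 'n \<Rightarrow> real) \<Rightarrow> ennreal" where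
  "hormander_const1 E K =
     (SUP (c, l)\<in>{(c, l). 0 < l}. SUP x\<in>cube c (l / 2). SUP z\<in>cube c (l / 2).
        \<Sum>j. let k = Suc j in
          ennreal ((2 ^ k * l) ^ CARD('n)) *
          luxemburg E (cube c (2 ^ k * l))
            (\<lambda>y. (K x y - K z y) * indicator (cube c (2 ^ k * l) - cube c (2 ^ (k - 1) * l)) y))"

definition hormander_const ::
    "(real \<Rightarrow> ennreal) \<Rightarrow> (real ^ 'n \<Rightarrow> real ^ 'n \<Rightarrow> real) \<Rightarrow> ennreal" where
  "hormander_const E K = max (hormander_const1 E K) (hormander_const1 E (\<lambda>x y. K y x))"

text \<open>The values of \<open>K\<close> on the diagonal play no role. Measurability of all sections of \<open>K\<close> is
  presupposed by the norms in \<open>hormander_const\<close>.\<close>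

definition hormander_kernel ::
    "(real \<Rightarrow> ennreal) \<Rightarrow> (real ^ 'n \<Rightarrow> real ^ 'n \<Rightarrow> real) \<Rightarrow> bool" where
  "hormander_kernel E K \<longleftrightarrow>
     (\<forall>C. compact C \<and> C \<subseteq> {(x, y). x \<noteq> y} \<longrightarrow> set_integrable lebesgue C (\<lambda>(x, y). K x y)) \<and>
     (\<forall>x. (\<lambda>y. K x y) \<in> borel_measurable lebesgue \<and> (\<lambda>y. K y x) \<in> borel_measurable lebesgue) \<and>
     (\<exists>c. \<forall>x y. x \<noteq> y \<longrightarrow> \<bar>K x y\<bar> \<le> c / norm (x - y) ^ CARD('n)) \<and>
     hormander_const E K < \<infinity>"

text \<open>Since \<open>T f\<close> is an element of \<open>L\<^sup>2\<close>, the integral representation is required for almost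
  every point outside the support.\<close>

definition hormander_operator ::
    "(real \<Rightarrow> ennreal) \<Rightarrow> ((real ^ 'n \<Rightarrow> real) \<Rightarrow> real ^ 'n \<Rightarrow> real) \<Rightarrow> bool" where
  "hormander_operator E T \<longleftrightarrow>
     bounded_linear_L2 T \<and>
     (\<exists>K. hormander_kernel E K \<and>
        (\<forall>f\<in>Cc_infinity. AE x in lebesgue. x \<notin> supp f \<longrightarrow> T f x = (LINT y|lebesgue. K x y * f y)))"


section \<open>The constant attached to the maximal operator\<close>

definition kappa :: "(real \<Rightarrow> real) \<Rightarrow> (real \<Rightarrow> real) \<Rightarrow> ennreal" where
  "kappa A \<phi> =
     (\<integral>\<^sup>+ t\<in>{1..}. ennreal (the_inv_into {0..} \<phi> t * A ((ln (exp 1 + t)) ^ 2)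
                          / (t ^ 2 * (ln (exp 1 + t)) ^ 3)) \<partial>lebesgue)"

end

theory Submission
  imports Defs
begin

text \<open>Work with dyadic cubes \<open>Q\<close> and their triples \<open>3Q\<close>. By a Calderon-Zygmund decomposition \<open>T\<close> is of
  weak type (1,1). On a cube \<open>Q\<close> with \<open>2\<^sup>-\<^sup>k\<close> comparable to the Luxemburg norm of \<open>f\<close> over \<open>3Q\<close>, a
  stopping time argument bounds \<open>T (f \<chi>\<^bsub>3Q\<^esub>)\<close> by a multiple of \<open>2\<^sup>-\<^sup>k\<close> off a family of subcubes of half
  the total measure, and on each such subcube \<open>P\<close> by \<open>T (f \<chi>\<^bsub>3P\<^esub>)\<close> plus such a multiple: the
  Hoermander condition controls the oscillation of the rest on \<open>P\<close>. Iteration dominates \<open>T f\<close> by a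
  sparse sum \<open>\<Sum> 2\<^sup>-\<^sup>k \<chi>\<^bsub>Q\<^esub>\<close> off the set where a maximal function of \<open>A (|f|)\<close> exceeds 1, and that set
  obeys the claim directly.

  For the sparse sum, take the cubes of one level \<open>k\<close>. The part of their overlap below a height of
  order \<open>2\<^sup>k\<^sup>/\<^sup>2\<close> contributes a summable multiple of the weight of the level set in question and is
  absorbed. The overlap exceeds this height only on an exponentially small part of each cube, where
  the weight is at most the \<open>\<phi>\<close>-mean of \<open>w\<close> times \<open>\<phi>\<^sup>-\<^sup>1(\<tau>) / \<tau>\<close> with \<open>\<tau> = exp (2 * 2\<^sup>k\<^sup>/\<^sup>2)\<close>; by
  submultiplicativity the measure of a cube of level \<open>k\<close> is at most \<open>A (2\<^sup>k\<^sup>+\<^sup>1)\<close> times a mass of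
  \<open>A (|f|)\<close> with bounded overlap. Summation over \<open>k\<close> is the integral \<open>kappa\<close>.\<close>

section \<open>Dyadic cubes\<close>

text \<open>The left side carries no maximal function, whereas every bound for a sparse sum costs a
  multiple of \<open>w\<close>. The remedy is to test only on the level set \<open>G\<close> itself:
  low overlap costs \<open>sig0\<close> times the weight of \<open>G\<close>, and \<open>G\<close>
  is cut at height \<open>2 * sig0\<close>, so this cost is absorbed. Absorption needs a finite
  weight, hence bounded sets and finite families until the end.

  Luxemburg norms of \<open>f\<close> are never formed. Level \<open>k\<close> of a cube is encoded
  by two inequalities for the mass of \<open>A (2 ^ k * |f|)\<close> on its triple: the upper one
  feeds the stopping argument and the Hoermander condition, the lower one pays for the measure of
  the cube by mass. The complementary function enters only through Young's inequality on the rings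
  of the Hoermander condition.

  Levels start at 0, so the estimate is proved at one fixed height \<open>LM\<close>; scaling and
  submultiplicativity restore \<open>lam\<close>. The grid has a coarsest scale \<open>L\<close>,
  chosen after \<open>f\<close>, on which no constant depends. The kernel represents
  \<open>T\<close> only on smooth functions, but the proof cuts \<open>f\<close> sharply along
  cubes, so the representation is carried over to such pieces through dyadic step functions.\<close>

type_synonym 'n cell = "nat \<times> (int ^ 'n)"

text \<open>\<open>nb L r (k, m)\<close> is the half-open cube of side \<open>(2 r + 1) L / 2\<^sup>k\<close> that is concentric with
  the dyadic cube of generation \<open>k\<close> and index \<open>m\<close>; so \<open>nb L 0\<close> is the dyadic cube itself.\<close>

definition nb :: "real \<Rightarrow> int \<Rightarrow> ('n::finite) cell \<Rightarrow> (real ^ 'n) set" where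
  "nb L r q = {x. \<forall>i. \<bar>\<lfloor>2 ^ fst q * x $ i / L\<rfloor> - snd q $ i\<bar> \<le> r}"

abbreviation dy :: "real \<Rightarrow> ('n::finite) cell \<Rightarrow> (real ^ 'n) set" where
  "dy L \<equiv> nb L 0"

definition edge :: "real \<Rightarrow> ('n::finite) cell \<Rightarrow> real" where
  "edge L q = L / 2 ^ fst q"

definition vol :: "real \<Rightarrow> ('n::finite) cell \<Rightarrow> real" where
  "vol L q = edge L q ^ CARD('n)"

definition ctr :: "real \<Rightarrow> ('n::finite) cell \<Rightarrow> real ^ 'n" where
  "ctr L q = (\<chi> i. edge L q * (snd q $ i + 1 / 2))"

definition idx :: "real \<Rightarrow> nat \<Rightarrow> real ^ 'n \<Rightarrow> ('n::finite) cell" where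
  "idx L k x = (k, \<chi> i. \<lfloor>2 ^ k * x $ i / L\<rfloor>)"

text \<open>Integer division rounds down, so negative indices are handled alike. The value is an
  ancestor for \<open>j \<le> fst q\<close>; for larger \<open>j\<close> the truncated subtraction
  gives exponent 0 and the value has no geometric meaning.\<close>

definition par :: "nat \<Rightarrow> ('n::finite) cell \<Rightarrow> ('n::finite) cell" where
  "par j q = (j, \<chi> i. snd q $ i div 2 ^ (fst q - j))"

definition anc :: "('n::finite) cell \<Rightarrow> ('n::finite) cell \<Rightarrow> bool" where
  "anc p q \<longleftrightarrow> fst p \<le> fst q \<and> par (fst p) q = p"

definition nbrs :: "int \<Rightarrow> ('n::finite) cell \<Rightarrow> (('n::finite) cell) set" where
  "nbrs r q = {p. fst p = fst q \<and> (\<forall>i. \<bar>snd p $ i - snd q $ i\<bar> \<le> r)}"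

lemma fst_idx [simp]: "fst (idx L k x) = k"
  by (simp add: idx_def)

lemma fst_par [simp]: "fst (par j q) = j"
  by (simp add: par_def)

lemma mem_nb_iff: "x \<in> nb L r q \<longleftrightarrow> idx L (fst q) x \<in> nbrs r q"
  by (simp add: nb_def nbrs_def idx_def)

lemma nbrs_0 [simp]: "nbrs 0 q = {q}"
  by (auto simp: nbrs_def vec_eq_iff prod_eq_iff)

lemma mem_dy_iff: "x \<in> dy L q \<longleftrightarrow> idx L (fst q) x = q"
  by (simp add: mem_nb_iff)

lemma mem_dy_idx [simp]: "x \<in> dy L (idx L k x)"
  by (simp add: mem_dy_iff)

lemma nbrs_sym: "p \<in> nbrs r q \<Longrightarrow> q \<in> nbrs r p"
  by (auto simp: nbrs_def abs_minus_commute)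

lemma nbrs_trans: "p \<in> nbrs r q \<Longrightarrow> q \<in> nbrs s u \<Longrightarrow> p \<in> nbrs (r + s) u"
proof -
  assume 1: "p \<in> nbrs r q" and 2: "q \<in> nbrs s u"
  have "\<bar>snd p $ i - snd u $ i\<bar> \<le> r + s" for i
  proof -
    have "\<bar>snd p $ i - snd q $ i\<bar> \<le> r" "\<bar>snd q $ i - snd u $ i\<bar> \<le> s"
      using 1 2 by (auto simp: nbrs_def)
    then show ?thesis by linarith
  qed
  with 1 2 show ?thesis by (auto simp: nbrs_def)
qed

lemma edge_pos: "0 < L \<Longrightarrow> 0 < edge L q"
  by (simp add: edge_def)

lemma vol_pos: "0 < L \<Longrightarrow> 0 < vol L q"
  by (simp add: vol_def edge_pos)

lemma vol_cong: "fst p = fst (q :: ('n::finite) cell) \<Longrightarrow> vol L (p :: 'n cell) = vol L q"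
  by (simp add: vol_def edge_def)

section \<open>Comparison with Euclidean boxes and volumes\<close>

lemma mem_nb_bounds:
  assumes "0 < L"
  shows "x \<in> nb L r q \<longleftrightarrow>
    (\<forall>i. edge L q * (snd q $ i - r) \<le> x $ i \<and> x $ i < edge L q * (snd q $ i + r + 1))"
proof -
  have "\<bar>\<lfloor>2 ^ fst q * x $ i / L\<rfloor> - snd q $ i\<bar> \<le> r \<longleftrightarrow>
      edge L q * (snd q $ i - r) \<le> x $ i \<and> x $ i < edge L q * (snd q $ i + r + 1)" for i
  proof -
    have "\<bar>\<lfloor>2 ^ fst q * x $ i / L\<rfloor> - snd q $ i\<bar> \<le> r \<longleftrightarrow>
      snd q $ i - r \<le> \<lfloor>2 ^ fst q * x $ i / L\<rfloor> \<and> \<lfloor>2 ^ fst q * x $ i / L\<rfloor> \<le> snd q $ i + r"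
      by auto
    also have "\<dots> \<longleftrightarrow> real_of_int (snd q $ i - r) \<le> 2 ^ fst q * x $ i / L
        \<and> 2 ^ fst q * x $ i / L < real_of_int (snd q $ i + r) + 1"
      by (simp add: le_floor_iff floor_le_iff)
    also have "\<dots> \<longleftrightarrow> edge L q * (snd q $ i - r) \<le> x $ i \<and> x $ i < edge L q * (snd q $ i + r + 1)"
      using assms by (simp add: edge_def field_simps)
    finally show ?thesis .
  qed
  then show ?thesis by (simp add: nb_def)
qed

lemma mem_cube: "x \<in> cube c l \<longleftrightarrow> (\<forall>i. \<bar>x $ i - c $ i\<bar> \<le> l / 2)"
proof -
  have "c $ i - l / 2 \<le> x $ i \<and> x $ i \<le> c $ i + l / 2 \<longleftrightarrow> \<bar>x $ i - c $ i\<bar> \<le> l / 2" for i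
    by linarith
  then show ?thesis by (simp add: cube_def mem_box_cart)
qed

lemma cube_mono: "l \<le> l' \<Longrightarrow> cube c l \<subseteq> cube c l'"
  unfolding mem_cube subset_iff by (meson divide_right_mono order_trans zero_le_numeral)

lemma nb_subset_cube:
  assumes "0 < L" shows "nb L r q \<subseteq> cube (ctr L q) (real_of_int (2 * r + 1) * edge L q)"
proof
  fix x assume "x \<in> nb L r q"
  then have *: "edge L q * (snd q $ i - r) \<le> x $ i" "x $ i < edge L q * (snd q $ i + r + 1)" for i
    using mem_nb_bounds[OF assms, of x r q] by blast+
  have "\<bar>x $ i - ctr L q $ i\<bar> \<le> real_of_int (2 * r + 1) * edge L q / 2" for i
      using *(1)[of i] *(2)[of i] by (simp add: ctr_def abs_le_iff field_simps)
  then show "x \<in> cube (ctr L q) (real_of_int (2 * r + 1) * edge L q)"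
    by (simp add: mem_cube)
qed

text \<open>With \<open>nb_subset_cube\<close> this squeezes the half-open cube between an open box
  and a closed cube of the same volume; the pair yields its measure, its closure and the passage
  from cells to the centred cubes of the definitions.\<close>

lemma box_subset_nb:
  assumes "0 < L"
  shows "box (ctr L q - (\<chi> i. real_of_int (2 * r + 1) * edge L q / 2)) (ctr L q + (\<chi> i. real_of_int (2 * r + 1) * edge L q / 2))
    \<subseteq> nb L r q"
proof
  fix x assume "x \<in> box (ctr L q - (\<chi> i. real_of_int (2 * r + 1) * edge L q / 2)) (ctr L q + (\<chi> i. real_of_int (2 * r + 1) * edge L q / 2))"
  then have *: "edge L q * (snd q $ i + 1 / 2) - real_of_int (2 * r + 1) * edge L q / 2 < x $ i"
    "x $ i < edge L q * (snd q $ i + 1 / 2) + real_of_int (2 * r + 1) * edge L q / 2" for i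
    by (auto simp: mem_box_cart ctr_def)
  have "edge L q * (snd q $ i - r) \<le> x $ i \<and> x $ i < edge L q * (snd q $ i + r + 1)" for i
      using *(1)[of i] *(2)[of i] by (simp add: field_simps)
  then show "x \<in> nb L r q"
    unfolding mem_nb_bounds[OF assms] by simp
qed

lemma prod_Basis_const:
  "(\<Prod>b\<in>(Basis :: (real ^ 'n) set). (\<chi> i. l) \<bullet> b) = l ^ CARD('n)"
proof -
  have "(\<chi> i. l) \<bullet> b = l" if b: "b \<in> (Basis :: (real ^ 'n) set)" for b
    using b by (auto simp: Basis_vec_def inner_axis)
  then have "(\<Prod>b\<in>(Basis :: (real ^ 'n) set). (\<chi> i. l) \<bullet> b) = (\<Prod>b\<in>(Basis :: (real ^ 'n) set). l)"
    by (rule prod.cong[OF refl])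
  then show ?thesis by simp
qed

lemma emeasure_box_centre:
  fixes c :: "real ^ 'n"
  assumes "0 \<le> l"
  shows "emeasure lborel (box (c - (\<chi> i. l / 2)) (c + (\<chi> i. l / 2))) = ennreal (l ^ CARD('n))"
    and "emeasure lborel (cube c l) = ennreal (l ^ CARD('n))"
proof -
  have le: "(c - (\<chi> i. l / 2)) \<bullet> b \<le> (c + (\<chi> i. l / 2)) \<bullet> b" if "b \<in> Basis" for b
    using that assms by (auto simp: Basis_vec_def inner_axis)
  have d: "(c + (\<chi> i. l / 2)) - (c - (\<chi> i. l / 2)) = (\<chi> i. l)"
    by (simp add: vec_eq_iff)
  show "emeasure lborel (box (c - (\<chi> i. l / 2)) (c + (\<chi> i. l / 2))) = ennreal (l ^ CARD('n))"
    by (subst emeasure_lborel_box[OF le]) (simp_all only: d prod_Basis_const)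
  show "emeasure lborel (cube c l) = ennreal (l ^ CARD('n))"
    unfolding cube_def by (subst emeasure_lborel_cbox[OF le]) (simp_all only: d prod_Basis_const)
qed

lemma cube_borel [measurable]: "cube c l \<in> sets borel"
  by (simp add: cube_def)

lemma compact_cube: "compact (cube c l)"
  by (simp add: cube_def)

lemma nb_borel [measurable]: "nb L r (q :: ('n::finite) cell) \<in> sets borel"
proof -
  have "nb L r q = (\<Inter>i. {x. \<bar>\<lfloor>2 ^ fst q * x $ i / L\<rfloor> - snd q $ i\<bar> \<le> r})"
    by (auto simp: nb_def)
  moreover have "{x :: real ^ 'n. \<bar>\<lfloor>2 ^ fst q * x $ i / L\<rfloor> - snd q $ i\<bar> \<le> r} \<in> sets borel" for i
  proof -
    have [measurable]: "(\<lambda>x :: real ^ 'n. x $ i) \<in> borel_measurable borel"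
      by (intro borel_measurable_continuous_onI continuous_intros)
    have "\<bar>\<lfloor>z\<rfloor> - m\<bar> \<le> r \<longleftrightarrow> of_int (m - r) \<le> z \<and> z < of_int (m + r) + 1" for z :: real and m
      by (auto simp: le_floor_iff[symmetric] floor_le_iff[symmetric] simp del: of_int_diff of_int_add)
    then show ?thesis by simp
  qed
  ultimately show ?thesis by simp
qed

lemma nb_lebesgue [measurable]: "nb L r q \<in> sets lebesgue"
  by simp

lemma emeasure_nb:
  fixes q :: "('n::finite) cell"
  assumes L: "0 < L" and r: "0 \<le> r"
  shows "emeasure lborel (nb L r q) = ennreal (real_of_int (2 * r + 1) ^ CARD('n) * vol L q)"
proof (rule antisym)
  have l: "0 \<le> real_of_int (2 * r + 1) * edge L q" using edge_pos[OF L, of q] r by simp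
  have eq: "(real_of_int (2 * r + 1) * edge L q) ^ CARD('n) = real_of_int (2 * r + 1) ^ CARD('n) * vol L q"
    by (simp add: vol_def power_mult_distrib)
  show "emeasure lborel (nb L r q) \<le> ennreal (real_of_int (2 * r + 1) ^ CARD('n) * vol L q)"
    using emeasure_mono[OF nb_subset_cube[OF L, of r q], of lborel]
    unfolding emeasure_box_centre(2)[OF l] eq by simp
  show "ennreal (real_of_int (2 * r + 1) ^ CARD('n) * vol L q) \<le> emeasure lborel (nb L r q)"
    using emeasure_mono[OF box_subset_nb[OF L, of q r], of lborel]
    unfolding emeasure_box_centre(1)[OF l] eq by simp
qed

lemma emeasure_dy:
  fixes q :: "('n::finite) cell"
  assumes L: "0 < L"
  shows "emeasure lborel (dy L q) = ennreal (vol L q)"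
  using emeasure_nb[OF L, of 0 q] by simp

lemma nb_mono: "r \<le> s \<Longrightarrow> nb L r q \<subseteq> nb L s q"
  unfolding nb_def using order_trans by blast

lemma bounded_nb: "0 < L \<Longrightarrow> bounded (nb L r q)"
  using bounded_subset[OF compact_imp_bounded[OF compact_cube] nb_subset_cube] .

section \<open>Ancestors, neighbours and nesting\<close>

lemma abs_div_diff:
  fixes a b d r :: int
  assumes "\<bar>a - b\<bar> \<le> r" "0 < d"
  shows "\<bar>a div d - b div d\<bar> \<le> r"
proof -
  have "0 \<le> r" using assms by linarith
  then have r: "r \<le> r * d" using assms by (simp add: mult_le_cancel_left1)
  have "a div d \<le> (b + r * d) div d"
    using assms r by (intro zdiv_mono1) auto
  moreover have "b div d \<le> (a + r * d) div d"
    using assms r by (intro zdiv_mono1) auto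
  ultimately show ?thesis using assms by (auto simp: abs_le_iff)
qed

lemma par_idx:
  assumes "j \<le> k" shows "par j (idx L k x) = idx L j x"
proof -
  have "\<lfloor>2 ^ k * x $ i / L\<rfloor> div 2 ^ (k - j) = \<lfloor>2 ^ j * x $ i / L\<rfloor>" for i
  proof -
    have "\<lfloor>2 ^ k * x $ i / L\<rfloor> div 2 ^ (k - j) = \<lfloor>(2 ^ k * x $ i / L) / real_of_int (2 ^ (k - j))\<rfloor>"
      by (rule floor_divide_real_eq_div[symmetric]) simp
    also have "(2 ^ k * x $ i / L) / real_of_int (2 ^ (k - j)) = 2 ^ j * x $ i / L"
      using power_add[of "2::real" j "k - j"] assms by simp
    finally show ?thesis .
  qed
  then show ?thesis by (simp add: par_def idx_def)
qed

lemma par_nbrs: "p \<in> nbrs r q \<Longrightarrow> par j p \<in> nbrs r (par j q)"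
  by (auto simp: nbrs_def par_def intro!: abs_div_diff)

lemma par_self [simp]: "par (fst q) q = q"
  by (simp add: par_def prod_eq_iff vec_eq_iff)

lemma par_par:
  assumes "j \<le> i" "i \<le> fst q" shows "par j (par i q) = par j q"
proof -
  have "fst q - j = (fst q - i) + (i - j)" using assms by simp
  then show ?thesis
    by (simp add: par_def vec_eq_iff zdiv_zmult2_eq power_add)
qed

lemma anc_refl [simp]: "anc q q"
  by (simp add: anc_def)

lemma anc_par: "j \<le> fst q \<Longrightarrow> anc (par j q) q"
  by (simp add: anc_def)

lemma anc_trans: "anc p q \<Longrightarrow> anc q u \<Longrightarrow> anc p u"
  unfolding anc_def using par_par by (metis order_trans)

lemma anc_linear: "anc p u \<Longrightarrow> anc q u \<Longrightarrow> fst p \<le> fst q \<Longrightarrow> anc p q"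
  unfolding anc_def using par_par by metis

lemma anc_antisym: "anc p q \<Longrightarrow> fst q \<le> fst p \<Longrightarrow> p = q"
  unfolding anc_def by (metis le_antisym par_self)

text \<open>Indices at distance at most \<open>r\<close> have quotients at distance at most
  \<open>r\<close>, as \<open>r \<le> r * d\<close> in \<open>abs_div_diff\<close>. So ancestors of
  neighbours are neighbours, and not only dyadic cubes but also their triples and quintuples are
  nested.\<close>

lemma anc_nb_subset:
  assumes "anc p q" shows "nb L r q \<subseteq> nb L r p"
proof
  fix x assume "x \<in> nb L r q"
  then have "idx L (fst q) x \<in> nbrs r q" by (simp add: mem_nb_iff)
  then have "par (fst p) (idx L (fst q) x) \<in> nbrs r (par (fst p) q)" by (rule par_nbrs)
  then show "x \<in> nb L r p"
    using assms by (simp add: mem_nb_iff anc_def par_idx)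
qed

lemma anc_idx: "x \<in> dy L q \<Longrightarrow> j \<le> fst q \<Longrightarrow> anc (idx L j x) q"
  by (metis anc_par mem_dy_iff par_idx)

lemma dy_meet_anc:
  assumes "x \<in> dy L p" "x \<in> dy L q" "fst p \<le> fst q"
  shows "anc p q"
  using assms by (metis anc_idx mem_dy_iff)

lemma nb_eq_UN_nbrs: "nb L r q = (\<Union>p\<in>nbrs r q. dy L p)"
proof (intro set_eqI iffI)
  fix x assume "x \<in> nb L r q"
  then show "x \<in> (\<Union>p\<in>nbrs r q. dy L p)" by (auto simp: mem_nb_iff intro!: bexI[of _ "idx L (fst q) x"])
next
  fix x assume "x \<in> (\<Union>p\<in>nbrs r q. dy L p)"
  then obtain p where p: "p \<in> nbrs r q" "x \<in> dy L p" by blast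
  then have "fst p = fst q" by (simp add: nbrs_def)
  with p show "x \<in> nb L r q" by (simp add: mem_nb_iff mem_dy_iff)
qed

lemma finite_vec_set:
  assumes "\<And>i. finite (F i)" shows "finite {m :: 'a ^ 'n. \<forall>i. m $ i \<in> F i}"
proof -
  have "(\<lambda>m i. m $ i) ` {m :: 'a ^ 'n. \<forall>i. m $ i \<in> F i} \<subseteq> PiE UNIV F" by auto
  then have "finite ((\<lambda>m i. m $ i) ` {m :: 'a ^ 'n. \<forall>i. m $ i \<in> F i})"
    using assms by (meson finite_PiE finite_subset finite_UNIV finite)
  then show ?thesis
    by (rule finite_imageD) (auto simp: inj_on_def vec_eq_iff fun_eq_iff)
qed

lemma card_vec_set:
  "card {m :: 'a ^ 'n. \<forall>i. m $ i \<in> F i} = (\<Prod>i\<in>UNIV. card (F i))"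
proof -
  have "bij_betw (\<lambda>m i. m $ i) {m :: 'a ^ 'n. \<forall>i. m $ i \<in> F i} (PiE UNIV F)"
    by (rule bij_betw_byWitness[where f' = vec_lambda]) (auto simp: PiE_def)
  then have "card {m :: 'a ^ 'n. \<forall>i. m $ i \<in> F i} = card (PiE UNIV F)"
    by (rule bij_betw_same_card)
  then show ?thesis by (simp add: card_PiE)
qed

lemma nbrs_eq_image: "nbrs r q = Pair (fst q) ` {m. \<forall>i. m $ i \<in> {snd q $ i - r .. snd q $ i + r}}"
proof -
  have "\<bar>a - b\<bar> \<le> r \<longleftrightarrow> a \<in> {b - r .. b + r}" for a b :: int by auto
  then show ?thesis by (auto simp only: nbrs_def image_iff mem_Collect_eq) (auto simp: prod_eq_iff)
qed

lemma finite_nbrs [simp]: "finite (nbrs r q)"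
  unfolding nbrs_eq_image by (intro finite_imageI finite_vec_set) simp

lemma card_nbrs:
  assumes "0 \<le> r" shows "card (nbrs r (q :: ('n::finite) cell)) = nat (2 * r + 1) ^ CARD('n)"
proof -
  have "card (nbrs r q) = card {m. \<forall>i. m $ i \<in> {snd q $ i - r .. snd q $ i + r}}"
    unfolding nbrs_eq_image by (rule card_image) (auto simp: inj_on_def)
  also have "\<dots> = (\<Prod>i\<in>(UNIV :: 'n set). nat (2 * r + 1))"
    unfolding card_vec_set by (intro prod.cong) auto
  finally show ?thesis by simp
qed

text \<open>The ancestor of \<open>q\<close> is a neighbour of the cell of \<open>y\<close>, which
  is a neighbour of \<open>p\<close>. The two unit steps add up to radius 2; this is the source of
  the powers of 5 in later constants.\<close>

lemma meet_nb_subset: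
  assumes "y \<in> nb L 1 p" "y \<in> nb L 1 q" "fst p \<le> fst q"
  shows "dy L q \<subseteq> nb L 2 p"
proof -
  have "idx L (fst q) y \<in> nbrs 1 q" using assms by (simp add: mem_nb_iff)
  then have "par (fst p) (idx L (fst q) y) \<in> nbrs 1 (par (fst p) q)" by (rule par_nbrs)
  then have "par (fst p) q \<in> nbrs 1 (idx L (fst p) y)"
    using assms(3) by (simp add: par_idx nbrs_sym)
  then have "par (fst p) q \<in> nbrs (1 + 1) p"
    by (rule nbrs_trans) (use assms in \<open>simp add: mem_nb_iff\<close>)
  then have "dy L (par (fst p) q) \<subseteq> nb L 2 p"
    by (auto simp: nb_eq_UN_nbrs[of _ 2])
  moreover have "dy L q \<subseteq> dy L (par (fst p) q)"
    by (intro anc_nb_subset anc_par assms)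
  ultimately show ?thesis by blast
qed

text \<open>These are the cubes that the Hoermander condition produces around a cell. Such a cube
  reaches \<open>2 ^ k\<close> edges from the centre of the cell in each direction, which is one
  edge of the ancestor, so it stays within the ancestor and its neighbours.\<close>

lemma cube_subset_nb_par:
  assumes L: "0 < L" and k: "k \<le> fst q"
  shows "cube (ctr L q) (2 ^ k * (2 * edge L q)) \<subseteq> nb L 1 (par (fst q - k) q)"
proof
  fix x assume x: "x \<in> cube (ctr L q) (2 ^ k * (2 * edge L q))"
  define e where "e = edge L q"
  have e: "0 < e" using edge_pos[OF L] by (simp add: e_def)
  have ep: "edge L (par (fst q - k) q) = 2 ^ k * e"
    using k by (simp add: edge_def e_def field_simps power_diff)
  show "x \<in> nb L 1 (par (fst q - k) q)"
    unfolding mem_nb_bounds[OF L] ep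
  proof
    fix i
    define m where "m = snd q $ i"
    define d where "d = m div 2 ^ k"
    have d: "d * 2 ^ k \<le> m" "m + 1 \<le> (d + 1) * 2 ^ k"
    proof -
      have "m = d * 2 ^ k + m mod 2 ^ k" unfolding d_def by (rule div_mult_mod_eq[symmetric])
      moreover have "0 \<le> m mod 2 ^ k" "m mod 2 ^ k < 2 ^ k" by simp_all
      moreover have "(d + 1) * 2 ^ k = d * 2 ^ k + 2 ^ k" by (simp add: distrib_right)
      ultimately show "d * 2 ^ k \<le> m" "m + 1 \<le> (d + 1) * 2 ^ k" by linarith+
    qed
    have d': "real_of_int d * 2 ^ k \<le> m" "m + 1 \<le> (real_of_int d + 1) * 2 ^ k"
      using d[THEN of_int_le_iff[where 'a = real, THEN iffD2]] by simp_all
    have "\<bar>x $ i - e * (m + 1 / 2)\<bar> \<le> 2 ^ k * (2 * e) / 2"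
      using x by (simp add: mem_cube ctr_def e_def m_def)
    then have x: "e * (m + 1 / 2 - 2 ^ k) \<le> x $ i" "x $ i \<le> e * (m + 1 / 2 + 2 ^ k)"
      by (auto simp: abs_le_iff algebra_simps)
    have "e * ((d - 1) * 2 ^ k) \<le> e * (m + 1 / 2 - 2 ^ k)"
      using e d' by (intro mult_left_mono) (auto simp: algebra_simps)
    \<comment> \<open>Strictness is required at the open upper face; it comes from the centre lying
      half an edge below \<open>m + 1\<close>.\<close>
    moreover have "e * (m + 1 / 2 + 2 ^ k) < e * ((d + 2) * 2 ^ k)"
      using e d' by (intro mult_strict_left_mono) (auto simp: algebra_simps)
    moreover have "snd (par (fst q - k) q) $ i = d" using k by (simp add: par_def d_def m_def)
    ultimately show "2 ^ k * e * (snd (par (fst q - k) q) $ i - 1) \<le> x $ i \<and>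
       x $ i < 2 ^ k * e * (snd (par (fst q - k) q) $ i + 1 + 1)"
      using x by (simp add: algebra_simps)
  qed
qed

lemma finite_dy_meet:
  fixes S :: "(real ^ 'n) set"
  assumes L: "0 < L" and S: "bounded S"
  shows "finite {q. fst q \<le> J \<and> dy L q \<inter> S \<noteq> {}}"
proof -
  obtain B where B: "\<And>x i. x \<in> S \<Longrightarrow> \<bar>x $ i\<bar> \<le> B"
    using S unfolding bounded_iff by (metis component_le_norm_cart order_trans)
  have "{q. fst q \<le> J \<and> dy L q \<inter> S \<noteq> {}} \<subseteq>
    (\<Union>k\<in>{..J}. Pair k ` {m :: int ^ 'n. \<forall>i. m $ i \<in> {\<lfloor>2 ^ k * (- B) / L\<rfloor> .. \<lfloor>2 ^ k * B / L\<rfloor>}})"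
  proof
    fix q :: "('n::finite) cell" assume q: "q \<in> {q. fst q \<le> J \<and> dy L q \<inter> S \<noteq> {}}"
    then obtain x where x: "x \<in> S" "x \<in> dy L q" by blast
    have "snd q $ i \<in> {\<lfloor>2 ^ fst q * (- B) / L\<rfloor> .. \<lfloor>2 ^ fst q * B / L\<rfloor>}" for i
    proof -
      have "snd q $ i = \<lfloor>2 ^ fst q * x $ i / L\<rfloor>"
        using x(2) by (simp add: nb_def)
      moreover have "- B \<le> x $ i" "x $ i \<le> B" using B[OF x(1), of i] by auto
      then have "2 ^ fst q * (- B) / L \<le> 2 ^ fst q * x $ i / L" "2 ^ fst q * x $ i / L \<le> 2 ^ fst q * B / L"
        using L by (intro divide_right_mono mult_left_mono; simp)+
      ultimately show ?thesis by (simp add: floor_mono del: mult_minus_right)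
    qed
    then have "q \<in> Pair (fst q) ` {m. \<forall>i. m $ i \<in> {\<lfloor>2 ^ fst q * (- B) / L\<rfloor> .. \<lfloor>2 ^ fst q * B / L\<rfloor>}}"
      by (intro image_eqI[of _ _ "snd q"]) (auto simp: prod_eq_iff)
    then show "q \<in> (\<Union>k\<in>{..J}. Pair k ` {m. \<forall>i. m $ i \<in> {\<lfloor>2 ^ k * (- B) / L\<rfloor> .. \<lfloor>2 ^ k * B / L\<rfloor>}})"
      using q by blast
  qed
  moreover have "finite \<dots>"
    by (intro finite_UN_I finite_imageI finite_vec_set) auto
  ultimately show ?thesis by (rule finite_subset)
qed

section \<open>Maximal cells of a family\<close>

definition mx :: "(('n::finite) cell) set \<Rightarrow> (('n::finite) cell) set" where
  "mx M = {q \<in> M. \<forall>p\<in>M. anc p q \<longrightarrow> p = q}"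

lemma mx_subset: "mx M \<subseteq> M"
  by (auto simp: mx_def)

text \<open>Generations are natural numbers, so among the ancestors of \<open>q\<close> in
  \<open>M\<close> one has least generation. Every family, finite or infinite, is thus covered by
  its maximal cells.\<close>

lemma mx_exists:
  assumes "q \<in> M" shows "\<exists>p\<in>mx M. anc p q"
proof -
  have ex: "\<exists>p. p \<in> M \<and> anc p q" using assms anc_refl by blast
  define p where "p = arg_min fst (\<lambda>p. p \<in> M \<and> anc p q)"
  have p: "p \<in> M" "anc p q" and least: "\<And>u. u \<in> M \<Longrightarrow> anc u q \<Longrightarrow> fst p \<le> fst u"
    using arg_min_natI[of "\<lambda>p. p \<in> M \<and> anc p q"] arg_min_nat_le[of "\<lambda>p. p \<in> M \<and> anc p q"] ex
    unfolding p_def by blast+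
  have "u = p" if "u \<in> M" "anc u p" for u
    using least[OF that(1) anc_trans[OF that(2) p(2)]] that(2) by (intro anc_antisym)
  then have "p \<in> mx M" using p unfolding mx_def by blast
  then show ?thesis using p by blast
qed

lemma mx_disjoint: "disjoint_family_on (dy L) (mx M)"
  unfolding disjoint_family_on_def
proof (intro ballI impI)
  fix p q assume pq: "p \<in> mx M" "q \<in> mx M" "p \<noteq> q"
  show "dy L p \<inter> dy L q = {}"
  proof (rule ccontr)
    assume "dy L p \<inter> dy L q \<noteq> {}"
    then obtain x where x: "x \<in> dy L p" "x \<in> dy L q" by blast
    show False
    proof (cases "fst p \<le> fst q")
      case True
      then show False using dy_meet_anc[OF x] pq by (auto simp: mx_def)
    next
      case False
      then show False using dy_meet_anc[OF x(2,1)] pq by (auto simp: mx_def)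
    qed
  qed
qed

section \<open>Countable unions, and integrals of arbitrary functions\<close>

lemma emeasure_UN_le_finite:
  assumes "countable I" and X: "\<And>i. i \<in> I \<Longrightarrow> X i \<in> sets M"
    and fin: "\<And>J. finite J \<Longrightarrow> J \<subseteq> I \<Longrightarrow> emeasure M (\<Union>i\<in>J. X i) \<le> B"
  shows "emeasure M (\<Union>i\<in>I. X i) \<le> B"
proof (cases "I = {}")
  case True
  then show ?thesis by simp
next
  case False
  define e where "e = from_nat_into I"
  have e: "range e = I" using False assms(1) by (simp add: e_def)
  have "(\<Union>i\<in>I. X i) = (\<Union>n::nat. \<Union>i\<in>e ` {..n}. X i)"
    using e by blast
  moreover have "emeasure M (\<Union>n::nat. \<Union>i\<in>e ` {..n}. X i) = (SUP n::nat. emeasure M (\<Union>i\<in>e ` {..n}. X i))"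
  proof (rule SUP_emeasure_incseq[symmetric])
    show "range (\<lambda>n::nat. \<Union>i\<in>e ` {..n}. X i) \<subseteq> sets M"
      using e X by (intro image_subsetI sets.finite_UN) auto
    show "incseq (\<lambda>n::nat. \<Union>i\<in>e ` {..n}. X i)"
      unfolding incseq_def by (intro allI impI UN_mono) auto
  qed
  moreover have "\<dots> \<le> B"
    using e by (intro SUP_least fin) auto
  ultimately show ?thesis by simp
qed

text \<open>The integrand is arbitrary because it will contain \<open>maximal \<phi> w\<close>,
  whose measurability is nowhere established. A simple function below \<open>c * g\<close> becomes
  one below \<open>g\<close> after division by \<open>c\<close>.\<close>

lemma nn_integral_cmult_le:
  assumes c: "0 < c" shows "(\<integral>\<^sup>+x. ennreal c * g x \<partial>M) \<le> ennreal c * (\<integral>\<^sup>+x. g x \<partial>M)"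
proof -
  have cc: "ennreal c * (ennreal (1 / c) * y) = y" "ennreal (1 / c) * (ennreal c * y) = y" for y
    using c by (simp_all add: mult.assoc[symmetric] ennreal_mult[symmetric])
  have "integral\<^sup>S M s \<le> ennreal c * (\<integral>\<^sup>+x. g x \<partial>M)"
    if s: "simple_function M s" "s \<le> (\<lambda>x. ennreal c * g x)" for s
  proof -
    have "integral\<^sup>S M s = (\<integral>\<^sup>+x. s x \<partial>M)" by (rule nn_integral_eq_simple_integral[OF s(1), symmetric])
    also have "\<dots> = (\<integral>\<^sup>+x. ennreal c * (ennreal (1 / c) * s x) \<partial>M)" by (simp only: cc)
    also have "\<dots> = ennreal c * (\<integral>\<^sup>+x. ennreal (1 / c) * s x \<partial>M)"
      using s(1)[THEN borel_measurable_simple_function] by (intro nn_integral_cmult) simp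
    also have "\<dots> \<le> ennreal c * (\<integral>\<^sup>+x. g x \<partial>M)"
    proof (intro mult_left_mono nn_integral_mono)
      fix x
      have "ennreal (1 / c) * s x \<le> ennreal (1 / c) * (ennreal c * g x)"
        using s(2) by (intro mult_left_mono) (auto simp: le_fun_def)
      then show "ennreal (1 / c) * s x \<le> g x" by (simp only: cc)
    qed simp
    finally show ?thesis .
  qed
  then show ?thesis unfolding nn_integral_def[of M "\<lambda>x. ennreal c * g x"]
    by (intro SUP_least) auto
qed

section \<open>Smooth bump functions\<close>

text \<open>This family of functions is closed under differentiation up to linear combinations.\<close>

definition expm :: "nat \<Rightarrow> real \<Rightarrow> real" where
  "expm j t = (if 0 < t then exp (- (1 / t)) / t ^ j else 0)"

lemma expm_tendsto_0: "(expm j \<longlongrightarrow> 0) (at 0)"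
proof -
  have "((\<lambda>t::real. inverse t ^ j / exp (inverse t)) \<longlongrightarrow> 0) (at_right 0)"
    by (rule filterlim_compose[OF tendsto_power_div_exp_0 filterlim_inverse_at_top_right])
  then have "(expm j \<longlongrightarrow> 0) (at_right 0)"
    by (rule Lim_transform_eventually)
       (auto simp: eventually_at_filter expm_def exp_minus field_simps)
  moreover have "(expm j \<longlongrightarrow> 0) (at_left 0)"
    by (rule tendsto_eventually) (auto simp: eventually_at_filter expm_def)
  ultimately show ?thesis by (simp add: filterlim_split_at)
qed

text \<open>At 0 the difference quotient of \<open>expm j\<close> is \<open>expm (Suc j)\<close>,
  which tends to 0 there; elsewhere the function agrees locally with an elementary one.\<close>

lemma expm_deriv: "(expm j has_real_derivative (expm (j + 2) t - j * expm (j + 1) t)) (at t)"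
proof -
  consider "t < 0" | "t = 0" | "0 < t" by linarith
  then show ?thesis
  proof cases
    case 1
    have "((\<lambda>_. 0) has_real_derivative 0) (at t)" by simp
    then have "(expm j has_real_derivative 0) (at t)"
      by (rule DERIV_cong_ev[THEN iffD1, rotated -1])
         (use 1 in \<open>auto simp: expm_def eventually_nhds intro!: exI[of _ "{..<0}"]\<close>)
    then show ?thesis using 1 by (simp add: expm_def)
  next
    case 2
    have "((\<lambda>h. (expm j (0 + h) - expm j 0) / h) \<longlongrightarrow> 0) (at 0)"
      by (rule Lim_transform_eventually[OF expm_tendsto_0[of "Suc j"]])
         (auto simp: expm_def eventually_at_filter)
    then show ?thesis using 2 by (simp add: DERIV_def) (simp add: expm_def)
  next
    case 3
    have "((\<lambda>t. exp (- (1 / t)) / t ^ j) has_real_derivative (expm (j + 2) t - j * expm (j + 1) t)) (at t)"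
    proof (cases j)
      case 0
      then show ?thesis
        using 3 by (auto intro!: derivative_eq_intros simp: expm_def field_simps power2_eq_square)
    next
      case (Suc i)
      then show ?thesis
        using 3 by (auto intro!: derivative_eq_intros simp: expm_def divide_simps power2_eq_square) (cases i; simp add: algebra_simps)
    qed
    then show ?thesis
      by (rule DERIV_cong_ev[THEN iffD1, rotated -1])
         (use 3 in \<open>auto simp: expm_def eventually_nhds intro!: exI[of _ "{0<..}"]\<close>)
  qed
qed

lemma C_k_continuous: "C_k k f \<Longrightarrow> continuous_on UNIV f"
proof (cases k)
  case (Suc i)
  assume "C_k k f"
  then show ?thesis using Suc
    by (auto intro!: continuous_at_imp_continuous_on differentiable_imp_continuous_within)
qed auto

lemma C_k_Suc: "C_k (Suc k) f \<Longrightarrow> C_k k f"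
proof (induction k arbitrary: f)
  case 0
  then show ?case using C_k_continuous C_k.simps(1) by blast
next
  case (Suc k)
  then show ?case by simp
qed

lemma C_k_const: "C_k k (\<lambda>_. c)"
  by (induction k arbitrary: c) auto

lemma C_k_add: "C_k k f \<Longrightarrow> C_k k g \<Longrightarrow> C_k k (\<lambda>x. f x + g x)"
proof (induction k arbitrary: f g)
  case 0
  then show ?case by (auto intro: continuous_intros)
next
  case (Suc k)
  have "frechet_derivative (\<lambda>x. f x + g x) (at x) = (\<lambda>v. frechet_derivative f (at x) v + frechet_derivative g (at x) v)" for x
    using Suc.prems by (intro frechet_derivative_at[symmetric] has_derivative_add) (auto simp: frechet_derivative_works[symmetric])
  then show ?case using Suc by auto
qed

lemma C_k_mult: "C_k k f \<Longrightarrow> C_k k g \<Longrightarrow> C_k k (\<lambda>x. f x * g x)"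
proof (induction k arbitrary: f g)
  case 0
  then show ?case by (auto intro: continuous_intros)
next
  case (Suc k)
  have "frechet_derivative (\<lambda>x. f x * g x) (at x) = (\<lambda>v. f x * frechet_derivative g (at x) v + frechet_derivative f (at x) v * g x)" for x
    using Suc.prems by (intro frechet_derivative_at[symmetric] has_derivative_mult) (auto simp: frechet_derivative_works[symmetric])
  then show ?case using Suc C_k_Suc[OF Suc.prems(1)] C_k_Suc[OF Suc.prems(2)]
    by (auto intro!: C_k_add)
qed

lemma C_k_nth: "C_k k (\<lambda>x :: real ^ 'n. x $ i)"
proof (cases k)
  case 0
  then show ?thesis by (auto intro: continuous_intros)
next
  case (Suc j)
  have d: "((\<lambda>x :: real ^ 'n. x $ i) has_derivative (\<lambda>v. v $ i)) (at x)" for x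
    by (intro bounded_linear_imp_has_derivative bounded_linear_vec_nth)
  have "frechet_derivative (\<lambda>x :: real ^ 'n. x $ i) (at x) = (\<lambda>v. v $ i)" for x
    by (rule frechet_derivative_at[OF d, symmetric])
  with Suc show ?thesis using d by (auto simp: C_k_const differentiable_def)
qed

lemma C_k_expm:
  assumes "\<And>k. C_k k q" shows "C_k k (\<lambda>x. expm j (q x))"
proof (induction k arbitrary: j)
  case 0
  have "continuous_on UNIV (expm j)"
    using DERIV_continuous[OF expm_deriv] by (auto intro!: continuous_at_imp_continuous_on)
  then show ?case
    using assms[of 0] continuous_on_compose2[of UNIV "expm j" UNIV q] by auto
next
  case (Suc k)
  have dq: "(q has_derivative frechet_derivative q (at x)) (at x)" for x
    using assms[of "Suc 0"] by (auto simp: frechet_derivative_works[symmetric])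
  have d: "((\<lambda>x. expm j (q x)) has_derivative (\<lambda>v. frechet_derivative q (at x) v * (expm (j + 2) (q x) - j * expm (j + 1) (q x)))) (at x)" for x
    by (rule DERIV_compose_FDERIV[OF expm_deriv dq])
  have "frechet_derivative (\<lambda>x. expm j (q x)) (at x) = (\<lambda>v. frechet_derivative q (at x) v * (expm (j + 2) (q x) + (- real j) * expm (j + 1) (q x)))" for x
    using frechet_derivative_at[OF d, of x] by simp
  moreover have "C_k k (\<lambda>x. frechet_derivative q (at x) v * (expm (j + 2) (q x) + (- real j) * expm (j + 1) (q x)))" for v
    using assms[of "Suc k"] by (intro C_k_mult C_k_add C_k_const Suc.IH) auto
  moreover have "(\<lambda>x. expm j (q x)) differentiable (at x)" for x
    using d unfolding differentiable_def by blast
  ultimately show ?case by simp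
qed

lemma C_k_prod:
  assumes "finite I" "\<And>i. i \<in> I \<Longrightarrow> C_k k (f i)" shows "C_k k (\<lambda>x. \<Prod>i\<in>I. f i x)"
  using assms by (induction rule: finite_induct) (auto intro: C_k_const C_k_mult)

text \<open>For a fixed point of the open box each factor is \<open>exp (- 1 / (m * c))\<close> with
  some positive \<open>c\<close>, which tends to 1 as \<open>m\<close> grows. These are the smooth
  functions that carry the kernel representation of \<open>T\<close> over to indicators of
  cells.\<close>

definition bump :: "nat \<Rightarrow> real ^ 'n \<Rightarrow> real ^ 'n \<Rightarrow> real ^ 'n \<Rightarrow> real" where
  "bump m a b x = (\<Prod>i\<in>UNIV. expm 0 (real m * ((x $ i - a $ i) * (b $ i - x $ i))))"

lemma C_k_bump: "C_k k (bump m a (b :: real ^ 'n))"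
proof -
  have "C_k k (\<lambda>x :: real ^ 'n. real m * ((x $ i + (- (a $ i))) * (b $ i + (- 1) * x $ i)))" for k i
    by (intro C_k_mult C_k_add C_k_const C_k_nth)
  then have "C_k k (\<lambda>x :: real ^ 'n. real m * ((x $ i - a $ i) * (b $ i - x $ i)))" for k i
    by simp
  then have "C_k k (\<lambda>x. \<Prod>i\<in>UNIV. expm 0 (real m * ((x $ i - a $ i) * (b $ i - x $ i))))"
    by (intro C_k_prod C_k_expm) auto
  then show ?thesis by (simp add: bump_def[abs_def])
qed

lemma expm0_bounds: "0 \<le> expm 0 t" "expm 0 t \<le> 1"
  by (auto simp: expm_def)

lemma bump_bounds: "0 \<le> bump m a b x" "bump m a b x \<le> 1"
  unfolding bump_def using expm0_bounds by (auto intro: prod_nonneg prod_le_1)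

lemma bump_outside:
  assumes ab: "\<And>i. a $ i \<le> b $ i" and x: "x \<notin> box a b"
  shows "bump m a b x = 0"
proof -
  obtain i where "x $ i \<le> a $ i \<or> b $ i \<le> x $ i"
    using x by (force simp: mem_box_cart not_less)
  then have "(x $ i - a $ i) * (b $ i - x $ i) \<le> 0"
    using ab[of i] by (auto intro: mult_nonneg_nonpos mult_nonpos_nonneg)
  then have "real m * ((x $ i - a $ i) * (b $ i - x $ i)) \<le> 0"
    by (simp add: mult_nonneg_nonpos)
  then have "expm 0 (real m * ((x $ i - a $ i) * (b $ i - x $ i))) = 0"
    by (simp add: expm_def)
  then show ?thesis unfolding bump_def by (intro prod_zero) auto
qed

lemma bump_tendsto:
  assumes ab: "\<And>i. a $ i \<le> b $ i"
  shows "(\<lambda>m. bump m a b x) \<longlonglongrightarrow> indicator (box a b) x"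
proof (cases "x \<in> box a b")
  case False
  then show ?thesis by (simp add: bump_outside[OF ab])
next
  case True
  have "(\<lambda>m. expm 0 (real m * ((x $ i - a $ i) * (b $ i - x $ i)))) \<longlonglongrightarrow> 1" for i
  proof -
    define c where "c = (x $ i - a $ i) * (b $ i - x $ i)"
    have c: "0 < c" using True by (auto simp: c_def mem_box_cart)
    have "(\<lambda>m. exp (- ((1 / c) * (1 / real m)))) \<longlonglongrightarrow> exp (- ((1 / c) * 0))"
      by (intro tendsto_intros lim_1_over_n)
    then have "(\<lambda>m. exp (- ((1 / c) * (1 / real m)))) \<longlonglongrightarrow> 1" by simp
    then have "(\<lambda>m. expm 0 (real m * c)) \<longlonglongrightarrow> 1"
    proof (rule Lim_transform_eventually)
      show "\<forall>\<^sub>F m in sequentially. exp (- ((1 / c) * (1 / real m))) = expm 0 (real m * c)"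
        using eventually_gt_at_top[of 0] by eventually_elim (use c in \<open>simp add: expm_def\<close>)
    qed
    then show ?thesis by (simp add: c_def)
  qed
  then have "(\<lambda>m. bump m a b x) \<longlonglongrightarrow> (\<Prod>i\<in>(UNIV :: 'a set). 1)"
    unfolding bump_def by (rule tendsto_prod)
  then show ?thesis using True by simp
qed

lemma supp_bump:
  assumes "\<And>i. a $ i \<le> b $ i" shows "supp (bump m a b) \<subseteq> cbox a b"
proof -
  have "support_on UNIV (bump m a b) \<subseteq> box a b"
    using bump_outside[OF assms] by (auto simp: support_on_def)
  then have "supp (bump m a b) \<subseteq> closure (box a b)" unfolding supp_def by (rule closure_mono)
  also have "\<dots> \<subseteq> cbox a b" by (rule closure_minimal) (auto simp: box_subset_cbox)
  finally show ?thesis .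
qed

lemma bump_Cc:
  assumes "\<And>i. a $ i \<le> b $ i" shows "bump m a b \<in> Cc_infinity"
proof -
  have "compact (supp (bump m a b))"
    using supp_bump[OF assms, of m] compact_cbox[of a b]
    by (metis bounded_cbox bounded_subset closed_closure compact_eq_bounded_closed supp_def)
  then show ?thesis by (simp add: Cc_infinity_def C_k_bump)
qed

section \<open>Bounded functions of bounded support\<close>

text \<open>The working class for \<open>T\<close>: contained in L1 and L2 and, unlike
  \<open>Cc_infinity\<close>, stable under multiplication by indicators, hence under all the
  decompositions of \<open>f\<close> used below.\<close>

definition nice :: "('a::euclidean_space \<Rightarrow> real) \<Rightarrow> bool" where
  "nice f \<longleftrightarrow> f \<in> borel_measurable lebesgue \<and> (\<exists>M. \<forall>x. \<bar>f x\<bar> \<le> M) \<and> bounded {x. f x \<noteq> 0}"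

lemma lebesgue_of_borel: "f \<in> borel_measurable borel \<Longrightarrow> f \<in> borel_measurable lebesgue"
  by (simp add: measurable_completion)

lemma nice_measurable [measurable_dest]: "nice f \<Longrightarrow> f \<in> borel_measurable lebesgue"
  by (simp add: nice_def)

lemma niceI:
  assumes "f \<in> borel_measurable lebesgue" "\<And>x. \<bar>f x\<bar> \<le> M" "bounded S" "\<And>x. x \<notin> S \<Longrightarrow> f x = 0"
  shows "nice f"
  unfolding nice_def using assms by (auto intro: bounded_subset[of S])

lemma nice_lin:
  assumes f: "nice f" and g: "nice g" shows "nice (\<lambda>x. a * f x + b * g x)"
proof -
  obtain M N where M: "\<And>x. \<bar>f x\<bar> \<le> M" "\<And>x. \<bar>g x\<bar> \<le> N" using f g unfolding nice_def by blast
  show ?thesis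
  proof (rule niceI)
    show "(\<lambda>x. a * f x + b * g x) \<in> borel_measurable lebesgue"
      using f g by (auto simp: nice_def)
    show "\<bar>a * f x + b * g x\<bar> \<le> \<bar>a\<bar> * M + \<bar>b\<bar> * N" for x
      using M[of x] abs_triangle_ineq[of "a * f x" "b * g x"]
        mult_left_mono[OF M(1)[of x] abs_ge_zero[of a]] mult_left_mono[OF M(2)[of x] abs_ge_zero[of b]]
      by (simp add: abs_mult)
    show "bounded ({x. f x \<noteq> 0} \<union> {x. g x \<noteq> 0})" using f g by (simp add: nice_def)
  qed auto
qed

lemma nice_diff: "nice f \<Longrightarrow> nice g \<Longrightarrow> nice (\<lambda>x. f x - g x)"
  using nice_lin[of f g 1 "-1"] by simp

lemma nice_add: "nice f \<Longrightarrow> nice g \<Longrightarrow> nice (\<lambda>x. f x + g x)"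
  using nice_lin[of f g 1 "1"] by simp

lemma nice_cmult: "nice f \<Longrightarrow> nice (\<lambda>x. a * f x)"
  using nice_lin[of f f a 0] by simp

lemma nice_zero [simp]: "nice (\<lambda>x. 0)"
  by (rule niceI[of _ 0 "{}"]) auto

lemma nice_sum: "finite I \<Longrightarrow> (\<And>i. i \<in> I \<Longrightarrow> nice (f i)) \<Longrightarrow> nice (\<lambda>x. \<Sum>i\<in>I. f i x)"
  by (induction rule: finite_induct) (auto intro: nice_add)

lemma nice_mult_bounded:
  assumes f: "nice f" and g: "g \<in> borel_measurable lebesgue" "\<And>x. \<bar>g x\<bar> \<le> N"
  shows "nice (\<lambda>x. g x * f x)"
proof -
  obtain M where M: "\<And>x. \<bar>f x\<bar> \<le> M" using f unfolding nice_def by blast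
  have "0 \<le> M" using M[of 0] by linarith
  show ?thesis
  proof (rule niceI)
    show "(\<lambda>x. g x * f x) \<in> borel_measurable lebesgue" using f g by (auto simp: nice_def)
    show "\<bar>g x * f x\<bar> \<le> N * M" for x
      unfolding abs_mult using M[of x] g(2)[of x] \<open>0 \<le> M\<close> by (intro mult_mono) auto
    show "bounded {x. f x \<noteq> 0}" using f by (simp add: nice_def)
  qed auto
qed

lemma nice_indicator:
  assumes "S \<in> sets lebesgue" "bounded S" shows "nice (indicator S)"
  by (rule niceI[of _ 1 S]) (use assms in \<open>auto simp: indicator_def\<close>)

lemma emeasure_bounded_finite_lebesgue: "bounded S \<Longrightarrow> emeasure lebesgue S < \<infinity>"
proof -
  assume "bounded S"
  then obtain a b where "S \<subseteq> cbox a b" by (meson bounded_subset_cbox_symmetric)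
  then have "emeasure lebesgue S \<le> emeasure lebesgue (cbox a b)" by (intro emeasure_mono) auto
  also have "\<dots> < \<infinity>" using emeasure_lborel_cbox_finite[of a b] by simp
  finally show ?thesis .
qed

lemma bounded_in_cbox: "bounded S \<Longrightarrow> \<exists>a b. S \<subseteq> cbox a (b :: 'a :: euclidean_space)"
  by (meson bounded_subset_cbox_symmetric)

lemma nice_integrable:
  assumes "nice f" shows "integrable lebesgue f"
proof -
  obtain M where M: "\<And>x. \<bar>f x\<bar> \<le> M" using assms unfolding nice_def by blast
  obtain a b where ab: "{x. f x \<noteq> 0} \<subseteq> cbox a b" using assms bounded_in_cbox unfolding nice_def by blast
  show ?thesis
    by (rule integrableI_bounded_set[of "cbox a b" _ _ M])
       (use assms M ab emeasure_bounded_finite_lebesgue[of "cbox a b"] in \<open>auto simp: nice_def\<close>)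
qed

lemma nice_power2: "nice f \<Longrightarrow> nice (\<lambda>x. (f x)\<^sup>2)"
  unfolding power2_eq_square using nice_mult_bounded unfolding nice_def by blast

lemma nice_abs: "nice f \<Longrightarrow> nice (\<lambda>x. \<bar>f x\<bar>)"
  unfolding nice_def by auto

lemma nice_L2: "nice f \<Longrightarrow> f \<in> L2"
  using nice_integrable[OF nice_power2] by (auto simp: L2_def nice_def)

lemma continuous_cc_nice:
  assumes "continuous_on UNIV f" "bounded {x. f x \<noteq> (0::real)}"
  shows "nice f"
proof -
  obtain a b where ab: "{x. f x \<noteq> 0} \<subseteq> cbox a b" using bounded_in_cbox assms(2) by blast
  have "compact (f ` cbox a b)"
    using assms(1) by (intro compact_continuous_image continuous_on_subset[OF assms(1)]) auto
  then obtain M where M: "\<And>x. x \<in> cbox a b \<Longrightarrow> \<bar>f x\<bar> \<le> M"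
    by (metis bounded_iff compact_imp_bounded image_eqI real_norm_def)
  have "\<bar>f x\<bar> \<le> max M 0" for x
    using M[of x] ab by (cases "f x = 0") auto
  then show ?thesis
    using assms by (intro niceI[of _ "max M 0" "cbox a b"] lebesgue_of_borel borel_measurable_continuous_onI) (use ab in auto)
qed

lemma nice_dct:
  assumes g: "\<And>n. nice (g n)" and h: "nice h" and M: "\<And>n x. \<bar>g n x\<bar> \<le> M"
    and S: "bounded S" "\<And>n x. x \<notin> S \<Longrightarrow> g n x = 0"
    and lim: "AE x in lebesgue. (\<lambda>n. g n x) \<longlonglongrightarrow> h x"
  shows "(\<lambda>n. \<integral>x. (g n x - h x)\<^sup>2 \<partial>lebesgue) \<longlonglongrightarrow> 0"
proof -
  obtain N where N: "\<And>x. \<bar>h x\<bar> \<le> N" using h unfolding nice_def by blast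
  obtain a b where ab: "S \<union> {x. h x \<noteq> 0} \<subseteq> cbox a b"
    using S(1) h bounded_in_cbox unfolding nice_def by (metis bounded_Un)
  have "(\<lambda>n. \<integral>x. (g n x - h x)\<^sup>2 \<partial>lebesgue) \<longlonglongrightarrow> (\<integral>x. 0 \<partial>(lebesgue :: 'a measure))"
  proof (rule integral_dominated_convergence)
    show "integrable lebesgue (\<lambda>x. (M + N)\<^sup>2 * indicator (cbox a b) x :: real)"
      using nice_integrable[OF nice_cmult[OF nice_indicator[of "cbox a b"]]] by simp
    show "AE x in lebesgue. (\<lambda>n. (g n x - h x)\<^sup>2) \<longlonglongrightarrow> 0"
      using lim
    proof eventually_elim
      case (elim x)
      then have "(\<lambda>n. (g n x - h x)\<^sup>2) \<longlonglongrightarrow> (h x - h x)\<^sup>2" by (intro tendsto_intros)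
      then show ?case by simp
    qed
    show "AE x in lebesgue. norm ((g n x - h x)\<^sup>2) \<le> (M + N)\<^sup>2 * indicator (cbox a b) x" for n
    proof (rule AE_I2)
      fix x
      show "norm ((g n x - h x)\<^sup>2) \<le> (M + N)\<^sup>2 * indicator (cbox a b) x"
      proof (cases "x \<in> cbox a b")
        case True
        have "\<bar>g n x - h x\<bar> \<le> M + N" using M[of n x] N[of x] by linarith
        then show ?thesis using True by (simp add: abs_le_square_iff[symmetric])
      next
        case False
        then have "g n x = 0" "h x = 0" using ab S(2) by auto
        then show ?thesis by simp
      qed
    qed
    show "(\<lambda>x. (g n x - h x)\<^sup>2) \<in> borel_measurable lebesgue" for n
      using nice_measurable[OF nice_power2[OF nice_diff[OF g[of n] h]]] .
  qed auto
  then show ?thesis by simp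
qed

section \<open>The operator and its kernel\<close>

lemma le_cmult_Inf:
  fixes a :: ennreal
  assumes c: "0 < c" and le: "\<And>s. s \<in> S \<Longrightarrow> a \<le> ennreal c * s"
  shows "a \<le> ennreal c * Inf S"
proof -
  have cc: "ennreal c * (ennreal (1 / c) * y) = y" "ennreal (1 / c) * (ennreal c * y) = y" for y
    using c by (simp_all add: mult.assoc[symmetric] ennreal_mult[symmetric])
  have "ennreal (1 / c) * a \<le> Inf S"
  proof (rule Inf_greatest)
    fix s assume "s \<in> S"
    have "ennreal (1 / c) * a \<le> ennreal (1 / c) * (ennreal c * s)"
      by (intro mult_left_mono le \<open>s \<in> S\<close>) simp
    then show "ennreal (1 / c) * a \<le> s" by (simp only: cc)
  qed
  then have "ennreal c * (ennreal (1 / c) * a) \<le> ennreal c * Inf S"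
    by (intro mult_left_mono) simp_all
  then show ?thesis by (simp only: cc)
qed

locale young =
  fixes A :: "real \<Rightarrow> real"
  assumes young: "young_function A"
begin

lemma A0 [simp]: "A 0 = 0"
  using young by (simp add: young_function_def)

lemma A_mono: "0 \<le> s \<Longrightarrow> s \<le> t \<Longrightarrow> A s \<le> A t"
  using young unfolding young_function_def
  by (cases "s = t") (auto intro!: less_imp_le strict_mono_onD[of "{0..}" A s t])

lemma A_strict: "0 \<le> s \<Longrightarrow> s < t \<Longrightarrow> A s < A t"
  using young unfolding young_function_def by (auto intro: strict_mono_onD[of "{0..}" A s t])

lemma A_nonneg: "0 \<le> t \<Longrightarrow> 0 \<le> A t"
  using A_mono[of 0 t] by simp

lemma A_pos: "0 < t \<Longrightarrow> 0 < A t"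
  using A_strict[of 0 t] by simp

lemma A_convex_ray:
  assumes "0 < s" "s \<le> t" shows "A s * t \<le> A t * s"
proof -
  have "convex_on {0..} A" using young by (simp add: young_function_def)
  from convex_onD[OF this, of "s / t" 0 t] have "A (s / t * t) \<le> (1 - s / t) * A 0 + s / t * A t"
    using assms by simp
  then show ?thesis using assms by (simp add: field_simps)
qed

lemma A_continuous: "continuous_on UNIV (\<lambda>t. A (max 0 t))"
proof (rule continuous_on_compose2[of "{0..}" A])
  show "continuous_on {0..} A" using young by (simp add: young_function_def)
  show "continuous_on UNIV (\<lambda>t::real. max 0 t)" by (intro continuous_intros)
qed auto

lemma A_borel: "(\<lambda>t. A (max 0 t)) \<in> borel_measurable borel"
  by (rule borel_measurable_continuous_onI[OF A_continuous])

lemma A_abs_measurable [measurable]: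
  assumes [measurable]: "g \<in> borel_measurable M" shows "(\<lambda>y. A \<bar>g y\<bar>) \<in> borel_measurable M"
proof -
  have "(\<lambda>y. A (max 0 \<bar>g y\<bar>)) \<in> borel_measurable M"
    by (rule measurable_compose[OF _ A_borel, of "\<lambda>y. \<bar>g y\<bar>"]) measurable
  then show ?thesis by (simp add: max_def)
qed

text \<open>Young's inequality with the complementary function replaced by one term of its supremum.
  That term is a measurable function of the integration variable, so integrals can be split before
  the supremum is brought in by monotonicity.\<close>

lemma young_ineq: "ennreal (s * t) \<le> ennreal (A s) + ennreal (s * t - A s)"
proof -
  consider "0 \<le> A s" "0 \<le> s * t - A s" | "A s < 0" | "s * t \<le> A s" by linarith
  then show ?thesis
  proof cases
    case 1
    then show ?thesis by (simp add: ennreal_plus[symmetric] del: ennreal_plus)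
  next
    case 2
    then show ?thesis by (intro add_increasing ennreal_leI) auto
  next
    case 3
    then show ?thesis by (intro add_increasing2 ennreal_leI) auto
  qed
qed

lemma complementary_ge: "0 \<le> s \<Longrightarrow> ennreal (s * t - A s) \<le> complementary A t"
  unfolding complementary_def by (cases "s = 0") (auto intro: SUP_upper)

text \<open>Generalised Hoelder inequality. For an admissible \<open>r\<close>, Young's inequality
  is applied to \<open>g\<close> and \<open>h / r\<close>: the mass of \<open>A (|g|)\<close>
  contributes \<open>D\<close> and the admissibility of \<open>r\<close> contributes 1. The infimum
  over \<open>r\<close> comes last.\<close>

lemma lux_int:
  fixes c :: "real ^ 'n"
  assumes l: "0 < l" and [measurable]: "h \<in> borel_measurable lebesgue" "g \<in> borel_measurable lebesgue"
    and D: "0 \<le> D" "(\<integral>\<^sup>+y\<in>cube c l. A \<bar>g y\<bar> \<partial>lebesgue) \<le> ennreal (D * l ^ CARD('n))"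
  shows "(\<integral>\<^sup>+y\<in>cube c l. \<bar>h y\<bar> * \<bar>g y\<bar> \<partial>lebesgue)
    \<le> ennreal ((D + 1) * l ^ CARD('n)) * luxemburg (complementary A) (cube c l) h"
  unfolding luxemburg_def
proof (rule le_cmult_Inf)
  show "0 < (D + 1) * l ^ CARD('n)" using l D by simp
  fix s assume "s \<in> {ennreal r |r. 0 < r \<and>
       (\<integral>\<^sup>+ y\<in>cube c l. complementary A (\<bar>h y\<bar> / r) \<partial>lebesgue) / emeasure lebesgue (cube c l) \<le> 1}"
  then obtain r where r: "s = ennreal r" "0 < r"
    "(\<integral>\<^sup>+ y\<in>cube c l. complementary A (\<bar>h y\<bar> / r) \<partial>lebesgue) / emeasure lebesgue (cube c l) \<le> 1"
    by blast
  have ln: "0 < l ^ CARD('n)" using l by simp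
  have em: "emeasure lebesgue (cube c l) = ennreal (l ^ CARD('n))"
    using emeasure_box_centre(2)[of l c] l by simp
  have comp: "(\<integral>\<^sup>+ y\<in>cube c l. complementary A (\<bar>h y\<bar> / r) \<partial>lebesgue) \<le> ennreal (l ^ CARD('n))"
  proof -
    define X where "X = (\<integral>\<^sup>+ y\<in>cube c l. complementary A (\<bar>h y\<bar> / r) \<partial>lebesgue)"
    have "X = X * ennreal (l ^ CARD('n)) / ennreal (l ^ CARD('n))"
      using l by (intro ennreal_mult_divide_eq[symmetric]) auto
    also have "\<dots> = X / ennreal (l ^ CARD('n)) * ennreal (l ^ CARD('n))"
      by (metis ennreal_times_divide mult.commute)
    also have "\<dots> \<le> 1 * ennreal (l ^ CARD('n))"
      using r(3) unfolding em X_def by (intro mult_right_mono) auto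
    finally show ?thesis by (simp add: X_def)
  qed
  have cm [measurable]: "cube c l \<in> sets lebesgue" by simp
  have "(\<integral>\<^sup>+y\<in>cube c l. \<bar>h y\<bar> * \<bar>g y\<bar> \<partial>lebesgue)
    = (\<integral>\<^sup>+y. ennreal r * (ennreal (\<bar>g y\<bar> * (\<bar>h y\<bar> / r)) * indicator (cube c l) y) \<partial>lebesgue)"
  proof (intro nn_integral_cong)
    fix y
    have "\<bar>h y\<bar> * \<bar>g y\<bar> = r * (\<bar>g y\<bar> * (\<bar>h y\<bar> / r))" using r(2) by simp
    then have "ennreal (\<bar>h y\<bar> * \<bar>g y\<bar>) = ennreal r * ennreal (\<bar>g y\<bar> * (\<bar>h y\<bar> / r))"
      using r(2) by (metis ennreal_mult' less_imp_le)
    then show "ennreal (\<bar>h y\<bar> * \<bar>g y\<bar>) * indicator (cube c l) y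
       = ennreal r * (ennreal (\<bar>g y\<bar> * (\<bar>h y\<bar> / r)) * indicator (cube c l) y)"
      by (simp add: mult.assoc)
  qed
  also have "\<dots> = ennreal r * (\<integral>\<^sup>+y\<in>cube c l. ennreal (\<bar>g y\<bar> * (\<bar>h y\<bar> / r)) \<partial>lebesgue)"
    by (rule nn_integral_cmult) measurable
  also have "\<dots> \<le> ennreal r * (\<integral>\<^sup>+y. (ennreal (A \<bar>g y\<bar>) * indicator (cube c l) y
      + ennreal (\<bar>g y\<bar> * (\<bar>h y\<bar> / r) - A \<bar>g y\<bar>) * indicator (cube c l) y) \<partial>lebesgue)"
    unfolding distrib_right[symmetric] by (intro mult_left_mono mult_right_mono nn_integral_mono young_ineq) simp_all
  also have "\<dots> = ennreal r * ((\<integral>\<^sup>+y\<in>cube c l. ennreal (A \<bar>g y\<bar>) \<partial>lebesgue)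
      + (\<integral>\<^sup>+y\<in>cube c l. ennreal (\<bar>g y\<bar> * (\<bar>h y\<bar> / r) - A \<bar>g y\<bar>) \<partial>lebesgue))"
    by (subst nn_integral_add) measurable
  also have "\<dots> \<le> ennreal r * (ennreal (D * l ^ CARD('n)) + ennreal (l ^ CARD('n)))"
  proof (intro mult_left_mono add_mono D(2) order_trans[OF _ comp] nn_integral_mono)
    fix y
    show "ennreal (\<bar>g y\<bar> * (\<bar>h y\<bar> / r) - A \<bar>g y\<bar>) * indicator (cube c l) y
      \<le> complementary A (\<bar>h y\<bar> / r) * indicator (cube c l) y"
      by (intro mult_right_mono complementary_ge) auto
  qed simp
  also have "\<dots> = ennreal ((D + 1) * l ^ CARD('n)) * s"
    using r ln D by (simp add: ennreal_plus[symmetric] ennreal_mult[symmetric] algebra_simps del: ennreal_plus)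
  finally show "(\<integral>\<^sup>+y\<in>cube c l. \<bar>h y\<bar> * \<bar>g y\<bar> \<partial>lebesgue) \<le> ennreal ((D + 1) * l ^ CARD('n)) * s" .
qed

text \<open>The complement of the cube is exhausted by dyadic rings, and \<open>lux_int\<close>
  applies on each of them with the same \<open>D\<close>. Its factor, the volume of the enlarged
  cube, is exactly the weight in the Hoermander sum.\<close>

lemma ring_sum:
  fixes c :: "real ^ 'n"
  assumes l: "0 < l" and h [measurable]: "h \<in> borel_measurable lebesgue" and g [measurable]: "g \<in> borel_measurable lebesgue"
    and D: "0 \<le> D" "\<And>j. (\<integral>\<^sup>+y\<in>cube c (2 ^ Suc j * l). A \<bar>g y\<bar> \<partial>lebesgue) \<le> ennreal (D * (2 ^ Suc j * l) ^ CARD('n))"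
    and H: "(\<Sum>j. ennreal ((2 ^ Suc j * l) ^ CARD('n)) * luxemburg (complementary A) (cube c (2 ^ Suc j * l))
            (\<lambda>y. h y * indicator (cube c (2 ^ Suc j * l) - cube c (2 ^ j * l)) y)) \<le> ennreal H"
  shows "(\<integral>\<^sup>+y\<in>- cube c l. \<bar>h y\<bar> * \<bar>g y\<bar> \<partial>lebesgue) \<le> ennreal ((D + 1) * H)"
proof -
  define R where "R j = cube c (2 ^ Suc j * l) - cube c (2 ^ j * l)" for j
  have [measurable]: "R j \<in> sets lebesgue" for j unfolding R_def by simp
  have cov: "\<exists>j. y \<in> R j" if y: "y \<notin> cube c l" for y
  proof -
    obtain M where M: "\<And>i. \<bar>(y - c) $ i\<bar> \<le> M"
      by (metis component_le_norm_cart)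
    obtain j0 :: nat where "M / (l / 2) < 2 ^ j0" using real_arch_pow[of 2 "M / (l / 2)"] by auto
    then have "y \<in> cube c (2 ^ j0 * l)"
    proof -
      have "\<bar>y $ i - c $ i\<bar> \<le> 2 ^ j0 * l / 2" for i
        using M[of i] \<open>M / (l / 2) < 2 ^ j0\<close> l by (simp add: field_simps)
      then show ?thesis by (simp add: mem_cube)
    qed
    define j where "j = (LEAST j. y \<in> cube c (2 ^ j * l))"
    have j: "y \<in> cube c (2 ^ j * l)" unfolding j_def by (rule LeastI) fact
    have "j \<noteq> 0" using j y by (metis mult_1 power_0)
    then obtain i where i: "j = Suc i" by (cases j) auto
    have "y \<notin> cube c (2 ^ i * l)" using not_less_Least[of i "\<lambda>j. y \<in> cube c (2 ^ j * l)"] i j_def by auto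
    then show ?thesis using j i by (auto simp: R_def)
  qed
  have "(\<integral>\<^sup>+y\<in>- cube c l. \<bar>h y\<bar> * \<bar>g y\<bar> \<partial>lebesgue) \<le> (\<integral>\<^sup>+y. (\<Sum>j. ennreal (\<bar>h y\<bar> * \<bar>g y\<bar>) * indicator (R j) y) \<partial>lebesgue)"
  proof (rule nn_integral_mono)
    fix y
    show "ennreal (\<bar>h y\<bar> * \<bar>g y\<bar>) * indicator (- cube c l) y \<le> (\<Sum>j. ennreal (\<bar>h y\<bar> * \<bar>g y\<bar>) * indicator (R j) y)"
    proof (cases "y \<in> cube c l")
      case False
      then obtain j where "y \<in> R j" using cov by blast
      then have "ennreal (\<bar>h y\<bar> * \<bar>g y\<bar>) = (\<Sum>j\<in>{j}. ennreal (\<bar>h y\<bar> * \<bar>g y\<bar>) * indicator (R j) y)" by simp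
      also have "\<dots> \<le> (\<Sum>j. ennreal (\<bar>h y\<bar> * \<bar>g y\<bar>) * indicator (R j) y)"
        by (rule sum_le_suminf) auto
      finally show ?thesis using False by simp
    qed simp
  qed
  also have "\<dots> = (\<Sum>j. \<integral>\<^sup>+y\<in>R j. ennreal (\<bar>h y\<bar> * \<bar>g y\<bar>) \<partial>lebesgue)"
    by (rule nn_integral_suminf) measurable
  also have "\<dots> \<le> (\<Sum>j. ennreal (D + 1) * (ennreal ((2 ^ Suc j * l) ^ CARD('n)) * luxemburg (complementary A) (cube c (2 ^ Suc j * l))
            (\<lambda>y. h y * indicator (R j) y)))"
  proof (rule suminf_le)
    fix j
    have "(\<integral>\<^sup>+y\<in>R j. ennreal (\<bar>h y\<bar> * \<bar>g y\<bar>) \<partial>lebesgue)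
      = (\<integral>\<^sup>+y\<in>cube c (2 ^ Suc j * l). \<bar>h y * indicator (R j) y\<bar> * \<bar>g y\<bar> \<partial>lebesgue)"
      by (intro nn_integral_cong) (auto simp: R_def split: split_indicator)
    also have "\<dots> \<le> ennreal ((D + 1) * (2 ^ Suc j * l) ^ CARD('n)) * luxemburg (complementary A) (cube c (2 ^ Suc j * l))
            (\<lambda>y. h y * indicator (R j) y)"
      using l D by (intro lux_int) auto
    also have "ennreal ((D + 1) * (2 ^ Suc j * l) ^ CARD('n)) = ennreal (D + 1) * ennreal ((2 ^ Suc j * l) ^ CARD('n))"
      using l D by (intro ennreal_mult) auto
    finally show "(\<integral>\<^sup>+y\<in>R j. ennreal (\<bar>h y\<bar> * \<bar>g y\<bar>) \<partial>lebesgue) \<le> ennreal (D + 1) * (ennreal ((2 ^ Suc j * l) ^ CARD('n)) * luxemburg (complementary A) (cube c (2 ^ Suc j * l))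
            (\<lambda>y. h y * indicator (R j) y))" by (simp only: mult.assoc)
  qed auto
  also have "\<dots> = ennreal (D + 1) * (\<Sum>j. ennreal ((2 ^ Suc j * l) ^ CARD('n)) * luxemburg (complementary A) (cube c (2 ^ Suc j * l))
            (\<lambda>y. h y * indicator (R j) y))"
    by (rule ennreal_suminf_cmult)
  also have "\<dots> \<le> ennreal (D + 1) * ennreal H"
    using H by (intro mult_left_mono) (auto simp: R_def)
  also have "\<dots> = ennreal ((D + 1) * H)" using D by (simp add: ennreal_mult')
  finally show ?thesis .
qed

text \<open>The only form in which the Hoermander condition is used. It serves twice: with
  \<open>g = 1\<close> for the bad parts of the Calderon-Zygmund decomposition, and with multiples
  of pieces of \<open>f\<close> for the oscillation on stopping cubes.\<close>

lemma hormander_const1_bound: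
  fixes c :: "real ^ 'n" and K :: "real ^ 'n \<Rightarrow> real ^ 'n \<Rightarrow> real"
  assumes l: "0 < l" and xz: "x \<in> cube c (l / 2)" "z \<in> cube c (l / 2)"
    and K [measurable]: "\<And>x. K x \<in> borel_measurable lebesgue" and g [measurable]: "g \<in> borel_measurable lebesgue"
    and D: "0 \<le> D" "\<And>j. (\<integral>\<^sup>+y\<in>cube c (2 ^ Suc j * l). A \<bar>g y\<bar> \<partial>lebesgue) \<le> ennreal (D * (2 ^ Suc j * l) ^ CARD('n))"
    and H: "hormander_const1 (complementary A) K \<le> ennreal H"
  shows "(\<integral>\<^sup>+y\<in>- cube c l. \<bar>K x y - K z y\<bar> * \<bar>g y\<bar> \<partial>lebesgue) \<le> ennreal ((D + 1) * H)"
proof (rule ring_sum[OF l _ g D])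
  show "(\<lambda>y. K x y - K z y) \<in> borel_measurable lebesgue" by simp
  let ?S = "\<lambda>c l x z. (\<Sum>j. let k = Suc j in
          ennreal ((2 ^ k * l) ^ CARD('n)) *
          luxemburg (complementary A) (cube c (2 ^ k * l))
            (\<lambda>y. (K x y - K z y) * indicator (cube c (2 ^ k * l) - cube c (2 ^ (k - 1) * l)) y))"
  have "(\<Sum>j. ennreal ((2 ^ Suc j * l) ^ CARD('n)) * luxemburg (complementary A) (cube c (2 ^ Suc j * l))
            (\<lambda>y. (K x y - K z y) * indicator (cube c (2 ^ Suc j * l) - cube c (2 ^ j * l)) y)) = ?S c l x z"
    by (simp add: Let_def)
  also have "\<dots> \<le> (SUP z\<in>cube c (l / 2). ?S c l x z)" by (rule SUP_upper[OF xz(2)])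
  also have "\<dots> \<le> (SUP x\<in>cube c (l / 2). SUP z\<in>cube c (l / 2). ?S c l x z)"
    by (rule SUP_upper[OF xz(1), where f = "\<lambda>x. SUP z\<in>cube c (l / 2). ?S c l x z"])
  also have "\<dots> \<le> hormander_const1 (complementary A) K"
    unfolding hormander_const1_def by (rule SUP_upper2[of "(c, l)"]) (use l in auto)
  finally show "(\<Sum>j. ennreal ((2 ^ Suc j * l) ^ CARD('n)) * luxemburg (complementary A) (cube c (2 ^ Suc j * l))
            (\<lambda>y. (K x y - K z y) * indicator (cube c (2 ^ Suc j * l) - cube c (2 ^ j * l)) y)) \<le> ennreal H"
    using H by (rule order_trans)
qed

end

text \<open>\<open>K\<close>, \<open>H\<close>, \<open>B\<close> and \<open>cK\<close> are witnesses
  for the existential statements in \<open>hormander_operator\<close>. All constants defined in this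
  locale are expressions in them, in \<open>A\<close> and in the dimension, so the final constant is
  fixed before the weight, \<phi>, the height and the function.\<close>

locale hoermander = young A
  for A :: "real \<Rightarrow> real" +
  fixes T :: "(real ^ 'n \<Rightarrow> real) \<Rightarrow> real ^ 'n \<Rightarrow> real" and K :: "real ^ 'n \<Rightarrow> real ^ 'n \<Rightarrow> real"
    and H B cK :: real
  assumes submult: "\<And>x y. 0 \<le> x \<Longrightarrow> 0 \<le> y \<Longrightarrow> A (x * y) \<le> A x * A y"
    and T_L2: "\<And>f. f \<in> L2 \<Longrightarrow> T f \<in> L2"
    and T_lin: "\<And>f g a b. f \<in> L2 \<Longrightarrow> g \<in> L2 \<Longrightarrow>
          AE x in lebesgue. T (\<lambda>y. a * f y + b * g y) x = a * T f x + b * T g x"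
    and B0: "0 \<le> B" and T_bd: "\<And>f. f \<in> L2 \<Longrightarrow> (LINT x|lebesgue. (T f x)\<^sup>2) \<le> B * (LINT x|lebesgue. (f x)\<^sup>2)"
    and K_loc: "\<And>C. compact C \<Longrightarrow> C \<subseteq> {(x, y). x \<noteq> y} \<Longrightarrow> set_integrable lebesgue C (\<lambda>(x, y). K x y)"
    and K_meas [measurable]: "\<And>x. (\<lambda>y. K x y) \<in> borel_measurable lebesgue" "\<And>x. (\<lambda>y. K y x) \<in> borel_measurable lebesgue"
    and cK: "0 \<le> cK" and K_size: "\<And>x y. x \<noteq> y \<Longrightarrow> \<bar>K x y\<bar> \<le> cK / norm (x - y) ^ CARD('n)"
    and H0: "0 \<le> H" and H1: "hormander_const1 (complementary A) K \<le> ennreal H"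
    and H2: "hormander_const1 (complementary A) (\<lambda>x y. K y x) \<le> ennreal H"
    and T_K: "\<And>f. f \<in> Cc_infinity \<Longrightarrow> AE x in lebesgue. x \<notin> supp f \<longrightarrow> T f x = (LINT y|lebesgue. K x y * f y)"
begin

lemma A1: "1 \<le> A 1"
  using submult[of 1 1] A_pos[of 1] by simp

lemma T_meas [measurable]: "nice g \<Longrightarrow> T g \<in> borel_measurable lebesgue"
  using T_L2[OF nice_L2] by (simp add: L2_def)

lemma T_diff:
  assumes "nice f" "nice g" shows "AE x in lebesgue. T (\<lambda>y. f y - g y) x = T f x - T g x"
  using T_lin[OF nice_L2[OF assms(1)] nice_L2[OF assms(2)], of 1 "-1"] by simp

lemma T_add:
  assumes "nice f" "nice g" shows "AE x in lebesgue. T (\<lambda>y. f y + g y) x = T f x + T g x"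
  using T_lin[OF nice_L2[OF assms(1)] nice_L2[OF assms(2)], of 1 1] by simp

lemma T_cmult:
  assumes "nice f" shows "AE x in lebesgue. T (\<lambda>y. a * f y) x = a * T f x"
  using T_lin[OF nice_L2[OF assms(1)] nice_L2[OF assms(1)], of a 0] by simp

lemma T_sq_integrable: "nice f \<Longrightarrow> integrable lebesgue (\<lambda>x. (T f x)\<^sup>2)"
  using T_L2[OF nice_L2] by (simp add: L2_def)

lemma T_null:
  assumes f: "nice f" and 0: "AE x in lebesgue. f x = 0" shows "AE x in lebesgue. T f x = 0"
proof -
  have "(LINT x|lebesgue. (f x)\<^sup>2) = 0"
    by (rule integral_eq_zero_AE) (use 0 in auto)
  with T_bd[OF nice_L2[OF f]] have "(LINT x|lebesgue. (T f x)\<^sup>2) \<le> 0" by simp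
  then have "(LINT x|lebesgue. (T f x)\<^sup>2) = 0" by (intro antisym) auto
  then have "AE x in lebesgue. (T f x)\<^sup>2 = 0"
    using integral_nonneg_eq_0_iff_AE[OF T_sq_integrable[OF f]] by simp
  then show ?thesis by simp
qed

lemma T_sum:
  assumes "finite I" "\<And>i. i \<in> I \<Longrightarrow> nice (f i)"
  shows "AE x in lebesgue. T (\<lambda>y. \<Sum>i\<in>I. f i y) x = (\<Sum>i\<in>I. T (f i) x)"
  using assms
proof (induction rule: finite_induct)
  case empty
  show ?case using T_null[OF nice_zero] by simp
next
  case (insert i I)
  have "AE x in lebesgue. T (\<lambda>y. f i y + (\<Sum>i\<in>I. f i y)) x = T (f i) x + T (\<lambda>y. \<Sum>i\<in>I. f i y) x"
    using insert by (intro T_add nice_sum) auto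
  moreover have "AE x in lebesgue. T (\<lambda>y. \<Sum>i\<in>I. f i y) x = (\<Sum>i\<in>I. T (f i) x)"
    using insert by auto
  ultimately show ?case
    by eventually_elim (use insert in simp)
qed

text \<open>Bounded pointwise convergence within a fixed bounded set gives L2 convergence, which
  \<open>T\<close> preserves; almost everywhere convergence of the images holds along a
  subsequence.\<close>

lemma T_limit:
  assumes g: "\<And>n. nice (g n)" and h: "nice h" and M: "\<And>n x. \<bar>g n x\<bar> \<le> M"
    and S: "bounded S" "\<And>n x. x \<notin> S \<Longrightarrow> g n x = 0"
    and lim: "AE x in lebesgue. (\<lambda>n. g n x) \<longlonglongrightarrow> h x"
  shows "\<exists>r :: nat \<Rightarrow> nat. strict_mono r \<and> (AE x in lebesgue. (\<lambda>n. T (g (r n)) x) \<longlonglongrightarrow> T h x)"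
proof -
  note d = nice_diff[OF g h]
  have c: "(\<lambda>n. B * (\<integral>x. (g n x - h x)\<^sup>2 \<partial>lebesgue)) \<longlonglongrightarrow> B * 0"
    by (intro tendsto_intros nice_dct[OF g h M S lim])
  have "(\<lambda>n. \<integral>x. (T (\<lambda>y. g n y - h y) x)\<^sup>2 \<partial>lebesgue) \<longlonglongrightarrow> 0"
    by (rule tendsto_sandwich[OF _ _ tendsto_const c[simplified]])
       (use T_bd[OF nice_L2[OF d]] in \<open>auto intro!: always_eventually\<close>)
  then have "(\<lambda>n. \<integral>x. norm ((T (\<lambda>y. g n y - h y) x)\<^sup>2) \<partial>lebesgue) \<longlonglongrightarrow> 0" by simp
  from tendsto_L1_AE_subseq[OF T_sq_integrable[OF d] this]
  obtain r :: "nat \<Rightarrow> nat" where r: "strict_mono r"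
    "AE x in lebesgue. (\<lambda>n. (T (\<lambda>y. g (r n) y - h y) x)\<^sup>2) \<longlonglongrightarrow> 0" by blast
  have "AE x in lebesgue. \<forall>n. T (\<lambda>y. g n y - h y) x = T (g n) x - T h x"
    unfolding AE_all_countable using T_diff[OF g h] by blast
  with r(2) have "AE x in lebesgue. (\<lambda>n. T (g (r n)) x) \<longlonglongrightarrow> T h x"
  proof eventually_elim
    case (elim x)
    have "(\<lambda>n. sqrt ((T (\<lambda>y. g (r n) y - h y) x)\<^sup>2)) \<longlonglongrightarrow> sqrt 0"
      by (intro tendsto_intros elim(1))
    then have "(\<lambda>n. \<bar>T (g (r n)) x - T h x\<bar>) \<longlonglongrightarrow> 0" using elim(2) by simp
    then show ?case by (simp add: tendsto_rabs_zero_iff LIM_zero_iff)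
  qed
  with r(1) show ?thesis by blast
qed

text \<open>The exceptional set \<open>F\<close> is kept as a parameter because limits and sums are
  formed with a common \<open>F\<close>. The property passes from bumps to indicators of cells, to
  dyadic step functions, and to continuous functions cut off along unions of cells.\<close>

definition rep :: "(real ^ 'n \<Rightarrow> real) \<Rightarrow> (real ^ 'n) set \<Rightarrow> bool" where
  "rep g F \<longleftrightarrow> (AE x in lebesgue. x \<notin> F \<longrightarrow> T g x = (LINT y|lebesgue. K x y * g y))"

text \<open>Here the size condition on the kernel enters: a point outside a closed set has positive
  distance \<open>d\<close> from it.\<close>

lemma K_bound:
  assumes "closed F" "x \<notin> F"
  shows "\<exists>M\<ge>0. \<forall>y\<in>F. \<bar>K x y\<bar> \<le> M"
proof -
  obtain d where d: "0 < d" "ball x d \<subseteq> - F"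
    using assms by (metis ComplI open_Compl open_contains_ball)
  have "\<bar>K x y\<bar> \<le> cK / d ^ CARD('n)" if "y \<in> F" for y
  proof -
    have y: "d \<le> norm (x - y)" using d that by (auto simp: dist_norm subset_iff not_less)
    then have "\<bar>K x y\<bar> \<le> cK / norm (x - y) ^ CARD('n)" using d(1) by (intro K_size) auto
    also have "\<dots> \<le> cK / d ^ CARD('n)" using y d(1) cK by (intro divide_left_mono power_mono mult_pos_pos zero_less_power) auto
    finally show ?thesis .
  qed
  then show ?thesis using d(1) cK by (intro exI[of _ "cK / d ^ CARD('n)"]) auto
qed

lemma kint:
  assumes F: "closed F" "x \<notin> F" and g: "nice g" "\<And>y. y \<notin> F \<Longrightarrow> g y = 0"
  shows "integrable lebesgue (\<lambda>y. K x y * g y)"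
proof -
  obtain M where M: "0 \<le> M" "\<And>y. y \<in> F \<Longrightarrow> \<bar>K x y\<bar> \<le> M" using K_bound[OF F] by blast
  show ?thesis
  proof (rule Bochner_Integration.integrable_bound)
    show "integrable lebesgue (\<lambda>y. M * \<bar>g y\<bar>)" using nice_integrable[OF nice_cmult[OF nice_abs[OF g(1)]]] .
    show "(\<lambda>y. K x y * g y) \<in> borel_measurable lebesgue"
      using g(1) by (auto intro: borel_measurable_times simp: nice_def)
    show "AE y in lebesgue. norm (K x y * g y) \<le> norm (M * \<bar>g y\<bar>)"
    proof (rule AE_I2)
      fix y
      show "norm (K x y * g y) \<le> norm (M * \<bar>g y\<bar>)"
        using M g(2)[of y] by (cases "y \<in> F") (auto simp: abs_mult intro: mult_right_mono)
    qed
  qed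
qed

text \<open>Outside \<open>F\<close> the kernel is bounded on \<open>F\<close>, so the integrals
  converge by dominated convergence; the other side converges by \<open>T_limit\<close>. Both limits
  are taken along the same subsequence.\<close>

lemma rep_limit:
  assumes F: "compact F" and g: "\<And>n. nice (g n)" and h: "nice h" and M: "\<And>n x. \<bar>g n x\<bar> \<le> M"
    and S: "\<And>n x. x \<notin> F \<Longrightarrow> g n x = 0"
    and lim: "AE x in lebesgue. (\<lambda>n. g n x) \<longlonglongrightarrow> h x"
    and rep: "\<And>n. rep (g n) F"
  shows "rep h F"
proof -
  obtain r :: "nat \<Rightarrow> nat" where r: "strict_mono r" "AE x in lebesgue. (\<lambda>n. T (g (r n)) x) \<longlonglongrightarrow> T h x"
    using T_limit[OF g h M compact_imp_bounded[OF F] S lim] by blast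
  have "AE x in lebesgue. \<forall>n. x \<notin> F \<longrightarrow> T (g n) x = (LINT y|lebesgue. K x y * g n y)"
    unfolding AE_all_countable using rep unfolding rep_def by blast
  with r(2) show ?thesis
    unfolding rep_def
  proof eventually_elim
    case (elim x)
    show ?case
    proof
      assume x: "x \<notin> F"
      obtain N where N: "0 \<le> N" "\<And>y. y \<in> F \<Longrightarrow> \<bar>K x y\<bar> \<le> N"
        using K_bound[OF compact_imp_closed[OF F] x] by blast
      have M0: "0 \<le> M" using M[of 0 0] by linarith
      have "(\<lambda>n. LINT y|lebesgue. K x y * g (r n) y) \<longlonglongrightarrow> (LINT y|lebesgue. K x y * h y)"
      proof (rule integral_dominated_convergence)
        show "integrable lebesgue (\<lambda>y. (N * M) * indicator F y)"
          using F by (intro nice_integrable nice_cmult nice_indicator) (auto simp: compact_imp_bounded compact_imp_closed)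
        show "AE y in lebesgue. (\<lambda>n. K x y * g (r n) y) \<longlonglongrightarrow> K x y * h y"
          using lim by eventually_elim (intro tendsto_intros LIMSEQ_subseq_LIMSEQ[OF _ r(1), unfolded o_def])
        show "AE y in lebesgue. norm (K x y * g (r n) y) \<le> (N * M) * indicator F y" for n
        proof (rule AE_I2)
          fix y
          show "norm (K x y * g (r n) y) \<le> (N * M) * indicator F y"
            using N(2)[of y] M[of "r n" y] S[of y "r n"] N(1) M0
            by (cases "y \<in> F") (auto simp: abs_mult intro!: mult_mono)
        qed
        show "(\<lambda>y. K x y * g (r n) y) \<in> borel_measurable lebesgue" for n
          using g[of "r n"] by (auto intro: borel_measurable_times simp: nice_def)
        show "(\<lambda>y. K x y * h y) \<in> borel_measurable lebesgue"
          using h by (auto intro: borel_measurable_times simp: nice_def)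
      qed
      moreover have "(\<lambda>n. LINT y|lebesgue. K x y * g (r n) y) = (\<lambda>n. T (g (r n)) x)"
        using elim x by auto
      ultimately show "T h x = (LINT y|lebesgue. K x y * h y)"
        using elim(1) LIMSEQ_unique by fastforce
    qed
  qed
qed

lemma rep_mono: "rep g F \<Longrightarrow> F \<subseteq> F' \<Longrightarrow> rep g F'"
  unfolding rep_def by (auto elim!: eventually_mono)

lemma rep_lin:
  assumes F: "closed F" and g: "nice g" "\<And>y. y \<notin> F \<Longrightarrow> g y = 0" "rep g F"
    and h: "nice h" "\<And>y. y \<notin> F \<Longrightarrow> h y = 0" "rep h F"
  shows "rep (\<lambda>y. a * g y + b * h y) F"
  using T_lin[OF nice_L2[OF g(1)] nice_L2[OF h(1)], of a b] g(3) h(3)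
  unfolding rep_def
proof eventually_elim
  case (elim x)
  show ?case
  proof
    assume x: "x \<notin> F"
    have "(LINT y|lebesgue. K x y * (a * g y + b * h y)) = (LINT y|lebesgue. a * (K x y * g y) + b * (K x y * h y))"
      by (simp add: algebra_simps)
    also have "\<dots> = a * (LINT y|lebesgue. K x y * g y) + b * (LINT y|lebesgue. K x y * h y)"
      using kint[OF F x g(1,2)] kint[OF F x h(1,2)] by simp
    finally show "T (\<lambda>y. a * g y + b * h y) x = (LINT y|lebesgue. K x y * (a * g y + b * h y))"
      using elim x by simp
  qed
qed

lemma rep_zero: "rep (\<lambda>y. 0) F"
  unfolding rep_def using T_null[OF nice_zero] by (auto elim!: eventually_mono)

lemma rep_sum:
  assumes "closed F" "finite I" "\<And>i. i \<in> I \<Longrightarrow> nice (g i) \<and> (\<forall>y. y \<notin> F \<longrightarrow> g i y = 0) \<and> rep (g i) F"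
  shows "rep (\<lambda>y. \<Sum>i\<in>I. g i y) F"
  using assms(2,3)
proof (induction rule: finite_induct)
  case empty
  show ?case by (simp add: rep_zero)
next
  case (insert i I)
  then show ?case
    using rep_lin[OF assms(1), of "g i" "\<lambda>y. \<Sum>i\<in>I. g i y" 1 1] by (auto intro: nice_sum)
qed

text \<open>The bumps tend to the indicator of the open box, which differs from that of
  \<open>S\<close> only on the boundary of the box, a null set.\<close>

lemma rep_box_AE:
  assumes ab: "\<And>i. a $ i \<le> b $ i" and S: "S \<in> sets lebesgue" "box a b \<subseteq> S" "S \<subseteq> cbox a b"
  shows "rep (indicator S) (cbox a b)"
proof (rule rep_limit[where g = "\<lambda>m. bump m a b" and M = 1])
  show "nice (bump n a b)" for n
    using bump_bounds[of n a b] bump_outside[OF ab] C_k_continuous[OF C_k_bump]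
    by (intro niceI[of _ 1 "box a b"] lebesgue_of_borel borel_measurable_continuous_onI) (auto simp: bounded_box abs_le_iff intro: order_trans[of _ 0])
  show "nice (indicator S :: real ^ 'n \<Rightarrow> real)"
    using S bounded_subset[OF bounded_cbox S(3)] by (intro nice_indicator)
  show "\<bar>bump n a b x\<bar> \<le> 1" for n x
    using bump_bounds[of n a b x] by simp
  show "bump n a b x = 0" if "x \<notin> cbox a b" for n x
    using that box_subset_cbox by (intro bump_outside[OF ab]) blast
  have "negligible (cbox a b - box a b)" by (rule negligible_frontier_interval)
  then have "cbox a b - box a b \<in> null_sets lebesgue" by (simp add: negligible_iff_null_sets)
  then have "AE x in lebesgue. x \<notin> cbox a b - box a b" by (rule AE_not_in)
  then show "AE x in lebesgue. (\<lambda>n. bump n a b x) \<longlonglongrightarrow> indicator S x"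
  proof eventually_elim
    case (elim x)
    then have "indicator S x = (indicator (box a b) x :: real)" using S by (auto simp: indicator_def)
    then show ?case using bump_tendsto[OF ab] by simp
  qed
  show "rep (bump n a b) (cbox a b)" for n
    using T_K[OF bump_Cc[OF ab, of n]] unfolding rep_def
    by (rule eventually_mono) (use supp_bump[OF ab, of n] in blast)
qed simp

lemma rep_dy:
  assumes L: "0 < L" shows "rep (indicator (dy L q)) (cube (ctr L q) (edge L q))"
  unfolding cube_def
  using box_subset_nb[OF L, of q 0] nb_subset_cube[OF L, of 0 q] edge_pos[OF L, of q]
  by (intro rep_box_AE) (auto simp: cube_def)

end

lemma cube_subset_closure_dy:
  assumes L: "0 < L" shows "cube (ctr L q) (edge L q) \<subseteq> closure (dy L q)"
proof -
  have "box (ctr L q - (\<chi> i. edge L q / 2)) (ctr L q + (\<chi> i. edge L q / 2)) \<noteq> {}"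
    using edge_pos[OF L, of q] by (auto simp: interval_ne_empty_cart)
  from closure_box[OF this] have "cube (ctr L q) (edge L q)
     = closure (box (ctr L q - (\<chi> i. edge L q / 2)) (ctr L q + (\<chi> i. edge L q / 2)))"
    by (simp add: cube_def)
  also have "\<dots> \<subseteq> closure (dy L q)"
    using box_subset_nb[OF L, of q 0] by (intro closure_mono) simp
  finally show ?thesis .
qed

section \<open>Dyadic step functions\<close>

definition crn :: "real \<Rightarrow> 'n::finite cell \<Rightarrow> real ^ 'n" where
  "crn L q = (\<chi> i. edge L q * snd q $ i)"

definition step :: "real \<Rightarrow> nat \<Rightarrow> (real ^ 'n \<Rightarrow> real) \<Rightarrow> bool" where
  "step L N g \<longleftrightarrow> (\<forall>x y. idx L N x = idx L N y \<longrightarrow> g x = g y) \<and> bounded {x. g x \<noteq> 0}"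

text \<open>Saturation with respect to the partition into cells of generation \<open>N\<close>: the
  set is a union of such cells, so cutting along it does not destroy constancy on cells.\<close>

definition sat :: "real \<Rightarrow> nat \<Rightarrow> (real ^ 'n) set \<Rightarrow> bool" where
  "sat L N S \<longleftrightarrow> (\<forall>x y. idx L N x = idx L N y \<longrightarrow> (x \<in> S \<longleftrightarrow> y \<in> S))"

lemma crn_mem: "0 < L \<Longrightarrow> crn L q \<in> dy L q"
  by (auto simp: mem_nb_bounds crn_def edge_pos)

lemma idx_crn [simp]: "0 < L \<Longrightarrow> idx L (fst q) (crn L q) = q"
  using crn_mem mem_dy_iff by blast

lemma sat_nb: "fst q \<le> N \<Longrightarrow> sat L N (nb L r (q :: ('n::finite) cell))"
  unfolding sat_def mem_nb_iff
proof (intro allI impI)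
  fix x y :: "real ^ 'n" assume "fst q \<le> N" "idx L N x = idx L N y"
  then have "idx L (fst q) x = idx L (fst q) y"
    using par_idx[of "fst q" N L x] par_idx[of "fst q" N L y] by simp
  then show "idx L (fst q) x \<in> nbrs r q \<longleftrightarrow> idx L (fst q) y \<in> nbrs r q" by simp
qed

lemma sat_mono: "sat L j S \<Longrightarrow> j \<le> N \<Longrightarrow> sat L N S"
  unfolding sat_def by (metis par_idx)

lemma sat_diff: "sat L N S \<Longrightarrow> sat L N S' \<Longrightarrow> sat L N (S - S')"
  unfolding sat_def by blast

lemma step_decomp:
  fixes g :: "real ^ 'n \<Rightarrow> real"
  assumes L: "0 < L" and g: "step L N g"
  defines "I \<equiv> {q. fst q = N \<and> dy L q \<inter> {x. g x \<noteq> 0} \<noteq> {}}"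
  shows "finite I" and "g = (\<lambda>x. \<Sum>q\<in>I. g (crn L q) * indicator (dy L q) x)"
    and "\<And>q. q \<in> I \<Longrightarrow> dy L q \<subseteq> {x. g x \<noteq> 0}"
proof -
  have "finite {q. fst q \<le> N \<and> dy L q \<inter> {x. g x \<noteq> 0} \<noteq> {}}"
    using g unfolding step_def by (intro finite_dy_meet L) blast
  then show fin: "finite I" by (rule finite_subset[rotated]) (auto simp: I_def)
  have const: "g x = g (crn L (idx L N x))" for x
  proof -
    have "idx L N x = idx L N (crn L (idx L N x))" using idx_crn[OF L, of "idx L N x"] by simp
    then show ?thesis using g unfolding step_def by blast
  qed
  show "g = (\<lambda>x. \<Sum>q\<in>I. g (crn L q) * indicator (dy L q) x)"
  proof
    fix x
    have "(\<Sum>q\<in>I. g (crn L q) * indicator (dy L q) x) = (\<Sum>q\<in>I. if q = idx L N x then g x else 0)"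
    proof (intro sum.cong refl)
      fix q assume "q \<in> I"
      then have "fst q = N" by (simp add: I_def)
      then have "x \<in> dy L q \<longleftrightarrow> q = idx L N x" by (auto simp: mem_dy_iff)
      then show "g (crn L q) * indicator (dy L q) x = (if q = idx L N x then g x else 0)"
        by (simp add: const[of x, symmetric])
    qed
    also have "\<dots> = (if idx L N x \<in> I then g x else 0)" using fin by (simp add: sum.delta')
    also have "\<dots> = g x"
      using mem_dy_idx[of x L N] by (force simp: I_def)
    finally show "g x = (\<Sum>q\<in>I. g (crn L q) * indicator (dy L q) x)" by simp
  qed
  fix q assume "q \<in> I"
  then obtain x where x: "x \<in> dy L q" "g x \<noteq> 0" "fst q = N" unfolding I_def by blast
  show "dy L q \<subseteq> {x. g x \<noteq> 0}"
  proof
    fix y assume "y \<in> dy L q"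
    then have "idx L N y = idx L N x" using x by (simp add: mem_dy_iff)
    then have "g y = g x" using g unfolding step_def by blast
    then show "y \<in> {x. g x \<noteq> 0}" using x by simp
  qed
qed

lemma step_nice:
  assumes L: "0 < L" and g: "step L N g" shows "nice g"
  by (subst step_decomp(2)[OF L g])
     (intro nice_sum step_decomp(1)[OF L g] nice_cmult nice_indicator bounded_nb L nb_lebesgue)

lemma step_borel:
  assumes L: "0 < L" and g: "step L N g" shows "g \<in> borel_measurable borel"
  by (subst step_decomp(2)[OF L g]) measurable

lemma sample_step:
  fixes S :: "(real ^ 'n) set"
  assumes "sat L N S" "bounded S"
  shows "step L N (\<lambda>x. f (crn L (idx L N x)) * indicator S x)"
  unfolding step_def
proof (intro conjI allI impI)
  fix x y :: "real ^ 'n" assume eq: "idx L N x = idx L N y"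
  then have "x \<in> S \<longleftrightarrow> y \<in> S" using assms(1) unfolding sat_def by blast
  then show "f (crn L (idx L N x)) * indicator S x = f (crn L (idx L N y)) * indicator S y"
    by (simp add: eq indicator_def)
next
  show "bounded {x. f (crn L (idx L N x)) * indicator S x \<noteq> 0}"
    by (rule bounded_subset[OF assms(2)]) (auto simp: indicator_def split: if_splits)
qed

lemma crn_dist:
  fixes x :: "real ^ 'n"
  assumes L: "0 < L" shows "norm (crn L (idx L N x) - x) \<le> CARD('n) * (L / 2 ^ N)"
proof -
  have "\<bar>(crn L (idx L N x) - x) $ i\<bar> \<le> L / 2 ^ N" for i
  proof -
    have "x \<in> dy L (idx L N x)" by simp
    from this[unfolded mem_nb_bounds[OF L], rule_format, of i] show ?thesis
      by (simp add: crn_def edge_def algebra_simps abs_le_iff)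
  qed
  then have "(\<Sum>i\<in>UNIV. \<bar>(crn L (idx L N x) - x) $ i\<bar>) \<le> (\<Sum>i\<in>(UNIV :: 'n set). L / 2 ^ N)"
    by (intro sum_mono)
  then show ?thesis using norm_le_l1_cart[of "crn L (idx L N x) - x"] by simp
qed

lemma sample_tendsto:
  fixes f :: "real ^ 'n \<Rightarrow> real"
  assumes L: "0 < L" and f: "continuous_on UNIV f"
  shows "(\<lambda>N. f (crn L (idx L N x))) \<longlonglongrightarrow> f x"
proof -
  have "(\<lambda>N. CARD('n) * (L * (1 / 2) ^ N)) \<longlonglongrightarrow> CARD('n) * (L * 0)"
    by (intro tendsto_intros LIMSEQ_realpow_zero) auto
  then have "(\<lambda>N. CARD('n) * (L * (1 / 2) ^ N)) \<longlonglongrightarrow> 0" by simp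
  then have "(\<lambda>N. crn L (idx L N x) - x) \<longlonglongrightarrow> 0"
  proof (rule Lim_null_comparison[rotated])
    have "norm (crn L (idx L N x) - x) \<le> CARD('n) * (L * (1 / 2) ^ N)" for N
      using crn_dist[OF L, of N x] by (simp add: power_one_over)
    then show "\<forall>\<^sub>F N in sequentially. norm (crn L (idx L N x) - x) \<le> CARD('n) * (L * (1 / 2) ^ N)"
      by (intro always_eventually) simp
  qed
  then have "(\<lambda>N. crn L (idx L N x)) \<longlonglongrightarrow> x" by (simp add: LIM_zero_iff)
  then show ?thesis using f continuous_on_tendsto_compose[of UNIV f] by auto
qed

context hoermander begin

lemma rep_step:
  assumes L: "0 < L" and g: "step L N g" shows "rep g (closure {x. g x \<noteq> 0})"
proof (subst step_decomp(2)[OF L g], rule rep_sum)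
  fix q assume q: "q \<in> {q. fst q = N \<and> dy L q \<inter> {x. g x \<noteq> 0} \<noteq> {}}"
  have sub: "dy L q \<subseteq> {x. g x \<noteq> 0}" by (rule step_decomp(3)[OF L g q])
  have cube: "cube (ctr L q) (edge L q) \<subseteq> closure {x. g x \<noteq> 0}"
    using cube_subset_closure_dy[OF L, of q] closure_mono[OF sub] by blast
  have n: "nice (indicator (dy L q) :: real ^ 'n \<Rightarrow> real)"
    by (intro nice_indicator bounded_nb L nb_lebesgue)
  have z: "y \<notin> closure {x. g x \<noteq> 0} \<Longrightarrow> indicator (dy L q) y = (0::real)" for y
    using sub closure_subset[of "{x. g x \<noteq> 0}"] by (auto simp: indicator_def)
  have "rep (\<lambda>x. g (crn L q) * indicator (dy L q) x + 0 * indicator (dy L q) x) (closure {x. g x \<noteq> 0})"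
    using rep_mono[OF rep_dy[OF L] cube] n z by (intro rep_lin) auto
  with n z show "nice (\<lambda>x. g (crn L q) * indicator (dy L q) x) \<and>
     (\<forall>y. y \<notin> closure {x. g x \<noteq> 0} \<longrightarrow> g (crn L q) * indicator (dy L q) y = 0) \<and>
     rep (\<lambda>x. g (crn L q) * indicator (dy L q) x) (closure {x. g x \<noteq> 0})"
    by (auto intro: nice_cmult)
qed (rule closed_closure step_decomp(1)[OF L g])+

text \<open>Sampling at the corners of ever smaller cells approximates the continuous factor by step
  functions, while the sharp cut along \<open>S\<close> is reproduced exactly because
  \<open>S\<close> is saturated.\<close>

lemma rep_continuous:
  assumes L: "0 < L" and f: "continuous_on UNIV f" "\<And>x. \<bar>f x\<bar> \<le> M" and S: "sat L j S" "bounded S"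
    and Sm: "S \<in> sets lebesgue"
  shows "nice (\<lambda>x. f x * indicator S x)" "rep (\<lambda>x. f x * indicator S x) (closure S)"
proof -
  \<comment> \<open>The shift by \<open>j\<close> keeps \<open>S\<close> saturated at every
    generation that occurs.\<close>
  define g where "g N x = f (crn L (idx L (N + j) x)) * indicator S x" for N x
  have g: "step L (N + j) (g N)" for N
    unfolding g_def by (intro sample_step sat_mono[OF S(1)] S(2)) auto
  have M0: "0 \<le> M" using f(2)[of 0] by linarith
  have b: "\<bar>f y * indicator S x\<bar> \<le> M" for x y
    using f(2)[of y] M0 by (auto simp: indicator_def)
  have fb: "f \<in> borel_measurable lebesgue" by (intro lebesgue_of_borel borel_measurable_continuous_onI f)
  show n: "nice (\<lambda>x. f x * indicator S x)"
  proof (rule niceI[of _ M S])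
    show "(\<lambda>x. f x * indicator S x) \<in> borel_measurable lebesgue" using fb Sm by simp
    show "\<bar>f x * indicator S x\<bar> \<le> M" for x by (rule b)
  qed (use S in auto)
  show "rep (\<lambda>x. f x * indicator S x) (closure S)"
  proof (rule rep_limit[where g = g and M = M])
    show "compact (closure S)" using S(2) by (simp add: compact_closure)
    show "nice (g N)" for N by (rule step_nice[OF L g])
    show "\<bar>g N x\<bar> \<le> M" for N x unfolding g_def using b by blast
    show "g N x = 0" if "x \<notin> closure S" for N x
      using that closure_subset[of S] by (auto simp: g_def indicator_def)
    have "(\<lambda>N. g N x) \<longlonglongrightarrow> f x * indicator S x" for x
      unfolding g_def
      by (rule tendsto_mult[OF LIMSEQ_ignore_initial_segment[OF sample_tendsto[OF L f(1)]] tendsto_const])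
    then show "AE x in lebesgue. (\<lambda>N. g N x) \<longlonglongrightarrow> f x * indicator S x" by simp
    show "rep (g N) (closure S)" for N
      by (rule rep_mono[OF rep_step[OF L g]]) (auto intro!: closure_mono simp: g_def indicator_def split: if_splits)
  qed (rule n)
qed

end

section \<open>The weak type estimate\<close>

lemma emeasure_dy_lebesgue: "0 < L \<Longrightarrow> emeasure lebesgue (dy L q) = ennreal (vol L q)"
  using emeasure_dy[of L q] by simp

lemma emeasure_nb_lebesgue:
  fixes q :: "('n::finite) cell"
  shows "0 < L \<Longrightarrow> 0 \<le> r \<Longrightarrow> emeasure lebesgue (nb L r q) = ennreal (real_of_int (2 * r + 1) ^ CARD('n) * vol L q)"
  using emeasure_nb[of L r q] by simp

lemma integral_ind_dy: "0 < L \<Longrightarrow> (LINT x|lebesgue. indicator (dy L q) x) = vol L q"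
  using emeasure_dy_lebesgue[of L q] vol_pos[of L q] by (simp add: measure_def)

lemma nice_ind_nb: "0 < L \<Longrightarrow> nice (indicator (nb L r q))"
  by (intro nice_indicator nb_lebesgue bounded_nb)

lemma nice_mult_ind:
  assumes "nice g" "S \<in> sets lebesgue" shows "nice (\<lambda>x. g x * indicator S x)"
  using nice_mult_bounded[OF assms(1), of "indicator S" 1] assms(2)
  by (simp add: mult.commute indicator_def)

lemma sum_indicator_disjoint:
  assumes "finite I" "disjoint_family_on X I"
  shows "(\<Sum>i\<in>I. indicator (X i) x) = (indicator (\<Union>i\<in>I. X i) x :: real)"
  by (rule indicator_UN_disjoint[OF assms, symmetric])

lemma sum_integral_disjoint_le:
  assumes g: "nice g" and I: "finite I" "disjoint_family_on X I" "\<And>i. i \<in> I \<Longrightarrow> X i \<in> sets lebesgue"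
  shows "(\<Sum>i\<in>I. LINT x|lebesgue. \<bar>g x\<bar> * indicator (X i) x) \<le> (LINT x|lebesgue. \<bar>g x\<bar>)"
proof -
  have "(\<Sum>i\<in>I. LINT x|lebesgue. \<bar>g x\<bar> * indicator (X i) x) = (LINT x|lebesgue. (\<Sum>i\<in>I. \<bar>g x\<bar> * indicator (X i) x))"
    using I by (intro Bochner_Integration.integral_sum[symmetric] nice_integrable nice_mult_ind nice_abs g)
  also have "\<dots> \<le> (LINT x|lebesgue. \<bar>g x\<bar>)"
  proof (intro integral_mono nice_integrable nice_sum nice_mult_ind nice_abs g I)
    fix x
    show "(\<Sum>i\<in>I. \<bar>g x\<bar> * indicator (X i) x) \<le> \<bar>g x\<bar>"
      unfolding sum_distrib_left[symmetric] sum_indicator_disjoint[OF I(1,2)]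
      by (simp add: indicator_def)
  qed auto
  finally show ?thesis .
qed

lemma step_mult_dy:
  assumes L: "0 < L" and g: "step L N g" and B: "fst B \<le> N"
  shows "step L N (\<lambda>x. (g x - c) * indicator (dy L B) x)"
  unfolding step_def
proof (intro conjI allI impI)
  fix x y :: "real ^ 'a" assume eq: "idx L N x = idx L N y"
  then have "x \<in> dy L B \<longleftrightarrow> y \<in> dy L B" using sat_nb[OF B, of L 0] unfolding sat_def by blast
  moreover have "g x = g y" using g eq unfolding step_def by blast
  ultimately show "(g x - c) * indicator (dy L B) x = (g y - c) * indicator (dy L B) y"
    by (simp add: indicator_def)
next
  show "bounded {x. (g x - c) * indicator (dy L B) x \<noteq> 0}"
    by (rule bounded_subset[OF bounded_nb[OF L, of 0 B]]) (auto simp: indicator_def split: if_splits)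
qed

lemma markov_lebesgue:
  fixes u :: "'a::euclidean_space \<Rightarrow> real"
  assumes u: "u \<in> borel_measurable lebesgue" and S: "S \<in> sets lebesgue" and a: "0 < a"
    and le: "(\<integral>\<^sup>+x\<in>S. ennreal (u x) \<partial>lebesgue) \<le> ennreal c"
  shows "emeasure lebesgue {x \<in> S. a < u x} \<le> ennreal (c / a)"
proof -
  have [measurable]: "u \<in> borel_measurable lebesgue" "S \<in> sets lebesgue" by fact+
  have "emeasure lebesgue {x \<in> S. a < u x} \<le> emeasure lebesgue {x \<in> S. 1 \<le> ennreal (1 / a) * ennreal (u x)}"
  proof (rule emeasure_mono)
    show "{x \<in> S. a < u x} \<subseteq> {x \<in> S. 1 \<le> ennreal (1 / a) * ennreal (u x)}"
    proof
      fix x assume x: "x \<in> {x \<in> S. a < u x}"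
      then have "1 \<le> (1 / a) * u x" using a by (simp add: field_simps)
      then have "ennreal 1 \<le> ennreal ((1 / a) * u x)" by (rule ennreal_leI)
      then show "x \<in> {x \<in> S. 1 \<le> ennreal (1 / a) * ennreal (u x)}"
        using x a by (simp add: ennreal_mult'[symmetric])
    qed
  qed (use S in measurable)
  also have "\<dots> \<le> ennreal (1 / a) * (\<integral>\<^sup>+x. ennreal (u x) * indicator S x \<partial>lebesgue)"
    by (rule nn_integral_Markov_inequality) (use S in measurable)
  also have "\<dots> \<le> ennreal (1 / a) * ennreal c" by (intro mult_left_mono le) simp
  also have "\<dots> = ennreal (c / a)" using a by (simp add: ennreal_mult'[symmetric])
  finally show ?thesis .
qed

context hoermander begin

definition HB :: real where "HB = (A 1 + 1) * H"

lemma HB0: "0 \<le> HB"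
  using A1 H0 by (simp add: HB_def)

text \<open>The function 1 has \<open>A\<close>-mean \<open>A 1\<close>, so the condition for the
  complementary function implies the classical one with the L1 norm. The kernel is varied in its
  second argument, because the cancellation of a bad part lies in the variable of
  integration.\<close>

lemma hormander2:
  assumes l: "0 < l" and xz: "x \<in> cube c (l / 2)" "z \<in> cube c (l / 2)"
  shows "(\<integral>\<^sup>+y\<in>- cube c l. \<bar>K y x - K y z\<bar> \<partial>lebesgue) \<le> ennreal HB"
proof -
  have "(\<integral>\<^sup>+y\<in>- cube c l. \<bar>K y x - K y z\<bar> * \<bar>1 :: real\<bar> \<partial>lebesgue) \<le> ennreal ((A 1 + 1) * H)"
  proof (rule hormander_const1_bound[OF l xz, of "\<lambda>x y. K y x" "\<lambda>_. 1"])
    show "(\<integral>\<^sup>+y\<in>cube c (2 ^ Suc j * l). ennreal (A \<bar>1\<bar>) \<partial>lebesgue) \<le> ennreal (A 1 * (2 ^ Suc j * l) ^ CARD('n))" for j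
      using l A1 emeasure_box_centre(2)[of "2 ^ Suc j * l" c]
      by (subst nn_integral_cmult_indicator) (simp_all add: ennreal_mult'[symmetric])
  qed (use A1 H2 in auto)
  then show ?thesis by (simp add: HB_def)
qed

text \<open>The kernel is only Lebesgue measurable jointly, so Tonelli's theorem is applied to a Borel
  version of it; the base point \<open>y0\<close> is chosen such that the section at \<open>y0\<close> agrees with that version.\<close>

lemma bad_part:
  assumes L: "0 < L" and b: "step L N b" and supp: "{x. b x \<noteq> 0} \<subseteq> dy L q"
    and mean: "(LINT x|lebesgue. b x) = 0"
    and X: "X \<in> sets borel" "bounded X"
  shows "(\<integral>\<^sup>+x\<in>X - cube (ctr L q) (2 * edge L q). \<bar>T b x\<bar> \<partial>lebesgue) \<le> ennreal (HB * (LINT x|lebesgue. \<bar>b x\<bar>))"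
proof -
  define Q where "Q = cube (ctr L q) (2 * edge L q)"
  define P where "P = cube (ctr L q) (edge L q)"
  define U0 where "U0 = box (ctr L q - (\<chi> i. edge L q)) (ctr L q + (\<chi> i. edge L q))"
  have e: "0 < edge L q" using edge_pos[OF L] .
  have PO: "P \<subseteq> U0"
  proof
    fix x assume "x \<in> P"
    then have *: "\<bar>x $ i - ctr L q $ i\<bar> \<le> edge L q / 2" for i by (simp add: P_def mem_cube)
    have "ctr L q $ i - edge L q < x $ i \<and> x $ i < ctr L q $ i + edge L q" for i
      using *[of i] e by linarith
    then show "x \<in> U0" by (simp add: U0_def mem_box_cart)
  qed
  have OQ: "U0 \<subseteq> Q"
    using box_subset_cbox by (auto simp: U0_def Q_def cube_def)
  have dP: "dy L q \<subseteq> P" using nb_subset_cube[OF L, of 0 q] by (simp add: P_def)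
  obtain u v where uv: "X \<subseteq> cbox u v" using bounded_in_cbox[OF X(2)] by blast
  \<comment> \<open>Removing the open box \<open>U0\<close>, which lies between \<open>P\<close> and
    \<open>Q\<close>, leaves a compact set. The product with \<open>P\<close> is therefore compact
    and avoids the diagonal, where local integrability of the kernel is available.\<close>
  define C where "C = (cbox u v - U0) \<times> P"
  have C: "compact C"
    unfolding C_def P_def by (intro compact_Times compact_diff compact_cube compact_cbox) (simp add: U0_def open_box)
  have Cd: "C \<subseteq> {(x, y). x \<noteq> y}" using PO by (auto simp: C_def)
  have nb: "nice b" by (rule step_nice[OF L b])
  have bb [measurable]: "b \<in> borel_measurable borel" by (rule step_borel[OF L b])
  define W where "W = X - Q"
  have W [measurable]: "W \<in> sets borel" using X by (simp add: W_def Q_def)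
  have WC: "x \<in> W \<Longrightarrow> b y \<noteq> 0 \<Longrightarrow> (x, y) \<in> C" "x \<in> W \<Longrightarrow> y \<in> dy L q \<Longrightarrow> (x, y) \<in> C" for x y
    using uv OQ supp dP by (auto simp: W_def C_def)
  define Kc where "Kc = (\<lambda>p. indicator C p *\<^sub>R (case p of (x, y) \<Rightarrow> K x y))"
  have "Kc \<in> borel_measurable lebesgue"
    using K_loc[OF C Cd] unfolding set_integrable_def Kc_def by (rule borel_measurable_integrable)
  from completion_ex_borel_measurable_real[OF this]
  obtain K' where K' [measurable]: "K' \<in> borel_measurable borel" and KK: "AE p in lborel. Kc p = K' p"
    by auto
  obtain Z where Z0: "{p \<in> space lborel. Kc p \<noteq> K' p} \<subseteq> Z" "emeasure lborel Z = 0" "Z \<in> sets lborel"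
    by (rule AE_E[OF KK])
  then have Z: "Z \<in> null_sets lborel" "{p \<in> space lborel. Kc p \<noteq> K' p} \<subseteq> Z"
    by (auto intro: null_setsI)
  have Zm [measurable]: "Z \<in> sets borel" using Z(1) by auto
  have Zk: "p \<notin> Z \<Longrightarrow> Kc p = K' p" for p using Z(2) by auto
  have "AE p in (lborel :: ((real ^ 'n) \<times> (real ^ 'n)) measure). p \<notin> Z" using Z(1) by (rule AE_not_in)
  then have "AE p in (lborel \<Otimes>\<^sub>M lborel :: ((real ^ 'n) \<times> (real ^ 'n)) measure). p \<notin> Z" by (simp only: lborel_prod)
  then have Z1: "AE x in (lborel :: (real ^ 'n) measure). AE y in (lborel :: (real ^ 'n) measure). (x, y) \<notin> Z"
    by (rule lborel_pair.AE_pair)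
  have Z2: "AE y in (lborel :: (real ^ 'n) measure). AE x in (lborel :: (real ^ 'n) measure). (x, y) \<notin> Z"
  proof -
    have "{x \<in> space (lborel \<Otimes>\<^sub>M lborel). (case x of (x, y) \<Rightarrow> (x, y) \<notin> Z)} \<in> sets (lborel \<Otimes>\<^sub>M (lborel :: (real ^ 'n) measure) :: ((real ^ 'n) \<times> (real ^ 'n)) measure)"
      unfolding lborel_prod using Zm by (simp add: Compl_eq[symmetric])
    then have "{x \<in> space (lborel \<Otimes>\<^sub>M lborel :: ((real ^ 'n) \<times> (real ^ 'n)) measure). (fst x, snd x) \<notin> Z} \<in> sets (lborel \<Otimes>\<^sub>M lborel)"
      by (simp add: case_prod_beta)
    from lborel_pair.AE_commute[of "\<lambda>x y. (x, y) \<notin> Z", OF this] show ?thesis using Z1 by simp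
  qed
  \<comment> \<open>Almost every point qualifies as \<open>y0\<close>, and the cell has positive
    measure.\<close>
  have "\<exists>y0\<in>dy L q. AE x in lborel. (x, y0) \<notin> Z"
  proof (rule ccontr)
    assume "\<not> ?thesis"
    then have "AE y in lborel. y \<notin> dy L q" using Z2 by (auto elim!: eventually_mono)
    then have "emeasure lborel (dy L q) = 0"
      by (subst (asm) AE_iff_measurable[of "dy L q"]) auto
    then show False using emeasure_dy[OF L, of q] vol_pos[OF L, of q] by simp
  qed
  then obtain y0 where y0: "y0 \<in> dy L q" "AE x in lborel. (x, y0) \<notin> Z" by blast
  have K'e: "K' (x, y) = K x y" if "(x, y) \<notin> Z" "(x, y) \<in> C" for x y
    using Zk[OF that(1)] that(2) by (simp add: Kc_def)
  have clos: "closure {x. b x \<noteq> 0} \<subseteq> Q"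
    by (rule closure_minimal) (use supp dP PO OQ in \<open>auto simp: Q_def compact_cube compact_imp_closed\<close>)
  have main: "AE x in lborel. ennreal \<bar>T b x\<bar> * indicator W x \<le> (\<integral>\<^sup>+y. ennreal (\<bar>K' (x, y) - K' (x, y0)\<bar> * \<bar>b y\<bar>) * indicator W x \<partial>lborel)"
  proof -
    have "AE x in lborel. x \<notin> closure {x. b x \<noteq> 0} \<longrightarrow> T b x = (LINT y|lebesgue. K x y * b y)"
      using rep_step[OF L b] unfolding rep_def AE_completion_iff .
    then show ?thesis using Z1 y0(2)
    proof eventually_elim
      case (elim x)
      show ?case
      proof (cases "x \<in> W")
        case True
        then have xc: "x \<notin> closure {x. b x \<noteq> 0}" using clos by (auto simp: W_def)
        have b0: "y \<notin> closure {x. b x \<noteq> 0} \<Longrightarrow> b y = 0" for y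
          using closure_subset[of "{x. b x \<noteq> 0}"] by auto
        have i1: "integrable lebesgue (\<lambda>y. K x y * b y)"
          by (rule kint[OF closed_closure xc nb b0])
        have i2: "integrable lebesgue (\<lambda>y. K x y0 * b y)"
          by (intro nice_integrable nice_cmult nb)
        \<comment> \<open>Cancellation: the subtracted integral is \<open>K x y0\<close> times the
          integral of \<open>b\<close>, hence 0.\<close>
        have "T b x = (LINT y|lebesgue. K x y * b y) - (LINT y|lebesgue. K x y0 * b y)"
          using elim(1) xc mean by simp
        also have "\<dots> = (LINT y|lebesgue. (K x y - K x y0) * b y)"
          using Bochner_Integration.integral_diff[OF i1 i2] by (simp add: algebra_simps)
        finally have T: "T b x = (LINT y|lebesgue. (K x y - K x y0) * b y)" .
        have "integrable lebesgue (\<lambda>y. (K x y - K x y0) * b y)"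
          using Bochner_Integration.integrable_diff[OF i1 i2] by (simp add: algebra_simps)
        from integral_norm_bound_ennreal[OF this]
        have "ennreal \<bar>T b x\<bar> \<le> (\<integral>\<^sup>+y. ennreal \<bar>(K x y - K x y0) * b y\<bar> \<partial>lebesgue)"
          by (simp add: T)
        also have "\<dots> = (\<integral>\<^sup>+y. ennreal \<bar>(K x y - K x y0) * b y\<bar> \<partial>lborel)"
          by (rule nn_integral_completion)
        also have "\<dots> = (\<integral>\<^sup>+y. ennreal (\<bar>K' (x, y) - K' (x, y0)\<bar> * \<bar>b y\<bar>) * indicator W x \<partial>lborel)"
        proof (rule nn_integral_cong_AE)
          show "AE y in lborel. ennreal \<bar>(K x y - K x y0) * b y\<bar> = ennreal (\<bar>K' (x, y) - K' (x, y0)\<bar> * \<bar>b y\<bar>) * indicator W x"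
            using elim(2)
          proof eventually_elim
            case (elim y)
            have "K' (x, y0) = K x y0" by (rule K'e[OF \<open>(x, y0) \<notin> Z\<close> WC(2)[OF True y0(1)]])
            moreover have "b y = 0 \<or> K' (x, y) = K x y" using K'e[OF elim] WC(1)[OF True] by blast
            ultimately show ?case using True by (auto simp: abs_mult)
          qed
        qed
        finally show ?thesis using True by simp
      qed simp
    qed
  qed
  have "(\<integral>\<^sup>+x\<in>X - Q. \<bar>T b x\<bar> \<partial>lebesgue) = (\<integral>\<^sup>+x. ennreal \<bar>T b x\<bar> * indicator W x \<partial>lborel)"
    unfolding W_def by (rule nn_integral_completion)
  also have "\<dots> \<le> (\<integral>\<^sup>+x. \<integral>\<^sup>+y. ennreal (\<bar>K' (x, y) - K' (x, y0)\<bar> * \<bar>b y\<bar>) * indicator W x \<partial>lborel \<partial>lborel)"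
    by (rule nn_integral_mono_AE[OF main])
  also have "\<dots> = (\<integral>\<^sup>+y. \<integral>\<^sup>+x. ennreal (\<bar>K' (x, y) - K' (x, y0)\<bar> * \<bar>b y\<bar>) * indicator W x \<partial>lborel \<partial>lborel)"
  proof (rule lborel_pair.Fubini'[symmetric])
    have [measurable]: "(\<lambda>x :: real ^ 'n. (x, y0)) \<in> borel \<rightarrow>\<^sub>M borel"
      by (intro borel_measurable_continuous_onI continuous_intros)
    have [measurable]: "K' \<in> borel_measurable (borel \<Otimes>\<^sub>M borel)" using K' by (simp only: borel_prod)
    show "(\<lambda>(x, y). ennreal (\<bar>K' (x, y) - K' (x, y0)\<bar> * \<bar>b y\<bar>) * indicator W x) \<in> borel_measurable (lborel \<Otimes>\<^sub>M lborel)"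
      by measurable
  qed
  also have "\<dots> \<le> (\<integral>\<^sup>+y. ennreal HB * ennreal \<bar>b y\<bar> \<partial>lborel)"
  proof (rule nn_integral_mono_AE, use Z2 in eventually_elim)
    case (elim y)
    show ?case
    proof (cases "b y = 0")
      case False
      then have y: "y \<in> dy L q" using supp by auto
      have "(\<integral>\<^sup>+x. ennreal (\<bar>K' (x, y) - K' (x, y0)\<bar> * \<bar>b y\<bar>) * indicator W x \<partial>lborel)
         = (\<integral>\<^sup>+x. ennreal \<bar>b y\<bar> * (ennreal \<bar>K x y - K x y0\<bar> * indicator W x) \<partial>lborel)"
      proof (rule nn_integral_cong_AE)
        show "AE x in lborel. ennreal (\<bar>K' (x, y) - K' (x, y0)\<bar> * \<bar>b y\<bar>) * indicator W x = ennreal \<bar>b y\<bar> * (ennreal \<bar>K x y - K x y0\<bar> * indicator W x)"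
          using elim y0(2)
        proof eventually_elim
          case (elim x)
          show ?case
          proof (cases "x \<in> W")
            case True
            then show ?thesis
              using K'e[OF elim(1) WC(2)[OF True y]] K'e[OF elim(2) WC(2)[OF True y0(1)]]
              by (simp add: ennreal_mult mult.commute)
          qed simp
        qed
      qed
      also have "\<dots> = (\<integral>\<^sup>+x. ennreal \<bar>b y\<bar> * (ennreal \<bar>K x y - K x y0\<bar> * indicator W x) \<partial>lebesgue)"
        by (rule nn_integral_completion[symmetric])
      also have "\<dots> = ennreal \<bar>b y\<bar> * (\<integral>\<^sup>+x. ennreal \<bar>K x y - K x y0\<bar> * indicator W x \<partial>lebesgue)"
      proof -
        define k where "k x = \<bar>K x y - K x y0\<bar>" for x
        have [measurable]: "k \<in> borel_measurable lebesgue"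
          unfolding k_def by (intro borel_measurable_abs borel_measurable_diff K_meas)
        have [measurable]: "W \<in> sets lebesgue" using W by simp
        show ?thesis unfolding k_def[symmetric] by (rule nn_integral_cmult) measurable
      qed
      also have "\<dots> \<le> ennreal \<bar>b y\<bar> * (\<integral>\<^sup>+x\<in>- Q. ennreal \<bar>K x y - K x y0\<bar> \<partial>lebesgue)"
        by (intro mult_left_mono nn_integral_mono) (auto simp: W_def split: split_indicator)
      also have "\<dots> \<le> ennreal \<bar>b y\<bar> * ennreal HB"
        unfolding Q_def using e y y0(1) dP by (intro mult_left_mono hormander2) (auto simp: P_def)
      finally show ?thesis by (simp add: mult.commute)
    qed simp
  qed
  also have "\<dots> = ennreal HB * (\<integral>\<^sup>+y. ennreal \<bar>b y\<bar> \<partial>lborel)"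
    by (rule nn_integral_cmult) measurable
  also have "(\<integral>\<^sup>+y. ennreal \<bar>b y\<bar> \<partial>lborel) = (\<integral>\<^sup>+y. ennreal \<bar>b y\<bar> \<partial>lebesgue)"
    by (rule nn_integral_completion[symmetric])
  also have "\<dots> = ennreal (LINT x|lebesgue. \<bar>b x\<bar>)"
    by (intro nn_integral_eq_integral nice_integrable nice_abs nb) auto
  also have "ennreal HB * \<dots> = ennreal (HB * (LINT x|lebesgue. \<bar>b x\<bar>))"
    using HB0 by (simp add: ennreal_mult')
  finally show ?thesis by (simp add: Q_def)
qed


text \<open>The three summands belong to the good part, by Chebyshev's inequality in L2 at height
  \<open>\<alpha> / 2\<close>; to the doubled selected cubes; and to the bad parts outside these,
  whose L1 norms sum to at most twice that of \<open>g\<close>.\<close>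

definition CZ :: real where "CZ = 8 * 2 ^ CARD('n) * B + 2 ^ CARD('n) + 4 * HB"

lemma CZ0: "0 \<le> CZ"
  using B0 HB0 by (simp add: CZ_def)

text \<open>Calderon-Zygmund decomposition of a step function. Since \<open>g\<close> is constant on
  cells of generation \<open>N\<close>, the selection stops there and is finite. The bound on
  averages at generation \<open>j\<close> makes every selected cell have a parent of small
  average.\<close>

lemma cz_step:
  assumes L: "0 < L" and g: "step L N g" and jN: "j \<le> N" and \<alpha>: "0 < \<alpha>"
    and avg: "\<And>R. fst R = j \<Longrightarrow> (LINT x|lebesgue. \<bar>g x\<bar> * indicator (dy L R) x) \<le> \<alpha> * vol L R"
    and X: "X \<in> sets borel" "bounded X"
  shows "emeasure lebesgue {x \<in> X. \<alpha> < \<bar>T g x\<bar>} \<le> ennreal (CZ * (LINT x|lebesgue. \<bar>g x\<bar>) / \<alpha>)"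
proof -
  define m where "m R = (LINT x|lebesgue. \<bar>g x\<bar> * indicator (dy L R) x)" for R
  define M where "M = {R. j < fst R \<and> fst R \<le> N \<and> \<alpha> * vol L R < m R}"
  define \<B> where "\<B> = mx M"
  define G where "G = (LINT x|lebesgue. \<bar>g x\<bar>)"
  have ng: "nice g" by (rule step_nice[OF L g])
  have vp: "0 < vol L R" for R :: "'n cell" by (rule vol_pos[OF L])
  have dm: "dy L R \<in> sets lebesgue" for R :: "'n cell" by (rule nb_lebesgue)
  have fM: "finite M"
  proof (rule finite_subset)
    show "finite {q. fst q \<le> N \<and> dy L q \<inter> {x. g x \<noteq> 0} \<noteq> {}}"
      using g unfolding step_def by (intro finite_dy_meet L) blast
    show "M \<subseteq> {q. fst q \<le> N \<and> dy L q \<inter> {x. g x \<noteq> 0} \<noteq> {}}"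
    proof
      fix R assume R: "R \<in> M"
      have "dy L R \<inter> {x. g x \<noteq> 0} \<noteq> {}"
      proof
        assume "dy L R \<inter> {x. g x \<noteq> 0} = {}"
        then have "\<bar>g x\<bar> * indicator (dy L R) x = 0" for x by (auto simp: indicator_def)
        then have "m R = 0" unfolding m_def by (simp only: Bochner_Integration.integral_zero)
        moreover have "\<alpha> * vol L R < m R" using R by (simp add: M_def)
        ultimately show False using mult_pos_pos[OF \<alpha> vp[of R]] by simp
      qed
      then show "R \<in> {q. fst q \<le> N \<and> dy L q \<inter> {x. g x \<noteq> 0} \<noteq> {}}" using R by (simp add: M_def)
    qed
  qed
  have fB: "finite \<B>" unfolding \<B>_def by (rule finite_subset[OF mx_subset fM])
  have disj: "disjoint_family_on (dy L) \<B>" unfolding \<B>_def by (rule mx_disjoint)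
  have BM: "R \<in> M" if "R \<in> \<B>" for R using that mx_subset unfolding \<B>_def by blast
  have mono: "m R \<le> m P" if "dy L R \<subseteq> dy L P" for R P
    unfolding m_def using that
    by (intro integral_mono nice_integrable nice_mult_ind nice_abs ng dm) (auto simp: indicator_def)
  \<comment> \<open>The parent either has generation \<open>j\<close>, where averages are small by
    assumption, or it is not selected, by maximality of \<open>R\<close>. Passing to it multiplies
    the volume by \<open>2 ^ CARD('n)\<close>.\<close>
  have up: "m R \<le> 2 ^ CARD('n) * \<alpha> * vol L R" if R: "R \<in> \<B>" for R
  proof -
    have jR: "j < fst R" "fst R \<le> N" using BM[OF R] by (auto simp: M_def)
    define P where "P = par (fst R - 1) R"
    have PR: "anc P R" unfolding P_def by (rule anc_par) simp
    have fP: "fst P = fst R - 1" by (simp add: P_def)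
    have "edge L P = 2 * edge L R"
    proof -
      obtain k where "fst R = Suc k" using jR by (cases "fst R") auto
      then show ?thesis by (simp add: edge_def fP)
    qed
    then have vP: "vol L P = 2 ^ CARD('n) * vol L R" by (simp add: vol_def power_mult_distrib)
    have "m P \<le> \<alpha> * vol L P"
    proof (cases "fst P = j")
      case True
      then show ?thesis using avg[of P] by (simp add: m_def)
    next
      case False
      have "P \<notin> M"
      proof
        assume "P \<in> M"
        then have "P = R" using R PR unfolding \<B>_def mx_def by blast
        then show False using fP jR by simp
      qed
      then show ?thesis using False fP jR by (auto simp: M_def)
    qed
    with mono[OF anc_nb_subset[OF PR]] vP show ?thesis by (simp add: mult_ac)
  qed
  have smG: "(\<Sum>R\<in>\<B>. m R) \<le> G"
    unfolding m_def G_def by (rule sum_integral_disjoint_le[OF ng fB disj dm])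
  define a where "a R = (LINT x|lebesgue. g x * indicator (dy L R) x) / vol L R" for R
  have am: "\<bar>a R\<bar> * vol L R \<le> m R" for R
  proof -
    have "\<bar>LINT x|lebesgue. g x * indicator (dy L R) x\<bar> \<le> (LINT x|lebesgue. \<bar>g x * indicator (dy L R) x\<bar>)"
      using integral_norm_bound[of lebesgue "\<lambda>x. g x * indicator (dy L R) x"] by simp
    also have "\<dots> = m R" unfolding m_def by (simp add: abs_mult)
    finally show ?thesis using vp[of R] by (simp add: a_def)
  qed
  have a_le: "\<bar>a R\<bar> \<le> 2 ^ CARD('n) * \<alpha>" if "R \<in> \<B>" for R
    using order_trans[OF am up[OF that]] vp[of R] by simp
  define b where "b R x = (g x - a R) * indicator (dy L R) x" for R x
  have sb: "step L N (b R)" if "R \<in> \<B>" for R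
    unfolding b_def using BM[OF that] by (intro step_mult_dy L g) (simp add: M_def)
  have nb: "nice (b R)" if "R \<in> \<B>" for R by (rule step_nice[OF L sb[OF that]])
  have ind: "integrable lebesgue (\<lambda>x. c * indicator (dy L R) x)" for R :: "'n cell" and c :: real
    by (intro nice_integrable nice_cmult nice_ind_nb L)
  have gi: "integrable lebesgue (\<lambda>x. g x * indicator (dy L R) x)" for R
    by (intro nice_integrable nice_mult_ind ng dm)
  have ci: "(LINT x|lebesgue. c * indicator (dy L R) x) = c * vol L R" for R :: "'n cell" and c :: real
    by (simp only: Bochner_Integration.integral_mult_right_zero integral_ind_dy[OF L])
  have mean: "(LINT x|lebesgue. b R x) = 0" for R
  proof -
    have "(LINT x|lebesgue. b R x) = (LINT x|lebesgue. g x * indicator (dy L R) x - a R * indicator (dy L R) x)"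
      by (simp add: b_def algebra_simps)
    also have "\<dots> = (LINT x|lebesgue. g x * indicator (dy L R) x) - a R * vol L R"
      by (subst Bochner_Integration.integral_diff[OF gi ind]) (simp only: Bochner_Integration.integral_mult_right_zero integral_ind_dy[OF L])
    also have "\<dots> = 0" using vp[of R] by (simp add: a_def)
    finally show ?thesis .
  qed
  have bsupp: "{x. b R x \<noteq> 0} \<subseteq> dy L R" for R by (auto simp: b_def indicator_def split: if_splits)
  have bL1: "(LINT x|lebesgue. \<bar>b R x\<bar>) \<le> 2 * m R" if R: "R \<in> \<B>" for R
  proof -
    have "(LINT x|lebesgue. \<bar>b R x\<bar>) \<le> (LINT x|lebesgue. \<bar>g x\<bar> * indicator (dy L R) x + \<bar>a R\<bar> * indicator (dy L R) x)"
    proof (rule integral_mono)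
      show "integrable lebesgue (\<lambda>x. \<bar>b R x\<bar>)" by (intro nice_integrable nice_abs nb R)
      show "integrable lebesgue (\<lambda>x. \<bar>g x\<bar> * indicator (dy L R) x + \<bar>a R\<bar> * indicator (dy L R) x)"
        by (intro Bochner_Integration.integrable_add ind nice_integrable nice_mult_ind nice_abs ng dm)
      show "\<bar>b R x\<bar> \<le> \<bar>g x\<bar> * indicator (dy L R) x + \<bar>a R\<bar> * indicator (dy L R) x" for x
        by (auto simp: b_def indicator_def)
    qed
    also have "\<dots> = m R + \<bar>a R\<bar> * vol L R"
      unfolding m_def
      by (subst Bochner_Integration.integral_add) (simp_all only: ci ind nice_integrable nice_mult_ind nice_abs ng dm)
    finally show ?thesis using am[of R] by simp
  qed
  define gg where "gg x = g x - (\<Sum>R\<in>\<B>. b R x)" for x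
  have nsum: "nice (\<lambda>x. \<Sum>R\<in>\<B>. b R x)" by (intro nice_sum fB nb)
  have ngg: "nice gg" unfolding gg_def by (intro nice_diff ng nsum)
  have gg_in: "gg x = a R" if "R \<in> \<B>" "x \<in> dy L R" for x R
  proof -
    have "b P x = 0" if "P \<in> \<B> - {R}" for P
      using disj \<open>R \<in> \<B>\<close> \<open>x \<in> dy L R\<close> that unfolding disjoint_family_on_def b_def by (auto simp: indicator_def)
    then have "(\<Sum>P\<in>\<B>. b P x) = b R x"
      using sum.remove[OF fB that(1), of "\<lambda>P. b P x"] by simp
    then show ?thesis using that(2) by (simp add: gg_def b_def)
  qed
  have gg_out: "gg x = g x" if "x \<notin> (\<Union>R\<in>\<B>. dy L R)" for x
  proof -
    have "(\<Sum>R\<in>\<B>. b R x) = 0" by (rule sum.neutral) (use that in \<open>auto simp: b_def indicator_def\<close>)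
    then show ?thesis by (simp add: gg_def)
  qed
  have two: "(1::real) \<le> 2 ^ CARD('n)" by simp
  have gg_bd: "\<bar>gg x\<bar> \<le> 2 ^ CARD('n) * \<alpha>" for x
  proof (cases "x \<in> (\<Union>R\<in>\<B>. dy L R)")
    case True
    then show ?thesis using gg_in a_le by auto
  next
    case False
    \<comment> \<open>On the cell of generation \<open>N\<close> the function is constant, so its
      average there is \<open>|g x|\<close> itself; this takes the place of Lebesgue
      differentiation.\<close>
    define R where "R = idx L N x"
    have "m R = (LINT y|lebesgue. \<bar>g x\<bar> * indicator (dy L R) y)"
      unfolding m_def
    proof (rule Bochner_Integration.integral_cong[OF refl])
      fix y
      show "\<bar>g y\<bar> * indicator (dy L R) y = \<bar>g x\<bar> * indicator (dy L R) y"
      proof (cases "y \<in> dy L R")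
        case True
        then have "idx L N y = idx L N x" by (simp add: R_def mem_dy_iff)
        then have "g y = g x" using g unfolding step_def by blast
        then show ?thesis by simp
      qed simp
    qed
    then have mR: "m R = \<bar>g x\<bar> * vol L R" by (simp only: ci)
    have "R \<notin> M"
    proof
      assume "R \<in> M"
      from mx_exists[OF this] obtain p where p: "p \<in> \<B>" "anc p R" unfolding \<B>_def by blast
      have "x \<in> dy L R" by (simp add: R_def)
      then have "x \<in> dy L p" using anc_nb_subset[OF p(2), of L 0] by blast
      then show False using False p(1) by blast
    qed
    then have "m R \<le> \<alpha> * vol L R"
      using jN avg[of R] by (cases "N = j") (auto simp: M_def R_def m_def)
    then have "\<bar>g x\<bar> \<le> \<alpha>" using mR vp[of R] by simp
    also have "\<alpha> \<le> 2 ^ CARD('n) * \<alpha>" using two \<alpha> by simp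
    finally show ?thesis by (simp only: gg_out[OF False])
  qed
  have gg_L1: "(LINT x|lebesgue. \<bar>gg x\<bar>) \<le> 2 * G"
  proof -
    have "(LINT x|lebesgue. \<bar>gg x\<bar>) \<le> (LINT x|lebesgue. \<bar>g x\<bar> + (\<Sum>R\<in>\<B>. \<bar>a R\<bar> * indicator (dy L R) x))"
    proof (rule integral_mono)
      show "integrable lebesgue (\<lambda>x. \<bar>gg x\<bar>)" by (intro nice_integrable nice_abs ngg)
      show "integrable lebesgue (\<lambda>x. \<bar>g x\<bar> + (\<Sum>R\<in>\<B>. \<bar>a R\<bar> * indicator (dy L R) x))"
        by (intro Bochner_Integration.integrable_add Bochner_Integration.integrable_sum ind nice_integrable nice_abs ng)
      show "\<bar>gg x\<bar> \<le> \<bar>g x\<bar> + (\<Sum>R\<in>\<B>. \<bar>a R\<bar> * indicator (dy L R) x)" for x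
      proof (cases "x \<in> (\<Union>R\<in>\<B>. dy L R)")
        case True
        then obtain R where R: "R \<in> \<B>" "x \<in> dy L R" by blast
        have "\<bar>gg x\<bar> = \<bar>a R\<bar> * indicator (dy L R) x" using gg_in[OF R] R(2) by simp
        also have "\<dots> \<le> (\<Sum>R\<in>\<B>. \<bar>a R\<bar> * indicator (dy L R) x)"
          by (rule member_le_sum[OF R(1) _ fB]) auto
        finally show ?thesis by simp
      next
        case False
        then show ?thesis using gg_out by (auto intro!: sum_nonneg)
      qed
    qed
    also have "\<dots> = G + (\<Sum>R\<in>\<B>. \<bar>a R\<bar> * vol L R)"
      unfolding G_def
      by (subst Bochner_Integration.integral_add)
         (simp_all only: Bochner_Integration.integrable_sum nice_integrable nice_abs ng
           Bochner_Integration.integral_sum ind ci)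
    also have "\<dots> \<le> G + (\<Sum>R\<in>\<B>. m R)" by (intro add_left_mono sum_mono am)
    finally show ?thesis using smG by simp
  qed
  have G0: "0 \<le> G" by (simp add: G_def)
  have gg_L2: "(LINT x|lebesgue. (gg x)\<^sup>2) \<le> 2 ^ CARD('n) * \<alpha> * (2 * G)"
  proof -
    have "(LINT x|lebesgue. (gg x)\<^sup>2) \<le> (LINT x|lebesgue. (2 ^ CARD('n) * \<alpha>) * \<bar>gg x\<bar>)"
    proof (intro integral_mono nice_integrable nice_power2 nice_cmult nice_abs ngg)
      fix x
      have "(gg x)\<^sup>2 = \<bar>gg x\<bar> * \<bar>gg x\<bar>" by (simp add: power2_eq_square)
      also have "\<dots> \<le> (2 ^ CARD('n) * \<alpha>) * \<bar>gg x\<bar>" by (intro mult_right_mono gg_bd) simp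
      finally show "(gg x)\<^sup>2 \<le> (2 ^ CARD('n) * \<alpha>) * \<bar>gg x\<bar>" .
    qed
    also have "\<dots> = (2 ^ CARD('n) * \<alpha>) * (LINT x|lebesgue. \<bar>gg x\<bar>)" by simp
    also have "\<dots> \<le> (2 ^ CARD('n) * \<alpha>) * (2 * G)" using \<alpha> by (intro mult_left_mono gg_L1) simp
    finally show ?thesis .
  qed
  \<comment> \<open>\<open>bad_part\<close> controls a bad part only off its doubled cube; the
    doubled cubes are given away in measure.\<close>
  define Om where "Om = (\<Union>R\<in>\<B>. cube (ctr L R) (2 * edge L R))"
  have Om [measurable]: "Om \<in> sets borel" unfolding Om_def using fB by (intro sets.finite_UN) auto
  have Xm [measurable]: "X \<in> sets lebesgue" using X(1) by simp
  have sumv: "(\<Sum>R\<in>\<B>. vol L R) \<le> G / \<alpha>"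
  proof -
    have "\<alpha> * (\<Sum>R\<in>\<B>. vol L R) \<le> (\<Sum>R\<in>\<B>. m R)"
      unfolding sum_distrib_left using BM by (intro sum_mono) (auto simp: M_def intro: less_imp_le)
    then show ?thesis using smG \<alpha> by (simp add: field_simps)
  qed
  have OmL: "emeasure lebesgue Om \<le> ennreal (2 ^ CARD('n) * G / \<alpha>)"
  proof -
    have "emeasure lebesgue Om \<le> (\<Sum>R\<in>\<B>. emeasure lebesgue (cube (ctr L R) (2 * edge L R)))"
      unfolding Om_def by (rule emeasure_subadditive_finite[OF fB]) auto
    also have "\<dots> = (\<Sum>R\<in>\<B>. ennreal (2 ^ CARD('n) * vol L R))"
    proof (rule sum.cong[OF refl])
      fix R :: "'n cell"
      show "emeasure lebesgue (cube (ctr L R) (2 * edge L R)) = ennreal (2 ^ CARD('n) * vol L R)"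
        using emeasure_box_centre(2)[of "2 * edge L R" "ctr L R"] edge_pos[OF L, of R]
        by (simp add: vol_def power_mult_distrib)
    qed
    also have "\<dots> = ennreal (2 ^ CARD('n) * (\<Sum>R\<in>\<B>. vol L R))"
      using vp by (subst sum_ennreal) (auto simp: sum_distrib_left less_imp_le)
    also have "\<dots> \<le> ennreal (2 ^ CARD('n) * (G / \<alpha>))"
      by (intro ennreal_leI mult_left_mono sumv) simp
    finally show ?thesis by simp
  qed
  define S1 where "S1 = {x \<in> UNIV. (\<alpha> / 2)\<^sup>2 < (T gg x)\<^sup>2}"
  have S1m [measurable]: "S1 \<in> sets lebesgue"
    using borel_measurable_power[OF T_meas[OF ngg], of 2] borel_measurable_less[of "\<lambda>_. (\<alpha> / 2)\<^sup>2" lebesgue "\<lambda>x. (T gg x)\<^sup>2"]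
    by (simp add: S1_def)
  have S1L: "emeasure lebesgue S1 \<le> ennreal (8 * 2 ^ CARD('n) * B * G / \<alpha>)"
  proof -
    have "emeasure lebesgue S1 \<le> ennreal (B * (2 ^ CARD('n) * \<alpha> * (2 * G)) / (\<alpha> / 2)\<^sup>2)"
      unfolding S1_def
    proof (rule markov_lebesgue)
      show "(\<lambda>x. (T gg x)\<^sup>2) \<in> borel_measurable lebesgue" by (intro borel_measurable_power T_meas ngg)
      have "(\<integral>\<^sup>+x. ennreal ((T gg x)\<^sup>2) \<partial>lebesgue) = ennreal (LINT x|lebesgue. (T gg x)\<^sup>2)"
        by (intro nn_integral_eq_integral T_sq_integrable ngg) auto
      also have "\<dots> \<le> ennreal (B * (2 ^ CARD('n) * \<alpha> * (2 * G)))"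
        by (intro ennreal_leI order_trans[OF T_bd[OF nice_L2[OF ngg]]] mult_left_mono gg_L2 B0)
      finally show "(\<integral>\<^sup>+x\<in>UNIV. ennreal ((T gg x)\<^sup>2) \<partial>lebesgue) \<le> ennreal (B * (2 ^ CARD('n) * \<alpha> * (2 * G)))" by simp
    qed (use \<alpha> in auto)
    also have "B * (2 ^ CARD('n) * \<alpha> * (2 * G)) / (\<alpha> / 2)\<^sup>2 = 8 * 2 ^ CARD('n) * B * G / \<alpha>"
      using \<alpha> by (simp add: field_simps power2_eq_square)
    finally show ?thesis .
  qed
  define u where "u x = (\<Sum>R\<in>\<B>. \<bar>T (b R) x\<bar>)" for x
  have um: "u \<in> borel_measurable lebesgue"
    unfolding u_def by (intro borel_measurable_sum borel_measurable_abs T_meas nb)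
  define S2 where "S2 = {x \<in> X - Om. \<alpha> / 2 < u x}"
  have S2m [measurable]: "S2 \<in> sets lebesgue"
  proof -
    have "S2 = (X - Om) \<inter> {x \<in> space lebesgue. \<alpha> / 2 < u x}" by (auto simp: S2_def)
    moreover have "{x \<in> space lebesgue. \<alpha> / 2 < u x} \<in> sets lebesgue" using um by measurable
    moreover have "X - Om \<in> sets lebesgue" using X Om by simp
    ultimately show ?thesis by (simp only: sets.Int)
  qed
  have S2L: "emeasure lebesgue S2 \<le> ennreal (2 * HB * G / (\<alpha> / 2))"
    unfolding S2_def
  proof (rule markov_lebesgue[OF um])
    have "(\<integral>\<^sup>+x\<in>X - Om. ennreal (u x) \<partial>lebesgue) = (\<integral>\<^sup>+x. (\<Sum>R\<in>\<B>. ennreal \<bar>T (b R) x\<bar> * indicator (X - Om) x) \<partial>lebesgue)"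
    proof (intro nn_integral_cong)
      fix x
      have "ennreal (u x) = (\<Sum>R\<in>\<B>. ennreal \<bar>T (b R) x\<bar>)"
        unfolding u_def by (rule sum_ennreal[symmetric]) simp
      then show "ennreal (u x) * indicator (X - Om) x = (\<Sum>R\<in>\<B>. ennreal \<bar>T (b R) x\<bar> * indicator (X - Om) x)"
        by (simp only: sum_distrib_right)
    qed
    also have "\<dots> = (\<Sum>R\<in>\<B>. \<integral>\<^sup>+x\<in>X - Om. ennreal \<bar>T (b R) x\<bar> \<partial>lebesgue)"
    proof (rule nn_integral_sum)
      fix R assume "R \<in> \<B>"
      define t where "t = T (b R)"
      have [measurable]: "t \<in> borel_measurable lebesgue"
        unfolding t_def by (rule T_meas[OF nb[OF \<open>R \<in> \<B>\<close>]])
      have [measurable]: "X - Om \<in> sets lebesgue" using X Om by simp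
      show "(\<lambda>x. ennreal \<bar>T (b R) x\<bar> * indicator (X - Om) x) \<in> borel_measurable lebesgue"
        unfolding t_def[symmetric] by measurable
    qed
    also have "\<dots> \<le> (\<Sum>R\<in>\<B>. ennreal (HB * (2 * m R)))"
    proof (rule sum_mono)
      fix R assume R: "R \<in> \<B>"
      have "(\<integral>\<^sup>+x\<in>X - Om. ennreal \<bar>T (b R) x\<bar> \<partial>lebesgue) \<le> (\<integral>\<^sup>+x\<in>X - cube (ctr L R) (2 * edge L R). ennreal \<bar>T (b R) x\<bar> \<partial>lebesgue)"
        using R by (intro nn_integral_mono) (auto simp: Om_def split: split_indicator)
      also have "\<dots> \<le> ennreal (HB * (LINT x|lebesgue. \<bar>b R x\<bar>))"
        by (rule bad_part[OF L sb[OF R] bsupp mean X])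
      also have "\<dots> \<le> ennreal (HB * (2 * m R))"
        by (intro ennreal_leI mult_left_mono bL1 R HB0)
      finally show "(\<integral>\<^sup>+x\<in>X - Om. ennreal \<bar>T (b R) x\<bar> \<partial>lebesgue) \<le> ennreal (HB * (2 * m R))" .
    qed
    also have "\<dots> = ennreal (\<Sum>R\<in>\<B>. HB * (2 * m R))"
      using HB0 by (intro sum_ennreal) (auto simp: m_def)
    also have "\<dots> \<le> ennreal (2 * HB * G)"
    proof (rule ennreal_leI)
      have "(\<Sum>R\<in>\<B>. HB * (2 * m R)) = 2 * HB * (\<Sum>R\<in>\<B>. m R)" by (simp add: sum_distrib_left mult.assoc mult.left_commute)
      also have "\<dots> \<le> 2 * HB * G" using HB0 by (intro mult_left_mono smG) simp
      finally show "(\<Sum>R\<in>\<B>. HB * (2 * m R)) \<le> 2 * HB * G" .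
    qed
    finally show "(\<integral>\<^sup>+x\<in>X - Om. ennreal (u x) \<partial>lebesgue) \<le> ennreal (2 * HB * G)" .
  qed (use \<alpha> X Om in auto)
  have "AE x in lebesgue. T gg x = T g x - T (\<lambda>y. \<Sum>R\<in>\<B>. b R y) x"
    unfolding gg_def by (rule T_diff[OF ng nsum])
  moreover have "AE x in lebesgue. T (\<lambda>y. \<Sum>R\<in>\<B>. b R y) x = (\<Sum>R\<in>\<B>. T (b R) x)"
    by (rule T_sum[OF fB nb])
  ultimately have AE: "AE x in lebesgue. x \<in> {x \<in> X. \<alpha> < \<bar>T g x\<bar>} \<longrightarrow> x \<in> S1 \<union> (Om \<union> S2)"
  proof eventually_elim
    case (elim x)
    show ?case
    proof
      assume x: "x \<in> {x \<in> X. \<alpha> < \<bar>T g x\<bar>}"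
      show "x \<in> S1 \<union> (Om \<union> S2)"
      proof (rule ccontr)
        assume *: "x \<notin> S1 \<union> (Om \<union> S2)"
        then have "(T gg x)\<^sup>2 \<le> (\<alpha> / 2)\<^sup>2" by (simp add: S1_def not_less)
        then have 1: "\<bar>T gg x\<bar> \<le> \<alpha> / 2" using \<alpha> by (simp add: abs_le_square_iff[symmetric])
        have 2: "u x \<le> \<alpha> / 2" using * x by (auto simp: S2_def)
        have "\<bar>T g x\<bar> = \<bar>T gg x + (\<Sum>R\<in>\<B>. T (b R) x)\<bar>" using elim by simp
        also have "\<dots> \<le> \<bar>T gg x\<bar> + \<bar>\<Sum>R\<in>\<B>. T (b R) x\<bar>" by (rule abs_triangle_ineq)
        also have "\<dots> \<le> \<bar>T gg x\<bar> + u x" unfolding u_def by (intro add_left_mono sum_abs)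
        finally show False using 1 2 x by simp
      qed
    qed
  qed
  have "emeasure lebesgue {x \<in> X. \<alpha> < \<bar>T g x\<bar>} \<le> emeasure lebesgue (S1 \<union> (Om \<union> S2))"
    by (rule emeasure_mono_AE[OF AE]) (intro sets.Un S1m S2m; use Om in simp)
  also have "\<dots> \<le> emeasure lebesgue S1 + (emeasure lebesgue Om + emeasure lebesgue S2)"
    using Om by (intro order_trans[OF emeasure_subadditive] add_mono order_refl emeasure_subadditive) auto
  also have "\<dots> \<le> ennreal (8 * 2 ^ CARD('n) * B * G / \<alpha>) + (ennreal (2 ^ CARD('n) * G / \<alpha>) + ennreal (2 * HB * G / (\<alpha> / 2)))"
    by (intro add_mono S1L OmL S2L)
  also have "\<dots> = ennreal (CZ * G / \<alpha>)"
    using \<alpha> G0 B0 HB0 by (simp add: ennreal_plus[symmetric] CZ_def field_simps del: ennreal_plus)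
  finally show ?thesis by (simp add: G_def)
qed


section \<open>Localised weak type estimate for continuous functions\<close>

definition CW :: real where "CW = 3 ^ CARD('n) * (2 * CZ + B)"

text \<open>On the triple \<open>f\<close> is approximated within \<open>lam\<close> by a step
  function \<open>g\<close>. The image of \<open>g\<close> is handled by \<open>cz_step\<close> at
  height \<open>\<Lambda> * lam\<close>, which dominates the averages of \<open>g\<close>, at most
  \<open>2 * lam\<close>, because \<open>2 \<le> \<Lambda>\<close>. The error is bounded by
  \<open>lam\<close> on a set of measure \<open>3 ^ CARD('n) * vol L q\<close>, so the L2 bound of
  \<open>T\<close> suffices. This explains both summands of \<open>CW\<close>.\<close>

lemma weak_main:
  assumes L: "0 < L" and f: "continuous_on UNIV f" "bounded {x. f x \<noteq> 0}" and lam: "0 < lam" and Lam: "2 \<le> \<Lambda>"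
    and avg: "\<And>R. R \<in> nbrs 1 q \<Longrightarrow> (LINT x|lebesgue. \<bar>f x\<bar> * indicator (dy L R) x) \<le> lam * vol L q"
  shows "emeasure lebesgue {x \<in> dy L q. 2 * \<Lambda> * lam < \<bar>T (\<lambda>x. f x * indicator (nb L 1 q) x) x\<bar>} \<le> ennreal (CW / \<Lambda> * vol L q)"
proof -
  define S where "S = nb L 1 q"
  define h where "h x = f x * indicator S x" for x
  have nf: "nice f" by (rule continuous_cc_nice[OF f])
  have Sm [measurable]: "S \<in> sets lebesgue" unfolding S_def by (rule nb_lebesgue)
  have Sb: "bounded S" unfolding S_def by (rule bounded_nb[OF L])
  have nh: "nice h" unfolding h_def by (rule nice_mult_ind[OF nf Sm])
  have vp: "0 < vol L q" by (rule vol_pos[OF L])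
  have dm: "dy L R \<in> sets lebesgue" for R :: "'n cell" by (rule nb_lebesgue)
  have ci: "(LINT x|lebesgue. c * indicator (dy L R) x) = c * vol L R" for R :: "'n cell" and c :: real
    by (simp only: Bochner_Integration.integral_mult_right_zero integral_ind_dy[OF L])
  have "compact (closure S)" using Sb by (simp add: compact_closure)
  then have "uniformly_continuous_on (closure S) f"
    by (intro compact_uniformly_continuous continuous_on_subset[OF f(1)]) auto
  then obtain d where d: "0 < d" "\<And>x y. x \<in> closure S \<Longrightarrow> y \<in> closure S \<Longrightarrow> dist y x < d \<Longrightarrow> dist (f y) (f x) < lam"
    using lam unfolding uniformly_continuous_on_def by blast
  obtain N0 :: nat where N0: "CARD('n) * L / d < 2 ^ N0" using real_arch_pow[of 2 "CARD('n) * L / d"] by auto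
  \<comment> \<open>Fine enough for \<open>f\<close> to vary by less than \<open>lam\<close> within
    a cell of the triple, and at least the generation of \<open>q\<close>, so that the triple is
    saturated.\<close>
  define N where "N = max N0 (fst q)"
  have "CARD('n) * (L / 2 ^ N) < d"
  proof -
    have "(2::real) ^ N0 \<le> 2 ^ N" by (intro power_increasing) (auto simp: N_def)
    with N0 have "CARD('n) * L / d < 2 ^ N" by linarith
    then show ?thesis using d(1) by (simp add: field_simps)
  qed
  have jN: "fst q \<le> N" by (simp add: N_def)
  have satS: "sat L N S" unfolding S_def by (rule sat_nb[OF jN])
  define g where "g x = f (crn L (idx L N x)) * indicator S x" for x
  have sg: "step L N g" unfolding g_def by (rule sample_step[OF satS Sb])
  have ng: "nice g" by (rule step_nice[OF L sg])
  have close: "\<bar>h x - g x\<bar> \<le> lam * indicator S x" for x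
  proof (cases "x \<in> S")
    case True
    have "idx L N (crn L (idx L N x)) = idx L N x" using idx_crn[OF L, of "idx L N x"] by simp
    then have "crn L (idx L N x) \<in> S" using satS True unfolding sat_def by blast
    then have cl: "crn L (idx L N x) \<in> closure S" "x \<in> closure S" using True closure_subset by blast+
    have "dist (crn L (idx L N x)) x < d"
      using crn_dist[OF L, of N x] \<open>CARD('n) * (L / 2 ^ N) < d\<close> by (simp add: dist_norm)
    from d(2)[OF cl(2,1) this] show ?thesis using True by (simp add: g_def h_def dist_real_def abs_minus_commute)
  qed (simp add: g_def h_def)
  have gR: "(LINT x|lebesgue. \<bar>g x\<bar> * indicator (dy L R) x) \<le> 2 * lam * vol L q" if R: "R \<in> nbrs 1 q" for R
  proof -
    have vR: "vol L R = vol L q" using R by (intro vol_cong) (simp add: nbrs_def)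
    have "(LINT x|lebesgue. \<bar>g x\<bar> * indicator (dy L R) x) \<le> (LINT x|lebesgue. \<bar>f x\<bar> * indicator (dy L R) x + lam * indicator (dy L R) x)"
    proof (rule integral_mono)
      show "integrable lebesgue (\<lambda>x. \<bar>g x\<bar> * indicator (dy L R) x)"
        by (intro nice_integrable nice_mult_ind nice_abs ng dm)
      show "integrable lebesgue (\<lambda>x. \<bar>f x\<bar> * indicator (dy L R) x + lam * indicator (dy L R) x)"
        by (intro Bochner_Integration.integrable_add nice_integrable nice_mult_ind nice_abs nf nice_cmult nice_ind_nb L dm)
      fix x
      have "\<bar>h x\<bar> \<le> \<bar>f x\<bar>" "indicator S x \<le> (1::real)" by (auto simp: h_def indicator_def)
      moreover have "lam * indicator S x \<le> lam" using lam by (auto simp: indicator_def)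
      ultimately have "\<bar>g x\<bar> \<le> \<bar>f x\<bar> + lam" using close[of x] by linarith
      then show "\<bar>g x\<bar> * indicator (dy L R) x \<le> \<bar>f x\<bar> * indicator (dy L R) x + lam * indicator (dy L R) x"
        by (auto simp: indicator_def)
    qed
    also have "\<dots> = (LINT x|lebesgue. \<bar>f x\<bar> * indicator (dy L R) x) + lam * vol L R"
      by (subst Bochner_Integration.integral_add)
         (simp_all only: ci nice_integrable nice_mult_ind nice_abs nf nice_cmult nice_ind_nb L dm)
    also have "\<dots> \<le> 2 * lam * vol L q" using avg[OF R] vR by simp
    finally show ?thesis .
  qed
  have g_out: "\<bar>g x\<bar> * indicator (dy L R) x = 0" if "fst R = fst q" "R \<notin> nbrs 1 q" for R x
  proof (cases "x \<in> dy L R")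
    case True
    then have "idx L (fst q) x = R" using that(1) by (simp add: mem_dy_iff)
    then have "x \<notin> S" using that(2) by (simp add: S_def mem_nb_iff)
    then show ?thesis by (simp add: g_def)
  qed simp
  have avg': "(LINT x|lebesgue. \<bar>g x\<bar> * indicator (dy L R) x) \<le> (\<Lambda> * lam) * vol L R" if R: "fst R = fst q" for R
  proof (cases "R \<in> nbrs 1 q")
    case True
    have vR: "vol L R = vol L q" by (rule vol_cong[OF R])
    have "2 * lam * vol L q \<le> (\<Lambda> * lam) * vol L q" using Lam lam vp by (intro mult_right_mono) auto
    with gR[OF True] vR show ?thesis by simp
  next
    case False
    show ?thesis unfolding g_out[OF R False] using Lam lam vol_pos[OF L, of R] by simp
  qed
  have disj: "disjoint_family_on (dy L) (nbrs 1 q)"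
    unfolding disjoint_family_on_def by (auto simp: mem_dy_iff nbrs_def)
  have gL1: "(LINT x|lebesgue. \<bar>g x\<bar>) \<le> 3 ^ CARD('n) * (2 * lam * vol L q)"
  proof -
    have "\<bar>g x\<bar> = (\<Sum>R\<in>nbrs 1 q. \<bar>g x\<bar> * indicator (dy L R) x)" for x
      unfolding sum_distrib_left[symmetric] sum_indicator_disjoint[OF finite_nbrs disj]
      unfolding nb_eq_UN_nbrs[symmetric] S_def[symmetric] by (auto simp: g_def indicator_def)
    then have "(LINT x|lebesgue. \<bar>g x\<bar>) = (LINT x|lebesgue. (\<Sum>R\<in>nbrs 1 q. \<bar>g x\<bar> * indicator (dy L R) x))" by (simp only:)
    also have "\<dots> = (\<Sum>R\<in>nbrs 1 q. LINT x|lebesgue. \<bar>g x\<bar> * indicator (dy L R) x)"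
      by (intro Bochner_Integration.integral_sum nice_integrable nice_mult_ind nice_abs ng dm)
    also have "\<dots> \<le> (\<Sum>R\<in>nbrs 1 q. 2 * lam * vol L q)" by (intro sum_mono gR)
    also have "\<dots> = 3 ^ CARD('n) * (2 * lam * vol L q)" by (simp add: card_nbrs)
    finally show ?thesis .
  qed
  define E1 where "E1 = {x \<in> dy L q. \<Lambda> * lam < \<bar>T g x\<bar>}"
  have "emeasure lebesgue E1 \<le> ennreal (CZ * (LINT x|lebesgue. \<bar>g x\<bar>) / (\<Lambda> * lam))"
    unfolding E1_def using Lam lam
    by (intro cz_step[OF L sg jN _ avg'] nb_borel bounded_nb L) auto
  also have "\<dots> \<le> ennreal (CZ * (3 ^ CARD('n) * (2 * lam * vol L q)) / (\<Lambda> * lam))"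
    using Lam lam CZ0 by (intro ennreal_leI divide_right_mono mult_left_mono gL1) auto
  also have "CZ * (3 ^ CARD('n) * (2 * lam * vol L q)) / (\<Lambda> * lam) = 3 ^ CARD('n) * (2 * CZ) / \<Lambda> * vol L q"
    using Lam lam by (simp add: field_simps)
  finally have E1: "emeasure lebesgue E1 \<le> ennreal (3 ^ CARD('n) * (2 * CZ) / \<Lambda> * vol L q)" .
  have ndiff: "nice (\<lambda>x. h x - g x)" by (rule nice_diff[OF nh ng])
  define E2 where "E2 = {x \<in> UNIV. (\<Lambda> * lam)\<^sup>2 < (T (\<lambda>x. h x - g x) x)\<^sup>2}"
  have sq: "(LINT x|lebesgue. (h x - g x)\<^sup>2) \<le> lam\<^sup>2 * (3 ^ CARD('n) * vol L q)"
  proof -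
    have mS: "(LINT x|lebesgue. indicator S x) = 3 ^ CARD('n) * vol L q"
      using emeasure_nb_lebesgue[OF L, of 1 q] vp by (simp add: S_def measure_def)
    have "(LINT x|lebesgue. (h x - g x)\<^sup>2) \<le> (LINT x|lebesgue. lam\<^sup>2 * indicator S x)"
    proof (intro integral_mono nice_integrable nice_power2 ndiff nice_cmult)
      show "nice (indicator S :: real ^ 'n \<Rightarrow> real)" by (rule nice_indicator[OF Sm Sb])
      fix x
      have "\<bar>h x - g x\<bar>\<^sup>2 \<le> (lam * indicator S x)\<^sup>2" by (intro power_mono close) simp
      also have "\<dots> = lam\<^sup>2 * indicator S x" by (simp add: power_mult_distrib indicator_def)
      finally show "(h x - g x)\<^sup>2 \<le> lam\<^sup>2 * indicator S x" by simp
    qed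
    also have "\<dots> = lam\<^sup>2 * (3 ^ CARD('n) * vol L q)" by (simp only: Bochner_Integration.integral_mult_right_zero mS)
    finally show ?thesis .
  qed
  have "emeasure lebesgue E2 \<le> ennreal (B * (lam\<^sup>2 * (3 ^ CARD('n) * vol L q)) / (\<Lambda> * lam)\<^sup>2)"
    unfolding E2_def
  proof (rule markov_lebesgue)
    show "(\<lambda>x. (T (\<lambda>x. h x - g x) x)\<^sup>2) \<in> borel_measurable lebesgue" by (intro borel_measurable_power T_meas ndiff)
    have "(\<integral>\<^sup>+x. ennreal ((T (\<lambda>x. h x - g x) x)\<^sup>2) \<partial>lebesgue) = ennreal (LINT x|lebesgue. (T (\<lambda>x. h x - g x) x)\<^sup>2)"
      by (intro nn_integral_eq_integral T_sq_integrable ndiff) auto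
    also have "\<dots> \<le> ennreal (B * (lam\<^sup>2 * (3 ^ CARD('n) * vol L q)))"
      by (intro ennreal_leI order_trans[OF T_bd[OF nice_L2[OF ndiff]]] mult_left_mono sq B0)
    finally show "(\<integral>\<^sup>+x\<in>UNIV. ennreal ((T (\<lambda>x. h x - g x) x)\<^sup>2) \<partial>lebesgue) \<le> ennreal (B * (lam\<^sup>2 * (3 ^ CARD('n) * vol L q)))" by simp
  qed (use Lam lam in auto)
  also have "\<dots> \<le> ennreal (3 ^ CARD('n) * B / \<Lambda> * vol L q)"
  proof (rule ennreal_leI)
    have "B * (lam\<^sup>2 * (3 ^ CARD('n) * vol L q)) / (\<Lambda> * lam)\<^sup>2 = (3 ^ CARD('n) * B * vol L q) * (1 / \<Lambda>\<^sup>2)"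
      using Lam lam by (simp add: field_simps power2_eq_square)
    also have "\<dots> \<le> (3 ^ CARD('n) * B * vol L q) * (1 / \<Lambda>)"
    proof (rule mult_left_mono)
      show "1 / \<Lambda>\<^sup>2 \<le> 1 / \<Lambda>" using Lam by (intro divide_left_mono) (auto simp: power2_eq_square)
      show "0 \<le> 3 ^ CARD('n) * B * vol L q" using B0 vp by simp
    qed
    finally show "B * (lam\<^sup>2 * (3 ^ CARD('n) * vol L q)) / (\<Lambda> * lam)\<^sup>2 \<le> 3 ^ CARD('n) * B / \<Lambda> * vol L q" by simp
  qed
  finally have E2: "emeasure lebesgue E2 \<le> ennreal (3 ^ CARD('n) * B / \<Lambda> * vol L q)" .
  have E1m: "E1 \<in> sets lebesgue"
  proof -
    have "E1 = dy L q \<inter> {x \<in> space lebesgue. \<Lambda> * lam < \<bar>T g x\<bar>}" by (auto simp: E1_def)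
    moreover have "{x \<in> space lebesgue. \<Lambda> * lam < \<bar>T g x\<bar>} \<in> sets lebesgue"
      using T_meas[OF ng] by measurable
    ultimately show ?thesis using nb_lebesgue[of L 0 q] by simp
  qed
  have E2m: "E2 \<in> sets lebesgue"
    using borel_measurable_power[OF T_meas[OF ndiff], of 2] borel_measurable_less[of "\<lambda>_. (\<Lambda> * lam)\<^sup>2" lebesgue "\<lambda>x. (T (\<lambda>x. h x - g x) x)\<^sup>2"]
    by (simp add: E2_def)
  have AE: "AE x in lebesgue. x \<in> {x \<in> dy L q. 2 * \<Lambda> * lam < \<bar>T h x\<bar>} \<longrightarrow> x \<in> E1 \<union> E2"
    using T_diff[OF nh ng]
  proof eventually_elim
    case (elim x)
    show ?case
    proof (intro impI, rule ccontr)
      assume x: "x \<in> {x \<in> dy L q. 2 * \<Lambda> * lam < \<bar>T h x\<bar>}" and *: "x \<notin> E1 \<union> E2"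
      have 0: "0 \<le> \<Lambda> * lam" using Lam lam by simp
      have "(T (\<lambda>x. h x - g x) x)\<^sup>2 \<le> (\<Lambda> * lam)\<^sup>2" using * by (simp add: E2_def not_less)
      then have "\<bar>T (\<lambda>x. h x - g x) x\<bar> \<le> \<bar>\<Lambda> * lam\<bar>" by (simp only: abs_le_square_iff)
      then have 1: "\<bar>T h x - T g x\<bar> \<le> \<Lambda> * lam" using elim 0 by simp
      have 2: "\<bar>T g x\<bar> \<le> \<Lambda> * lam" using * x by (auto simp: E1_def)
      show False using 1 2 x by auto
    qed
  qed
  have "emeasure lebesgue {x \<in> dy L q. 2 * \<Lambda> * lam < \<bar>T h x\<bar>} \<le> emeasure lebesgue (E1 \<union> E2)"
    by (rule emeasure_mono_AE[OF AE]) (use E1m E2m in simp)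
  also have "\<dots> \<le> emeasure lebesgue E1 + emeasure lebesgue E2" by (rule emeasure_subadditive[OF E1m E2m])
  also have "\<dots> \<le> ennreal (3 ^ CARD('n) * (2 * CZ) / \<Lambda> * vol L q) + ennreal (3 ^ CARD('n) * B / \<Lambda> * vol L q)"
    by (intro add_mono E1 E2)
  also have "\<dots> = ennreal (CW / \<Lambda> * vol L q)"
    using Lam B0 CZ0 vp by (simp add: ennreal_plus[symmetric] CW_def field_simps del: ennreal_plus)
  finally show ?thesis unfolding h_def[abs_def] S_def .
qed

end

section \<open>Stopping cubes\<close>

lemma nn_integral_UN_le:
  assumes I: "finite I" and X: "\<And>i. i \<in> I \<Longrightarrow> X i \<in> sets M" and u: "u \<in> borel_measurable M"
  shows "(\<integral>\<^sup>+x\<in>(\<Union>i\<in>I. X i). u x \<partial>M) \<le> (\<Sum>i\<in>I. \<integral>\<^sup>+x\<in>X i. u x \<partial>M)"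
proof -
  have "(\<integral>\<^sup>+x\<in>(\<Union>i\<in>I. X i). u x \<partial>M) \<le> (\<integral>\<^sup>+x. (\<Sum>i\<in>I. u x * indicator (X i) x) \<partial>M)"
  proof (rule nn_integral_mono)
    fix x
    show "u x * indicator (\<Union>i\<in>I. X i) x \<le> (\<Sum>i\<in>I. u x * indicator (X i) x)"
    proof (cases "x \<in> (\<Union>i\<in>I. X i)")
      case True
      then obtain i where i: "i \<in> I" "x \<in> X i" by blast
      have "u x * indicator (\<Union>i\<in>I. X i) x = u x * indicator (X i) x" using True i by simp
      also have "\<dots> \<le> (\<Sum>i\<in>I. u x * indicator (X i) x)" by (rule member_le_sum[OF i(1) _ I]) simp
      finally show ?thesis .
    qed simp
  qed
  also have "\<dots> = (\<Sum>i\<in>I. \<integral>\<^sup>+x\<in>X i. u x \<partial>M)"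
    using X u by (intro nn_integral_sum) auto
  finally show ?thesis .
qed

text \<open>Pigeonhole among the \<open>3 ^ CARD('n)\<close> cells of the triple. It trades a
  condition on overlapping triples for one on dyadic cells, whose maximal members are
  disjoint.\<close>

lemma neighbour_select:
  fixes R :: "('n::finite) cell"
  assumes L: "0 < L" and c: "0 < c" and u: "u \<in> borel_measurable lebesgue"
    and big: "ennreal (c * 3 ^ CARD('n) * vol L R) < (\<integral>\<^sup>+x\<in>nb L 1 R. u x \<partial>lebesgue)"
  shows "\<exists>P\<in>nbrs 1 R. ennreal (c * vol L P) < (\<integral>\<^sup>+x\<in>dy L P. u x \<partial>lebesgue)"
proof (rule ccontr)
  assume "\<not> ?thesis"
  then have le: "P \<in> nbrs 1 R \<Longrightarrow> (\<integral>\<^sup>+x\<in>dy L P. u x \<partial>lebesgue) \<le> ennreal (c * vol L P)" for P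
    by (auto simp: not_less)
  have "(\<integral>\<^sup>+x\<in>nb L 1 R. u x \<partial>lebesgue) \<le> (\<Sum>P\<in>nbrs 1 R. \<integral>\<^sup>+x\<in>dy L P. u x \<partial>lebesgue)"
    unfolding nb_eq_UN_nbrs[of L 1 R] by (rule nn_integral_UN_le[OF finite_nbrs nb_lebesgue u])
  also have "\<dots> \<le> (\<Sum>P\<in>nbrs 1 R. ennreal (c * vol L R))"
  proof (rule sum_mono)
    fix P assume P: "P \<in> nbrs 1 R"
    then have "vol L P = vol L R" by (intro vol_cong) (simp add: nbrs_def)
    then show "(\<integral>\<^sup>+x\<in>dy L P. u x \<partial>lebesgue) \<le> ennreal (c * vol L R)" using le[OF P] by simp
  qed
  also have "\<dots> = ennreal (\<Sum>P\<in>nbrs 1 R. c * vol L R)"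
    using c vol_pos[OF L, of R] by (intro sum_ennreal) auto
  also have "\<dots> = ennreal (c * 3 ^ CARD('n) * vol L R)" by (simp add: card_nbrs mult_ac)
  finally show False using big by simp
qed

text \<open>The maximal dyadic cubes of \<open>M\<close> are disjoint and their neighbourhoods cover the
  left-hand set, so no covering theorem is needed. The function \<open>H\<close> need not be measurable.\<close>

lemma maximal_bound:
  fixes j :: nat and v u H :: "real ^ 'n \<Rightarrow> ennreal"
  assumes L: "0 < L" and c: "0 < c" and u [measurable]: "u \<in> borel_measurable lebesgue"
    and v [measurable]: "v \<in> borel_measurable lebesgue"
  defines "M \<equiv> {P :: 'n cell. j \<le> fst P \<and> ennreal (c * vol L P) < (\<integral>\<^sup>+x\<in>dy L P. u x \<partial>lebesgue)}"
  assumes H: "\<And>P x. P \<in> M \<Longrightarrow> x \<in> dy L P \<Longrightarrow> (\<integral>\<^sup>+y\<in>nb L 1 P. v y \<partial>lebesgue) \<le> ennreal (vol L P) * H x"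
  shows "(\<integral>\<^sup>+x\<in>(\<Union>P\<in>M. nb L 1 P). v x \<partial>lebesgue) \<le> ennreal (1 / c) * (\<integral>\<^sup>+x. u x * H x \<partial>lebesgue)"
proof -
  \<comment> \<open>As a measure with density \<open>v\<close>, the weighted integral of a countable
    union can be reduced to finite subfamilies.\<close>
  define N where "N = density lebesgue v"
  have N: "emeasure N S = (\<integral>\<^sup>+x\<in>S. v x \<partial>lebesgue)" if "S \<in> sets lebesgue" for S
    unfolding N_def using that by (intro emeasure_density) auto
  have sub: "(\<Union>P\<in>M. nb L 1 P) \<subseteq> (\<Union>P\<in>mx M. nb L 1 P)"
    using mx_exists[of _ M] anc_nb_subset[of _ _ L 1] by blast
  have sets: "(\<Union>P\<in>mx M. nb L 1 P) \<in> sets lebesgue"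
    by (rule sets.countable_UN'[OF countableI_type]) (auto intro: nb_lebesgue)
  have fin: "emeasure N (\<Union>P\<in>J. nb L 1 P) \<le> ennreal (1 / c) * (\<integral>\<^sup>+x. u x * H x \<partial>lebesgue)"
    if J: "finite J" "J \<subseteq> mx M" for J
  proof -
    define m where "m P = (\<integral>\<^sup>+y\<in>nb L 1 P. v y \<partial>lebesgue)" for P
    define b where "b P = ennreal (1 / vol L P) * m P" for P
    have JM: "P \<in> M" if "P \<in> J" for P using that J(2) mx_subset by blast
    have disj: "disjoint_family_on (dy L) J" using mx_disjoint J(2) by (rule disjoint_family_on_mono[rotated])
    have vp: "0 < vol L P" for P :: "'n cell" by (rule vol_pos[OF L])
    have "emeasure N (\<Union>P\<in>J. nb L 1 P) \<le> (\<Sum>P\<in>J. m P)"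
      unfolding m_def using J(1) by (subst N) (auto intro!: nn_integral_UN_le v)
    also have "\<dots> \<le> (\<Sum>P\<in>J. ennreal (1 / c) * (\<integral>\<^sup>+x. (u x * indicator (dy L P) x) * b P \<partial>lebesgue))"
    proof (rule sum_mono)
      fix P assume P: "P \<in> J"
      have "m P = ennreal (1 / c) * (ennreal (c * vol L P) * b P)"
        using c vp[of P] by (simp add: b_def mult.assoc[symmetric] ennreal_mult[symmetric])
      also have "\<dots> \<le> ennreal (1 / c) * ((\<integral>\<^sup>+x\<in>dy L P. u x \<partial>lebesgue) * b P)"
        using JM[OF P] by (intro mult_left_mono mult_right_mono) (auto simp: M_def less_imp_le)
      also have "(\<integral>\<^sup>+x\<in>dy L P. u x \<partial>lebesgue) * b P = (\<integral>\<^sup>+x. (u x * indicator (dy L P) x) * b P \<partial>lebesgue)"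
        by (rule nn_integral_multc[symmetric]) measurable
      finally show "m P \<le> ennreal (1 / c) * (\<integral>\<^sup>+x. (u x * indicator (dy L P) x) * b P \<partial>lebesgue)" .
    qed
    also have "\<dots> = ennreal (1 / c) * (\<integral>\<^sup>+x. (\<Sum>P\<in>J. (u x * indicator (dy L P) x) * b P) \<partial>lebesgue)"
      unfolding sum_distrib_left[symmetric] by (subst nn_integral_sum) measurable
    also have "\<dots> \<le> ennreal (1 / c) * (\<integral>\<^sup>+x. u x * H x \<partial>lebesgue)"
    proof (intro mult_left_mono nn_integral_mono)
      fix x
      show "(\<Sum>P\<in>J. (u x * indicator (dy L P) x) * b P) \<le> u x * H x"
      proof (cases "x \<in> (\<Union>P\<in>J. dy L P)")
        case True
        then obtain P where P: "P \<in> J" "x \<in> dy L P" by blast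
        have "x \<notin> dy L P'" if "P' \<in> J - {P}" for P'
          using disj P that unfolding disjoint_family_on_def by blast
        then have "(\<Sum>P\<in>J - {P}. (u x * indicator (dy L P) x) * b P) = 0" by (intro sum.neutral) auto
        then have "(\<Sum>P\<in>J. (u x * indicator (dy L P) x) * b P) = u x * b P"
          using sum.remove[OF J(1) P(1), of "\<lambda>P. (u x * indicator (dy L P) x) * b P"] P(2) by simp
        also have "b P \<le> H x"
        proof -
          have "b P \<le> ennreal (1 / vol L P) * (ennreal (vol L P) * H x)"
            unfolding b_def m_def by (intro mult_left_mono H JM P) simp
          also have "\<dots> = H x" using vp[of P] by (simp add: mult.assoc[symmetric] ennreal_mult[symmetric])
          finally show ?thesis .
        qed
        then have "u x * b P \<le> u x * H x" by (intro mult_left_mono) simp_all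
        finally show ?thesis .
      next
        case False
        then have "(\<Sum>P\<in>J. (u x * indicator (dy L P) x) * b P) = 0" by (intro sum.neutral) auto
        then show ?thesis by simp
      qed
    qed simp
    finally show ?thesis .
  qed
  have "(\<integral>\<^sup>+x\<in>(\<Union>P\<in>M. nb L 1 P). v x \<partial>lebesgue) \<le> (\<integral>\<^sup>+x\<in>(\<Union>P\<in>mx M. nb L 1 P). v x \<partial>lebesgue)"
    using sub by (intro nn_integral_mono) (auto split: split_indicator)
  also have "\<dots> = emeasure N (\<Union>P\<in>mx M. nb L 1 P)" by (rule N[OF sets, symmetric])
  also have "\<dots> \<le> ennreal (1 / c) * (\<integral>\<^sup>+x. u x * H x \<partial>lebesgue)"
    by (rule emeasure_UN_le_finite[OF countableI_type _ fin]) (auto simp: N_def)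
  finally show ?thesis .
qed

context hoermander begin

text \<open>\<open>C0\<close> makes the cells of too large mass occupy at most
  \<open>1 / 2 ^ (CARD('n) + 4)\<close> of the reference cell; its factor 9 is 3 from
  \<open>neighbour_select\<close> times 3 from the volume of triples. \<open>Lm\<close> achieves the
  same proportion in \<open>weak_main\<close>. \<open>CE\<close> collects the bounds at a good
  point, for a cell and for its stopping cell, and the oscillation bound.\<close>

definition C0 :: real where "C0 = 9 ^ CARD('n) * 2 ^ (CARD('n) + 4)"
definition Lm :: real where "Lm = max 2 (CW * 2 ^ (CARD('n) + 4))"
definition CE :: real where "CE = 8 * Lm + 2 * Lm * (1 + C0) + (C0 + 1) * H"

lemma C0_ge_1: "1 \<le> C0"
proof -
  have "(1::real) * 1 \<le> 9 ^ CARD('n) * 2 ^ (CARD('n) + 4)" by (intro mult_mono one_le_power) auto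
  then show ?thesis by (simp add: C0_def)
qed

lemma CE_nonneg: "0 \<le> CE"
  using C0_ge_1 H0 by (simp add: CE_def Lm_def)

text \<open>Stands in for the Luxemburg norm: up to the dimensional factor between a cell and its
  triple, \<open>mA f s (nb L 1 q) \<le> ennreal (vol L q)\<close> says that the norm of
  \<open>f\<close> over the triple is at most \<open>1 / s\<close>.\<close>

definition mA :: "(real ^ 'n \<Rightarrow> real) \<Rightarrow> real \<Rightarrow> (real ^ 'n) set \<Rightarrow> ennreal" where
  "mA f s E = (\<integral>\<^sup>+x\<in>E. ennreal (A \<bar>s * f x\<bar>) \<partial>lebesgue)"

lemma mA_mono: "E \<subseteq> F \<Longrightarrow> mA f s E \<le> mA f s F"
  unfolding mA_def by (intro nn_integral_mono) (auto split: split_indicator)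

text \<open>Convexity and \<open>1 \<le> A 1\<close>, which follows from submultiplicativity. This
  inequality converts control of the \<open>A\<close>-mass into control of L1 means.\<close>

lemma A_lower: "0 \<le> t \<Longrightarrow> t \<le> 1 + A t"
proof (cases "t \<le> 1")
  case True
  assume "0 \<le> t"
  then show ?thesis using True A_nonneg[of t] by simp
next
  case False
  then have "A 1 * t \<le> A t * 1" by (intro A_convex_ray) auto
  moreover have "1 * t \<le> A 1 * t" using A1 False by (intro mult_right_mono) auto
  ultimately show ?thesis by simp
qed

lemma mean_le_mA:
  assumes L: "0 < L" and f: "nice f" and s: "0 < s" and c: "0 \<le> c"
    and le: "mA f s (nb L 1 q) \<le> ennreal (c * vol L q)" and R: "R \<in> nbrs 1 q"
  shows "(LINT x|lebesgue. \<bar>f x\<bar> * indicator (dy L R) x) \<le> (1 + c) / s * vol L q"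
proof -
  have vR: "vol L R = vol L q" using R by (intro vol_cong) (simp add: nbrs_def)
  have vp: "0 < vol L q" by (rule vol_pos[OF L])
  have sub: "dy L R \<subseteq> nb L 1 q" using R by (auto simp: nb_eq_UN_nbrs[of L 1 q])
  have fm [measurable]: "f \<in> borel_measurable lebesgue" using f by (simp add: nice_def)
  have n: "nice (\<lambda>x. \<bar>f x\<bar> * indicator (dy L R) x)" by (intro nice_mult_ind nice_abs f nb_lebesgue)
  have "ennreal (s * (LINT x|lebesgue. \<bar>f x\<bar> * indicator (dy L R) x)) = ennreal (LINT x|lebesgue. s * (\<bar>f x\<bar> * indicator (dy L R) x))"
    by simp
  also have "\<dots> = (\<integral>\<^sup>+x. ennreal (s * (\<bar>f x\<bar> * indicator (dy L R) x)) \<partial>lebesgue)"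
    using s by (intro nn_integral_eq_integral[symmetric] nice_integrable nice_cmult n) auto
  also have "\<dots> \<le> (\<integral>\<^sup>+x. indicator (dy L R) x + ennreal (A \<bar>s * f x\<bar>) * indicator (dy L R) x \<partial>lebesgue)"
  proof (rule nn_integral_mono)
    fix x
    have "s * \<bar>f x\<bar> \<le> 1 + A \<bar>s * f x\<bar>" using A_lower[of "\<bar>s * f x\<bar>"] s by (simp add: abs_mult)
    then have "ennreal (s * \<bar>f x\<bar>) \<le> ennreal (1 + A \<bar>s * f x\<bar>)" by (rule ennreal_leI)
    also have "\<dots> = 1 + ennreal (A \<bar>s * f x\<bar>)" using A_nonneg by (subst ennreal_plus) auto
    finally show "ennreal (s * (\<bar>f x\<bar> * indicator (dy L R) x)) \<le> indicator (dy L R) x + ennreal (A \<bar>s * f x\<bar>) * indicator (dy L R) x"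
      by (auto simp: indicator_def)
  qed
  also have "\<dots> = emeasure lebesgue (dy L R) + mA f s (dy L R)"
    unfolding mA_def by (subst nn_integral_add) simp_all
  also have "\<dots> \<le> ennreal (vol L q) + ennreal (c * vol L q)"
    using emeasure_dy_lebesgue[OF L, of R] vR by (intro add_mono order_trans[OF mA_mono[OF sub] le]) simp
  also have "\<dots> = ennreal ((1 + c) * vol L q)" using c vp by (simp add: ennreal_plus[symmetric] algebra_simps del: ennreal_plus)
  finally have "s * (LINT x|lebesgue. \<bar>f x\<bar> * indicator (dy L R) x) \<le> (1 + c) * vol L q"
    using c vp by (subst (asm) ennreal_le_iff) auto
  then show ?thesis using s by (simp add: field_simps)
qed

lemma sets_T_gt:
  assumes "nice g" "S \<in> sets lebesgue" shows "{x \<in> S. a < \<bar>T g x\<bar>} \<in> sets lebesgue"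
proof -
  have "{x \<in> S. a < \<bar>T g x\<bar>} = S \<inter> {x \<in> space lebesgue. a < \<bar>T g x\<bar>}" by auto
  moreover have "{x \<in> space lebesgue. a < \<bar>T g x\<bar>} \<in> sets lebesgue"
    by (intro borel_measurable_less borel_measurable_const borel_measurable_abs T_meas assms(1))
  ultimately show ?thesis using assms(2) by simp
qed

text \<open>The Hoermander condition is applied to the cube of twice the edge of \<open>P\<close>,
  on which \<open>g\<close> vanishes. Its dilates lie in triples of ancestors of \<open>P\<close>,
  whose mass is bounded by \<open>C0\<close> as long as they stay below \<open>q\<close>. The
  representation of \<open>T\<close> holds almost everywhere only, hence the null set.\<close>

lemma oscillation:
  assumes L: "0 < L" and f: "continuous_on UNIV f" "bounded {x. f x \<noteq> 0}" and s: "0 < s"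
    and qP: "anc q P" and q: "mA f s (nb L 1 q) \<le> ennreal (vol L q)"
    and anc: "\<And>R. anc q R \<Longrightarrow> anc R P \<Longrightarrow> mA f s (nb L 1 R) \<le> ennreal (C0 * vol L R)"
  defines "g \<equiv> \<lambda>x. f x * indicator (nb L 1 q - nb L 1 P) x"
  shows "\<exists>N\<in>null_sets lebesgue. \<forall>x\<in>dy L P - N. \<forall>z\<in>dy L P - N. \<bar>T g x - T g z\<bar> \<le> (C0 + 1) * H / s"
proof -
  have nf: "nice f" by (rule continuous_cc_nice[OF f])
  then obtain M where M: "\<And>x. \<bar>f x\<bar> \<le> M" unfolding nice_def by blast
  have fm [measurable]: "f \<in> borel_measurable lebesgue" using nf by (simp add: nice_def)
  define S where "S = nb L 1 q - nb L 1 P"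
  have fqP: "fst q \<le> fst P" using qP by (simp add: anc_def)
  have sS: "sat L (fst P) S" unfolding S_def by (intro sat_diff sat_nb fqP order_refl)
  have Sb: "bounded S" unfolding S_def by (rule bounded_subset[OF bounded_nb[OF L, of 1 q]]) auto
  have Sm [measurable]: "S \<in> sets lebesgue" unfolding S_def by (intro sets.Diff nb_lebesgue)
  have g: "nice g" "rep g (closure S)"
    using rep_continuous[OF L f(1) M sS Sb Sm] by (simp_all add: g_def S_def)
  have gm [measurable]: "g \<in> borel_measurable lebesgue" using g by (simp add: nice_def)
  define c where "c = ctr L P"
  define e where "e = edge L P"
  have e: "0 < e" unfolding e_def by (rule edge_pos[OF L])
  have gz: "g y = 0" if "y \<notin> S" for y using that by (simp add: g_def S_def)
  have cl: "dy L P \<inter> closure S = {}"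
  proof -
    define U where "U = box (c - (\<chi> i. real_of_int (2 * 1 + 1) * e / 2)) (c + (\<chi> i. real_of_int (2 * 1 + 1) * e / 2))"
    have "U \<subseteq> nb L 1 P" unfolding U_def c_def e_def by (rule box_subset_nb[OF L])
    then have "U \<inter> S = {}" by (auto simp: S_def)
    then have "U \<inter> closure S = {}" by (subst open_Int_closure_eq_empty) (simp_all add: U_def open_box)
    moreover have "dy L P \<subseteq> U"
    proof
      fix x assume "x \<in> dy L P"
      then have "x \<in> cube c e" using nb_subset_cube[OF L, of 0 P] by (auto simp: c_def e_def)
      then have *: "\<bar>x $ i - c $ i\<bar> \<le> e / 2" for i by (simp add: mem_cube)
      have "c $ i - 3 * e / 2 < x $ i \<and> x $ i < c $ i + 3 * e / 2" for i using *[of i] e by linarith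
      then show "x \<in> U" by (simp add: U_def mem_box_cart)
    qed
    ultimately show ?thesis by blast
  qed
  obtain N where N: "N \<in> null_sets lebesgue" "\<And>x. x \<notin> N \<Longrightarrow> x \<notin> closure S \<Longrightarrow> T g x = (LINT y|lebesgue. K x y * g y)"
  proof -
    obtain N where "{x \<in> space lebesgue. \<not> (x \<notin> closure S \<longrightarrow> T g x = (LINT y|lebesgue. K x y * g y))} \<subseteq> N"
      "emeasure lebesgue N = 0" "N \<in> sets lebesgue"
      using g(2) unfolding rep_def by (rule AE_E)
    then show thesis by (intro that[of N] null_setsI) auto
  qed
  have "\<bar>T g x - T g z\<bar> \<le> (C0 + 1) * H / s" if x: "x \<in> dy L P - N" and z: "z \<in> dy L P - N" for x z
  proof -
    have xc: "x \<notin> closure S" "z \<notin> closure S" using x z cl by auto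
    have g0: "y \<notin> closure S \<Longrightarrow> g y = 0" for y using gz closure_subset[of S] by blast
    note i = kint[OF closed_closure xc(1) g(1) g0] kint[OF closed_closure xc(2) g(1) g0]
    have Tx: "T g x = (LINT y|lebesgue. K x y * g y)" "T g z = (LINT y|lebesgue. K z y * g y)"
      using N(2) x z xc by auto
    have T: "T g x - T g z = (LINT y|lebesgue. (K x y - K z y) * g y)"
      unfolding Tx using Bochner_Integration.integral_diff[OF i] by (simp add: algebra_simps)
    have int: "integrable lebesgue (\<lambda>y. (K x y - K z y) * g y)"
      using Bochner_Integration.integrable_diff[OF i] by (simp add: algebra_simps)
    have "ennreal (s * \<bar>T g x - T g z\<bar>) = ennreal s * ennreal \<bar>T g x - T g z\<bar>" using s by (simp add: ennreal_mult')
    also have "\<dots> \<le> ennreal s * (\<integral>\<^sup>+y. ennreal \<bar>(K x y - K z y) * g y\<bar> \<partial>lebesgue)"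
      using integral_norm_bound_ennreal[OF int] by (intro mult_left_mono) (simp_all add: T)
    also have "\<dots> = (\<integral>\<^sup>+y. ennreal s * ennreal \<bar>(K x y - K z y) * g y\<bar> \<partial>lebesgue)"
      using borel_measurable_integrable[OF int] by (intro nn_integral_cmult[symmetric]) auto
    also have "\<dots> \<le> (\<integral>\<^sup>+y\<in>- cube c (2 * e). \<bar>K x y - K z y\<bar> * \<bar>s * g y\<bar> \<partial>lebesgue)"
    proof (rule nn_integral_mono)
      fix y
      \<comment> \<open>The doubled cell lies in the triple of \<open>P\<close>, which has been
        removed from \<open>S\<close>.\<close>
      have "y \<notin> S" if "y \<in> cube c (2 * e)"
        using cube_subset_nb_par[OF L, of 0 P] that by (auto simp: S_def c_def e_def)
      then show "ennreal s * ennreal \<bar>(K x y - K z y) * g y\<bar> \<le> ennreal (\<bar>K x y - K z y\<bar> * \<bar>s * g y\<bar>) * indicator (- cube c (2 * e)) y"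
        using gz[of y] s by (auto simp: ennreal_mult'[symmetric] abs_mult mult_ac split: split_indicator)
    qed
    also have "\<dots> \<le> ennreal ((C0 + 1) * H)"
    proof (rule hormander_const1_bound)
      show "0 < 2 * e" using e by simp
      have "dy L P \<subseteq> cube c e" using nb_subset_cube[OF L, of 0 P] by (auto simp: c_def e_def)
      then show "x \<in> cube c (2 * e / 2)" "z \<in> cube c (2 * e / 2)" using x z by auto
      show "(\<lambda>y. s * g y) \<in> borel_measurable lebesgue" by simp
      show "0 \<le> C0" by (simp add: C0_def)
      fix j
      have gf: "A \<bar>s * g y\<bar> \<le> A \<bar>s * f y\<bar>" for y
        by (rule A_mono) (auto simp: g_def indicator_def)
      have gq: "(\<integral>\<^sup>+y\<in>E. ennreal (A \<bar>s * g y\<bar>) \<partial>lebesgue) \<le> mA f s (nb L 1 q)" for E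
        unfolding mA_def
      proof (rule nn_integral_mono)
        fix y
        show "ennreal (A \<bar>s * g y\<bar>) * indicator E y \<le> ennreal (A \<bar>s * f y\<bar>) * indicator (nb L 1 q) y"
          by (auto simp: g_def split: split_indicator)
      qed
      show "(\<integral>\<^sup>+y\<in>cube c (2 ^ Suc j * (2 * e)). ennreal (A \<bar>s * g y\<bar>) \<partial>lebesgue) \<le> ennreal (C0 * (2 ^ Suc j * (2 * e)) ^ CARD('n))"
      \<comment> \<open>Dilates that have outgrown \<open>q\<close> see at most the whole mass over
        the triple of \<open>q\<close>, and their volume is at least that of
        \<open>q\<close>.\<close>
      proof (cases "fst q + Suc j \<le> fst P")
        case True
        define R where "R = par (fst P - Suc j) P"
        have RP: "anc R P" unfolding R_def by (rule anc_par) simp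
        have qR: "anc q R" by (rule anc_linear[OF qP RP]) (use True in \<open>simp add: R_def\<close>)
        have "edge L R = 2 ^ Suc j * e"
          using True by (simp add: edge_def R_def e_def power_diff field_simps)
        then have vR: "vol L R = (2 ^ Suc j * e) ^ CARD('n)" by (simp add: vol_def)
        have "cube c (2 ^ Suc j * (2 * e)) \<subseteq> nb L 1 R"
          unfolding c_def e_def R_def by (rule cube_subset_nb_par[OF L]) (use True in simp)
        then have "(\<integral>\<^sup>+y\<in>cube c (2 ^ Suc j * (2 * e)). ennreal (A \<bar>s * g y\<bar>) \<partial>lebesgue) \<le> mA f s (nb L 1 R)"
          unfolding mA_def using gf by (intro nn_integral_mono) (auto intro: ennreal_leI split: split_indicator)
        also have "\<dots> \<le> ennreal (C0 * vol L R)" by (rule anc[OF qR RP])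
        also have "\<dots> \<le> ennreal (C0 * (2 ^ Suc j * (2 * e)) ^ CARD('n))"
          unfolding vR using e by (intro ennreal_leI mult_left_mono power_mono) (auto simp: C0_def)
        finally show ?thesis .
      next
        case False
        have "(\<integral>\<^sup>+y\<in>cube c (2 ^ Suc j * (2 * e)). ennreal (A \<bar>s * g y\<bar>) \<partial>lebesgue) \<le> ennreal (vol L q)"
          by (rule order_trans[OF gq q])
        also have "\<dots> \<le> ennreal (C0 * (2 ^ Suc j * (2 * e)) ^ CARD('n))"
        proof (rule ennreal_leI)
          have "edge L q = 2 ^ (fst P - fst q) * e"
            using fqP by (simp add: edge_def e_def power_diff field_simps)
          also have "\<dots> \<le> 2 ^ Suc j * (2 * e)"
            using e False by (intro mult_mono power_increasing) auto
          finally have "vol L q \<le> (2 ^ Suc j * (2 * e)) ^ CARD('n)"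
            unfolding vol_def using edge_pos[OF L, of q] by (intro power_mono) auto
          moreover have "1 * (2 ^ Suc j * (2 * e)) ^ CARD('n) \<le> C0 * (2 ^ Suc j * (2 * e)) ^ CARD('n)"
            using e by (intro mult_right_mono C0_ge_1) simp
          ultimately show "vol L q \<le> C0 * (2 ^ Suc j * (2 * e)) ^ CARD('n)" by linarith
        qed
        finally show ?thesis .
      qed
    qed (use H1 in auto)
    finally have "s * \<bar>T g x - T g z\<bar> \<le> (C0 + 1) * H"
      using H0 by (subst (asm) ennreal_le_iff) (auto simp: C0_def)
    then show ?thesis using s by (simp add: field_simps)
  qed
  with N(1) show ?thesis by blast
qed


text \<open>The exceptional set is enlarged to an open set \<open>U\<close>, and the stopping cubes \<open>P\<close> are the maximal
  ones of which \<open>U\<close> occupies more than a fixed fraction. Every point of \<open>U\<close> then lies in a stopping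
  cube without appeal to the differentiation theorem, while half of each stopping cube lies outside
  \<open>U\<close>; a good point there controls \<open>T\<close> of the far part of \<open>f\<close> on all of \<open>P\<close> by the oscillation bound.\<close>

lemma stopping:
  assumes L: "0 < L" and f: "continuous_on UNIV f" "bounded {x. f x \<noteq> 0}" and s: "0 < s"
    and q: "mA f s (nb L 1 q) \<le> ennreal (vol L q)"
  shows "\<exists>ch. (\<forall>P\<in>ch. fst q < fst P \<and> anc q P) \<and> disjoint_family_on (dy L) ch
    \<and> emeasure lebesgue (\<Union>P\<in>ch. dy L P) \<le> ennreal (vol L q / 2)
    \<and> (AE x in lebesgue. x \<in> dy L q \<longrightarrow> x \<notin> (\<Union>P\<in>ch. dy L P) \<longrightarrow> \<bar>T (\<lambda>x. f x * indicator (nb L 1 q) x) x\<bar> \<le> CE / s)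
    \<and> (\<forall>P\<in>ch. AE x in lebesgue. x \<in> dy L P \<longrightarrow>
        \<bar>T (\<lambda>x. f x * indicator (nb L 1 q) x) x\<bar> \<le> \<bar>T (\<lambda>x. f x * indicator (nb L 1 P) x) x\<bar> + CE / s)"
proof -
  define d where "d = CARD('n)"
  have nf: "nice f" by (rule continuous_cc_nice[OF f])
  have fm [measurable]: "f \<in> borel_measurable lebesgue" using nf by (simp add: nice_def)
  have vp: "0 < vol L R" for R :: "'n cell" by (rule vol_pos[OF L])
  have dm [measurable]: "dy L R \<in> sets lebesgue" for R :: "'n cell" by (rule nb_lebesgue)
  note C01 = C0_ge_1
  have Lm: "2 \<le> Lm" "CW / Lm \<le> 1 / 2 ^ (d + 4)"
  proof -
    show 2: "2 \<le> Lm" by (simp add: Lm_def)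
    have "CW * 2 ^ (d + 4) \<le> Lm" by (simp add: Lm_def d_def)
    then show "CW / Lm \<le> 1 / 2 ^ (d + 4)" using 2 by (simp add: field_simps)
  qed
  define h where "h R x = f x * indicator (nb L 1 R) x" for R x
  have nh: "nice (h R)" for R unfolding h_def by (rule nice_mult_ind[OF nf nb_lebesgue])
  have weak: "emeasure lebesgue {x \<in> dy L R. 2 * Lm * ((1 + c) / s) < \<bar>T (h R) x\<bar>} \<le> ennreal (vol L R / 2 ^ (d + 4))"
    if c: "0 \<le> c" and le: "mA f s (nb L 1 R) \<le> ennreal (c * vol L R)" for R c
  proof -
    have "emeasure lebesgue {x \<in> dy L R. 2 * Lm * ((1 + c) / s) < \<bar>T (h R) x\<bar>} \<le> ennreal (CW / Lm * vol L R)"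
      unfolding h_def using c s
      by (intro weak_main[OF L f _ Lm(1)] mean_le_mA[OF L nf s c le]) auto
    also have "\<dots> \<le> ennreal (1 / 2 ^ (d + 4) * vol L R)"
      by (intro ennreal_leI mult_right_mono Lm) (simp add: vp less_imp_le)
    finally show ?thesis by simp
  qed
  \<comment> \<open>Three quantities of this size, two exceptional sets and the excess of the open
    set over them, add up to at most \<open>vol L q / 2 ^ (d + 2)\<close>.\<close>
  define \<eta> where "\<eta> = vol L q / 2 ^ (d + 4)"
  have \<eta>: "0 < \<eta>" using vp by (simp add: \<eta>_def)
  define E1 where "E1 = {x \<in> dy L q. 2 * Lm * ((1 + 1) / s) < \<bar>T (h q) x\<bar>}"
  have E1: "emeasure lebesgue E1 \<le> ennreal \<eta>" unfolding E1_def \<eta>_def by (rule weak) (use q in auto)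
  have E1m [measurable]: "E1 \<in> sets lebesgue" unfolding E1_def by (rule sets_T_gt[OF nh dm])
  \<comment> \<open>These cells violate the mass hypothesis of \<open>oscillation\<close>. A single
    point outside all of them certifies that hypothesis simultaneously for all cells below
    \<open>q\<close> that contain the point.\<close>
  define Bad where "Bad = {R. anc q R \<and> ennreal (C0 * vol L R) < mA f s (nb L 1 R)}"
  define E2 where "E2 = (\<Union>R\<in>Bad. dy L R)"
  have E2m [measurable]: "E2 \<in> sets lebesgue"
    unfolding E2_def by (rule sets.countable_UN'[OF countableI_type]) (auto intro: nb_lebesgue)
  have E2: "emeasure lebesgue E2 \<le> ennreal \<eta>"
  proof -
    define u where "u x = ennreal (A \<bar>s * f x\<bar>) * indicator (nb L 1 q) x" for x
    have um [measurable]: "u \<in> borel_measurable lebesgue"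
      unfolding u_def using nb_lebesgue[of L 1 q] by simp
    define c where "c = C0 / 3 ^ d"
    have c: "0 < c" using C01 by (simp add: c_def)
    define M where "M = {P :: 'n cell. fst q \<le> fst P \<and> ennreal (c * vol L P) < (\<integral>\<^sup>+x\<in>dy L P. u x \<partial>lebesgue)}"
    have sub: "E2 \<subseteq> (\<Union>P\<in>M. nb L 1 P)"
    proof
      fix x assume "x \<in> E2"
      then obtain R where R: "anc q R" "ennreal (C0 * vol L R) < mA f s (nb L 1 R)" "x \<in> dy L R"
        by (auto simp: E2_def Bad_def)
      have "mA f s (nb L 1 R) = (\<integral>\<^sup>+x\<in>nb L 1 R. u x \<partial>lebesgue)"
        unfolding mA_def u_def using anc_nb_subset[OF R(1), of L 1]
        by (intro nn_integral_cong) (auto split: split_indicator)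
      then have "ennreal (c * 3 ^ CARD('n) * vol L R) < (\<integral>\<^sup>+x\<in>nb L 1 R. u x \<partial>lebesgue)"
        using R(2) by (simp add: c_def d_def)
      from neighbour_select[OF L c um this] obtain P where
        P: "P \<in> nbrs 1 R" "ennreal (c * vol L P) < (\<integral>\<^sup>+x\<in>dy L P. u x \<partial>lebesgue)" by blast
      have "fst P = fst R" using P(1) by (simp add: nbrs_def)
      then have "P \<in> M" using R(1) P(2) by (simp add: M_def anc_def)
      moreover have "dy L R \<subseteq> nb L 1 P"
        unfolding nb_eq_UN_nbrs[of L 1 P] using nbrs_sym[OF P(1)] by blast
      ultimately show "x \<in> (\<Union>P\<in>M. nb L 1 P)" using R(3) by blast
    qed
    have "emeasure lebesgue E2 = (\<integral>\<^sup>+x\<in>E2. 1 \<partial>lebesgue)" by simp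
    also have "\<dots> \<le> (\<integral>\<^sup>+x\<in>(\<Union>P\<in>M. nb L 1 P). 1 \<partial>lebesgue)"
      using sub by (intro nn_integral_mono) (auto split: split_indicator)
    also have "\<dots> \<le> ennreal (1 / c) * (\<integral>\<^sup>+x. u x * ennreal (3 ^ d) \<partial>lebesgue)"
      unfolding M_def
    proof (rule maximal_bound[OF L c um])
      fix P :: "'n cell" and x
      have "(\<integral>\<^sup>+y\<in>nb L 1 P. 1 \<partial>lebesgue) = emeasure lebesgue (nb L 1 P)" using nb_lebesgue[of L 1 P] by simp
      also have "\<dots> = ennreal (3 ^ d * vol L P)" using emeasure_nb_lebesgue[OF L, of 1 P] by (simp add: d_def)
      finally show "(\<integral>\<^sup>+y\<in>nb L 1 P. 1 \<partial>lebesgue) \<le> ennreal (vol L P) * ennreal (3 ^ d)"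
        using vp[of P] by (simp add: ennreal_mult[symmetric] mult.commute)
    qed simp
    also have "\<dots> = ennreal (1 / c) * (mA f s (nb L 1 q) * ennreal (3 ^ d))"
      by (subst nn_integral_multc) (simp_all add: mA_def u_def[abs_def])
    also have "\<dots> \<le> ennreal (1 / c) * (ennreal (vol L q) * ennreal (3 ^ d))"
      by (intro mult_left_mono mult_right_mono q) simp_all
    also have "\<dots> = ennreal (1 / c * (vol L q * 3 ^ d))"
      using c vp[of q] by (simp add: ennreal_mult[symmetric])
    also have "1 / c * (vol L q * 3 ^ d) = \<eta>"
    proof -
      have "(9::real) ^ d = 3 ^ d * 3 ^ d" by (simp add: power_mult_distrib[symmetric])
      then show ?thesis by (simp add: c_def C0_def \<eta>_def d_def field_simps)
    qed
    finally show ?thesis .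
  qed
  obtain U where U: "open U" "E1 \<union> E2 \<subseteq> U" "emeasure lebesgue (U - (E1 \<union> E2)) < ennreal \<eta>"
  proof -
    have Em: "E1 \<union> E2 \<in> sets lebesgue" by simp
    show thesis by (rule sets_lebesgue_outer_open[OF Em \<eta>]) (rule that)
  qed
  have Um [measurable]: "U \<in> sets lebesgue" using U(1) by simp
  have Uv: "emeasure lebesgue U \<le> ennreal (vol L q / 2 ^ (d + 2))"
  proof -
    have "emeasure lebesgue U \<le> emeasure lebesgue ((E1 \<union> E2) \<union> (U - (E1 \<union> E2)))"
      by (intro emeasure_mono) auto
    also have "\<dots> \<le> (emeasure lebesgue E1 + emeasure lebesgue E2) + emeasure lebesgue (U - (E1 \<union> E2))"
      by (intro order_trans[OF emeasure_subadditive] add_right_mono emeasure_subadditive) auto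
    also have "\<dots> \<le> (ennreal \<eta> + ennreal \<eta>) + ennreal \<eta>"
      using E1 E2 U(3) by (intro add_mono) auto
    also have "\<dots> = ennreal (3 * \<eta>)" using \<eta> by (simp add: ennreal_plus[symmetric] del: ennreal_plus)
    also have "\<dots> \<le> ennreal (vol L q / 2 ^ (d + 2))"
      using vp[of q] by (intro ennreal_leI) (simp add: \<eta>_def power_add field_simps)
    finally show ?thesis .
  qed
  \<comment> \<open>The threshold is low enough that an unselected parent, having
    \<open>2 ^ d\<close> times the volume, leaves half of the child outside \<open>U\<close>, and
    high enough that the selected cells fill at most half of \<open>q\<close>.\<close>
  define St where "St = {P. anc q P \<and> fst q < fst P \<and> ennreal (vol L P / 2 ^ (d + 1)) < emeasure lebesgue (dy L P \<inter> U)}"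
  define ch where "ch = mx St"
  have chS: "P \<in> St" if "P \<in> ch" for P using that mx_subset unfolding ch_def by blast
  have disj: "disjoint_family_on (dy L) ch" unfolding ch_def by (rule mx_disjoint)
  have vol_ch: "emeasure lebesgue (\<Union>P\<in>ch. dy L P) \<le> ennreal (vol L q / 2)"
  proof (rule emeasure_UN_le_finite)
    fix J assume J: "finite J" "J \<subseteq> ch"
    have dJ: "disjoint_family_on (\<lambda>P. dy L P \<inter> U) J"
      using disj J(2) unfolding disjoint_family_on_def by blast
    have "emeasure lebesgue (\<Union>P\<in>J. dy L P) \<le> (\<Sum>P\<in>J. emeasure lebesgue (dy L P))"
      by (rule emeasure_subadditive_finite[OF J(1)]) auto
    also have "\<dots> \<le> (\<Sum>P\<in>J. ennreal (2 ^ (d + 1)) * emeasure lebesgue (dy L P \<inter> U))"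
    proof (rule sum_mono)
      fix P assume "P \<in> J"
      then have "P \<in> St" using J(2) chS by blast
      then have "ennreal (vol L P / 2 ^ (d + 1)) < emeasure lebesgue (dy L P \<inter> U)"
        unfolding St_def by blast
      then have "ennreal (vol L P / 2 ^ (d + 1)) \<le> emeasure lebesgue (dy L P \<inter> U)"
        by (rule less_imp_le)
      then have "ennreal (2 ^ (d + 1)) * ennreal (vol L P / 2 ^ (d + 1)) \<le> ennreal (2 ^ (d + 1)) * emeasure lebesgue (dy L P \<inter> U)"
        by (intro mult_left_mono) simp_all
      then show "emeasure lebesgue (dy L P) \<le> ennreal (2 ^ (d + 1)) * emeasure lebesgue (dy L P \<inter> U)"
        using vp[of P] by (simp add: emeasure_dy_lebesgue[OF L] ennreal_mult'[symmetric] del: power_Suc power_Suc2 power_add_numeral)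
    qed
    also have "\<dots> = ennreal (2 ^ (d + 1)) * emeasure lebesgue (\<Union>P\<in>J. dy L P \<inter> U)"
      unfolding sum_distrib_left[symmetric] using J(1) dJ by (subst sum_emeasure) auto
    also have "\<dots> \<le> ennreal (2 ^ (d + 1)) * ennreal (vol L q / 2 ^ (d + 2))"
      by (intro mult_left_mono order_trans[OF emeasure_mono Uv]) auto
    also have "\<dots> = ennreal (vol L q / 2)"
      using vp[of q] by (subst ennreal_mult'[symmetric]) (simp_all add: field_simps)
    finally show "emeasure lebesgue (\<Union>P\<in>J. dy L P) \<le> ennreal (vol L q / 2)" .
  qed auto
  have cover: "x \<in> (\<Union>P\<in>ch. dy L P)" if x: "x \<in> dy L q" "x \<in> U" for x
  proof -
    obtain r where r: "0 < r" "ball x r \<subseteq> U" using U(1) x(2) open_contains_ball by blast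
    obtain N0 :: nat where N0: "2 * CARD('n) * L / r < 2 ^ N0" using real_arch_pow[of 2 "2 * CARD('n) * L / r"] by auto
    define N where "N = max N0 (Suc (fst q))"
    have "(2::real) ^ N0 \<le> 2 ^ N" by (intro power_increasing) (auto simp: N_def)
    with N0 have "2 * CARD('n) * L / r < 2 ^ N" by linarith
    then have small: "2 * (CARD('n) * (L / 2 ^ N)) < r" using r(1) by (simp add: field_simps)
    define P where "P = idx L N x"
    have "dy L P \<subseteq> U"
    proof
      fix y assume "y \<in> dy L P"
      then have "idx L N y = idx L N x" by (simp add: P_def mem_dy_iff)
      then have "norm (crn L (idx L N x) - y) \<le> CARD('n) * (L / 2 ^ N)" "norm (crn L (idx L N x) - x) \<le> CARD('n) * (L / 2 ^ N)"
        using crn_dist[OF L, of N y] crn_dist[OF L, of N x] by simp_all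
      moreover have "norm (x - y) \<le> norm (crn L (idx L N x) - y) + norm (crn L (idx L N x) - x)"
        using norm_triangle_ineq4[of "crn L (idx L N x) - y" "crn L (idx L N x) - x"] by simp
      moreover have "norm (x - y) < r" if "a \<le> t" "b \<le> t" "norm (x - y) \<le> a + b" "2 * t < r" for a b t :: real
        using that by linarith
      ultimately have "norm (x - y) < r" using small by blast
      then have "dist x y < r" by (simp add: dist_norm)
      then show "y \<in> U" using r(2) by auto
    qed
    then have "emeasure lebesgue (dy L P \<inter> U) = ennreal (vol L P)"
      by (simp add: Int_absorb2 emeasure_dy_lebesgue[OF L])
    moreover have "ennreal (vol L P / 2 ^ (d + 1)) < ennreal (vol L P)"
    proof (rule ennreal_lessI[OF vp])
      have "(1::real) < 2 ^ (d + 1)" by (rule one_less_power) auto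
      then show "vol L P / 2 ^ (d + 1) < vol L P" using vp[of P] by (simp add: field_simps del: power_Suc)
    qed
    moreover have "anc q P" "fst q < fst P"
      using x(1) by (auto intro!: dy_meet_anc[of x L] simp: P_def N_def)
    ultimately have "P \<in> St" by (simp add: St_def)
    from mx_exists[OF this] obtain p where p: "p \<in> ch" "anc p P" by (auto simp: ch_def)
    moreover have "x \<in> dy L P" by (simp add: P_def)
    ultimately show ?thesis using anc_nb_subset[OF p(2), of L 0] by blast
  qed
  have half: "emeasure lebesgue (dy L P \<inter> U) \<le> ennreal (vol L P / 2)" if P: "P \<in> ch" for P
  proof -
    have Pq: "anc q P" "fst q < fst P" using chS[OF P] by (auto simp: St_def)
    define p where "p = par (fst P - 1) P"
    have pP: "anc p P" unfolding p_def by (rule anc_par) simp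
    have fp: "fst p = fst P - 1" by (simp add: p_def)
    have qp: "anc q p" by (rule anc_linear[OF Pq(1) pP]) (use Pq fp in simp)
    have "edge L p = 2 * edge L P"
    proof -
      obtain k where "fst P = Suc k" using Pq by (cases "fst P") auto
      then show ?thesis by (simp add: edge_def fp)
    qed
    then have vP: "vol L p = 2 ^ d * vol L P" by (simp add: vol_def power_mult_distrib d_def)
    have "emeasure lebesgue (dy L P \<inter> U) \<le> emeasure lebesgue (dy L p \<inter> U)"
      using anc_nb_subset[OF pP, of L 0] by (intro emeasure_mono) auto
    \<comment> \<open>The parent may be \<open>q\<close> itself, which \<open>St\<close> excludes by
      its strict inequality of generations; in that case the bound on the measure of
      \<open>U\<close> gives the density.\<close>
    also have "\<dots> \<le> ennreal (vol L p / 2 ^ (d + 1))"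
    proof (cases "fst p = fst q")
      case True
      then have "p = q" using anc_antisym[OF qp] by simp
      then have "emeasure lebesgue (dy L p \<inter> U) \<le> ennreal (vol L p / 2 ^ (d + 2))"
        using order_trans[OF emeasure_mono Uv, of "dy L p \<inter> U"] by simp
      also have "\<dots> \<le> ennreal (vol L p / 2 ^ (d + 1))"
        using vp[of p] by (intro ennreal_leI divide_left_mono power_increasing) auto
      finally show ?thesis .
    next
      case False
      have "p \<notin> St"
      proof
        assume "p \<in> St"
        then have "p = P" using P pP unfolding ch_def mx_def by blast
        then show False using fp Pq by simp
      qed
      moreover have "fst q < fst p" using False qp by (simp add: anc_def)
      ultimately show ?thesis using qp by (auto simp: St_def not_less)
    qed
    also have "vol L p / 2 ^ (d + 1) = vol L P / 2" by (simp add: vP)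
    finally show ?thesis .
  qed
  have CEb: "4 * Lm / s \<le> CE / s" "(8 * Lm + 2 * Lm * (1 + C0)) / s - 4 * Lm / s + (C0 + 1) * H / s \<le> CE / s"
  proof -
    have *: "0 \<le> 4 * Lm" "0 \<le> 2 * Lm * (1 + C0)" "0 \<le> (C0 + 1) * H" using Lm(1) C01 H0 by auto
    show "4 * Lm / s \<le> CE / s" using s * unfolding CE_def by (intro divide_right_mono) auto
    have "(8 * Lm + 2 * Lm * (1 + C0)) / s - 4 * Lm / s + (C0 + 1) * H / s
      = (8 * Lm + 2 * Lm * (1 + C0) - 4 * Lm + (C0 + 1) * H) / s" by (simp add: add_divide_distrib diff_divide_distrib)
    also have "\<dots> \<le> CE / s" using s * unfolding CE_def by (intro divide_right_mono) auto
    finally show "(8 * Lm + 2 * Lm * (1 + C0)) / s - 4 * Lm / s + (C0 + 1) * H / s \<le> CE / s" .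
  qed
  have out: "\<bar>T (h q) x\<bar> \<le> 4 * Lm / s" if "x \<in> dy L q" "x \<notin> U" for x
  proof -
    have "x \<notin> E1" using that(2) U(2) by blast
    then show ?thesis using that(1) by (simp add: E1_def not_less)
  qed
  have part5: "AE x in lebesgue. x \<in> dy L P \<longrightarrow> \<bar>T (h q) x\<bar> \<le> \<bar>T (h P) x\<bar> + CE / s" if P: "P \<in> ch" for P
  proof -
    have Pq: "anc q P" "fst q < fst P" using chS[OF P] by (auto simp: St_def)
    have sub: "dy L P \<subseteq> dy L q" "nb L 1 P \<subseteq> nb L 1 q" by (intro anc_nb_subset Pq(1))+
    have "emeasure lebesgue (dy L P \<inter> U) < emeasure lebesgue (dy L P)"
    proof -
      have "ennreal (vol L P / 2) < ennreal (vol L P)" using vp[of P] by (intro ennreal_lessI) auto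
      then show ?thesis using half[OF P] by (simp add: emeasure_dy_lebesgue[OF L])
    qed
    \<comment> \<open>A point of \<open>P\<close> outside \<open>U\<close> avoids \<open>E2\<close>,
      so no cell between \<open>q\<close> and \<open>P\<close> is bad.\<close>
    then obtain x0 where x0: "x0 \<in> dy L P" "x0 \<notin> U" by (metis Int_absorb2 less_irrefl subsetI)
    have good: "mA f s (nb L 1 R) \<le> ennreal (C0 * vol L R)" if R: "anc q R" "anc R P" for R
    proof -
      have "x0 \<in> dy L R" using x0(1) anc_nb_subset[OF R(2), of L 0] by blast
      then have "R \<notin> Bad" using x0(2) U(2) unfolding E2_def by blast
      then show ?thesis using R(1) by (simp add: Bad_def not_less)
    qed
    define g where "g x = f x * indicator (nb L 1 q - nb L 1 P) x" for x
    have ng: "nice g" unfolding g_def by (intro nice_mult_ind nf sets.Diff nb_lebesgue)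
    obtain N where N: "N \<in> null_sets lebesgue"
      "\<And>x z. x \<in> dy L P - N \<Longrightarrow> z \<in> dy L P - N \<Longrightarrow> \<bar>T g x - T g z\<bar> \<le> (C0 + 1) * H / s"
      using oscillation[OF L f s Pq(1) q good] unfolding g_def by blast
    define W where "W = {x \<in> dy L P. 2 * Lm * ((1 + C0) / s) < \<bar>T (h P) x\<bar>}"
    have Wm [measurable]: "W \<in> sets lebesgue" unfolding W_def by (rule sets_T_gt[OF nh dm])
    have Wv: "emeasure lebesgue W \<le> ennreal (vol L P / 2 ^ (d + 4))"
      unfolding W_def using C01 good[OF Pq(1) anc_refl] by (intro weak) auto
    have "AE x in lebesgue. T (\<lambda>x. h q x - h P x) x = T (h q) x - T (h P) x" by (rule T_diff[OF nh nh])
    moreover have "(\<lambda>x. h q x - h P x) = g"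
      using sub(2) by (auto simp: h_def g_def fun_eq_iff indicator_def)
    ultimately have Tg: "AE x in lebesgue. T g x = T (h q) x - T (h P) x" by simp
    \<comment> \<open>\<open>U\<close> takes at most half of \<open>P\<close>, \<open>W\<close> at
      most the fraction \<open>1 / 2 ^ (d + 4)\<close>, and the remaining exceptions are null. At
      such a \<open>z\<close> the far part is the difference of two bounded quantities.\<close>
    have "\<exists>z\<in>dy L P - N. z \<notin> U \<and> z \<notin> W \<and> T g z = T (h q) z - T (h P) z"
    proof (rule ccontr)
      assume no: "\<not> ?thesis"
      have "AE x in lebesgue. x \<in> dy L P \<longrightarrow> x \<in> (dy L P \<inter> U) \<union> W"
        using Tg AE_not_in[OF N(1)] by eventually_elim (use no in blast)
      then have "emeasure lebesgue (dy L P) \<le> emeasure lebesgue ((dy L P \<inter> U) \<union> W)"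
        by (rule emeasure_mono_AE) simp
      also have "\<dots> \<le> emeasure lebesgue (dy L P \<inter> U) + emeasure lebesgue W"
        by (rule emeasure_subadditive) auto
      also have "\<dots> \<le> ennreal (vol L P / 2) + ennreal (vol L P / 2 ^ (d + 4))"
        by (intro add_mono half[OF P] Wv)
      also have "\<dots> = ennreal (vol L P / 2 + vol L P / 2 ^ (d + 4))"
        using vp[of P] by (simp add: ennreal_plus[symmetric] del: ennreal_plus)
      finally have "vol L P \<le> vol L P / 2 + vol L P / 2 ^ (d + 4)"
        using vp[of P] unfolding emeasure_dy_lebesgue[OF L] by (subst (asm) ennreal_le_iff) auto
      moreover have "vol L P / 2 ^ (d + 4) < vol L P / 2"
      proof -
        have "(2::real) ^ 1 < 2 ^ (d + 4)" by (rule power_strict_increasing) auto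
        then show ?thesis using vp[of P] by (intro divide_strict_left_mono) auto
      qed
      ultimately show False by simp
    qed
    then obtain z where z: "z \<in> dy L P - N" "z \<notin> U" "z \<notin> W" "T g z = T (h q) z - T (h P) z" by blast
    have "\<bar>T (h q) z\<bar> \<le> 4 * Lm / s" using z sub(1) by (intro out) auto
    moreover have "\<bar>T (h P) z\<bar> \<le> 2 * Lm * ((1 + C0) / s)" using z by (auto simp: W_def)
    ultimately have "\<bar>T g z\<bar> \<le> 4 * Lm / s + 2 * Lm * ((1 + C0) / s)" unfolding z(4) by linarith
    also have "\<dots> = (8 * Lm + 2 * Lm * (1 + C0)) / s - 4 * Lm / s"
      using s by (simp add: field_simps)
    finally have zg: "\<bar>T g z\<bar> \<le> (8 * Lm + 2 * Lm * (1 + C0)) / s - 4 * Lm / s" .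
    show ?thesis using Tg AE_not_in[OF N(1)]
    proof eventually_elim
      case (elim x)
      show ?case
      proof
        assume x: "x \<in> dy L P"
        have "\<bar>T g x - T g z\<bar> \<le> (C0 + 1) * H / s" using N(2)[of x z] x elim z by blast
        then show "\<bar>T (h q) x\<bar> \<le> \<bar>T (h P) x\<bar> + CE / s" using elim(1) zg CEb(2) by linarith
      qed
    qed
  qed
  have part4: "x \<in> dy L q \<longrightarrow> x \<notin> (\<Union>P\<in>ch. dy L P) \<longrightarrow> \<bar>T (h q) x\<bar> \<le> CE / s" for x
    using out cover CEb(1) by (meson order_trans)
  have "\<forall>P\<in>ch. fst q < fst P \<and> anc q P" using chS by (auto simp: St_def)
  with disj vol_ch part4 part5 show ?thesis
    unfolding h_def by (intro exI[of _ ch]) auto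
qed

end

section \<open>Sparse domination\<close>

context hoermander begin

text \<open>\<open>k\<close> is the last scale at which the mass stays below the volume. The first
  inequality is the hypothesis of \<open>stopping\<close> with \<open>s = 2 ^ k\<close>; the second
  later bounds the volume of \<open>Q\<close> by mass.\<close>

definition good :: "real \<Rightarrow> (real ^ 'n \<Rightarrow> real) \<Rightarrow> nat \<Rightarrow> 'n cell \<Rightarrow> bool" where
  "good L f k Q \<longleftrightarrow> mA f (2 ^ k) (nb L 1 Q) \<le> ennreal (vol L Q) \<and> ennreal (vol L Q) < mA f (2 ^ Suc k) (nb L 1 Q)"

text \<open>Without a level the mass inequality propagates from scale 1 to all scales
  \<open>2 ^ k\<close>. The means of \<open>|f|\<close> over the cells of the triple are then at
  most a multiple of \<open>1 / 2 ^ k\<close> for every \<open>k\<close>, so \<open>f\<close>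
  vanishes almost everywhere there.\<close>

lemma not_good_null:
  assumes L: "0 < L" and f: "nice f"
    and 1: "mA f 1 (nb L 1 Q) \<le> ennreal (vol L Q)" and no: "\<And>k. \<not> good L f k Q"
  shows "AE x in lebesgue. T (\<lambda>x. f x * indicator (nb L 1 Q) x) x = 0"
proof (rule T_null)
  have all: "mA f (2 ^ k) (nb L 1 Q) \<le> ennreal (vol L Q)" for k
  proof (induction k)
    case 0
    then show ?case using 1 by simp
  next
    case (Suc k)
    then show ?case using no[of k] by (simp add: good_def not_less)
  qed
  have z: "AE x in lebesgue. \<bar>f x\<bar> * indicator (dy L R) x = 0" if R: "R \<in> nbrs 1 Q" for R
  proof -
    have i: "integrable lebesgue (\<lambda>x. \<bar>f x\<bar> * indicator (dy L R) x)"
      by (intro nice_integrable nice_mult_ind nice_abs f nb_lebesgue)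
    have le: "(LINT x|lebesgue. \<bar>f x\<bar> * indicator (dy L R) x) \<le> 2 * vol L Q * (1 / 2) ^ k" for k
      using mean_le_mA[OF L f _ _ _ R, of "2 ^ k" 1] all[of k] by (simp add: power_one_over field_simps)
    have "(\<lambda>k. 2 * vol L Q * (1 / 2) ^ k) \<longlonglongrightarrow> 2 * vol L Q * 0"
      by (intro tendsto_intros LIMSEQ_realpow_zero) auto
    then have "(LINT x|lebesgue. \<bar>f x\<bar> * indicator (dy L R) x) \<le> 2 * vol L Q * 0"
      by (rule LIMSEQ_le_const) (use le in auto)
    moreover have "0 \<le> (LINT x|lebesgue. \<bar>f x\<bar> * indicator (dy L R) x)" by simp
    ultimately have "(LINT x|lebesgue. \<bar>f x\<bar> * indicator (dy L R) x) = 0" by linarith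
    then show ?thesis using integral_nonneg_eq_0_iff_AE[OF i] by simp
  qed
  have "AE x in lebesgue. \<forall>R\<in>nbrs 1 Q. \<bar>f x\<bar> * indicator (dy L R) x = 0"
    by (rule AE_finite_allI[OF finite_nbrs z])
  then show "AE x in lebesgue. f x * indicator (nb L 1 Q) x = 0"
  proof eventually_elim
    case (elim x)
    show ?case
    proof (cases "x \<in> nb L 1 Q")
      case True
      then obtain R where "R \<in> nbrs 1 Q" "x \<in> dy L R" unfolding nb_eq_UN_nbrs[of L 1 Q] by blast
      then show ?thesis using elim by force
    qed simp
  qed
  show "nice (\<lambda>x. f x * indicator (nb L 1 Q) x)" by (intro nice_mult_ind f nb_lebesgue)
qed

text \<open>\<open>S\<close> consists of the cells reachable from \<open>Q0\<close> through stopping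
  cells that have a level. What remains of a cell after removal of its stopping cells is at least
  half of it, and these remainders are disjoint; hence packing in every measurable \<open>V\<close>,
  later used with cells and with quintuples. \<open>F\<close> is finite because almost every point
  leaves the stopping cells after finitely many rounds.\<close>

lemma sparse_domination:
  assumes L: "0 < L" and f: "continuous_on UNIV f" "bounded {x. f x \<noteq> 0}"
    and Q0: "mA f 1 (nb L 1 Q0) \<le> ennreal (vol L Q0)"
  shows "\<exists>S lev. (\<forall>Q\<in>S. anc Q0 Q \<and> good L f (lev Q) Q)
    \<and> (\<forall>F V. finite F \<longrightarrow> F \<subseteq> S \<longrightarrow> V \<in> sets lebesgue \<longrightarrow> (\<forall>Q\<in>F. dy L Q \<subseteq> V) \<longrightarrow>
          ennreal (\<Sum>Q\<in>F. vol L Q) \<le> 2 * emeasure lebesgue V)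
    \<and> (AE x in lebesgue. x \<in> dy L Q0 \<longrightarrow> x \<notin> (\<Union>P\<in>{P. ennreal (vol L P) < mA f 1 (nb L 1 P)}. dy L P) \<longrightarrow>
          (\<exists>F. finite F \<and> F \<subseteq> S \<and> (\<forall>P\<in>F. x \<in> dy L P) \<and>
             \<bar>T (\<lambda>x. f x * indicator (nb L 1 Q0) x) x\<bar> \<le> 2 * CE * (\<Sum>P\<in>F. 1 / 2 ^ lev P)))"
proof -
  define Om where "Om = (\<Union>P\<in>{P. ennreal (vol L P) < mA f 1 (nb L 1 P)}. dy L P)"
  define h where "h R x = f x * indicator (nb L 1 R) x" for R x
  have nf: "nice f" by (rule continuous_cc_nice[OF f])
  have vp: "0 < vol L R" for R :: "'n cell" by (rule vol_pos[OF L])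
  have dm [measurable]: "dy L R \<in> sets lebesgue" for R :: "'n cell" by (rule nb_lebesgue)
  have UNm: "(\<Union>R\<in>I. dy L R) \<in> sets lebesgue" for I :: "'n cell set"
    by (rule sets.countable_UN'[OF countableI_type]) (auto intro: nb_lebesgue)
  note CE0 = CE_nonneg
  define gd where "gd Q \<longleftrightarrow> (\<exists>k. good L f k Q)" for Q
  define lev where "lev Q = (SOME k. good L f k Q)" for Q
  have lev: "good L f (lev Q) Q" if "gd Q" for Q
    using that unfolding gd_def lev_def by (rule someI_ex)
  \<comment> \<open>Cells without a level end the iteration harmlessly: either they lie in the
    excluded set, or the image of their local piece of \<open>f\<close> vanishes almost
    everywhere.\<close>
  have bad: "dy L P \<subseteq> Om \<or> (AE x in lebesgue. T (h P) x = 0)" if "\<not> gd P" for P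
  proof (cases "mA f 1 (nb L 1 P) \<le> ennreal (vol L P)")
    case True
    have "AE x in lebesgue. T (h P) x = 0" unfolding h_def
      by (rule not_good_null[OF L nf True]) (use that in \<open>auto simp: gd_def\<close>)
    then show ?thesis by blast
  next
    case False
    then have "P \<in> {P. ennreal (vol L P) < mA f 1 (nb L 1 P)}" by simp
    then show ?thesis unfolding Om_def by blast
  qed
  show ?thesis
  proof (cases "gd Q0")
    case False
    have "AE x in lebesgue. x \<in> dy L Q0 \<longrightarrow> x \<notin> Om \<longrightarrow>
          (\<exists>F. finite F \<and> F \<subseteq> {} \<and> (\<forall>P\<in>F. x \<in> dy L P) \<and> \<bar>T (h Q0) x\<bar> \<le> 2 * CE * (\<Sum>P\<in>F. 1 / 2 ^ lev P))"
    proof (cases "dy L Q0 \<subseteq> Om")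
      case True
      then show ?thesis by (intro AE_I2) auto
    next
      case False
      then have "AE x in lebesgue. T (h Q0) x = 0" using bad[OF \<open>\<not> gd Q0\<close>] by blast
      then show ?thesis by eventually_elim auto
    qed
    then show ?thesis unfolding Om_def[symmetric] h_def[symmetric]
      by (intro exI[of _ "{}"] exI[of _ lev]) (simp add: h_def[abs_def])
  next
    case gQ0: True
    define Pr where "Pr Q ch \<longleftrightarrow> (\<forall>P\<in>ch. fst Q < fst P \<and> anc Q P) \<and> disjoint_family_on (dy L) ch
      \<and> emeasure lebesgue (\<Union>P\<in>ch. dy L P) \<le> ennreal (vol L Q / 2)
      \<and> (AE x in lebesgue. x \<in> dy L Q \<longrightarrow> x \<notin> (\<Union>P\<in>ch. dy L P) \<longrightarrow> \<bar>T (h Q) x\<bar> \<le> CE / 2 ^ lev Q)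
      \<and> (\<forall>P\<in>ch. AE x in lebesgue. x \<in> dy L P \<longrightarrow> \<bar>T (h Q) x\<bar> \<le> \<bar>T (h P) x\<bar> + CE / 2 ^ lev Q)" for Q ch
    define ch where "ch Q = (SOME c. Pr Q c)" for Q
    have ch0: "Pr Q (ch Q)" if "gd Q" for Q
      unfolding ch_def
    proof (rule someI_ex)
      have "mA f (2 ^ lev Q) (nb L 1 Q) \<le> ennreal (vol L Q)" using lev[OF that] by (simp add: good_def)
      from stopping[OF L f _ this] show "\<exists>c. Pr Q c" unfolding Pr_def h_def by simp
    qed
    have ch_anc: "fst Q < fst P" "anc Q P" if "gd Q" "P \<in> ch Q" for Q P using ch0[OF that(1)] that(2) unfolding Pr_def by blast+
    have ch_disj: "disjoint_family_on (dy L) (ch Q)" if "gd Q" for Q using ch0[OF that] unfolding Pr_def by blast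
    have ch_vol: "emeasure lebesgue (\<Union>P\<in>ch Q. dy L P) \<le> ennreal (vol L Q / 2)" if "gd Q" for Q using ch0[OF that] unfolding Pr_def by blast
    have ch_out: "AE x in lebesgue. x \<in> dy L Q \<longrightarrow> x \<notin> (\<Union>P\<in>ch Q. dy L P) \<longrightarrow> \<bar>T (h Q) x\<bar> \<le> CE / 2 ^ lev Q" if "gd Q" for Q
      using ch0[OF that] unfolding Pr_def by blast
    have ch_in: "AE x in lebesgue. x \<in> dy L P \<longrightarrow> \<bar>T (h Q) x\<bar> \<le> \<bar>T (h P) x\<bar> + CE / 2 ^ lev Q" if "gd Q" "P \<in> ch Q" for Q P
      using ch0[OF that(1)] that(2) unfolding Pr_def by blast
    define R where "R = {(Q, P). gd Q \<and> P \<in> ch Q \<and> gd P}"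
    have R_anc: "anc Q P" "fst Q \<le> fst P" if "(Q, P) \<in> R\<^sup>*" for Q P
    proof -
      show "anc Q P" using that
      proof (induction rule: rtrancl_induct)
        case (step P P')
        then show ?case using ch_anc(2)[of P P'] anc_trans[of Q P P'] by (auto simp: R_def)
      qed simp
      then show "fst Q \<le> fst P" by (simp add: anc_def)
    qed
    have R_first: "\<exists>P1. (Q, P1) \<in> R \<and> (P1, P) \<in> R\<^sup>*" if "(Q, P) \<in> R\<^sup>*" "Q \<noteq> P" for Q P
      using that by (metis converse_rtranclE)
    define S where "S = {P. (Q0, P) \<in> R\<^sup>*}"
    have Sg: "gd Q" if "Q \<in> S" for Q
    proof -
      have "(Q0, Q) \<in> R\<^sup>*" using that by (simp add: S_def)
      then show ?thesis by (cases rule: rtranclE) (use gQ0 in \<open>auto simp: R_def\<close>)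
    qed
    \<comment> \<open>Reachable cells with a common point lie on one branch: the stopping cells of a
      given cell are disjoint, so the point determines the successor.\<close>
    have comparable: "(P, Q) \<in> R\<^sup>* \<or> (Q, P) \<in> R\<^sup>*"
      if P: "(Q0, P) \<in> R\<^sup>*" and Q: "(Q0, Q) \<in> R\<^sup>*" and x: "x \<in> dy L P" "x \<in> dy L Q" for P Q x
      using Q x(2)
    proof (induction rule: rtrancl_induct)
      case base
      then show ?case using P by blast
    next
      case (step Q Q')
      have QQ: "gd Q" "Q' \<in> ch Q" using step(2) by (auto simp: R_def)
      have "x \<in> dy L Q" using step(4) anc_nb_subset[OF ch_anc(2)[OF QQ], of L 0] by blast
      from step(3)[OF this] show ?case
      proof
        assume "(P, Q) \<in> R\<^sup>*"
        then show ?thesis using step(2) by (meson rtrancl.rtrancl_into_rtrancl)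
      next
        assume QP: "(Q, P) \<in> R\<^sup>*"
        show ?thesis
        proof (cases "Q = P")
          case True
          then show ?thesis using step(2) by blast
        next
          case False
          from R_first[OF QP False] obtain P1 where P1: "(Q, P1) \<in> R" "(P1, P) \<in> R\<^sup>*" by blast
          have "x \<in> dy L P1" using x(1) anc_nb_subset[OF R_anc(1)[OF P1(2)], of L 0] by blast
          moreover have "P1 \<in> ch Q" using P1(1) by (simp add: R_def)
          ultimately have "P1 = Q'"
            using ch_disj[OF QQ(1)] QQ(2) step(4) unfolding disjoint_family_on_def by blast
          then show ?thesis using P1(2) by blast
        qed
      qed
    qed
    define E where "E Q = dy L Q - (\<Union>P\<in>ch Q. dy L P)" for Q
    have Em: "E Q \<in> sets lebesgue" for Q unfolding E_def by (intro sets.Diff dm UNm)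
    have strict: "dy L P \<inter> E Q = {}" if "(Q, P) \<in> R\<^sup>*" "Q \<noteq> P" for P Q
    proof -
      from R_first[OF that] obtain P1 where P1: "(Q, P1) \<in> R" "(P1, P) \<in> R\<^sup>*" by blast
      have "dy L P \<subseteq> dy L P1" by (rule anc_nb_subset[OF R_anc(1)[OF P1(2)]])
      moreover have "P1 \<in> ch Q" using P1(1) by (simp add: R_def)
      ultimately show ?thesis by (auto simp: E_def)
    qed
    have Ed: "disjoint_family_on E S"
      unfolding disjoint_family_on_def
    proof (intro ballI impI)
      fix P Q assume PQ: "P \<in> S" "Q \<in> S" "P \<noteq> Q"
      show "E P \<inter> E Q = {}"
      proof (rule ccontr)
        assume "E P \<inter> E Q \<noteq> {}"
        then obtain x where x: "x \<in> E P" "x \<in> E Q" by blast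
        then have xd: "x \<in> dy L P" "x \<in> dy L Q" by (auto simp: E_def)
        have "(P, Q) \<in> R\<^sup>* \<or> (Q, P) \<in> R\<^sup>*"
          using comparable[OF _ _ xd] PQ by (simp add: S_def)
        then show False
        proof
          assume "(P, Q) \<in> R\<^sup>*"
          then show False using strict[of P Q] PQ(3) x(1) xd(2) by blast
        next
          assume "(Q, P) \<in> R\<^sup>*"
          then show False using strict[of Q P] PQ(3) x(2) xd(1) by blast
        qed
      qed
    qed
    have Ev: "ennreal (vol L Q) \<le> 2 * emeasure lebesgue (E Q)" if Q: "Q \<in> S" for Q
    proof -
      have "ennreal (vol L Q) = emeasure lebesgue (dy L Q)" by (simp only: emeasure_dy_lebesgue[OF L])
      also have "\<dots> \<le> emeasure lebesgue (E Q \<union> (\<Union>P\<in>ch Q. dy L P))"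
        by (rule emeasure_mono) (auto simp: E_def intro!: sets.Un Em UNm)
      also have "\<dots> \<le> emeasure lebesgue (E Q) + emeasure lebesgue (\<Union>P\<in>ch Q. dy L P)"
        by (rule emeasure_subadditive[OF Em UNm])
      also have "\<dots> \<le> emeasure lebesgue (E Q) + ennreal (vol L Q / 2)"
        by (intro add_left_mono ch_vol Sg Q)
      finally have *: "ennreal (vol L Q) \<le> emeasure lebesgue (E Q) + ennreal (vol L Q / 2)" .
      show ?thesis
      proof (cases "emeasure lebesgue (E Q)")
        case (real e)
        then have "vol L Q \<le> e + vol L Q / 2"
          using * vp[of Q] by (simp add: ennreal_plus[symmetric] del: ennreal_plus)
        then have "ennreal (vol L Q) \<le> ennreal (2 * e)" by (intro ennreal_leI) simp
        then show ?thesis using real by (simp add: ennreal_mult')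
      next
        case top
        then show ?thesis by (simp add: ennreal_mult_top)
      qed
    qed
    have carleson: "ennreal (\<Sum>Q\<in>F. vol L Q) \<le> 2 * emeasure lebesgue V"
      if F: "finite F" "F \<subseteq> S" and V: "V \<in> sets lebesgue" "\<forall>Q\<in>F. dy L Q \<subseteq> V" for F V
    proof -
      have "ennreal (\<Sum>Q\<in>F. vol L Q) = (\<Sum>Q\<in>F. ennreal (vol L Q))"
        using vp by (intro sum_ennreal[symmetric]) (simp add: less_imp_le)
      also have "\<dots> \<le> (\<Sum>Q\<in>F. 2 * emeasure lebesgue (E Q))" using F by (intro sum_mono Ev) auto
      also have "\<dots> = 2 * (\<Sum>Q\<in>F. emeasure lebesgue (E Q))" by (simp add: sum_distrib_left)
      also have "(\<Sum>Q\<in>F. emeasure lebesgue (E Q)) = emeasure lebesgue (\<Union>Q\<in>F. E Q)"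
        using Ed F Em by (intro sum_emeasure) (auto intro: disjoint_family_on_mono)
      also have "2 * \<dots> \<le> 2 * emeasure lebesgue V"
        using V by (intro mult_left_mono emeasure_mono) (auto simp: E_def)
      finally show ?thesis .
    qed
    \<comment> \<open>The points still covered after \<open>m\<close> rounds. Each round at least
      halves the measure, so the points that are never released form a null set.\<close>
    define G where "G m Q = (\<Union>P\<in>(R ^^ m) `` {Q}. dy L P)" for m Q
    have Gm: "G m Q \<in> sets lebesgue" for m Q unfolding G_def by (rule UNm)
    have G_vol: "gd Q \<Longrightarrow> emeasure lebesgue (G m Q) \<le> ennreal (vol L Q / 2 ^ m)" for m Q
    proof (induction m arbitrary: Q)
      case 0
      then show ?case using emeasure_dy_lebesgue[OF L, of Q] by (simp add: G_def)
    next
      case (Suc m)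
      have "G (Suc m) Q = (\<Union>P\<in>R `` {Q}. G m P)"
      proof -
        have "R ^^ Suc m = R O R ^^ m" by (simp only: relpow.simps(2) relpow_commute)
        then have "(R ^^ Suc m) `` {Q} = (\<Union>P\<in>R `` {Q}. (R ^^ m) `` {P})" by blast
        then show ?thesis unfolding G_def by blast
      qed
      also have "emeasure lebesgue \<dots> \<le> ennreal (vol L Q / 2 ^ Suc m)"
      proof (rule emeasure_UN_le_finite[OF countableI_type Gm])
        fix J assume J: "finite J" "J \<subseteq> R `` {Q}"
        have Jch: "J \<subseteq> ch Q" and Jg: "\<And>P. P \<in> J \<Longrightarrow> gd P" using J(2) by (auto simp: R_def)
        have dJ: "disjoint_family_on (dy L) J" by (rule disjoint_family_on_mono[OF Jch ch_disj[OF Suc.prems]])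
        have "emeasure lebesgue (\<Union>P\<in>J. G m P) \<le> (\<Sum>P\<in>J. emeasure lebesgue (G m P))"
          using J(1) Gm by (intro emeasure_subadditive_finite) auto
        also have "\<dots> \<le> (\<Sum>P\<in>J. ennreal (1 / 2 ^ m) * emeasure lebesgue (dy L P))"
        proof (rule sum_mono)
          fix P assume "P \<in> J"
          then have "emeasure lebesgue (G m P) \<le> ennreal (1 / 2 ^ m * vol L P)" using Suc.IH[OF Jg] by simp
          also have "\<dots> = ennreal (1 / 2 ^ m) * ennreal (vol L P)" by (rule ennreal_mult') simp
          finally show "emeasure lebesgue (G m P) \<le> ennreal (1 / 2 ^ m) * emeasure lebesgue (dy L P)"
            by (simp only: emeasure_dy_lebesgue[OF L])
        qed
        also have "\<dots> = ennreal (1 / 2 ^ m) * (\<Sum>P\<in>J. emeasure lebesgue (dy L P))" by (simp add: sum_distrib_left)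
        also have "(\<Sum>P\<in>J. emeasure lebesgue (dy L P)) = emeasure lebesgue (\<Union>P\<in>J. dy L P)"
          using J(1) dJ dm by (intro sum_emeasure) auto
        also have "ennreal (1 / 2 ^ m) * \<dots> \<le> ennreal (1 / 2 ^ m) * ennreal (vol L Q / 2)"
          using Jch by (intro mult_left_mono order_trans[OF emeasure_mono[OF _ UNm] ch_vol[OF Suc.prems]]) auto
        also have "\<dots> = ennreal (vol L Q / 2 ^ Suc m)"
          by (subst ennreal_mult'[symmetric]) (simp_all add: field_simps)
        finally show "emeasure lebesgue (\<Union>P\<in>J. G m P) \<le> ennreal (vol L Q / 2 ^ Suc m)" .
      qed
      finally show ?case .
    qed
    have G_null: "AE x in lebesgue. \<exists>m. x \<notin> G m Q0"
    proof -
      define Z where "Z = (\<Inter>m. G m Q0)"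
      have Zm: "Z \<in> sets lebesgue" unfolding Z_def by (rule sets.countable_INT) (use Gm in blast)+
      have le: "emeasure lebesgue Z \<le> ennreal (vol L Q0 * (1 / 2) ^ m)" for m
      proof -
        have "emeasure lebesgue Z \<le> emeasure lebesgue (G m Q0)" by (rule emeasure_mono[OF _ Gm]) (auto simp: Z_def)
        then show ?thesis using G_vol[OF gQ0, of m] by (simp add: power_one_over)
      qed
      have "(\<lambda>m. ennreal (vol L Q0 * (1 / 2) ^ m)) \<longlonglongrightarrow> ennreal (vol L Q0 * 0)"
        by (intro tendsto_ennrealI tendsto_intros LIMSEQ_realpow_zero) auto
      then have "emeasure lebesgue Z \<le> ennreal (vol L Q0 * 0)"
        by (rule LIMSEQ_le_const) (use le in auto)
      then have "Z \<in> null_sets lebesgue" using Zm by (intro null_setsI) auto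
      from AE_not_in[OF this] show ?thesis by eventually_elim (auto simp: Z_def)
    qed
    have dom: "gd Q \<Longrightarrow> AE x in lebesgue. x \<in> dy L Q \<longrightarrow> x \<notin> Om \<longrightarrow> x \<notin> G m Q \<longrightarrow>
        (\<exists>F. finite F \<and> F \<subseteq> {P. (Q, P) \<in> R\<^sup>*} \<and> (\<forall>P\<in>F. x \<in> dy L P) \<and> \<bar>T (h Q) x\<bar> \<le> 2 * CE * (\<Sum>P\<in>F. 1 / 2 ^ lev P))" for m Q
    proof (induction m arbitrary: Q)
      case 0
      then show ?case by (auto simp: G_def)
    next
      case (Suc m)
      have A1: "AE x in lebesgue. \<forall>P. P \<in> ch Q \<longrightarrow> x \<in> dy L P \<longrightarrow> \<bar>T (h Q) x\<bar> \<le> \<bar>T (h P) x\<bar> + CE / 2 ^ lev Q"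
        unfolding AE_all_countable using ch_in[OF Suc.prems] by auto
      have A2: "AE x in lebesgue. \<forall>P. gd P \<longrightarrow> x \<in> dy L P \<longrightarrow> x \<notin> Om \<longrightarrow> x \<notin> G m P \<longrightarrow>
        (\<exists>F. finite F \<and> F \<subseteq> {P'. (P, P') \<in> R\<^sup>*} \<and> (\<forall>P'\<in>F. x \<in> dy L P') \<and> \<bar>T (h P) x\<bar> \<le> 2 * CE * (\<Sum>P'\<in>F. 1 / 2 ^ lev P'))"
        unfolding AE_all_countable using Suc.IH by auto
      have A3: "AE x in lebesgue. \<forall>P. \<not> gd P \<longrightarrow> x \<in> dy L P \<longrightarrow> x \<notin> Om \<longrightarrow> T (h P) x = 0"
        unfolding AE_all_countable
      proof
        fix P
        show "AE x in lebesgue. \<not> gd P \<longrightarrow> x \<in> dy L P \<longrightarrow> x \<notin> Om \<longrightarrow> T (h P) x = 0"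
        proof (cases "gd P \<or> dy L P \<subseteq> Om")
          case True
          then show ?thesis by (intro AE_I2) auto
        next
          case False
          then have "AE x in lebesgue. T (h P) x = 0" using bad[of P] by blast
          then show ?thesis by eventually_elim simp
        qed
      qed
      show ?case using A1 A2 A3 ch_out[OF Suc.prems]
      proof eventually_elim
        case (elim x)
        show ?case
        proof (intro impI)
          assume x: "x \<in> dy L Q" "x \<notin> Om" "x \<notin> G (Suc m) Q"
          have single: "\<exists>F. finite F \<and> F \<subseteq> {P. (Q, P) \<in> R\<^sup>*} \<and> (\<forall>P\<in>F. x \<in> dy L P) \<and> \<bar>T (h Q) x\<bar> \<le> 2 * CE * (\<Sum>P\<in>F. 1 / 2 ^ lev P)"
            if "\<bar>T (h Q) x\<bar> \<le> CE / 2 ^ lev Q"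
          proof -
            have "CE / 2 ^ lev Q \<le> 2 * CE * (1 / 2 ^ lev Q)" using CE0 by (simp add: field_simps)
            then show ?thesis using that x(1) by (intro exI[of _ "{Q}"]) auto
          qed
          show "\<exists>F. finite F \<and> F \<subseteq> {P. (Q, P) \<in> R\<^sup>*} \<and> (\<forall>P\<in>F. x \<in> dy L P) \<and> \<bar>T (h Q) x\<bar> \<le> 2 * CE * (\<Sum>P\<in>F. 1 / 2 ^ lev P)"
          proof (cases "x \<in> (\<Union>P\<in>ch Q. dy L P)")
            case False
            then show ?thesis using elim(4) x(1) by (intro single) blast
          next
            case True
            then obtain P where P: "P \<in> ch Q" "x \<in> dy L P" by blast
            have step: "\<bar>T (h Q) x\<bar> \<le> \<bar>T (h P) x\<bar> + CE / 2 ^ lev Q" using elim(1) P by blast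
            show ?thesis
            proof (cases "gd P")
              case False
              then have "T (h P) x = 0" using elim(3) P x by blast
              then show ?thesis using step by (intro single) simp
            next
              case True
              have QP: "(Q, P) \<in> R" using Suc.prems P True by (simp add: R_def)
              have "x \<notin> G m P"
                using x(3) relpow_Suc_I2[OF QP] unfolding G_def by blast
              then obtain F where F: "finite F" "F \<subseteq> {P'. (P, P') \<in> R\<^sup>*}" "\<forall>P'\<in>F. x \<in> dy L P'"
                "\<bar>T (h P) x\<bar> \<le> 2 * CE * (\<Sum>P'\<in>F. 1 / 2 ^ lev P')"
                using elim(2)[rule_format, OF True P(2) x(2)] by blast
              \<comment> \<open>Generations increase strictly along a branch, so \<open>Q\<close>
                contributes a summand not yet present in the sum over \<open>F\<close>.\<close>
              have "Q \<notin> F"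
              proof
                assume "Q \<in> F"
                then have "fst P \<le> fst Q" using F(2) R_anc(2) by blast
                then show False using ch_anc(1)[OF Suc.prems P(1)] by simp
              qed
              then have sum: "(\<Sum>P\<in>insert Q F. 1 / 2 ^ lev P) = 1 / 2 ^ lev Q + (\<Sum>P\<in>F. 1 / 2 ^ lev P :: real)"
                using F(1) by simp
              have "CE / 2 ^ lev Q \<le> 2 * CE * (1 / 2 ^ lev Q)" using CE0 by (simp add: field_simps)
              then have "\<bar>T (h Q) x\<bar> \<le> 2 * CE * (\<Sum>P\<in>insert Q F. 1 / 2 ^ lev P)"
                unfolding sum distrib_left using step F(4) by linarith
              moreover have "insert Q F \<subseteq> {P. (Q, P) \<in> R\<^sup>*}"
                using F(2) QP by (auto intro: converse_rtrancl_into_rtrancl)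
              ultimately show ?thesis using F(1,3) x(1) by (intro exI[of _ "insert Q F"]) auto
            qed
          qed
        qed
      qed
    qed
    have "AE x in lebesgue. \<forall>m. x \<in> dy L Q0 \<longrightarrow> x \<notin> Om \<longrightarrow> x \<notin> G m Q0 \<longrightarrow>
        (\<exists>F. finite F \<and> F \<subseteq> S \<and> (\<forall>P\<in>F. x \<in> dy L P) \<and> \<bar>T (h Q0) x\<bar> \<le> 2 * CE * (\<Sum>P\<in>F. 1 / 2 ^ lev P))"
      unfolding AE_all_countable S_def using dom[OF gQ0] by blast
    with G_null have fin: "AE x in lebesgue. x \<in> dy L Q0 \<longrightarrow> x \<notin> Om \<longrightarrow>
        (\<exists>F. finite F \<and> F \<subseteq> S \<and> (\<forall>P\<in>F. x \<in> dy L P) \<and> \<bar>T (h Q0) x\<bar> \<le> 2 * CE * (\<Sum>P\<in>F. 1 / 2 ^ lev P))"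
      by eventually_elim blast
    have "anc Q0 Q \<and> good L f (lev Q) Q" if "Q \<in> S" for Q
      using that lev[OF Sg[OF that]] R_anc(1)[of Q0 Q] by (simp add: S_def)
    then show ?thesis
      unfolding Om_def[symmetric]
      using carleson fin[unfolded h_def[abs_def]] by (intro exI[of _ S] exI[of _ lev]) blast
  qed
qed

end

section \<open>Weighted estimates\<close>

context young begin

text \<open>In the applications the Young function of this locale is \<phi>, so \<open>Ai\<close>
  becomes the inverse function in \<open>kappa\<close>.\<close>

abbreviation Ai :: "real \<Rightarrow> real" where "Ai \<equiv> the_inv_into {0..} A"

lemma A_inj: "inj_on A {0..}"
  using young by (auto simp: young_function_def intro: strict_mono_on_imp_inj_on)

lemma A_surj: "0 \<le> t \<Longrightarrow> \<exists>s\<ge>0. A s = t"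
proof -
  assume t: "0 \<le> t"
  define b where "b = max 1 (t / A 1)"
  have A1: "0 < A 1" by (rule A_pos) simp
  have "A 1 * b \<le> A b * 1" by (rule A_convex_ray) (auto simp: b_def)
  moreover have "t \<le> A 1 * b"
  proof -
    have "t = A 1 * (t / A 1)" using A1 by simp
    also have "\<dots> \<le> A 1 * b" using A1 by (intro mult_left_mono) (auto simp: b_def)
    finally show ?thesis .
  qed
  ultimately have "t \<le> A b" by simp
  moreover have "continuous_on {0..b} A"
    using young by (auto simp: young_function_def intro: continuous_on_subset)
  moreover have "0 \<le> b" by (simp add: b_def)
  ultimately show ?thesis using IVT'[of A 0 t b] t by fastforce
qed

lemma Ai: assumes "0 \<le> t" shows "0 \<le> Ai t" "A (Ai t) = t"
proof -
  have "t \<in> A ` {0..}" using A_surj[OF assms] by force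
  then show "0 \<le> Ai t" "A (Ai t) = t"
    using the_inv_into_into[OF A_inj _ order_refl] f_the_inv_into_f[OF A_inj] by auto
qed

lemma Ai_pos: "0 < t \<Longrightarrow> 0 < Ai t"
  using Ai[of t] by (cases "Ai t = 0") (auto simp: less_le)

lemma Ai_mono: assumes "0 \<le> s" "s \<le> t" shows "Ai s \<le> Ai t"
proof (rule ccontr)
  assume "\<not> Ai s \<le> Ai t"
  then have "A (Ai t) < A (Ai s)" using Ai[of t] assms by (intro A_strict) auto
  then show False using Ai[of t] Ai[of s] assms by simp
qed

lemma Ai_ratio: assumes "0 < s" "s \<le> t" shows "Ai t / t \<le> Ai s / s"
proof -
  have "A (Ai s) * Ai t \<le> A (Ai t) * Ai s"
    using assms by (intro A_convex_ray Ai_pos Ai_mono) auto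
  then have "s * Ai t \<le> t * Ai s" using Ai[of s] Ai[of t] assms by simp
  then show ?thesis using assms by (simp add: field_simps)
qed

text \<open>Either \<open>s\<close> is below the value \<open>Ai \<tau>\<close>, or convexity along
  rays compares \<open>A s / s\<close> with its value there. Integrated, this replaces the Luxemburg
  norm of an indicator in Hoelder's inequality.\<close>

lemma linear_bound:
  assumes t: "0 < \<tau>" and s: "0 \<le> s" shows "s \<le> Ai \<tau> + Ai \<tau> / \<tau> * A s"
proof (cases "s \<le> Ai \<tau>")
  case True
  have "0 \<le> Ai \<tau> / \<tau> * A s" using t s Ai(1)[of \<tau>] A_nonneg[OF s] by simp
  with True show ?thesis by linarith
next
  case False
  then have "A (Ai \<tau>) * s \<le> A s * Ai \<tau>" using t by (intro A_convex_ray Ai_pos) auto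
  then have "s \<le> Ai \<tau> / \<tau> * A s" using t Ai(2)[of \<tau>] by (simp add: field_simps)
  then show ?thesis using Ai(1)[of \<tau>] t by simp
qed

text \<open>For admissible \<open>r\<close> the bound \<open>linear_bound\<close> is integrated for
  \<open>w / r\<close>. The constant term gains from the smallness of \<open>E\<close>, the other
  from admissibility; both give the same quantity, hence the factor 2.\<close>

lemma weight_small_set:
  fixes c :: "real ^ 'n"
  assumes l: "0 < l" and w [measurable]: "w \<in> borel_measurable lebesgue" and w0: "\<And>x. 0 \<le> w x"
    and E: "E \<in> sets lebesgue" "E \<subseteq> cube c l" and t: "0 < \<tau>" and Em: "emeasure lebesgue E \<le> ennreal (l ^ CARD('n) / \<tau>)"
  shows "(\<integral>\<^sup>+x\<in>E. w x \<partial>lebesgue) \<le> ennreal (2 * l ^ CARD('n) * (Ai \<tau> / \<tau>)) * luxemburg (\<lambda>t. ennreal (A t)) (cube c l) w"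
  unfolding luxemburg_def
proof (rule le_cmult_Inf)
  have [measurable]: "E \<in> sets lebesgue" by fact
  have [measurable]: "cube c l \<in> sets lebesgue" by simp
  have ln: "0 < l ^ CARD('n)" using l by simp
  have si: "0 < Ai \<tau> / \<tau>" using t Ai_pos by simp
  show "0 < 2 * l ^ CARD('n) * (Ai \<tau> / \<tau>)" by (intro mult_pos_pos ln si) simp
  fix s assume "s \<in> {ennreal r |r. 0 < r \<and>
       (\<integral>\<^sup>+ y\<in>cube c l. ennreal (A (\<bar>w y\<bar> / r)) \<partial>lebesgue) / emeasure lebesgue (cube c l) \<le> 1}"
  then obtain r where r: "s = ennreal r" "0 < r"
    "(\<integral>\<^sup>+ y\<in>cube c l. ennreal (A (\<bar>w y\<bar> / r)) \<partial>lebesgue) / emeasure lebesgue (cube c l) \<le> 1"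
    by blast
  have em: "emeasure lebesgue (cube c l) = ennreal (l ^ CARD('n))"
    using emeasure_box_centre(2)[of l c] l by simp
  have meas [measurable]: "(\<lambda>y. A (\<bar>w y\<bar> / r)) \<in> borel_measurable lebesgue"
  proof -
    have "(\<lambda>y. A \<bar>w y / r\<bar>) \<in> borel_measurable lebesgue" by measurable
    then show ?thesis using r(2) by simp
  qed
  define X where "X = (\<integral>\<^sup>+ y\<in>cube c l. ennreal (A (\<bar>w y\<bar> / r)) \<partial>lebesgue)"
  have X: "X \<le> ennreal (l ^ CARD('n))"
  proof -
    have "X = X * ennreal (l ^ CARD('n)) / ennreal (l ^ CARD('n))"
      using l by (intro ennreal_mult_divide_eq[symmetric]) auto
    also have "\<dots> = X / ennreal (l ^ CARD('n)) * ennreal (l ^ CARD('n))"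
      by (metis ennreal_times_divide mult.commute)
    also have "\<dots> \<le> 1 * ennreal (l ^ CARD('n))"
      using r(3) unfolding em X_def by (intro mult_right_mono) auto
    finally show ?thesis by simp
  qed
  have "(\<integral>\<^sup>+x\<in>E. w x \<partial>lebesgue) \<le> (\<integral>\<^sup>+x. ennreal (r * Ai \<tau>) * indicator E x + ennreal (r * (Ai \<tau> / \<tau>)) * (ennreal (A (\<bar>w x\<bar> / r)) * indicator (cube c l) x) \<partial>lebesgue)"
  proof (rule nn_integral_mono)
    fix x
    show "ennreal (w x) * indicator E x \<le> ennreal (r * Ai \<tau>) * indicator E x + ennreal (r * (Ai \<tau> / \<tau>)) * (ennreal (A (\<bar>w x\<bar> / r)) * indicator (cube c l) x)"
    proof (cases "x \<in> E")
      case True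
      have "w x / r \<le> Ai \<tau> + Ai \<tau> / \<tau> * A (w x / r)" using w0 r(2) by (intro linear_bound t) simp
      then have "r * (w x / r) \<le> r * (Ai \<tau> + Ai \<tau> / \<tau> * A (w x / r))" using r(2) by (intro mult_left_mono) auto
      then have "w x \<le> r * Ai \<tau> + r * (Ai \<tau> / \<tau>) * A (\<bar>w x\<bar> / r)" using r(2) w0[of x] by (simp add: algebra_simps)
      then have "ennreal (w x) \<le> ennreal (r * Ai \<tau> + r * (Ai \<tau> / \<tau>) * A (\<bar>w x\<bar> / r))" by (rule ennreal_leI)
      also have "\<dots> = ennreal (r * Ai \<tau>) + ennreal (r * (Ai \<tau> / \<tau>)) * ennreal (A (\<bar>w x\<bar> / r))"
      proof -
        have nn: "0 \<le> r * Ai \<tau>" "0 \<le> r * (Ai \<tau> / \<tau>)" "0 \<le> A (\<bar>w x\<bar> / r)"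
          using r(2) t Ai_pos[OF t] by (auto intro!: mult_nonneg_nonneg A_nonneg)
        show ?thesis by (simp only: ennreal_plus[OF nn(1) mult_nonneg_nonneg[OF nn(2,3)]] ennreal_mult'[OF nn(2)])
      qed
      finally show ?thesis using True E(2) by auto
    qed simp
  qed
  also have "\<dots> = ennreal (r * Ai \<tau>) * emeasure lebesgue E + ennreal (r * (Ai \<tau> / \<tau>)) * X"
    unfolding X_def by (subst nn_integral_add) (auto simp: nn_integral_cmult_indicator nn_integral_cmult)
  also have "\<dots> \<le> ennreal (r * Ai \<tau>) * ennreal (l ^ CARD('n) / \<tau>) + ennreal (r * (Ai \<tau> / \<tau>)) * ennreal (l ^ CARD('n))"
    by (intro add_mono mult_left_mono Em X) simp_all
  also have "\<dots> = ennreal (2 * l ^ CARD('n) * (Ai \<tau> / \<tau>)) * s"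
    using r(1,2) t ln si Ai(1)[of \<tau>] by (simp add: ennreal_mult[symmetric] ennreal_plus[symmetric] field_simps del: ennreal_plus)
  finally show "(\<integral>\<^sup>+x\<in>E. w x \<partial>lebesgue) \<le> ennreal (2 * l ^ CARD('n) * (Ai \<tau> / \<tau>)) * s" .
qed

end

section \<open>Weights: measurability and local finiteness\<close>

lemma weight_measurable:
  assumes "weight w" shows "w \<in> borel_measurable lebesgue"
proof (rule borel_measurable_LIMSEQ_real)
  fix x
  show "(\<lambda>n. w x * indicator (cball 0 (real n)) x) \<longlonglongrightarrow> w x"
  proof (rule tendsto_eventually)
    obtain N :: nat where N: "norm x \<le> N" using real_arch_simple by blast
    show "\<forall>\<^sub>F n in sequentially. w x * indicator (cball 0 (real n)) x = w x"
      using eventually_ge_at_top[of N] by eventually_elim (use N in auto)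
  qed
  fix n :: nat
  have "set_integrable lebesgue (cball 0 (real n)) w" using assms by (simp add: weight_def)
  then show "(\<lambda>x. w x * indicator (cball 0 (real n)) x) \<in> borel_measurable lebesgue"
    unfolding set_integrable_def by (auto dest: borel_measurable_integrable simp: mult.commute)
qed

text \<open>Finite weight of bounded sets is what permits the absorption in
  \<open>local_bound\<close>.\<close>

lemma weight_finite:
  assumes w: "weight w" and S: "bounded S" shows "(\<integral>\<^sup>+x\<in>S. w x \<partial>lebesgue) < \<infinity>"
proof -
  obtain a b where ab: "S \<subseteq> cbox a b" using bounded_in_cbox[OF S] by blast
  have "integrable lebesgue (\<lambda>x. indicator (cbox a b) x *\<^sub>R w x)"
  proof -
    have "set_integrable lebesgue (cbox a b) w" using w compact_cbox[of a b] unfolding weight_def by simp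
    then show ?thesis by (simp only: set_integrable_def)
  qed
  then have "(\<integral>\<^sup>+x. ennreal (norm (indicator (cbox a b) x *\<^sub>R w x)) \<partial>lebesgue) < \<infinity>"
    unfolding integrable_iff_bounded by blast
  moreover have "(\<integral>\<^sup>+x\<in>S. w x \<partial>lebesgue) \<le> (\<integral>\<^sup>+x. ennreal (norm (indicator (cbox a b) x *\<^sub>R w x)) \<partial>lebesgue)"
  proof (rule nn_integral_mono)
    fix x
    have "0 \<le> w x" using w unfolding weight_def by blast
    then show "ennreal (w x) * indicator S x \<le> ennreal (norm (indicator (cbox a b) x *\<^sub>R w x))"
      using ab by (auto split: split_indicator)
  qed
  ultimately show ?thesis by (rule order_le_less_trans[rotated])
qed

section \<open>Counting overlaps of dyadic cubes\<close>

text \<open>Only strictly finer members are counted, so along the chain of cells through a point the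
  counts are ranks. Dyadic cells correspond to \<open>r = 0\<close>, triples to
  \<open>r = 1\<close>.\<close>

definition cnt :: "real \<Rightarrow> int \<Rightarrow> 'n::finite cell set \<Rightarrow> 'n cell \<Rightarrow> real ^ 'n \<Rightarrow> nat" where
  "cnt L r F Q y = card {P \<in> F. fst Q < fst P \<and> y \<in> nb L r P}"

text \<open>Take a coarsest member \<open>Q\<close> of the family in question. The others are either
  strictly finer, hence among the fewer than \<open>N\<close> members counted for \<open>Q\<close>,
  or of the same generation, hence among the neighbours of the cell of \<open>y\<close>.\<close>

lemma card_low_count:
  fixes F :: "('n::finite) cell set"
  assumes F: "finite F" and r: "0 \<le> r"
  shows "card {Q \<in> F. y \<in> nb L r Q \<and> cnt L r F Q y < N} \<le> N + nat (2 * r + 1) ^ CARD('n)"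
proof (cases "{Q \<in> F. y \<in> nb L r Q \<and> cnt L r F Q y < N} = {}")
  case True
  show ?thesis by (simp only: True card.empty)
next
  case False
  define D where "D = {Q \<in> F. y \<in> nb L r Q \<and> cnt L r F Q y < N}"
  have ex: "\<exists>Q. Q \<in> D" using False by (auto simp: D_def)
  define Q where "Q = arg_min fst (\<lambda>Q. Q \<in> D)"
  have Q: "Q \<in> D" "\<And>P. P \<in> D \<Longrightarrow> fst Q \<le> fst P"
    using ex arg_min_natI[of "\<lambda>Q. Q \<in> D"] arg_min_nat_le[of "\<lambda>Q. Q \<in> D"] unfolding Q_def by blast+
  have "D \<subseteq> {P \<in> F. fst Q < fst P \<and> y \<in> nb L r P} \<union> nbrs r (idx L (fst Q) y)"
  proof
    fix P assume P: "P \<in> D"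
    show "P \<in> {P \<in> F. fst Q < fst P \<and> y \<in> nb L r P} \<union> nbrs r (idx L (fst Q) y)"
    proof (cases "fst Q < fst P")
      case True
      then show ?thesis using P by (auto simp: D_def)
    next
      case False
      then have "fst P = fst Q" using Q(2)[OF P] by simp
      then have "idx L (fst Q) y \<in> nbrs r P" using P by (simp add: D_def mem_nb_iff)
      then show ?thesis using nbrs_sym by blast
    qed
  qed
  then have "card D \<le> card ({P \<in> F. fst Q < fst P \<and> y \<in> nb L r P} \<union> nbrs r (idx L (fst Q) y))"
    using F by (intro card_mono) auto
  also have "\<dots> \<le> cnt L r F Q y + nat (2 * r + 1) ^ CARD('n)"
    unfolding cnt_def card_nbrs[OF r, of "idx L (fst Q) y", symmetric] by (rule card_Un_le)
  also have "\<dots> \<le> N + nat (2 * r + 1) ^ CARD('n)" using Q(1) by (simp add: D_def)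
  finally show ?thesis by (simp add: D_def)
qed

lemma cnt_eq_sum:
  assumes "finite F"
  shows "ennreal (real (cnt L r F Q y)) = (\<Sum>P\<in>{P \<in> F. fst Q < fst P}. indicator (nb L r P) y)"
proof -
  have "(\<Sum>P\<in>{P \<in> F. fst Q < fst P}. indicator (nb L r P) y :: ennreal) = (\<Sum>P\<in>{P \<in> F. fst Q < fst P}. ennreal (indicator (nb L r P) y))"
    by (intro sum.cong) (auto simp: indicator_def)
  also have "\<dots> = ennreal (\<Sum>P\<in>{P \<in> F. fst Q < fst P}. indicator (nb L r P) y)" by (intro sum_ennreal) simp
  also have "(\<Sum>P\<in>{P \<in> F. fst Q < fst P}. indicator (nb L r P) y) = real (card ({P \<in> F. fst Q < fst P} \<inter> {P. y \<in> nb L r P}))"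
    using assms by (simp add: indicator_def sum.If_cases)
  also have "{P \<in> F. fst Q < fst P} \<inter> {P. y \<in> nb L r P} = {P \<in> F. fst Q < fst P \<and> y \<in> nb L r P}" by blast
  finally show ?thesis by (simp add: cnt_def)
qed

lemma cnt_measurable:
  assumes "finite F" shows "(\<lambda>y. real (cnt L r F Q y)) \<in> borel_measurable lebesgue"
proof -
  have "(\<lambda>y. \<Sum>P\<in>{P \<in> F. fst Q < fst P}. indicator (nb L r P) y :: real) \<in> borel_measurable lebesgue"
    by (intro borel_measurable_sum borel_measurable_indicator nb_lebesgue)
  moreover have "(\<Sum>P\<in>{P \<in> F. fst Q < fst P}. indicator (nb L r P) y) = real (cnt L r F Q y)" for y
  proof -
    have "(\<Sum>P\<in>{P \<in> F. fst Q < fst P}. indicator (nb L r P) y) = real (card ({P \<in> F. fst Q < fst P} \<inter> {P. y \<in> nb L r P}))"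
      using assms by (simp add: indicator_def sum.If_cases)
    also have "{P \<in> F. fst Q < fst P} \<inter> {P. y \<in> nb L r P} = {P \<in> F. fst Q < fst P \<and> y \<in> nb L r P}" by blast
    finally show ?thesis by (simp add: cnt_def)
  qed
  ultimately show ?thesis by simp
qed

lemma sum_rank_power:
  fixes C :: "nat set" and x :: real
  assumes "finite C"
  shows "(\<Sum>p\<in>C. x ^ card {q \<in> C. p < q}) = (\<Sum>i<card C. x ^ i)"
  using assms
proof (induction rule: finite_linorder_min_induct)
  case (insert b C)
  have b: "b \<notin> C" using insert by auto
  have "{q \<in> insert b C. b < q} = C" using insert by auto
  moreover have "{q \<in> insert b C. p < q} = {q \<in> C. p < q}" if "p \<in> C" for p using insert that by auto
  ultimately have "(\<Sum>p\<in>insert b C. x ^ card {q \<in> insert b C. p < q}) = x ^ card C + (\<Sum>p\<in>C. x ^ card {q \<in> C. p < q})"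
    using insert b by simp
  then show ?case using insert b by simp
qed simp

text \<open>Cells through \<open>y\<close> are determined by their generation, so the counts of the
  members below \<open>Q\<close> run through 0 up to \<open>cnt L 0 F Q y - 1\<close> and the sum is
  geometric. The factor \<open>1 / 4\<close> is the excess of the ratio over 1.\<close>

lemma cnt_power_telescope:
  fixes F :: "('n::finite) cell set"
  assumes F: "finite F"
  shows "(5 / 4 :: real) ^ cnt L 0 F Q y = 1 + (1 / 4) * (\<Sum>P\<in>{P \<in> F. fst Q < fst P}. (5 / 4) ^ cnt L 0 F P y * indicator (dy L P) y)"
proof -
  define C where "C = {P \<in> F. fst Q < fst P \<and> y \<in> dy L P}"
  have fC: "finite C" using F by (simp add: C_def)
  have inj: "inj_on fst C"
    by (rule inj_onI) (auto simp: C_def mem_dy_iff)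
  have rank: "cnt L 0 F P y = card {q \<in> fst ` C. fst P < q}" if P: "P \<in> C" for P
  proof -
    have "{q \<in> fst ` C. fst P < q} = fst ` {P' \<in> F. fst P < fst P' \<and> y \<in> dy L P'}"
      using P by (auto simp: C_def)
    moreover have "inj_on fst {P' \<in> F. fst P < fst P' \<and> y \<in> dy L P'}"
      by (rule inj_on_subset[OF inj]) (use P in \<open>auto simp: C_def\<close>)
    ultimately show ?thesis by (simp add: cnt_def card_image)
  qed
  have "(\<Sum>P\<in>{P \<in> F. fst Q < fst P}. (5 / 4 :: real) ^ cnt L 0 F P y * indicator (dy L P) y) = (\<Sum>P\<in>C. (5 / 4) ^ cnt L 0 F P y)"
    using F by (intro sum.mono_neutral_cong_right) (auto simp: C_def)
  also have "\<dots> = (\<Sum>P\<in>C. (5 / 4) ^ card {q \<in> fst ` C. fst P < q})" by (intro sum.cong) (simp_all add: rank)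
  also have "\<dots> = (\<Sum>p\<in>fst ` C. (5 / 4) ^ card {q \<in> fst ` C. p < q})" by (simp add: sum.reindex[OF inj])
  also have "\<dots> = (\<Sum>i<card (fst ` C). (5 / 4) ^ i)" using fC by (intro sum_rank_power) simp
  also have "card (fst ` C) = cnt L 0 F Q y" by (simp add: card_image[OF inj]) (simp add: cnt_def C_def)
  also have "(\<Sum>i<cnt L 0 F Q y. (5 / 4 :: real) ^ i) = 4 * ((5 / 4) ^ cnt L 0 F Q y - 1)"
    by (simp add: geometric_sum)
  finally have S: "(\<Sum>P\<in>{P \<in> F. fst Q < fst P}. (5 / 4 :: real) ^ cnt L 0 F P y * indicator (dy L P) y)
    = 4 * ((5 / 4) ^ cnt L 0 F Q y - 1)" .
  show ?thesis unfolding S by (simp add: right_diff_distrib)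
qed

text \<open>The cubes containing a point form a chain, along which the powers of \<open>5 / 4\<close> telescope; this
  turns the Carleson condition into a bound by induction from the small cubes to the large ones.\<close>

lemma exponential_integrability:
  fixes F :: "('n::finite) cell set"
  assumes L: "0 < L" and F: "finite F"
    and car: "\<And>Q. Q \<in> F \<Longrightarrow> (\<Sum>P\<in>{P \<in> F. anc Q P}. vol L P) \<le> 2 * vol L Q"
    and Q: "Q \<in> F"
  shows "(\<integral>\<^sup>+y\<in>dy L Q. ennreal ((5 / 4) ^ cnt L 0 F Q y) \<partial>lebesgue) \<le> ennreal (2 * vol L Q)"
  using Q
proof (induction "Max (fst ` F) - fst Q" arbitrary: Q rule: less_induct)
  case less
  note Q = less.prems
  have vp: "0 < vol L R" for R :: "'n cell" by (rule vol_pos[OF L])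
  define D where "D = {P \<in> F. anc Q P \<and> fst Q < fst P}"
  have fD: "finite D" using F by (simp add: D_def)
  have powm: "(\<lambda>y. ennreal ((5 / 4) ^ cnt L 0 F P y)) \<in> borel_measurable lebesgue" for P
  proof -
    have "(\<lambda>y. (5 / 4) powr (real (cnt L 0 F P y))) \<in> borel_measurable lebesgue"
      by (intro powr_real_measurable cnt_measurable F) simp
    then show ?thesis by (simp add: powr_realpow)
  qed
  have IH: "(\<integral>\<^sup>+y\<in>dy L P. ennreal ((5 / 4) ^ cnt L 0 F P y) \<partial>lebesgue) \<le> ennreal (2 * vol L P)" if P: "P \<in> D" for P
  proof (rule less.hyps)
    have "fst P \<le> Max (fst ` F)" using P F by (auto simp: D_def)
    then show "Max (fst ` F) - fst P < Max (fst ` F) - fst Q" using P by (auto simp: D_def)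
    show "P \<in> F" using P by (simp add: D_def)
  qed
  have "(\<integral>\<^sup>+y\<in>dy L Q. ennreal ((5 / 4) ^ cnt L 0 F Q y) \<partial>lebesgue)
    \<le> (\<integral>\<^sup>+y. indicator (dy L Q) y + (\<Sum>P\<in>D. ennreal (1 / 4) * (ennreal ((5 / 4) ^ cnt L 0 F P y) * indicator (dy L P) y)) \<partial>lebesgue)"
  proof (rule nn_integral_mono)
    fix y
    show "ennreal ((5 / 4) ^ cnt L 0 F Q y) * indicator (dy L Q) y \<le> indicator (dy L Q) y + (\<Sum>P\<in>D. ennreal (1 / 4) * (ennreal ((5 / 4) ^ cnt L 0 F P y) * indicator (dy L P) y))"
    proof (cases "y \<in> dy L Q")
      case True
      have "(\<Sum>P\<in>{P \<in> F. fst Q < fst P}. (5 / 4 :: real) ^ cnt L 0 F P y * indicator (dy L P) y) = (\<Sum>P\<in>D. (5 / 4) ^ cnt L 0 F P y * indicator (dy L P) y)"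
        using F dy_meet_anc[OF True]
        by (intro sum.mono_neutral_right) (auto simp: D_def indicator_def)
      then have "ennreal ((5 / 4) ^ cnt L 0 F Q y) = ennreal (1 + (\<Sum>P\<in>D. (1 / 4) * ((5 / 4) ^ cnt L 0 F P y * indicator (dy L P) y)))"
        by (subst cnt_power_telescope[OF F]) (simp add: sum_distrib_left)
      also have "\<dots> = 1 + ennreal (\<Sum>P\<in>D. (1 / 4) * ((5 / 4) ^ cnt L 0 F P y * indicator (dy L P) y))"
        by (subst ennreal_plus) (auto intro!: sum_nonneg)
      also have "ennreal (\<Sum>P\<in>D. (1 / 4) * ((5 / 4) ^ cnt L 0 F P y * indicator (dy L P) y)) = (\<Sum>P\<in>D. ennreal ((1 / 4) * ((5 / 4) ^ cnt L 0 F P y * indicator (dy L P) y)))"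
        by (intro sum_ennreal[symmetric]) simp
      also have "\<dots> = (\<Sum>P\<in>D. ennreal (1 / 4) * (ennreal ((5 / 4) ^ cnt L 0 F P y) * indicator (dy L P) y))"
        by (intro sum.cong refl) (auto simp: ennreal_mult'[symmetric] indicator_def)
      finally show ?thesis using True by simp
    qed simp
  qed
  also have "\<dots> = ennreal (vol L Q) + (\<Sum>P\<in>D. ennreal (1 / 4) * (\<integral>\<^sup>+y\<in>dy L P. ennreal ((5 / 4) ^ cnt L 0 F P y) \<partial>lebesgue))"
    using powm nb_lebesgue[of L 0] emeasure_dy_lebesgue[OF L, of Q]
    by (subst nn_integral_add) (auto simp: nn_integral_sum nn_integral_cmult simp del: emeasure_completion)
  also have "\<dots> \<le> ennreal (vol L Q) + (\<Sum>P\<in>D. ennreal (1 / 4) * ennreal (2 * vol L P))"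
    by (intro add_left_mono sum_mono mult_left_mono IH) simp_all
  also have "\<dots> = ennreal (vol L Q) + ennreal (1 / 2 * (\<Sum>P\<in>D. vol L P))"
    using vp by (simp add: ennreal_mult'[symmetric] sum_ennreal less_imp_le sum_distrib_left)
  also have "\<dots> = ennreal (vol L Q + 1 / 2 * (\<Sum>P\<in>D. vol L P))"
    using vp[of Q] vp by (intro ennreal_plus[symmetric]) (auto intro!: sum_nonneg simp: less_imp_le)
  \<comment> \<open>The ratio \<open>5 / 4\<close> is tuned to this step: with packing constant 2
    and induction bound 2, the new total is again exactly twice the volume.\<close>
  also have "\<dots> \<le> ennreal (2 * vol L Q)"
  proof (rule ennreal_leI)
    have "(\<Sum>P\<in>D. vol L P) \<le> (\<Sum>P\<in>{P \<in> F. anc Q P}. vol L P)"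
      using F vp by (intro sum_mono2) (auto simp: D_def less_imp_le)
    then show "vol L Q + 1 / 2 * (\<Sum>P\<in>D. vol L P) \<le> 2 * vol L Q" using car[OF Q] by simp
  qed
  finally show ?case .
qed

lemma overlap_tail:
  fixes F :: "('n::finite) cell set"
  assumes L: "0 < L" and F: "finite F"
    and car: "\<And>Q. Q \<in> F \<Longrightarrow> (\<Sum>P\<in>{P \<in> F. anc Q P}. vol L P) \<le> 2 * vol L Q"
    and Q: "Q \<in> F"
  shows "{y \<in> dy L Q. u \<le> cnt L 0 F Q y} \<in> sets lebesgue"
    "emeasure lebesgue {y \<in> dy L Q. u \<le> cnt L 0 F Q y} \<le> ennreal (2 * vol L Q / (5 / 4) ^ u)"
proof -
  have cm [measurable]: "(\<lambda>y. real (cnt L 0 F Q y)) \<in> borel_measurable lebesgue" by (rule cnt_measurable[OF F])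
  have dm [measurable]: "dy L Q \<in> sets lebesgue" by (rule nb_lebesgue)
  have eq: "{y \<in> dy L Q. u \<le> cnt L 0 F Q y} = dy L Q \<inter> {y \<in> space lebesgue. real u \<le> real (cnt L 0 F Q y)}" by auto
  show m [measurable]: "{y \<in> dy L Q. u \<le> cnt L 0 F Q y} \<in> sets lebesgue"
    unfolding eq by (intro sets.Int dm borel_measurable_le borel_measurable_const cm)
  have "emeasure lebesgue {y \<in> dy L Q. u \<le> cnt L 0 F Q y} = (\<integral>\<^sup>+y. indicator {y \<in> dy L Q. u \<le> cnt L 0 F Q y} y \<partial>lebesgue)"
    using m by simp
  also have "\<dots> \<le> (\<integral>\<^sup>+y. ennreal (1 / (5 / 4) ^ u) * (ennreal ((5 / 4) ^ cnt L 0 F Q y) * indicator (dy L Q) y) \<partial>lebesgue)"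
  proof (rule nn_integral_mono)
    fix y
    show "indicator {y \<in> dy L Q. u \<le> cnt L 0 F Q y} y \<le> ennreal (1 / (5 / 4) ^ u) * (ennreal ((5 / 4) ^ cnt L 0 F Q y) * indicator (dy L Q) y)"
    proof (cases "y \<in> dy L Q \<and> u \<le> cnt L 0 F Q y")
      case True
      then have "(5 / 4 :: real) ^ u \<le> (5 / 4) ^ cnt L 0 F Q y" by (intro power_increasing) auto
      then have "1 \<le> 1 / (5 / 4) ^ u * (5 / 4 :: real) ^ cnt L 0 F Q y" by (simp add: field_simps)
      then have "ennreal 1 \<le> ennreal (1 / (5 / 4) ^ u * (5 / 4 :: real) ^ cnt L 0 F Q y)" by (rule ennreal_leI)
      then show ?thesis using True by (simp add: ennreal_mult'[symmetric])
    qed simp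
  qed
  also have "\<dots> \<le> ennreal (1 / (5 / 4) ^ u) * (\<integral>\<^sup>+y\<in>dy L Q. ennreal ((5 / 4) ^ cnt L 0 F Q y) \<partial>lebesgue)"
    by (rule nn_integral_cmult_le) simp
  also have "\<dots> \<le> ennreal (1 / (5 / 4) ^ u) * ennreal (2 * vol L Q)"
    by (intro mult_left_mono exponential_integrability[OF L F car Q]) simp_all
  also have "\<dots> = ennreal (2 * vol L Q / (5 / 4) ^ u)" by (simp add: ennreal_mult'[symmetric])
  finally show "emeasure lebesgue {y \<in> dy L Q. u \<le> cnt L 0 F Q y} \<le> ennreal (2 * vol L Q / (5 / 4) ^ u)" .
qed

section \<open>The constant of the maximal operator\<close>

text \<open>The range of \<open>t\<close> is cut at the exponentials of
  \<open>r j = sqrt 2 ^ j\<close>. On \<open>J k\<close> the logarithm is at least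
  \<open>r (k + 1)\<close>, with square \<open>2 ^ Suc k\<close>, and at most
  \<open>2 * r (k + 2)\<close>. The integral of \<open>1 / t\<close> over \<open>J k\<close> is
  \<open>r (k + 2) - r (k + 1)\<close>, at least a quarter of \<open>r (k + 2)\<close>. So 128 is 8
  from the cube of the logarithm, 4 from this quarter, and 4 from
  \<open>(r (k + 2))\<^sup>2 = 2 ^ (k + 2)\<close>.\<close>

lemma kappa_sum:
  assumes A: "young A" and \<phi>: "young \<phi>"
  shows "ennreal (\<Sum>k<N. A (2 ^ Suc k) * (the_inv_into {0..} \<phi> (exp (sqrt 2 ^ (k + 2))) / exp (sqrt 2 ^ (k + 2))) / 2 ^ k)
    \<le> 128 * kappa A \<phi>"
proof -
  interpret A: young A by fact
  interpret \<phi>: young \<phi> by fact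
  define r where "r j = sqrt 2 ^ j" for j
  define \<tau> where "\<tau> k = exp (r (k + 2))" for k
  define \<theta> where "\<theta> k = \<phi>.Ai (\<tau> k) / \<tau> k" for k
  have s2: "4 / 3 \<le> sqrt 2" by (rule real_le_rsqrt) (simp add: power2_eq_square)
  have r1: "1 \<le> r j" for j unfolding r_def using s2 by (intro one_le_power) linarith
  have rmono: "r i \<le> r j" if "i \<le> j" for i j unfolding r_def using s2 that by (intro power_increasing) linarith+
  have r2: "2 \<le> r (k + 2)" for k
  proof -
    have "r 2 = 2" by (simp add: r_def)
    then show ?thesis using rmono[of 2 "k + 2"] by simp
  qed
  have rsq: "(r j)\<^sup>2 = 2 ^ j" for j
  proof -
    have "(r j)\<^sup>2 = (sqrt 2 ^ 2) ^ j" unfolding r_def by (simp only: power_mult[symmetric] mult.commute)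
    then show ?thesis by simp
  qed
  have th0: "0 < \<tau> k" "0 \<le> \<theta> k" for k using \<phi>.Ai(1)[of "\<tau> k"] by (simp_all add: \<tau>_def \<theta>_def)
  define c where "c k = \<theta> k * A (2 ^ Suc k) / (2 * r (k + 2)) ^ 3" for k
  have c0: "0 \<le> c k" for k using th0(2)[of k] A.A_nonneg[of "2 ^ Suc k"] r1[of "k + 2"] by (simp add: c_def)
  define J where "J k = {exp (r (k + 1)) <.. exp (r (k + 2))}" for k
  have Jdisj: "k = k'" if "t \<in> J k" "t \<in> J k'" for t k k'
  proof (rule ccontr)
    assume "k \<noteq> k'"
    then consider "k < k'" | "k' < k" by linarith
    then show False
    proof cases
      case 1
      then have "exp (r (k + 2)) \<le> exp (r (k' + 1))" using rmono[of "k + 2" "k' + 1"] by simp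
      then show False using that unfolding J_def greaterThanAtMost_iff by linarith
    next
      case 2
      then have "exp (r (k' + 2)) \<le> exp (r (k + 1))" using rmono[of "k' + 2" "k + 1"] by simp
      then show False using that unfolding J_def greaterThanAtMost_iff by linarith
    qed
  qed
  have J1: "1 \<le> t" if "t \<in> J k" for t k
  proof -
    have "1 \<le> exp (r (k + 1))" using r1[of "k + 1"] by simp
    then show ?thesis using that unfolding J_def greaterThanAtMost_iff by linarith
  qed
  have pt: "c k / t \<le> \<phi>.Ai t * A ((ln (exp 1 + t))\<^sup>2) / (t\<^sup>2 * (ln (exp 1 + t)) ^ 3)" if t: "t \<in> J k" for t k
  proof -
    have t1: "1 \<le> t" by (rule J1[OF t])
    have l1: "r (k + 1) \<le> ln (exp 1 + t)"
    proof -
      have "exp (r (k + 1)) \<le> exp 1 + t" using t by (simp add: J_def add_increasing)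
      then show ?thesis using t1 by (subst ln_ge_iff) (auto intro: add_pos_pos)
    qed
    have l2: "ln (exp 1 + t) \<le> 2 * r (k + 2)"
    proof -
      have "exp 1 + t \<le> exp 2 * t"
      proof -
        have e: "exp 1 * exp 1 = exp (2::real)" by (simp add: exp_add[symmetric])
        have e2: "(2::real) \<le> exp 1" using exp_ge_add_one_self[of "1::real"] by simp
        then have "exp 1 * 2 \<le> exp (2::real)" unfolding e[symmetric] by (intro mult_left_mono) auto
        moreover have "exp 1 + t \<le> exp 1 * t + exp 1 * t"
          using t1 e2 by (intro add_mono) (auto simp: mult_le_cancel_left1 mult_le_cancel_right1)
        moreover have "exp 1 * 2 * t \<le> exp (2::real) * t" using \<open>exp 1 * 2 \<le> exp 2\<close> t1 by (intro mult_right_mono) auto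
        moreover have "exp 1 * t + exp 1 * t = exp 1 * 2 * t" by simp
        ultimately show ?thesis by linarith
      qed
      then have "ln (exp 1 + t) \<le> ln (exp 2 * t)" using t1 by (subst ln_le_cancel_iff) (auto intro: add_pos_pos)
      also have "\<dots> = 2 + ln t" using t1 by (simp add: ln_mult)
      also have "ln t \<le> r (k + 2)"
        using t t1 by (intro order_trans[OF ln_mono[of t "exp (r (k + 2))"]]) (auto simp: J_def)
      also have "2 \<le> r (k + 2)" by (rule r2)
      finally show ?thesis by simp
    qed
    have lp: "0 < ln (exp 1 + t)" using l1 r1[of "k + 1"] by linarith
    have a: "A (2 ^ Suc k) \<le> A ((ln (exp 1 + t))\<^sup>2)"
    proof (rule A.A_mono)
      have "(r (k + 1))\<^sup>2 \<le> (ln (exp 1 + t))\<^sup>2" using l1 r1[of "k + 1"] by (intro power_mono) auto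
      then show "2 ^ Suc k \<le> (ln (exp 1 + t))\<^sup>2" by (simp only: rsq Suc_eq_plus1)
    qed simp
    have th: "\<theta> k \<le> \<phi>.Ai t / t" unfolding \<theta>_def using t t1 by (intro \<phi>.Ai_ratio) (auto simp: J_def \<tau>_def)
    have "c k / t = \<theta> k * A (2 ^ Suc k) / (t * (2 * r (k + 2)) ^ 3)" by (simp add: c_def)
    also have "\<dots> \<le> (\<phi>.Ai t / t * A ((ln (exp 1 + t))\<^sup>2)) / (t * (ln (exp 1 + t)) ^ 3)"
    proof (rule frac_le)
      show "0 \<le> \<phi>.Ai t / t * A ((ln (exp 1 + t))\<^sup>2)" using \<phi>.Ai(1)[of t] t1 A.A_nonneg by simp
      show "\<theta> k * A (2 ^ Suc k) \<le> \<phi>.Ai t / t * A ((ln (exp 1 + t))\<^sup>2)"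
        using th a th0(2)[of k] A.A_nonneg[of "2 ^ Suc k"] by (intro mult_mono) auto
      show "0 < t * (ln (exp 1 + t)) ^ 3" using lp t1 by simp
      show "t * (ln (exp 1 + t)) ^ 3 \<le> t * (2 * r (k + 2)) ^ 3" using lp l2 t1 by (intro mult_left_mono power_mono) auto
    qed
    also have "\<dots> = \<phi>.Ai t * A ((ln (exp 1 + t))\<^sup>2) / (t\<^sup>2 * (ln (exp 1 + t)) ^ 3)"
      by (simp add: power2_eq_square)
    finally show ?thesis .
  qed
  have blk: "(\<integral>\<^sup>+t. ennreal (c k / t) * indicator (J k) t \<partial>lborel) = ennreal (c k * (r (k + 2) - r (k + 1)))" for k
  proof -
    have p: "0 < exp (r (k + 1))" by simp
    have le: "exp (r (k + 1)) \<le> exp (r (k + 2))" using rmono[of "k + 1" "k + 2"] by simp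
    have "(\<integral>\<^sup>+t. ennreal (c k / t) * indicator (J k) t \<partial>lborel) = (\<integral>\<^sup>+t. ennreal (c k / t) * indicator {exp (r (k + 1)) .. exp (r (k + 2))} t \<partial>lborel)"
    proof (rule nn_integral_cong_AE)
      show "AE t in lborel. ennreal (c k / t) * indicator (J k) t = ennreal (c k / t) * indicator {exp (r (k + 1)) .. exp (r (k + 2))} t"
        using AE_lborel_singleton[of "exp (r (k + 1))"] by eventually_elim (auto simp: J_def indicator_def)
    qed
    also have "\<dots> = ennreal (c k * ln (exp (r (k + 2))) - c k * ln (exp (r (k + 1))))"
    proof (rule nn_integral_FTC_Icc)
      show "(\<lambda>t. c k / t) \<in> borel_measurable borel" by measurable
      fix t assume t: "t \<in> {exp (r (k + 1)) .. exp (r (k + 2))}"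
      then have tp: "0 < t" using p by (meson atLeastAtMost_iff less_le_trans)
      then show "DERIV (\<lambda>t. c k * ln t) t :> c k / t" by (auto intro!: derivative_eq_intros simp: divide_inverse)
      show "0 \<le> c k / t" using c0 tp by simp
    qed (rule le)
    finally show ?thesis by (simp add: right_diff_distrib)
  qed
  have bl: "A (2 ^ Suc k) * (\<phi>.Ai (exp (sqrt 2 ^ (k + 2))) / exp (sqrt 2 ^ (k + 2))) / 2 ^ k \<le> 128 * (c k * (r (k + 2) - r (k + 1)))" for k
  proof -
    have rr: "r (k + 2) = sqrt 2 * r (k + 1)" by (simp add: r_def)
    have rp: "0 < r (k + 2)" using r1[of "k + 2"] by linarith
    have "r (k + 2) / 4 \<le> r (k + 2) - r (k + 1)"
    proof -
      have "(4 / 3) * r (k + 1) \<le> sqrt 2 * r (k + 1)" using s2 r1[of "k + 1"] by (intro mult_right_mono) auto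
      then show ?thesis unfolding rr by linarith
    qed
    then have "128 * (c k * (r (k + 2) / 4)) \<le> 128 * (c k * (r (k + 2) - r (k + 1)))"
      using c0 by (intro mult_left_mono) auto
    moreover have "128 * (c k * (r (k + 2) / 4)) = A (2 ^ Suc k) * \<theta> k / 2 ^ k"
    proof -
      have "128 * (c k * (r (k + 2) / 4)) = 4 * \<theta> k * A (2 ^ Suc k) / (r (k + 2))\<^sup>2"
        using rp by (simp add: c_def field_simps power2_eq_square power3_eq_cube)
      also have "\<dots> = A (2 ^ Suc k) * \<theta> k / 2 ^ k" unfolding rsq by (simp add: field_simps)
      finally show ?thesis .
    qed
    moreover have "\<theta> k = \<phi>.Ai (exp (sqrt 2 ^ (k + 2))) / exp (sqrt 2 ^ (k + 2))" by (simp only: \<theta>_def \<tau>_def r_def)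
    ultimately show ?thesis by simp
  qed
  have "ennreal (\<Sum>k<N. A (2 ^ Suc k) * (\<phi>.Ai (exp (sqrt 2 ^ (k + 2))) / exp (sqrt 2 ^ (k + 2))) / 2 ^ k)
    \<le> ennreal (\<Sum>k<N. 128 * (c k * (r (k + 2) - r (k + 1))))"
    by (intro ennreal_leI sum_mono bl)
  also have "\<dots> = ennreal 128 * ennreal (\<Sum>k<N. c k * (r (k + 2) - r (k + 1)))"
    unfolding sum_distrib_left[symmetric] by (rule ennreal_mult') simp
  also have "ennreal (\<Sum>k<N. c k * (r (k + 2) - r (k + 1))) = (\<Sum>k<N. ennreal (c k * (r (k + 2) - r (k + 1))))"
    using c0 rmono by (intro sum_ennreal[symmetric]) (auto intro!: mult_nonneg_nonneg)
  also have "\<dots> = (\<Sum>k<N. \<integral>\<^sup>+t. ennreal (c k / t) * indicator (J k) t \<partial>lborel)" by (simp only: blk)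
  also have "\<dots> = (\<integral>\<^sup>+t. (\<Sum>k<N. ennreal (c k / t) * indicator (J k) t) \<partial>lborel)"
    by (rule nn_integral_sum[symmetric]) (auto simp: J_def)
  also have "\<dots> \<le> (\<integral>\<^sup>+t\<in>{1..}. ennreal (\<phi>.Ai t * A ((ln (exp 1 + t))\<^sup>2) / (t\<^sup>2 * (ln (exp 1 + t)) ^ 3)) \<partial>lborel)"
  proof (rule nn_integral_mono)
    fix t
    show "(\<Sum>k<N. ennreal (c k / t) * indicator (J k) t) \<le> ennreal (\<phi>.Ai t * A ((ln (exp 1 + t))\<^sup>2) / (t\<^sup>2 * (ln (exp 1 + t)) ^ 3)) * indicator {1..} t"
    proof (cases "\<exists>k<N. t \<in> J k")
      case True
      then obtain k where k: "k < N" "t \<in> J k" by blast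
      have "(\<Sum>k<N. ennreal (c k / t) * indicator (J k) t) = (\<Sum>k\<in>{k}. ennreal (c k / t) * indicator (J k) t)"
      proof -
        have "t \<notin> J i" if "i \<noteq> k" for i using Jdisj[OF k(2)] that by blast
        then show ?thesis using k(1) by (intro sum.mono_neutral_right) auto
      qed
      also have "\<dots> = ennreal (c k / t)" using k(2) by simp
      also have "\<dots> \<le> ennreal (\<phi>.Ai t * A ((ln (exp 1 + t))\<^sup>2) / (t\<^sup>2 * (ln (exp 1 + t)) ^ 3))"
        by (intro ennreal_leI pt k(2))
      finally show ?thesis using J1[OF k(2)] by simp
    next
      case False
      then have "(\<Sum>k<N. ennreal (c k / t) * indicator (J k) t) = 0" by (intro sum.neutral) auto
      then show ?thesis by simp
    qed
  qed
  also have "\<dots> = kappa A \<phi>" unfolding kappa_def by (rule nn_integral_completion[symmetric])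
  finally show ?thesis by (simp add: mult_left_mono)
qed

section \<open>Weighted bounds for finite sparse families\<close>

context hoermander begin

text \<open>The overlap from which the heavy part of a triple has mass at most half the volume of
  its cell: packing in quintuples contributes \<open>2 * 5 ^ CARD('n)\<close>, raising the level by
  one contributes \<open>A 2\<close>, and the half another 2.\<close>

definition NN :: nat where "NN = nat \<lceil>4 * 5 ^ CARD('n) * A 2\<rceil>"

lemma NN: "4 * 5 ^ CARD('n) * A 2 \<le> NN" "0 < NN"
proof -
  have "1 \<le> A 2" using A1 A_mono[of 1 2] by simp
  then have "0 < 4 * 5 ^ CARD('n) * A 2" by simp
  then show "4 * 5 ^ CARD('n) * A 2 \<le> NN" "0 < NN" unfolding NN_def by linarith+
qed

text \<open>The part of a cube that is covered by many smaller cubes of the same level carries at most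
  half of its mass, and the remaining parts have bounded overlap.\<close>

lemma mass_bound:
  fixes a :: "'n cell \<Rightarrow> ennreal" and MW :: "real ^ 'n \<Rightarrow> ennreal"
  assumes L: "0 < L" and f: "f \<in> borel_measurable lebesgue" and F: "finite F"
    and good: "\<And>Q. Q \<in> F \<Longrightarrow> good L f k Q"
    and car: "\<And>Q. Q \<in> F \<Longrightarrow> (\<Sum>P\<in>{P \<in> F. dy L P \<subseteq> nb L 2 Q}. vol L P) \<le> 2 * 5 ^ CARD('n) * vol L Q"
    and a: "\<And>Q y. Q \<in> F \<Longrightarrow> y \<in> nb L 1 Q \<Longrightarrow> a Q \<le> MW y"
  shows "(\<Sum>Q\<in>F. ennreal (vol L Q) * a Q) \<le> ennreal (2 * (NN + 3 ^ CARD('n)) * A (2 ^ Suc k)) * (\<integral>\<^sup>+x. ennreal (A \<bar>f x\<bar>) * MW x \<partial>lebesgue)"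
proof -
  note f [measurable]
  have nm [measurable]: "nb L r P \<in> sets lebesgue" for r and P :: "'n cell" by (rule nb_lebesgue)
  have vp: "0 < vol L R" for R :: "'n cell" by (rule vol_pos[OF L])
  define s :: real where "s = 2 ^ Suc k"
  define \<Phi> where "\<Phi> y = ennreal (A \<bar>s * f y\<bar>)" for y
  have \<Phi>m [measurable]: "\<Phi> \<in> borel_measurable lebesgue" unfolding \<Phi>_def by measurable
  have cm [measurable]: "(\<lambda>y. real (cnt L 1 F Q y)) \<in> borel_measurable lebesgue" for Q by (rule cnt_measurable[OF F])
  define Lo where "Lo Q = {y \<in> nb L 1 Q. cnt L 1 F Q y < NN}" for Q
  define Hi where "Hi Q = {y \<in> nb L 1 Q. NN \<le> cnt L 1 F Q y}" for Q
  have Lom [measurable]: "Lo Q \<in> sets lebesgue" for Q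
  proof -
    have "Lo Q = nb L 1 Q \<inter> {y \<in> space lebesgue. real (cnt L 1 F Q y) < real NN}" by (auto simp: Lo_def)
    then show ?thesis using borel_measurable_less[OF cm[of Q] borel_measurable_const[of "real NN"]] nm[of 1 Q] by (simp only: sets.Int)
  qed
  have Him [measurable]: "Hi Q \<in> sets lebesgue" for Q
  proof -
    have "Hi Q = nb L 1 Q - Lo Q" by (auto simp: Hi_def Lo_def)
    then show ?thesis using nm[of 1 Q] Lom[of Q] by (simp only: sets.Diff)
  qed
  \<comment> \<open>Submultiplicativity carries the upper level inequality from scale
    \<open>2 ^ k\<close> to \<open>2 ^ Suc k\<close>, where the lower one lives, at the price of
    \<open>A 2\<close>.\<close>
  have dbl: "mA f s E \<le> ennreal (A 2) * mA f (2 ^ k) E" if "E \<in> sets lebesgue" for E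
  proof -
    have [measurable]: "E \<in> sets lebesgue" by fact
    have "mA f s E \<le> (\<integral>\<^sup>+x. ennreal (A 2) * (ennreal (A \<bar>2 ^ k * f x\<bar>) * indicator E x) \<partial>lebesgue)"
      unfolding mA_def
    proof (rule nn_integral_mono)
      fix x
      have "A \<bar>s * f x\<bar> \<le> A 2 * A \<bar>2 ^ k * f x\<bar>"
        using submult[of 2 "\<bar>2 ^ k * f x\<bar>"] by (simp add: s_def abs_mult mult.assoc)
      then have "ennreal (A \<bar>s * f x\<bar>) \<le> ennreal (A 2) * ennreal (A \<bar>2 ^ k * f x\<bar>)"
        using A_nonneg[of 2] by (simp add: ennreal_mult'[symmetric] ennreal_leI)
      then show "ennreal (A \<bar>s * f x\<bar>) * indicator E x \<le> ennreal (A 2) * (ennreal (A \<bar>2 ^ k * f x\<bar>) * indicator E x)"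
        by (auto split: split_indicator)
    qed
    also have "\<dots> = ennreal (A 2) * mA f (2 ^ k) E" unfolding mA_def by (rule nn_integral_cmult) measurable
    finally show ?thesis .
  qed
  have Hi: "(\<integral>\<^sup>+y\<in>Hi Q. \<Phi> y \<partial>lebesgue) \<le> ennreal (vol L Q / 2)" if Q: "Q \<in> F" for Q
  proof -
    define D where "D = {P \<in> F. fst Q < fst P}"
    have fD: "finite D" using F by (simp add: D_def)
    have "ennreal (real NN) * (\<integral>\<^sup>+y\<in>Hi Q. \<Phi> y \<partial>lebesgue) = (\<integral>\<^sup>+y. ennreal (real NN) * (\<Phi> y * indicator (Hi Q) y) \<partial>lebesgue)"
      by (rule nn_integral_cmult[symmetric]) measurable
    also have "\<dots> \<le> (\<integral>\<^sup>+y. (\<Sum>P\<in>D. \<Phi> y * indicator (nb L 1 Q \<inter> nb L 1 P) y) \<partial>lebesgue)"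
    proof (rule nn_integral_mono)
      fix y
      show "ennreal (real NN) * (\<Phi> y * indicator (Hi Q) y) \<le> (\<Sum>P\<in>D. \<Phi> y * indicator (nb L 1 Q \<inter> nb L 1 P) y)"
      proof (cases "y \<in> Hi Q")
        case True
        then have y: "y \<in> nb L 1 Q" "NN \<le> cnt L 1 F Q y" by (auto simp: Hi_def)
        have "ennreal (real NN) * \<Phi> y \<le> ennreal (real (cnt L 1 F Q y)) * \<Phi> y"
          using y(2) by (intro mult_right_mono ennreal_leI) auto
        also have "\<dots> = (\<Sum>P\<in>D. \<Phi> y * indicator (nb L 1 Q \<inter> nb L 1 P) y)"
          unfolding cnt_eq_sum[OF F] D_def[symmetric] sum_distrib_right using y(1)
          by (intro sum.cong) (auto simp: indicator_def)
        finally show ?thesis using True by simp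
      qed simp
    qed
    also have "\<dots> = (\<Sum>P\<in>D. \<integral>\<^sup>+y\<in>nb L 1 Q \<inter> nb L 1 P. \<Phi> y \<partial>lebesgue)"
      by (rule nn_integral_sum) measurable
    also have "\<dots> \<le> (\<Sum>P\<in>{P \<in> F. dy L P \<subseteq> nb L 2 Q}. ennreal (A 2 * vol L P))"
    proof -
      have "(\<Sum>P\<in>D. \<integral>\<^sup>+y\<in>nb L 1 Q \<inter> nb L 1 P. \<Phi> y \<partial>lebesgue) = (\<Sum>P\<in>{P \<in> D. nb L 1 Q \<inter> nb L 1 P \<noteq> {}}. \<integral>\<^sup>+y\<in>nb L 1 Q \<inter> nb L 1 P. \<Phi> y \<partial>lebesgue)"
        using fD by (intro sum.mono_neutral_right) auto
      also have "\<dots> \<le> (\<Sum>P\<in>{P \<in> D. nb L 1 Q \<inter> nb L 1 P \<noteq> {}}. ennreal (A 2 * vol L P))"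
      proof (rule sum_mono)
        fix P assume "P \<in> {P \<in> D. nb L 1 Q \<inter> nb L 1 P \<noteq> {}}"
        then have P: "P \<in> F" by (simp add: D_def)
        have "(\<integral>\<^sup>+y\<in>nb L 1 Q \<inter> nb L 1 P. \<Phi> y \<partial>lebesgue) \<le> mA f s (nb L 1 P)"
          unfolding mA_def \<Phi>_def by (intro nn_integral_mono) (auto split: split_indicator)
        also have "\<dots> \<le> ennreal (A 2) * mA f (2 ^ k) (nb L 1 P)" by (rule dbl[OF nm])
        also have "\<dots> \<le> ennreal (A 2) * ennreal (vol L P)" using good[OF P] by (intro mult_left_mono) (auto simp: good_def)
        also have "\<dots> = ennreal (A 2 * vol L P)" using A_nonneg[of 2] by (simp add: ennreal_mult')
        finally show "(\<integral>\<^sup>+y\<in>nb L 1 Q \<inter> nb L 1 P. \<Phi> y \<partial>lebesgue) \<le> ennreal (A 2 * vol L P)" .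
      qed
      also have "\<dots> \<le> (\<Sum>P\<in>{P \<in> F. dy L P \<subseteq> nb L 2 Q}. ennreal (A 2 * vol L P))"
      proof (rule sum_mono2)
        \<comment> \<open>Where triples meet, the finer cell lies in the quintuple of the coarser
          one, and there the packing condition applies.\<close>
        show "{P \<in> D. nb L 1 Q \<inter> nb L 1 P \<noteq> {}} \<subseteq> {P \<in> F. dy L P \<subseteq> nb L 2 Q}"
        proof
          fix P assume P: "P \<in> {P \<in> D. nb L 1 Q \<inter> nb L 1 P \<noteq> {}}"
          then obtain y where y: "y \<in> nb L 1 Q" "y \<in> nb L 1 P" by blast
          have "fst Q \<le> fst P" "P \<in> F" using P by (auto simp: D_def)
          then show "P \<in> {P \<in> F. dy L P \<subseteq> nb L 2 Q}" using meet_nb_subset[OF y] by blast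
        qed
      qed (use F in auto)
      finally show ?thesis .
    qed
    also have "\<dots> = ennreal (A 2 * (\<Sum>P\<in>{P \<in> F. dy L P \<subseteq> nb L 2 Q}. vol L P))"
      unfolding sum_distrib_left using vp A_nonneg[of 2] by (intro sum_ennreal) (simp add: less_imp_le)
    also have "\<dots> \<le> ennreal (A 2 * (2 * 5 ^ CARD('n) * vol L Q))"
      using A_nonneg[of 2] by (intro ennreal_leI mult_left_mono car Q) auto
    also have "\<dots> \<le> ennreal (real NN * (vol L Q / 2))"
    proof (rule ennreal_leI)
      have "4 * 5 ^ CARD('n) * A 2 * (vol L Q / 2) \<le> real NN * (vol L Q / 2)"
        using NN(1) vp[of Q] by (intro mult_right_mono) auto
      then show "A 2 * (2 * 5 ^ CARD('n) * vol L Q) \<le> real NN * (vol L Q / 2)" by (simp add: mult_ac)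
    qed
    also have "\<dots> = ennreal (real NN) * ennreal (vol L Q / 2)" by (rule ennreal_mult') simp
    finally have NX: "ennreal (real NN) * (\<integral>\<^sup>+y\<in>Hi Q. \<Phi> y \<partial>lebesgue) \<le> ennreal (real NN) * ennreal (vol L Q / 2)" .
    have "ennreal (1 / real NN) * (ennreal (real NN) * (\<integral>\<^sup>+y\<in>Hi Q. \<Phi> y \<partial>lebesgue)) \<le> ennreal (1 / real NN) * (ennreal (real NN) * ennreal (vol L Q / 2))"
      by (rule mult_left_mono[OF NX]) simp
    moreover have "ennreal (1 / real NN) * (ennreal (real NN) * z) = z" for z
      unfolding mult.assoc[symmetric] using NN(2) by (subst ennreal_mult'[symmetric]) simp_all
    ultimately show ?thesis by (simp only:)
  qed
  have Lo: "ennreal (vol L Q) \<le> 2 * (\<integral>\<^sup>+y\<in>Lo Q. \<Phi> y \<partial>lebesgue)" if Q: "Q \<in> F" for Q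
  proof -
    have "ennreal (vol L Q) \<le> mA f s (nb L 1 Q)" using good[OF Q] by (simp add: good_def s_def less_imp_le)
    also have "\<dots> = (\<integral>\<^sup>+y. \<Phi> y * indicator (Lo Q) y + \<Phi> y * indicator (Hi Q) y \<partial>lebesgue)"
      unfolding mA_def \<Phi>_def[symmetric]
      by (intro nn_integral_cong) (auto simp: Lo_def Hi_def split: split_indicator)
    also have "\<dots> = (\<integral>\<^sup>+y\<in>Lo Q. \<Phi> y \<partial>lebesgue) + (\<integral>\<^sup>+y\<in>Hi Q. \<Phi> y \<partial>lebesgue)"
      by (rule nn_integral_add) measurable
    also have "\<dots> \<le> (\<integral>\<^sup>+y\<in>Lo Q. \<Phi> y \<partial>lebesgue) + ennreal (vol L Q / 2)"
      by (intro add_left_mono Hi Q)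
    finally have *: "ennreal (vol L Q) \<le> (\<integral>\<^sup>+y\<in>Lo Q. \<Phi> y \<partial>lebesgue) + ennreal (vol L Q / 2)" .
    show ?thesis
    proof (cases "\<integral>\<^sup>+y\<in>Lo Q. \<Phi> y \<partial>lebesgue")
      case (real e)
      then have "vol L Q \<le> e + vol L Q / 2"
        using * vp[of Q] by (simp add: ennreal_plus[symmetric] del: ennreal_plus)
      then have "ennreal (vol L Q) \<le> ennreal (2 * e)" by (intro ennreal_leI) simp
      then show ?thesis using real by (simp add: ennreal_mult')
    next
      case top
      then show ?thesis by (simp add: ennreal_mult_top)
    qed
  qed
  have "(\<Sum>Q\<in>F. ennreal (vol L Q) * a Q) \<le> (\<Sum>Q\<in>F. \<integral>\<^sup>+y. (2 * (\<Phi> y * indicator (Lo Q) y)) * a Q \<partial>lebesgue)"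
  proof (rule sum_mono)
    fix Q assume Q: "Q \<in> F"
    have "ennreal (vol L Q) * a Q \<le> (2 * (\<integral>\<^sup>+y\<in>Lo Q. \<Phi> y \<partial>lebesgue)) * a Q"
      by (intro mult_right_mono Lo Q) simp
    also have "2 * (\<integral>\<^sup>+y\<in>Lo Q. \<Phi> y \<partial>lebesgue) = (\<integral>\<^sup>+y. 2 * (\<Phi> y * indicator (Lo Q) y) \<partial>lebesgue)"
      by (rule nn_integral_cmult[symmetric]) measurable
    also have "\<dots> * a Q = (\<integral>\<^sup>+y. (2 * (\<Phi> y * indicator (Lo Q) y)) * a Q \<partial>lebesgue)"
      by (rule nn_integral_multc[symmetric]) measurable
    finally show "ennreal (vol L Q) * a Q \<le> (\<integral>\<^sup>+y. (2 * (\<Phi> y * indicator (Lo Q) y)) * a Q \<partial>lebesgue)" .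
  qed
  also have "\<dots> = (\<integral>\<^sup>+y. (\<Sum>Q\<in>F. (2 * (\<Phi> y * indicator (Lo Q) y)) * a Q) \<partial>lebesgue)"
    by (rule nn_integral_sum[symmetric]) measurable
  also have "\<dots> \<le> (\<integral>\<^sup>+y. ennreal (2 * (NN + 3 ^ CARD('n)) * A s) * (ennreal (A \<bar>f y\<bar>) * MW y) \<partial>lebesgue)"
  proof (rule nn_integral_mono)
    fix y
    define D where "D = {Q \<in> F. y \<in> nb L 1 Q \<and> cnt L 1 F Q y < NN}"
    have cD: "card D \<le> NN + 3 ^ CARD('n)" unfolding D_def using card_low_count[OF F, of 1 y L NN] by simp
    have As: "0 \<le> A s" by (rule A_nonneg) (simp add: s_def)
    have "(\<Sum>Q\<in>F. (2 * (\<Phi> y * indicator (Lo Q) y)) * a Q) = (\<Sum>Q\<in>D. (2 * \<Phi> y) * a Q)"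
      using F by (intro sum.mono_neutral_cong_right) (auto simp: D_def Lo_def)
    also have "\<dots> \<le> (\<Sum>Q\<in>D. (2 * \<Phi> y) * MW y)"
      by (intro sum_mono mult_left_mono a) (auto simp: D_def)
    also have "\<dots> = of_nat (card D) * ((2 * \<Phi> y) * MW y)" by simp
    also have "\<dots> \<le> of_nat (NN + 3 ^ CARD('n)) * ((2 * \<Phi> y) * MW y)"
      using cD by (intro mult_right_mono of_nat_mono) auto
    also have "\<dots> \<le> of_nat (NN + 3 ^ CARD('n)) * ((2 * (ennreal (A s) * ennreal (A \<bar>f y\<bar>))) * MW y)"
    proof (intro mult_left_mono mult_right_mono)
      have "A \<bar>s * f y\<bar> \<le> A s * A \<bar>f y\<bar>" using submult[of s "\<bar>f y\<bar>"] by (simp add: s_def abs_mult)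
      then show "\<Phi> y \<le> ennreal (A s) * ennreal (A \<bar>f y\<bar>)"
        unfolding \<Phi>_def using As by (simp add: ennreal_mult'[symmetric] ennreal_leI)
    qed simp_all
    also have "\<dots> = (of_nat (NN + 3 ^ CARD('n)) * 2 * ennreal (A s)) * (ennreal (A \<bar>f y\<bar>) * MW y)" by (simp only: mult_ac)
    also have "of_nat (NN + 3 ^ CARD('n)) * 2 * ennreal (A s) = ennreal (2 * (NN + 3 ^ CARD('n)) * A s)"
    proof -
      have "2 * (NN + 3 ^ CARD('n)) * A s = real (NN + 3 ^ CARD('n)) * 2 * A s" by simp
      also have "ennreal \<dots> = ennreal (real (NN + 3 ^ CARD('n)) * 2) * ennreal (A s)" by (rule ennreal_mult''[OF As])
      also have "ennreal (real (NN + 3 ^ CARD('n)) * 2) = ennreal (real (NN + 3 ^ CARD('n))) * ennreal 2"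
        by (rule ennreal_mult'') simp
      finally show ?thesis by (simp only: ennreal_of_nat_eq_real_of_nat ennreal_numeral)
    qed
    finally show "(\<Sum>Q\<in>F. (2 * (\<Phi> y * indicator (Lo Q) y)) * a Q) \<le> ennreal (2 * (NN + 3 ^ CARD('n)) * A s) * (ennreal (A \<bar>f y\<bar>) * MW y)" .
  qed
  also have "\<dots> \<le> ennreal (2 * (NN + 3 ^ CARD('n)) * A s) * (\<integral>\<^sup>+x. ennreal (A \<bar>f x\<bar>) * MW x \<partial>lebesgue)"
  proof (rule nn_integral_cmult_le)
    have "0 < A s" by (rule A_pos) (simp add: s_def)
    then show "0 < 2 * (NN + 3 ^ CARD('n)) * A s" using NN(2) by (intro mult_pos_pos) (auto intro: add_pos_pos)
  qed
  finally show ?thesis by (simp add: s_def)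
qed

text \<open>Each cell is split at overlap \<open>u\<close>. Below it at most \<open>u + 1\<close>
  cells of the family meet in a point, which costs a multiple of the weight of \<open>G\<close>. The
  rest has relative measure at most \<open>1 / \<tau>\<close> by \<open>overlap_tail\<close>, and
  \<open>weight_small_set\<close> applies to it. The norm of \<open>w\<close> is taken over the
  triple cube because it has to be dominated by \<open>maximal\<close> at all points of the triple,
  where the mass of \<open>f\<close> sits.\<close>

lemma level_bound:
  fixes F :: "'n cell set" and w :: "real ^ 'n \<Rightarrow> real"
  assumes L: "0 < L" and w: "w \<in> borel_measurable lebesgue" "\<And>x. 0 \<le> w x" and \<phi>: "young \<phi>" and F: "finite F"
    and car: "\<And>Q. Q \<in> F \<Longrightarrow> (\<Sum>P\<in>{P \<in> F. anc Q P}. vol L P) \<le> 2 * vol L Q"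
    and G: "G \<in> sets lebesgue" and t: "0 < \<tau>" "2 * \<tau> \<le> (5 / 4) ^ u"
  shows "(\<Sum>Q\<in>F. \<integral>\<^sup>+x\<in>dy L Q \<inter> G. w x \<partial>lebesgue) \<le> ennreal (u + 1) * (\<integral>\<^sup>+x\<in>G. w x \<partial>lebesgue)
    + ennreal (2 * 3 ^ CARD('n) * (the_inv_into {0..} \<phi> \<tau> / \<tau>)) *
      (\<Sum>Q\<in>F. ennreal (vol L Q) * luxemburg (\<lambda>t. ennreal (\<phi> t)) (cube (ctr L Q) (3 * edge L Q)) w)"
proof -
  interpret \<phi>: young \<phi> by fact
  have [measurable]: "G \<in> sets lebesgue" "w \<in> borel_measurable lebesgue" by fact+
  have nm [measurable]: "nb L r P \<in> sets lebesgue" for r and P :: "'n cell" by (rule nb_lebesgue)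
  have vp: "0 < vol L R" for R :: "'n cell" by (rule vol_pos[OF L])
  define a where "a Q = luxemburg (\<lambda>t. ennreal (\<phi> t)) (cube (ctr L Q) (3 * edge L Q)) w" for Q :: "'n cell"
  define Hi where "Hi Q = {y \<in> dy L Q. u \<le> cnt L 0 F Q y}" for Q
  have Him [measurable]: "Hi Q \<in> sets lebesgue" if "Q \<in> F" for Q
    unfolding Hi_def by (rule overlap_tail(1)[OF L F car that])
  define Lo where "Lo Q = dy L Q \<inter> G - Hi Q" for Q
  have Lom: "Lo Q \<in> sets lebesgue" if "Q \<in> F" for Q
    unfolding Lo_def by (intro sets.Diff sets.Int nm G Him that)
  have pos: "0 \<le> \<phi>.Ai \<tau> / \<tau>" using t \<phi>.Ai(1)[of \<tau>] by simp
  have one: "(\<integral>\<^sup>+x\<in>dy L Q \<inter> G. w x \<partial>lebesgue) \<le> (\<integral>\<^sup>+x\<in>Lo Q. w x \<partial>lebesgue) + ennreal (2 * 3 ^ CARD('n) * (\<phi>.Ai \<tau> / \<tau>)) * (ennreal (vol L Q) * a Q)"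
    if Q: "Q \<in> F" for Q
  proof -
    have [measurable]: "Lo Q \<in> sets lebesgue" "Hi Q \<in> sets lebesgue" using Lom[OF Q] Him[OF Q] .
    have "(\<integral>\<^sup>+x\<in>dy L Q \<inter> G. w x \<partial>lebesgue) \<le> (\<integral>\<^sup>+x. w x * indicator (Lo Q) x + w x * indicator (Hi Q) x \<partial>lebesgue)"
      using w(2) by (intro nn_integral_mono) (auto simp: Lo_def split: split_indicator)
    also have "\<dots> = (\<integral>\<^sup>+x. ennreal (w x) * indicator (Lo Q) x + ennreal (w x) * indicator (Hi Q) x \<partial>lebesgue)"
      using w(2) by (intro nn_integral_cong) (auto split: split_indicator)
    also have "\<dots> = (\<integral>\<^sup>+x\<in>Lo Q. w x \<partial>lebesgue) + (\<integral>\<^sup>+x\<in>Hi Q. w x \<partial>lebesgue)"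
      by (rule nn_integral_add) measurable
    also have "(\<integral>\<^sup>+x\<in>Hi Q. w x \<partial>lebesgue) \<le> ennreal (2 * (3 * edge L Q) ^ CARD('n) * (\<phi>.Ai \<tau> / \<tau>)) * a Q"
      unfolding a_def
    proof (rule \<phi>.weight_small_set[OF _ w Him[OF Q] _ t(1)])
      show "0 < 3 * edge L Q" using edge_pos[OF L, of Q] by simp
      show "Hi Q \<subseteq> cube (ctr L Q) (3 * edge L Q)"
        using nb_subset_cube[OF L, of 0 Q] cube_mono[of "edge L Q" "3 * edge L Q" "ctr L Q"] edge_pos[OF L, of Q]
        by (auto simp: Hi_def)
      have "emeasure lebesgue (Hi Q) \<le> ennreal (2 * vol L Q / (5 / 4) ^ u)"
        unfolding Hi_def by (rule overlap_tail(2)[OF L F car Q])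
      also have "\<dots> \<le> ennreal ((3 * edge L Q) ^ CARD('n) / \<tau>)"
      proof (rule ennreal_leI)
        have "2 * vol L Q / (5 / 4) ^ u \<le> 2 * vol L Q / (2 * \<tau>)"
          using t vp[of Q] by (intro divide_left_mono) auto
        also have "\<dots> = 1 * vol L Q / \<tau>" using t by simp
        also have "\<dots> \<le> 3 ^ CARD('n) * vol L Q / \<tau>"
          using t vp[of Q] by (intro divide_right_mono mult_right_mono) auto
        finally show "2 * vol L Q / (5 / 4) ^ u \<le> (3 * edge L Q) ^ CARD('n) / \<tau>"
          by (simp add: vol_def power_mult_distrib)
      qed
      finally show "emeasure lebesgue (Hi Q) \<le> ennreal ((3 * edge L Q) ^ CARD('n) / \<tau>)" .
    qed
    also have "2 * (3 * edge L Q) ^ CARD('n) * (\<phi>.Ai \<tau> / \<tau>) = 2 * 3 ^ CARD('n) * (\<phi>.Ai \<tau> / \<tau>) * vol L Q"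
      by (simp add: vol_def power_mult_distrib)
    also have "ennreal \<dots> * a Q = ennreal (2 * 3 ^ CARD('n) * (\<phi>.Ai \<tau> / \<tau>)) * (ennreal (vol L Q) * a Q)"
    proof -
      have "0 \<le> 2 * 3 ^ CARD('n) * (\<phi>.Ai \<tau> / \<tau>)" by (intro mult_nonneg_nonneg pos) simp_all
      from ennreal_mult'[OF this] show ?thesis by (simp only: mult.assoc[of "ennreal _"])
    qed
    finally show ?thesis by simp
  qed
  have "(\<Sum>Q\<in>F. \<integral>\<^sup>+x\<in>Lo Q. w x \<partial>lebesgue) = (\<integral>\<^sup>+x. (\<Sum>Q\<in>F. w x * indicator (Lo Q) x) \<partial>lebesgue)"
  proof -
    have "(\<Sum>Q\<in>F. \<integral>\<^sup>+x\<in>Lo Q. w x \<partial>lebesgue) = (\<integral>\<^sup>+x. (\<Sum>Q\<in>F. ennreal (w x) * indicator (Lo Q) x) \<partial>lebesgue)"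
      using Lom by (intro nn_integral_sum[symmetric]) auto
    also have "\<dots> = (\<integral>\<^sup>+x. ennreal (\<Sum>Q\<in>F. w x * indicator (Lo Q) x) \<partial>lebesgue)"
      using w(2) by (intro nn_integral_cong) (subst sum_ennreal[symmetric], auto simp: ennreal_mult' ennreal_indicator intro!: sum.cong)
    finally show ?thesis .
  qed
  also have "\<dots> \<le> (\<integral>\<^sup>+x. ennreal (u + 1) * (ennreal (w x) * indicator G x) \<partial>lebesgue)"
  proof (rule nn_integral_mono)
    fix y
    define D where "D = {Q \<in> F. y \<in> dy L Q \<and> cnt L 0 F Q y < u}"
    have cD: "card D \<le> u + 1" unfolding D_def using card_low_count[OF F, of 0 y L u] by simp
    show "ennreal (\<Sum>Q\<in>F. w y * indicator (Lo Q) y) \<le> ennreal (u + 1) * (ennreal (w y) * indicator G y)"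
    proof (cases "y \<in> G")
      case True
      have "(\<Sum>Q\<in>F. w y * indicator (Lo Q) y) = (\<Sum>Q\<in>D. w y)"
        using F True by (intro sum.mono_neutral_cong_right) (auto simp: D_def Lo_def Hi_def indicator_def split: if_splits)
      also have "\<dots> = real (card D) * w y" by simp
      also have "\<dots> \<le> real (u + 1) * w y" using cD w(2)[of y] by (intro mult_right_mono) linarith+
      finally have "ennreal (\<Sum>Q\<in>F. w y * indicator (Lo Q) y) \<le> ennreal (real (u + 1) * w y)" by (rule ennreal_leI)
      also have "\<dots> = ennreal (u + 1) * ennreal (w y)" by (rule ennreal_mult') simp
      finally show ?thesis using True by simp
    next
      case False
      then have "(\<Sum>Q\<in>F. w y * indicator (Lo Q) y) = 0" by (intro sum.neutral) (auto simp: Lo_def)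
      then show ?thesis by simp
    qed
  qed
  also have "\<dots> = ennreal (u + 1) * (\<integral>\<^sup>+x\<in>G. w x \<partial>lebesgue)"
    by (rule nn_integral_cmult) measurable
  finally have lo: "(\<Sum>Q\<in>F. \<integral>\<^sup>+x\<in>Lo Q. w x \<partial>lebesgue) \<le> ennreal (u + 1) * (\<integral>\<^sup>+x\<in>G. w x \<partial>lebesgue)" .
  have "(\<Sum>Q\<in>F. \<integral>\<^sup>+x\<in>dy L Q \<inter> G. w x \<partial>lebesgue) \<le> (\<Sum>Q\<in>F. (\<integral>\<^sup>+x\<in>Lo Q. w x \<partial>lebesgue) + ennreal (2 * 3 ^ CARD('n) * (\<phi>.Ai \<tau> / \<tau>)) * (ennreal (vol L Q) * a Q))"
    by (intro sum_mono one)
  also have "\<dots> = (\<Sum>Q\<in>F. \<integral>\<^sup>+x\<in>Lo Q. w x \<partial>lebesgue) + ennreal (2 * 3 ^ CARD('n) * (\<phi>.Ai \<tau> / \<tau>)) * (\<Sum>Q\<in>F. ennreal (vol L Q) * a Q)"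
    by (simp only: sum.distrib sum_distrib_left)
  also have "\<dots> \<le> ennreal (u + 1) * (\<integral>\<^sup>+x\<in>G. w x \<partial>lebesgue) + ennreal (2 * 3 ^ CARD('n) * (\<phi>.Ai \<tau> / \<tau>)) * (\<Sum>Q\<in>F. ennreal (vol L Q) * a Q)"
    by (intro add_right_mono lo)
  finally show ?thesis by (simp only: a_def)
qed

end

section \<open>From finite sparse families to the operator\<close>

lemma density_subset:
  assumes w: "w \<in> borel_measurable lebesgue" and S: "S \<in> sets lebesgue"
  shows "emeasure (density lebesgue (\<lambda>x. ennreal (w x))) S = (\<integral>\<^sup>+x\<in>S. ennreal (w x) \<partial>lebesgue)"
  using assms by (intro emeasure_density) auto

lemma luxemburg_le_maximal:
  assumes L: "0 < L" and y: "y \<in> nb L 1 Q"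
  shows "luxemburg (\<lambda>t. ennreal (\<phi> t)) (cube (ctr L Q) (3 * edge L Q)) w \<le> maximal \<phi> w y"
proof -
  have "y \<in> cube (ctr L Q) (3 * edge L Q)" using nb_subset_cube[OF L, of 1 Q] y by auto
  then show ?thesis
    unfolding maximal_def using edge_pos[OF L, of Q]
    by (intro SUP_upper2[of "(ctr L Q, 3 * edge L Q)"]) auto
qed

context hoermander begin

text \<open>At level \<open>k\<close> the overlap is cut at height \<open>uk k\<close>, which is proportional to \<open>2\<^sup>k\<^sup>/\<^sup>2\<close>: then
  \<open>uk k / 2\<^sup>k\<close> is summable, while the remaining set has relative measure at most
  \<open>exp (- 2 * 2\<^sup>k\<^sup>/\<^sup>2)\<close>, which is what the logarithms in \<open>kappa\<close> detect.\<close>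

definition UU :: real where "UU = ln (2 * exp 2) / ln (5 / 4)"
definition uk :: "nat \<Rightarrow> nat" where "uk k = nat \<lceil>UU * sqrt 2 ^ k\<rceil>"
text \<open>\<open>sig0\<close> bounds the sum of \<open>(uk k + 1) / 2 ^ k\<close>: the terms are
  at most \<open>(UU + 2) * (3 / 4) ^ k\<close>, as \<open>sqrt 2 / 2 \<le> 3 / 4\<close>.
  \<open>CB\<close> is 128 from \<open>kappa_sum\<close> times the constants of
  \<open>level_bound\<close> and \<open>mass_bound\<close>.\<close>

definition sig0 :: real where "sig0 = 4 * (UU + 2)"
definition CB :: real where "CB = 128 * (4 * 3 ^ CARD('n) * (NN + 3 ^ CARD('n)))"

lemma UU_pos: "0 < UU"
proof -
  have "(1::real) < exp 2" by simp
  then have "0 < ln (2 * exp (2::real))" by (intro ln_gt_zero) linarith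
  then show ?thesis by (simp add: UU_def)
qed

lemma sqrt2_pow_ge_1: "1 \<le> sqrt 2 ^ k"
  by (rule one_le_power) simp

text \<open>\<open>UU\<close> is the exponent for which the power of \<open>5 / 4\<close> equals
  \<open>2 * exp 2\<close>, and \<open>sqrt 2 ^ (k + 2)\<close> is twice \<open>sqrt 2 ^ k\<close>.
  As \<open>sqrt 2 ^ k\<close> is at least 1, raising the factor 2 to this power only enlarges
  it.\<close>

lemma uk_large: "2 * exp (sqrt 2 ^ (k + 2)) \<le> (5 / 4) ^ uk k"
proof -
  define r where "r = sqrt 2 ^ k"
  have r: "1 \<le> r" unfolding r_def by (rule sqrt2_pow_ge_1)
  have "UU * r \<le> uk k" unfolding uk_def r_def by linarith
  then have "UU * r * ln (5 / 4) \<le> uk k * ln (5 / 4)" by (intro mult_right_mono) auto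
  moreover have "UU * r * ln (5 / 4) = r * ln (2 * exp 2)" by (simp add: UU_def)
  moreover have "ln (2 * exp 2) = ln 2 + (2::real)" by (simp add: ln_mult)
  moreover have "ln 2 + 2 * r \<le> r * (ln 2 + 2)"
    using mult_right_mono[OF r, of "ln 2"] by (simp add: algebra_simps)
  ultimately have "ln 2 + 2 * r \<le> uk k * ln (5 / 4)" by simp
  then have "exp (ln 2 + 2 * r) \<le> exp (uk k * ln (5 / 4 :: real))" by simp
  also have "exp (uk k * ln (5 / 4 :: real)) = (5 / 4) ^ uk k" by (simp add: exp_of_nat_mult)
  finally have "2 * exp (2 * r) \<le> (5 / 4) ^ uk k" by (simp add: exp_add)
  moreover have "sqrt 2 ^ (k + 2) = 2 * r" by (simp add: power_add r_def)
  ultimately show ?thesis by (simp only:)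
qed

lemma uk_sum: "(\<Sum>k<N. (uk k + 1) / 2 ^ k) \<le> sig0"
proof -
  have s: "sqrt 2 \<le> 3 / 2" by (rule real_le_lsqrt) (simp_all add: power2_eq_square)
  have "(\<Sum>k<N. (uk k + 1) / 2 ^ k) \<le> (\<Sum>k<N. (UU + 2) * (3 / 4) ^ k)"
  proof (rule sum_mono)
    fix k
    have r: "1 \<le> sqrt 2 ^ k" by (rule sqrt2_pow_ge_1)
    have "0 \<le> UU * sqrt 2 ^ k" using UU_pos by simp
    then have "real (uk k) \<le> UU * sqrt 2 ^ k + 1" unfolding uk_def by linarith
    then have "real (uk k + 1) \<le> UU * sqrt 2 ^ k + 2 * sqrt 2 ^ k" using r unfolding of_nat_add of_nat_1 by linarith
    then have "real (uk k + 1) \<le> (UU + 2) * sqrt 2 ^ k" by (simp only: distrib_right)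
    then have "(uk k + 1) / 2 ^ k \<le> (UU + 2) * sqrt 2 ^ k / 2 ^ k" by (intro divide_right_mono) auto
    also have "\<dots> = (UU + 2) * (sqrt 2 / 2) ^ k" by (simp add: power_divide)
    also have "\<dots> \<le> (UU + 2) * (3 / 4) ^ k" using UU_pos s by (intro mult_left_mono power_mono) auto
    finally show "(uk k + 1) / 2 ^ k \<le> (UU + 2) * (3 / 4) ^ k" .
  qed
  also have "\<dots> = (UU + 2) * (\<Sum>k<N. (3 / 4) ^ k)" by (simp add: sum_distrib_left)
  also have "(\<Sum>k<N. (3 / 4 :: real) ^ k) \<le> 4" by (simp add: geometric_sum)
  finally show ?thesis using UU_pos by (simp add: sig0_def mult_left_mono)
qed

text \<open>The family is sorted by level. Within a level \<open>level_bound\<close> separates the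
  weight of \<open>G\<close> from Luxemburg means of \<open>w\<close>, and \<open>mass_bound\<close>
  turns the latter into the integral on the right. The packing hypothesis is used with
  \<open>V\<close> a cell and with \<open>V\<close> a quintuple. Over the levels, the coefficients
  of the weight of \<open>G\<close> sum to at most \<open>sig0\<close> and the others to a multiple
  of \<open>kappa A \<phi>\<close>.\<close>

lemma finite_sparse_bound:
  fixes w :: "real ^ 'n \<Rightarrow> real"
  assumes L: "0 < L" and w: "w \<in> borel_measurable lebesgue" "\<And>x. 0 \<le> w x" and \<phi>: "young \<phi>"
    and f: "f \<in> borel_measurable lebesgue" and F: "finite F"
    and good: "\<And>Q. Q \<in> F \<Longrightarrow> good L f (lev Q) Q"
    and car: "\<And>F' V. F' \<subseteq> F \<Longrightarrow> V \<in> sets lebesgue \<Longrightarrow> (\<And>Q. Q \<in> F' \<Longrightarrow> dy L Q \<subseteq> V) \<Longrightarrow>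
        ennreal (\<Sum>Q\<in>F'. vol L Q) \<le> 2 * emeasure lebesgue V"
    and G: "G \<in> sets lebesgue"
  shows "(\<Sum>Q\<in>F. ennreal (1 / 2 ^ lev Q) * (\<integral>\<^sup>+x\<in>dy L Q \<inter> G. w x \<partial>lebesgue))
    \<le> ennreal sig0 * (\<integral>\<^sup>+x\<in>G. w x \<partial>lebesgue)
      + ennreal CB * (kappa A \<phi> * (\<integral>\<^sup>+x. ennreal (A \<bar>f x\<bar>) * maximal \<phi> w x \<partial>lebesgue))"
proof -
  interpret \<phi>: young \<phi> by fact
  define X where "X = (\<integral>\<^sup>+x. ennreal (A \<bar>f x\<bar>) * maximal \<phi> w x \<partial>lebesgue)"
  define wG where "wG = (\<integral>\<^sup>+x\<in>G. w x \<partial>lebesgue)"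
  define m where "m Q = (\<integral>\<^sup>+x\<in>dy L Q \<inter> G. w x \<partial>lebesgue)" for Q
  define a where "a Q = luxemburg (\<lambda>t. ennreal (\<phi> t)) (cube (ctr L Q) (3 * edge L Q)) w" for Q :: "'n cell"
  define \<tau> where "\<tau> k = exp (sqrt 2 ^ (k + 2))" for k
  define \<theta> where "\<theta> k = \<phi>.Ai (\<tau> k) / \<tau> k" for k
  have th: "0 \<le> \<theta> k" for k using \<phi>.Ai(1)[of "\<tau> k"] by (simp add: \<theta>_def \<tau>_def)
  have vp: "0 < vol L R" for R :: "'n cell" by (rule vol_pos[OF L])
  define C where "C = 4 * 3 ^ CARD('n) * (real NN + 3 ^ CARD('n))"
  have C: "0 \<le> C" by (simp add: C_def)
  obtain N where N: "\<And>Q. Q \<in> F \<Longrightarrow> lev Q < N"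
  proof (rule that[of "Suc (Max (lev ` F))"])
    fix Q assume "Q \<in> F"
    then show "lev Q < Suc (Max (lev ` F))" using F by (simp add: less_Suc_eq_le)
  qed
  have lvl: "(\<Sum>Q\<in>{Q \<in> F. lev Q = k}. m Q) \<le> ennreal (uk k + 1) * wG + ennreal (C * (A (2 ^ Suc k) * \<theta> k)) * X" for k
  proof -
    define D where "D = {Q \<in> F. lev Q = k}"
    have D: "finite D" "D \<subseteq> F" using F by (auto simp: D_def)
    have gD: "good L f k Q" if "Q \<in> D" for Q using that good[of Q] by (simp add: D_def)
    have car1: "(\<Sum>P\<in>{P \<in> D. anc Q P}. vol L P) \<le> 2 * vol L Q" for Q
    proof -
      have "ennreal (\<Sum>P\<in>{P \<in> D. anc Q P}. vol L P) \<le> 2 * emeasure lebesgue (dy L Q)"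
        using D(2) by (intro car nb_lebesgue anc_nb_subset) auto
      also have "\<dots> = ennreal (2 * vol L Q)"
        unfolding emeasure_dy_lebesgue[OF L] by (simp add: ennreal_mult')
      finally show ?thesis using vp[of Q] by (subst (asm) ennreal_le_iff) auto
    qed
    have car2: "(\<Sum>P\<in>{P \<in> D. dy L P \<subseteq> nb L 2 Q}. vol L P) \<le> 2 * 5 ^ CARD('n) * vol L Q" for Q
    proof -
      have "ennreal (\<Sum>P\<in>{P \<in> D. dy L P \<subseteq> nb L 2 Q}. vol L P) \<le> 2 * emeasure lebesgue (nb L 2 Q)"
        using D(2) by (intro car nb_lebesgue) auto
      also have "emeasure lebesgue (nb L 2 Q) = ennreal (5 ^ CARD('n) * vol L Q)"
        using emeasure_nb_lebesgue[OF L, of 2 Q] by simp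
      also have "2 * \<dots> = ennreal (2 * 5 ^ CARD('n) * vol L Q)" by (simp add: ennreal_mult' mult.assoc)
      finally show ?thesis using vp[of Q] by (subst (asm) ennreal_le_iff) auto
    qed
    have tau: "0 < \<tau> k" "2 * \<tau> k \<le> (5 / 4) ^ uk k" unfolding \<tau>_def by (simp, rule uk_large)
    have "(\<Sum>Q\<in>D. m Q) \<le> ennreal (uk k + 1) * wG + ennreal (2 * 3 ^ CARD('n) * \<theta> k) * (\<Sum>Q\<in>D. ennreal (vol L Q) * a Q)"
      unfolding m_def wG_def \<theta>_def a_def by (rule level_bound[OF L w \<phi> D(1) car1 G tau])
    also have "\<dots> \<le> ennreal (uk k + 1) * wG + ennreal (2 * 3 ^ CARD('n) * \<theta> k) * (ennreal (2 * (NN + 3 ^ CARD('n)) * A (2 ^ Suc k)) * X)"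
      unfolding X_def a_def
      by (intro add_left_mono mult_left_mono mass_bound[OF L f D(1) gD car2] luxemburg_le_maximal L) simp_all
    also have "ennreal (2 * 3 ^ CARD('n) * \<theta> k) * (ennreal (2 * (NN + 3 ^ CARD('n)) * A (2 ^ Suc k)) * X) = ennreal (C * (A (2 ^ Suc k) * \<theta> k)) * X"
    proof -
      have "0 \<le> 2 * 3 ^ CARD('n) * \<theta> k" using th by simp
      from ennreal_mult'[OF this] have "ennreal (2 * 3 ^ CARD('n) * \<theta> k) * ennreal (2 * (NN + 3 ^ CARD('n)) * A (2 ^ Suc k))
        = ennreal (2 * 3 ^ CARD('n) * \<theta> k * (2 * (NN + 3 ^ CARD('n)) * A (2 ^ Suc k)))" by simp
      also have "2 * 3 ^ CARD('n) * \<theta> k * (2 * (NN + 3 ^ CARD('n)) * A (2 ^ Suc k)) = C * (A (2 ^ Suc k) * \<theta> k)"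
        by (simp add: C_def algebra_simps)
      finally show ?thesis by (simp only: mult.assoc[symmetric])
    qed
    finally show ?thesis by (simp only: D_def)
  qed
  have "(\<Sum>Q\<in>F. ennreal (1 / 2 ^ lev Q) * m Q) = (\<Sum>k<N. \<Sum>Q\<in>{Q \<in> F. lev Q = k}. ennreal (1 / 2 ^ lev Q) * m Q)"
    using F N by (intro sum.group[symmetric]) auto
  also have "\<dots> = (\<Sum>k<N. ennreal (1 / 2 ^ k) * (\<Sum>Q\<in>{Q \<in> F. lev Q = k}. m Q))"
    by (simp add: sum_distrib_left)
  also have "\<dots> \<le> (\<Sum>k<N. ennreal (1 / 2 ^ k) * (ennreal (uk k + 1) * wG + ennreal (C * (A (2 ^ Suc k) * \<theta> k)) * X))"
    by (intro sum_mono mult_left_mono lvl) simp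
  also have "\<dots> = (\<Sum>k<N. ennreal ((uk k + 1) / 2 ^ k) * wG + ennreal (C * (A (2 ^ Suc k) * \<theta> k / 2 ^ k)) * X)"
  proof (rule sum.cong[OF refl])
    fix k
    have "ennreal (1 / 2 ^ k) * ennreal (uk k + 1) = ennreal ((uk k + 1) / 2 ^ k)"
      by (subst ennreal_mult'[symmetric]) simp_all
    moreover have "ennreal (1 / 2 ^ k) * ennreal (C * (A (2 ^ Suc k) * \<theta> k)) = ennreal (C * (A (2 ^ Suc k) * \<theta> k / 2 ^ k))"
      by (simp add: ennreal_mult'[symmetric])
    ultimately show "ennreal (1 / 2 ^ k) * (ennreal (uk k + 1) * wG + ennreal (C * (A (2 ^ Suc k) * \<theta> k)) * X)
      = ennreal ((uk k + 1) / 2 ^ k) * wG + ennreal (C * (A (2 ^ Suc k) * \<theta> k / 2 ^ k)) * X"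
      by (simp only: distrib_left mult.assoc[symmetric])
  qed
  also have "\<dots> = ennreal (\<Sum>k<N. (uk k + 1) / 2 ^ k) * wG + ennreal (\<Sum>k<N. C * (A (2 ^ Suc k) * \<theta> k / 2 ^ k)) * X"
  proof -
    have "(\<Sum>k<N. ennreal ((uk k + 1) / 2 ^ k)) = ennreal (\<Sum>k<N. (uk k + 1) / 2 ^ k)" by (intro sum_ennreal) simp
    moreover have "(\<Sum>k<N. ennreal (C * (A (2 ^ Suc k) * \<theta> k / 2 ^ k))) = ennreal (\<Sum>k<N. C * (A (2 ^ Suc k) * \<theta> k / 2 ^ k))"
      using C th A_nonneg by (intro sum_ennreal mult_nonneg_nonneg divide_nonneg_nonneg) auto
    ultimately show ?thesis by (simp only: sum.distrib sum_distrib_right[symmetric])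
  qed
  also have "\<dots> \<le> ennreal sig0 * wG + ennreal CB * (kappa A \<phi> * X)"
  proof (intro add_mono mult_right_mono ennreal_leI uk_sum)
    have "ennreal (\<Sum>k<N. C * (A (2 ^ Suc k) * \<theta> k / 2 ^ k)) = ennreal C * ennreal (\<Sum>k<N. A (2 ^ Suc k) * \<theta> k / 2 ^ k)"
      unfolding sum_distrib_left[symmetric] using C by (rule ennreal_mult')
    also have "\<dots> \<le> ennreal C * (128 * kappa A \<phi>)"
      unfolding \<theta>_def \<tau>_def by (intro mult_left_mono kappa_sum \<phi> young_axioms) simp
    also have "\<dots> = ennreal CB * kappa A \<phi>"
    proof -
      have "CB = C * 128" by (simp add: CB_def C_def)
      then have "ennreal CB = ennreal C * ennreal 128" using C by (simp only: ennreal_mult')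
      then show ?thesis by (simp add: mult.assoc)
    qed
    finally have "ennreal (\<Sum>k<N. C * (A (2 ^ Suc k) * \<theta> k / 2 ^ k)) * X \<le> (ennreal CB * kappa A \<phi>) * X"
      by (rule mult_right_mono) simp
    then show "ennreal (\<Sum>k<N. C * (A (2 ^ Suc k) * \<theta> k / 2 ^ k)) * X \<le> ennreal CB * (kappa A \<phi> * X)"
      by (simp only: mult.assoc)
  qed simp
  finally show ?thesis by (simp only: m_def wG_def X_def)
qed

text \<open>\<open>CB\<close> stems from the sparse part, the second summand from the set where the
  maximal function is large. \<open>LM\<close> is chosen such that \<open>|T f| > LM\<close> outside
  that set forces the sparse sum above \<open>2 * sig0\<close>, twice the coefficient to be
  absorbed.\<close>

definition CF :: real where "CF = CB + 2 * 9 ^ CARD('n) * (128 * exp 2)"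
definition LM :: real where "LM = 2 * CE * (2 * sig0)"

lemma sig0_ge_1: "1 \<le> sig0"
  using UU_pos by (simp add: sig0_def)

text \<open>The term \<open>k = 0\<close> of \<open>kappa_sum\<close>, whose exponent is
  \<open>sqrt 2 ^ 2 = 2\<close>. It bounds \<open>kappa\<close> from below, so that the estimate for
  the excluded set, in which \<open>kappa\<close> does not arise by itself, also fits the
  claim.\<close>

lemma inverse_at_1_le_kappa:
  assumes "young \<phi>"
  shows "ennreal (the_inv_into {0..} \<phi> 1) \<le> ennreal (128 * exp 2) * kappa A \<phi>"
proof -
  interpret \<phi>: young \<phi> by fact
  have e: "(1::real) \<le> exp 2" by simp
  have "\<phi>.Ai 1 \<le> \<phi>.Ai (exp 2)" by (intro \<phi>.Ai_mono) auto
  also have "\<dots> \<le> A 2 * \<phi>.Ai (exp 2)"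
    using A1 A_mono[of 1 2] \<phi>.Ai(1)[of "exp 2"] by (simp add: mult_le_cancel_right1)
  also have "\<dots> = exp 2 * (\<Sum>k<1::nat. A (2 ^ Suc k) * (\<phi>.Ai (exp (sqrt 2 ^ (k + 2))) / exp (sqrt 2 ^ (k + 2))) / 2 ^ k)"
    by simp
  finally have "ennreal (\<phi>.Ai 1) \<le> ennreal (exp 2 * (\<Sum>k<1::nat. A (2 ^ Suc k) * (\<phi>.Ai (exp (sqrt 2 ^ (k + 2))) / exp (sqrt 2 ^ (k + 2))) / 2 ^ k))"
    by (rule ennreal_leI)
  also have "\<dots> = ennreal (exp 2) * ennreal (\<Sum>k<1::nat. A (2 ^ Suc k) * (\<phi>.Ai (exp (sqrt 2 ^ (k + 2))) / exp (sqrt 2 ^ (k + 2))) / 2 ^ k)"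
    by (rule ennreal_mult') simp
  also have "\<dots> \<le> ennreal (exp 2) * (128 * kappa A \<phi>)"
    by (intro mult_left_mono kappa_sum young_axioms assms) simp
  also have "\<dots> = ennreal (128 * exp 2) * kappa A \<phi>"
    by (simp add: ennreal_mult' mult_ac)
  finally show ?thesis .
qed

text \<open>Truncation to generations up to \<open>J\<close> makes the sparse family finite and the
  superlevel sets \<open>G J\<close> increasing. Testing the truncated sum on \<open>G J\<close>
  gives an inequality with the weight of \<open>G J\<close> on both sides, which is solved for this
  weight; then \<open>J\<close> tends to infinity. The excluded set \<open>Om\<close> is treated by
  \<open>maximal_bound\<close> with the weight as \<open>v\<close>.\<close>

lemma local_bound:
  assumes L: "0 < L" and w: "weight w" and \<phi>: "young \<phi>"
    and f: "continuous_on UNIV f" "bounded {x. f x \<noteq> 0}" "{x. f x \<noteq> 0} \<subseteq> nb L 1 Q0"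
    and Q0: "mA f 1 (nb L 1 Q0) \<le> ennreal (vol L Q0)"
  shows "(\<integral>\<^sup>+x\<in>{x \<in> dy L Q0. LM < \<bar>T f x\<bar>}. w x \<partial>lebesgue)
    \<le> ennreal CF * (kappa A \<phi> * (\<integral>\<^sup>+x. ennreal (A \<bar>f x\<bar>) * maximal \<phi> w x \<partial>lebesgue))"
proof -
  interpret \<phi>: young \<phi> by fact
  define X where "X = (\<integral>\<^sup>+x. ennreal (A \<bar>f x\<bar>) * maximal \<phi> w x \<partial>lebesgue)"
  have nf: "nice f" by (rule continuous_cc_nice[OF f(1,2)])
  have fm [measurable]: "f \<in> borel_measurable lebesgue" using nf by (simp add: nice_def)
  have wm [measurable]: "w \<in> borel_measurable lebesgue" by (rule weight_measurable[OF w])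
  have w0: "0 \<le> w x" for x using w unfolding weight_def by blast
  have dm: "dy L R \<in> sets lebesgue" for R :: "'n cell" by (rule nb_lebesgue)
  have vp: "0 < vol L R" for R :: "'n cell" by (rule vol_pos[OF L])
  define W where "W = density lebesgue (\<lambda>x. ennreal (w x))"
  have W: "emeasure W S = (\<integral>\<^sup>+x\<in>S. w x \<partial>lebesgue)" if "S \<in> sets lebesgue" for S
    unfolding W_def by (rule density_subset[OF wm that])
  have Ws: "sets W = sets lebesgue" by (simp add: W_def)
  have fh: "(\<lambda>x. f x * indicator (nb L 1 Q0) x) = f" using f(3) by (auto simp: fun_eq_iff indicator_def)
  define Om where "Om = (\<Union>P\<in>{P. ennreal (vol L P) < mA f 1 (nb L 1 P)}. dy L P)"
  have Omm: "Om \<in> sets lebesgue" unfolding Om_def by (rule sets.countable_UN'[OF countableI_type]) (auto intro: nb_lebesgue)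
  obtain S lev where S: "\<forall>Q\<in>S. anc Q0 Q \<and> good L f (lev Q) Q"
    and car: "\<forall>F V. finite F \<longrightarrow> F \<subseteq> S \<longrightarrow> V \<in> sets lebesgue \<longrightarrow> (\<forall>Q\<in>F. dy L Q \<subseteq> V) \<longrightarrow>
          ennreal (\<Sum>Q\<in>F. vol L Q) \<le> 2 * emeasure lebesgue V"
    and dom: "AE x in lebesgue. x \<in> dy L Q0 \<longrightarrow> x \<notin> Om \<longrightarrow>
          (\<exists>F. finite F \<and> F \<subseteq> S \<and> (\<forall>P\<in>F. x \<in> dy L P) \<and> \<bar>T f x\<bar> \<le> 2 * CE * (\<Sum>P\<in>F. 1 / 2 ^ lev P))"
    using sparse_domination[OF L f(1,2) Q0] unfolding fh Om_def[symmetric] by blast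
  \<comment> \<open>All members of \<open>S\<close> lie in the bounded set \<open>dy L Q0\<close>,
    so bounding the generation leaves finitely many.\<close>
  define SJ where "SJ J = {Q \<in> S. fst Q \<le> J}" for J
  have SJf: "finite (SJ J)" for J
  proof (rule finite_subset)
    show "finite {q. fst q \<le> J \<and> dy L q \<inter> dy L Q0 \<noteq> {}}" by (rule finite_dy_meet[OF L bounded_nb[OF L]])
    show "SJ J \<subseteq> {q. fst q \<le> J \<and> dy L q \<inter> dy L Q0 \<noteq> {}}"
    proof
      fix Q assume Q: "Q \<in> SJ J"
      then have "dy L Q \<subseteq> dy L Q0" using S by (intro anc_nb_subset) (auto simp: SJ_def)
      then show "Q \<in> {q. fst q \<le> J \<and> dy L q \<inter> dy L Q0 \<noteq> {}}" using crn_mem[OF L, of Q] Q by (auto simp: SJ_def)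
    qed
  qed
  define h where "h J x = (\<Sum>Q\<in>SJ J. 1 / 2 ^ lev Q * indicator (dy L Q) x :: real)" for J x
  have hm: "h J \<in> borel_measurable lebesgue" for J
    unfolding h_def by (intro borel_measurable_sum borel_measurable_times borel_measurable_const borel_measurable_indicator dm)
  have hmono: "h I x \<le> h J x" if "I \<le> J" for I J x
    unfolding h_def using that by (intro sum_mono2 SJf) (auto simp: SJ_def)
  define G where "G J = dy L Q0 \<inter> {x \<in> space lebesgue. 2 * sig0 < h J x}" for J
  have Gm: "G J \<in> sets lebesgue" for J
    unfolding G_def by (intro sets.Int dm borel_measurable_less borel_measurable_const hm)
  have Gmono: "G I \<subseteq> G J" if "I \<le> J" for I J
    unfolding G_def using hmono[OF that] by (auto intro: less_le_trans)
  have GW: "emeasure W (G J) \<le> ennreal CB * (kappa A \<phi> * X)" for J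
  proof -
    define wG where "wG = (\<integral>\<^sup>+x\<in>G J. w x \<partial>lebesgue)"
    have fin: "wG < \<infinity>"
      unfolding wG_def by (rule weight_finite[OF w bounded_subset[OF bounded_nb[OF L, of 0 Q0]]]) (auto simp: G_def)
    have "ennreal (2 * sig0) * wG = (\<integral>\<^sup>+x. ennreal (2 * sig0) * (ennreal (w x) * indicator (G J) x) \<partial>lebesgue)"
      unfolding wG_def using Gm[of J] by (intro nn_integral_cmult[symmetric]) auto
    also have "\<dots> \<le> (\<integral>\<^sup>+x. (\<Sum>Q\<in>SJ J. ennreal (1 / 2 ^ lev Q) * (ennreal (w x) * indicator (dy L Q \<inter> G J) x)) \<partial>lebesgue)"
    proof (rule nn_integral_mono)
      fix x
      show "ennreal (2 * sig0) * (ennreal (w x) * indicator (G J) x) \<le> (\<Sum>Q\<in>SJ J. ennreal (1 / 2 ^ lev Q) * (ennreal (w x) * indicator (dy L Q \<inter> G J) x))"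
      proof (cases "x \<in> G J")
        case True
        then have "2 * sig0 \<le> h J x" by (simp add: G_def)
        then have "ennreal (2 * sig0) \<le> ennreal (h J x)" by (rule ennreal_leI)
        also have "\<dots> = (\<Sum>Q\<in>SJ J. ennreal (1 / 2 ^ lev Q * indicator (dy L Q) x))"
          unfolding h_def by (intro sum_ennreal[symmetric]) simp
        finally have "ennreal (2 * sig0) * ennreal (w x) \<le> (\<Sum>Q\<in>SJ J. ennreal (1 / 2 ^ lev Q * indicator (dy L Q) x)) * ennreal (w x)"
          by (rule mult_right_mono) simp
        also have "\<dots> = (\<Sum>Q\<in>SJ J. ennreal (1 / 2 ^ lev Q) * (ennreal (w x) * indicator (dy L Q \<inter> G J) x))"
          unfolding sum_distrib_right using True by (intro sum.cong) (auto simp: indicator_def)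
        finally show ?thesis using True by simp
      qed simp
    qed
    also have "\<dots> = (\<Sum>Q\<in>SJ J. \<integral>\<^sup>+x. ennreal (1 / 2 ^ lev Q) * (ennreal (w x) * indicator (dy L Q \<inter> G J) x) \<partial>lebesgue)"
      using Gm[of J] dm by (intro nn_integral_sum) auto
    also have "\<dots> = (\<Sum>Q\<in>SJ J. ennreal (1 / 2 ^ lev Q) * (\<integral>\<^sup>+x\<in>dy L Q \<inter> G J. w x \<partial>lebesgue))"
      using Gm[of J] dm by (intro sum.cong refl nn_integral_cmult) auto
    also have "\<dots> \<le> ennreal sig0 * wG + ennreal CB * (kappa A \<phi> * X)"
      unfolding wG_def X_def
    proof (rule finite_sparse_bound[OF L wm w0 \<phi> fm SJf _ _ Gm])
      show "good L f (lev Q) Q" if "Q \<in> SJ J" for Q using S that by (auto simp: SJ_def)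
      fix F' V assume F': "F' \<subseteq> SJ J" "V \<in> sets lebesgue" "\<And>Q. Q \<in> F' \<Longrightarrow> dy L Q \<subseteq> V"
      have "F' \<subseteq> S" using F'(1) by (auto simp: SJ_def)
      with F' show "ennreal (\<Sum>Q\<in>F'. vol L Q) \<le> 2 * emeasure lebesgue V"
        using car finite_subset[OF F'(1) SJf] by blast
    qed
    finally have *: "ennreal (2 * sig0) * wG \<le> ennreal sig0 * wG + ennreal CB * (kappa A \<phi> * X)" .
    obtain v where v: "0 \<le> v" "wG = ennreal v" using fin by (cases wG) auto
    \<comment> \<open>Absorption: half of the left side cancels the first term on the right, and the
      remaining coefficient \<open>sig0\<close> is at least 1.\<close>
    have "wG \<le> ennreal CB * (kappa A \<phi> * X)"
    proof (cases "ennreal CB * (kappa A \<phi> * X)")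
      case (real y)
      have "2 * sig0 * v \<le> sig0 * v + y"
        using * v real sig0_ge_1 by (simp add: ennreal_mult'[symmetric] ennreal_plus[symmetric] del: ennreal_plus)
      moreover have "1 * v \<le> sig0 * v" using sig0_ge_1 v by (intro mult_right_mono) auto
      ultimately have "v \<le> y" by simp
      then show ?thesis using real v by (simp add: ennreal_leI)
    qed simp
    then show ?thesis by (simp only: W[OF Gm] wG_def)
  qed
  have GU: "emeasure W (\<Union>J. G J) \<le> ennreal CB * (kappa A \<phi> * X)"
  proof (rule emeasure_UN_le_finite)
    fix I :: "nat set" assume I: "finite I"
    have "(\<Union>J\<in>I. G J) \<subseteq> G (Max I)" using Gmono I by (auto dest: Max_ge)
    then have "emeasure W (\<Union>J\<in>I. G J) \<le> emeasure W (G (Max I))" using Gm Ws by (intro emeasure_mono) auto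
    then show "emeasure W (\<Union>J\<in>I. G J) \<le> ennreal CB * (kappa A \<phi> * X)" using GW order_trans by blast
  qed (use Gm Ws in auto)
  have OmW: "emeasure W Om \<le> ennreal (2 * 9 ^ CARD('n) * (128 * exp 2)) * (kappa A \<phi> * X)"
  proof -
    \<comment> \<open>With this value the pigeonhole constant \<open>c * 3 ^ CARD('n)\<close> is 1,
      the threshold in the definition of \<open>Om\<close>.\<close>
    define c :: real where "c = 1 / 3 ^ CARD('n)"
    have c: "0 < c" by (simp add: c_def)
    define u where "u x = ennreal (A \<bar>f x\<bar>)" for x
    have um: "u \<in> borel_measurable lebesgue" unfolding u_def by measurable
    define M where "M = {P :: 'n cell. 0 \<le> fst P \<and> ennreal (c * vol L P) < (\<integral>\<^sup>+x\<in>dy L P. u x \<partial>lebesgue)}"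
    define C where "C = 2 * 3 ^ CARD('n) * \<phi>.Ai 1"
    have Ai1: "0 < \<phi>.Ai 1" by (rule \<phi>.Ai_pos) simp
    have C: "0 < C" using Ai1 by (simp add: C_def)
    have sub: "Om \<subseteq> (\<Union>P\<in>M. nb L 1 P)"
    proof
      fix x assume "x \<in> Om"
      then obtain R where R: "ennreal (vol L R) < mA f 1 (nb L 1 R)" "x \<in> dy L R" by (auto simp: Om_def)
      then have "ennreal (c * 3 ^ CARD('n) * vol L R) < (\<integral>\<^sup>+x\<in>nb L 1 R. u x \<partial>lebesgue)"
        by (simp add: mA_def u_def c_def)
      from neighbour_select[OF L c um this] obtain P where
        P: "P \<in> nbrs 1 R" "ennreal (c * vol L P) < (\<integral>\<^sup>+x\<in>dy L P. u x \<partial>lebesgue)" by blast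
      then have "P \<in> M" by (simp add: M_def)
      moreover have "dy L R \<subseteq> nb L 1 P"
        unfolding nb_eq_UN_nbrs[of L 1 P] using nbrs_sym[OF P(1)] by blast
      ultimately show "x \<in> (\<Union>P\<in>M. nb L 1 P)" using R(2) by blast
    qed
    have "emeasure W Om \<le> (\<integral>\<^sup>+x\<in>(\<Union>P\<in>M. nb L 1 P). w x \<partial>lebesgue)"
      unfolding W[OF Omm] using sub by (intro nn_integral_mono) (auto split: split_indicator)
    also have "\<dots> \<le> ennreal (1 / c) * (\<integral>\<^sup>+x. u x * (ennreal C * maximal \<phi> w x) \<partial>lebesgue)"
      unfolding M_def
    proof (rule maximal_bound[OF L c um])
      fix P :: "'n cell" and x assume x: "x \<in> dy L P"
      have x1: "x \<in> nb L 1 P" using x nb_mono[of 0 1 L P] by auto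
      have e: "0 < 3 * edge L P" using edge_pos[OF L, of P] by simp
      \<comment> \<open>The small-set estimate is used with \<open>\<tau> = 1\<close> and the whole
        triple as the set.\<close>
      have "(\<integral>\<^sup>+y\<in>nb L 1 P. w y \<partial>lebesgue) \<le> ennreal (2 * (3 * edge L P) ^ CARD('n) * (\<phi>.Ai 1 / 1)) * luxemburg (\<lambda>t. ennreal (\<phi> t)) (cube (ctr L P) (3 * edge L P)) w"
      proof (rule \<phi>.weight_small_set[OF e wm w0 nb_lebesgue])
        show "nb L 1 P \<subseteq> cube (ctr L P) (3 * edge L P)" using nb_subset_cube[OF L, of 1 P] by simp
        show "emeasure lebesgue (nb L 1 P) \<le> ennreal ((3 * edge L P) ^ CARD('n) / 1)"
          using emeasure_nb_lebesgue[OF L, of 1 P] by (simp add: vol_def power_mult_distrib)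
      qed simp
      also have "\<dots> \<le> ennreal (2 * (3 * edge L P) ^ CARD('n) * (\<phi>.Ai 1 / 1)) * maximal \<phi> w x"
        by (intro mult_left_mono luxemburg_le_maximal[OF L x1]) simp
      also have "2 * (3 * edge L P) ^ CARD('n) * (\<phi>.Ai 1 / 1) = vol L P * C"
        by (simp add: C_def vol_def power_mult_distrib)
      also have "ennreal (vol L P * C) * maximal \<phi> w x = ennreal (vol L P) * (ennreal C * maximal \<phi> w x)"
        using vp[of P] by (simp add: ennreal_mult' mult.assoc)
      finally show "(\<integral>\<^sup>+y\<in>nb L 1 P. w y \<partial>lebesgue) \<le> ennreal (vol L P) * (ennreal C * maximal \<phi> w x)" .
    qed simp
    also have "\<dots> = ennreal (1 / c) * (\<integral>\<^sup>+x. ennreal C * (ennreal (A \<bar>f x\<bar>) * maximal \<phi> w x) \<partial>lebesgue)"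
      by (simp only: u_def mult.left_commute)
    also have "\<dots> \<le> ennreal (1 / c) * (ennreal C * X)"
      unfolding X_def by (intro mult_left_mono nn_integral_cmult_le C) simp
    also have "\<dots> = ennreal (2 * 9 ^ CARD('n)) * (ennreal (\<phi>.Ai 1) * X)"
    proof -
      have nine: "(9::real) ^ CARD('n) = 3 ^ CARD('n) * 3 ^ CARD('n)" by (simp add: power_mult_distrib[symmetric])
      have "ennreal (1 / c) * ennreal C = ennreal (1 / c * C)" by (rule ennreal_mult'[symmetric]) (use c in simp)
      also have "1 / c * C = 2 * 9 ^ CARD('n) * \<phi>.Ai 1" by (simp add: c_def C_def nine)
      also have "ennreal \<dots> = ennreal (2 * 9 ^ CARD('n)) * ennreal (\<phi>.Ai 1)" by (rule ennreal_mult') simp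
      finally show ?thesis by (simp only: mult.assoc[symmetric])
    qed
    also have "\<dots> \<le> ennreal (2 * 9 ^ CARD('n)) * ((ennreal (128 * exp 2) * kappa A \<phi>) * X)"
      by (intro mult_left_mono mult_right_mono inverse_at_1_le_kappa \<phi>) simp_all
    also have "\<dots> = ennreal (2 * 9 ^ CARD('n) * (128 * exp 2)) * (kappa A \<phi> * X)"
    proof -
      have "ennreal (2 * 9 ^ CARD('n) * (128 * exp 2)) = ennreal (2 * 9 ^ CARD('n)) * ennreal (128 * exp 2)" by (rule ennreal_mult') simp
      then show ?thesis by (simp only: mult.assoc)
    qed
    finally show ?thesis .
  qed
  have Em: "{x \<in> dy L Q0. LM < \<bar>T f x\<bar>} \<in> sets lebesgue" by (rule sets_T_gt[OF nf dm])
  have GUm: "(\<Union>J. G J) \<in> sets lebesgue" using Gm by blast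
  have "AE x in lebesgue. x \<in> {x \<in> dy L Q0. LM < \<bar>T f x\<bar>} \<longrightarrow> x \<in> Om \<union> (\<Union>J. G J)"
    using dom
  proof eventually_elim
    case (elim x)
    show ?case
    proof (intro impI, rule ccontr)
      assume x: "x \<in> {x \<in> dy L Q0. LM < \<bar>T f x\<bar>}" and no: "x \<notin> Om \<union> (\<Union>J. G J)"
      then obtain F where F: "finite F" "F \<subseteq> S" "\<forall>P\<in>F. x \<in> dy L P" "\<bar>T f x\<bar> \<le> 2 * CE * (\<Sum>P\<in>F. 1 / 2 ^ lev P)"
        using elim by blast
      define J where "J = Max (fst ` F)"
      have FJ: "F \<subseteq> SJ J"
      proof
        fix P assume "P \<in> F"
        then show "P \<in> SJ J" using F(1,2) by (auto simp: SJ_def J_def)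
      qed
      have "(\<Sum>P\<in>F. 1 / 2 ^ lev P) = (\<Sum>P\<in>F. 1 / 2 ^ lev P * indicator (dy L P) x :: real)"
        using F(3) by (intro sum.cong) auto
      also have "\<dots> \<le> h J x" unfolding h_def by (intro sum_mono2 SJf FJ) auto
      finally have hJ: "(\<Sum>P\<in>F. 1 / 2 ^ lev P) \<le> h J x" .
      have "x \<notin> G J" using no by blast
      then have "h J x \<le> 2 * sig0" using x by (auto simp: G_def)
      moreover have "0 \<le> 2 * CE" using CE_nonneg by simp
      ultimately have "2 * CE * (\<Sum>P\<in>F. 1 / 2 ^ lev P) \<le> 2 * CE * (2 * sig0)" using hJ by (intro mult_left_mono) auto
      then show False using F(4) x unfolding LM_def mem_Collect_eq by linarith
    qed
  qed
  then have "(\<integral>\<^sup>+x\<in>{x \<in> dy L Q0. LM < \<bar>T f x\<bar>}. w x \<partial>lebesgue) \<le> (\<integral>\<^sup>+x\<in>Om \<union> (\<Union>J. G J). w x \<partial>lebesgue)"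
    by (intro nn_integral_mono_AE) (auto elim!: eventually_mono split: split_indicator)
  also have "\<dots> = emeasure W (Om \<union> (\<Union>J. G J))" using Omm GUm by (intro W[symmetric] sets.Un)
  also have "\<dots> \<le> emeasure W Om + emeasure W (\<Union>J. G J)" using Omm GUm Ws by (intro emeasure_subadditive) auto
  also have "\<dots> \<le> ennreal (2 * 9 ^ CARD('n) * (128 * exp 2)) * (kappa A \<phi> * X) + ennreal CB * (kappa A \<phi> * X)"
    by (intro add_mono OmW GU)
  also have "\<dots> = ennreal CF * (kappa A \<phi> * X)"
    unfolding distrib_right[symmetric] by (subst ennreal_plus[symmetric]) (simp_all add: CF_def CB_def add.commute)
  finally show ?thesis by (simp only: X_def)
qed

text \<open>For large \<open>L\<close> each of the \<open>2 ^ CARD('n)\<close> cells of generation 0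
  at the origin has the support of \<open>f\<close> in its triple. The mass condition at scale 1
  holds as well, since the total mass \<open>I\<close> is at most \<open>L\<close> and
  \<open>L \<le> L ^ CARD('n)\<close> for \<open>L \<ge> 1\<close>. The bound is the same for all
  \<open>L\<close>, so it survives the exhaustion of space by the sets \<open>E N\<close>.\<close>

lemma global_bound:
  assumes w: "weight w" and \<phi>: "young \<phi>"
    and f: "continuous_on UNIV f" "bounded {x. f x \<noteq> 0}"
  shows "(\<integral>\<^sup>+x\<in>{x. LM < \<bar>T f x\<bar>}. w x \<partial>lebesgue)
    \<le> ennreal (2 ^ CARD('n) * CF) * (kappa A \<phi> * (\<integral>\<^sup>+x. ennreal (A \<bar>f x\<bar>) * maximal \<phi> w x \<partial>lebesgue))"
proof -
  define Y where "Y = kappa A \<phi> * (\<integral>\<^sup>+x. ennreal (A \<bar>f x\<bar>) * maximal \<phi> w x \<partial>lebesgue)"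
  have nf: "nice f" by (rule continuous_cc_nice[OF f])
  then obtain M where M: "\<And>x. \<bar>f x\<bar> \<le> M" unfolding nice_def by blast
  have fm [measurable]: "f \<in> borel_measurable lebesgue" using nf by (simp add: nice_def)
  have wm: "w \<in> borel_measurable lebesgue" by (rule weight_measurable[OF w])
  define W where "W = density lebesgue (\<lambda>x. ennreal (w x))"
  have W: "emeasure W S = (\<integral>\<^sup>+x\<in>S. w x \<partial>lebesgue)" if "S \<in> sets lebesgue" for S
    unfolding W_def by (rule density_subset[OF wm that])
  have Ws: "sets W = sets lebesgue" by (simp add: W_def)
  have nA: "nice (\<lambda>x. A \<bar>1 * f x\<bar>)"
  proof (rule niceI[OF _ _ f(2)])
    show "(\<lambda>x. A \<bar>1 * f x\<bar>) \<in> borel_measurable lebesgue" by measurable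
    show "\<bar>A \<bar>1 * f x\<bar>\<bar> \<le> A M" for x using A_mono[OF _ M[of x]] A_nonneg[of "\<bar>f x\<bar>"] by simp
  qed simp
  define I where "I = (LINT x|lebesgue. A \<bar>1 * f x\<bar>)"
  have I: "mA f 1 S \<le> ennreal I" for S
  proof -
    have "mA f 1 S \<le> (\<integral>\<^sup>+x. ennreal (A \<bar>1 * f x\<bar>) \<partial>lebesgue)"
      unfolding mA_def by (intro nn_integral_mono) (auto split: split_indicator)
    also have "\<dots> = ennreal I"
      unfolding I_def by (intro nn_integral_eq_integral nice_integrable nA AE_I2 A_nonneg) simp
    finally show ?thesis .
  qed
  obtain R where R0: "\<forall>x\<in>{x. f x \<noteq> 0}. norm x \<le> R" using f(2) unfolding bounded_iff by blast
  have R: "\<bar>x $ i\<bar> \<le> R" if "f x \<noteq> 0" for x i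
    using R0 that component_le_norm_cart[of x i] by force
  obtain N0 :: nat where N0: "max (max I (R + 1)) 1 \<le> N0" using real_arch_simple by blast
  \<comment> \<open>For every \<open>L\<close> above the size of the support, the indices of the
    cells of generation 0 that meet the support lie in this set. Any two of its members differ by at
    most 1 in each coordinate, so each triple contains the support.\<close>
  define Z where "Z = {m :: int ^ 'n. \<forall>i. m $ i \<in> {-1, 0}}"
  have fZ: "finite Z" unfolding Z_def by (rule finite_vec_set) simp
  have cZ: "card Z = 2 ^ CARD('n)" unfolding Z_def card_vec_set by (simp add: numeral_2_eq_2)
  define E where "E N = {x :: real ^ 'n. \<forall>i. \<bar>x $ i\<bar> < real (N + N0)} \<inter> {x \<in> UNIV. LM < \<bar>T f x\<bar>}" for N
  have Em: "E N \<in> sets lebesgue" for N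
  proof -
    have [measurable]: "(\<lambda>x :: real ^ 'n. x $ i) \<in> borel_measurable borel" for i
      by (intro borel_measurable_continuous_onI continuous_intros)
    have "{x :: real ^ 'n. \<forall>i. \<bar>x $ i\<bar> < real (N + N0)} = (\<Inter>i. {x \<in> space borel. \<bar>x $ i\<bar> < real (N + N0)})" by auto
    moreover have "(\<Inter>i. {x \<in> space borel. \<bar>x $ i\<bar> < real (N + N0)}) \<in> sets (borel :: (real ^ 'n) measure)"
      by (intro sets.finite_INT) auto
    ultimately have "{x :: real ^ 'n. \<forall>i. \<bar>x $ i\<bar> < real (N + N0)} \<in> sets lebesgue" by simp
    then show ?thesis unfolding E_def by (intro sets.Int sets_T_gt[OF nf]) auto
  qed
  have EW: "emeasure W (E N) \<le> ennreal (2 ^ CARD('n) * CF) * Y" for N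
  proof -
    define L where "L = real (N + N0)"
    have L: "1 \<le> L" "I \<le> L" "R < L" using N0 by (auto simp: L_def)
    then have L0: "0 < L" by simp
    have small: "\<lfloor>t / L\<rfloor> = -1 \<or> \<lfloor>t / L\<rfloor> = 0" if "\<bar>t\<bar> < L" for t
    proof -
      have "-1 \<le> t / L" "t / L < 1" using that L0 by (auto simp: field_simps abs_less_iff)
      then show ?thesis by linarith
    qed
    define D where "D m = {x \<in> dy L (0, m). LM < \<bar>T f x\<bar>}" for m :: "int ^ 'n"
    have Dm: "D m \<in> sets lebesgue" for m unfolding D_def by (rule sets_T_gt[OF nf nb_lebesgue])
    have sub: "E N \<subseteq> (\<Union>m\<in>Z. D m)"
    proof
      fix x assume x: "x \<in> E N"
      define m where "m = snd (idx L 0 x)"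
      have "m \<in> Z" using x small by (auto simp: m_def Z_def idx_def E_def L_def)
      moreover have "idx L 0 x = (0, m)" by (simp add: m_def prod_eq_iff)
      then have "x \<in> dy L (0, m)" using mem_dy_idx[of x L 0] by simp
      ultimately show "x \<in> (\<Union>m\<in>Z. D m)" using x by (auto simp: D_def E_def)
    qed
    have "emeasure W (E N) \<le> emeasure W (\<Union>m\<in>Z. D m)" using sub Dm fZ Ws by (intro emeasure_mono) auto
    also have "\<dots> \<le> (\<Sum>m\<in>Z. emeasure W (D m))" using Dm fZ Ws by (intro emeasure_subadditive_finite) auto
    also have "\<dots> \<le> (\<Sum>m\<in>Z. ennreal CF * Y)"
    proof (rule sum_mono)
      fix m assume m: "m \<in> Z"
      have s: "{x. f x \<noteq> 0} \<subseteq> nb L 1 (0, m)"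
      proof
        fix x assume "x \<in> {x. f x \<noteq> 0}"
        then have "\<bar>x $ i\<bar> < L" for i using R[of x i] L(3) by simp
        then have fl: "\<lfloor>x $ i / L\<rfloor> = -1 \<or> \<lfloor>x $ i / L\<rfloor> = 0" for i by (rule small)
        have "\<bar>\<lfloor>x $ i / L\<rfloor> - m $ i\<bar> \<le> 1" for i
        proof -
          have "m $ i = -1 \<or> m $ i = 0" using m by (simp add: Z_def)
          then show ?thesis using fl[of i] by auto
        qed
        then show "x \<in> nb L 1 (0, m)" by (simp add: nb_def)
      qed
      have "mA f 1 (nb L 1 (0, m)) \<le> ennreal (vol L (0, m))"
      proof (rule order_trans[OF I ennreal_leI])
        have "L ^ 1 \<le> L ^ CARD('n)" using L(1) by (intro power_increasing) auto
        then show "I \<le> vol L (0, m)" using L(2) by (simp add: vol_def edge_def)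
      qed
      from local_bound[OF L0 w \<phi> f s this] show "emeasure W (D m) \<le> ennreal CF * Y"
        unfolding W[OF Dm] by (simp only: D_def Y_def)
    qed
    also have "\<dots> = ennreal (2 ^ CARD('n)) * (ennreal CF * Y)"
      by (simp add: cZ ennreal_of_nat_eq_real_of_nat)
    also have "\<dots> = ennreal (2 ^ CARD('n) * CF) * Y" by (simp add: ennreal_mult' mult.assoc)
    finally show ?thesis .
  qed
  have "{x. LM < \<bar>T f x\<bar>} = (\<Union>N. E N)"
  proof (intro set_eqI iffI)
    fix x assume x: "x \<in> {x. LM < \<bar>T f x\<bar>}"
    obtain N :: nat where "norm x < N" using reals_Archimedean2 by blast
    then have "\<bar>x $ i\<bar> < real (N + N0)" for i using component_le_norm_cart[of x i] by simp
    then show "x \<in> (\<Union>N. E N)" using x by (auto simp: E_def)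
  qed (auto simp: E_def)
  then have "(\<integral>\<^sup>+x\<in>{x. LM < \<bar>T f x\<bar>}. w x \<partial>lebesgue) = emeasure W (\<Union>N. E N)"
    using Em by (subst W) auto
  also have "\<dots> \<le> ennreal (2 ^ CARD('n) * CF) * Y"
  proof (rule emeasure_UN_le_finite)
    fix J :: "nat set" assume J: "finite J"
    have "(\<Union>N\<in>J. E N) \<subseteq> E (Max J)"
    proof
      fix x assume "x \<in> (\<Union>N\<in>J. E N)"
      then obtain N where N: "N \<in> J" "x \<in> E N" by blast
      have "real (N + N0) \<le> real (Max J + N0)" using J N(1) by simp
      then show "x \<in> E (Max J)" using N(2) unfolding E_def by (auto intro: less_le_trans)
    qed
    then have "emeasure W (\<Union>N\<in>J. E N) \<le> emeasure W (E (Max J))" using Em Ws by (intro emeasure_mono) auto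
    then show "emeasure W (\<Union>N\<in>J. E N) \<le> ennreal (2 ^ CARD('n) * CF) * Y" using EW order_trans by blast
  qed (use Em Ws in auto)
  finally show ?thesis by (simp only: Y_def)
qed

end

section \<open>Extraction of constants and scaling\<close>

lemma hormander_operator_hoermander:
  fixes T :: "(real ^ 'n \<Rightarrow> real) \<Rightarrow> real ^ 'n \<Rightarrow> real"
  assumes A: "young_function A" "submultiplicative A" and T: "hormander_operator (complementary A) T"
  shows "\<exists>K H B cK. hoermander A T K H B cK"
proof -
  have lin: "bounded_linear_L2 T" using T by (simp add: hormander_operator_def)
  obtain K where K: "hormander_kernel (complementary A) K"
    "\<forall>f\<in>Cc_infinity. AE x in lebesgue. x \<notin> supp f \<longrightarrow> T f x = (LINT y|lebesgue. K x y * f y)"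
    using T unfolding hormander_operator_def by blast
  obtain B0 where B0: "\<forall>f\<in>L2. (LINT x|lebesgue. (T f x)\<^sup>2) \<le> B0 * (LINT x|lebesgue. (f x)\<^sup>2)"
    using lin unfolding bounded_linear_L2_def by blast
  obtain c0 where c0: "\<forall>x y. x \<noteq> y \<longrightarrow> \<bar>K x y\<bar> \<le> c0 / norm (x - y) ^ CARD('n)"
    using K(1) unfolding hormander_kernel_def by blast
  have "hormander_const (complementary A) K < \<infinity>" using K(1) unfolding hormander_kernel_def by blast
  then obtain H where H: "0 \<le> H" "hormander_const (complementary A) K = ennreal H"
    by (cases "hormander_const (complementary A) K") auto
  have "hoermander A T K H (max 0 B0) (max 0 c0)"
  proof
    show "young_function A" by fact
    show "A (x * y) \<le> A x * A y" if "0 \<le> x" "0 \<le> y" for x y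
      using A(2) that by (simp add: submultiplicative_def)
    show "T f \<in> L2" if "f \<in> L2" for f using lin that unfolding bounded_linear_L2_def by blast
    show "AE x in lebesgue. T (\<lambda>y. a * f y + b * g y) x = a * T f x + b * T g x" if "f \<in> L2" "g \<in> L2" for f g a b
      using lin that unfolding bounded_linear_L2_def by blast
    show "(LINT x|lebesgue. (T f x)\<^sup>2) \<le> max 0 B0 * (LINT x|lebesgue. (f x)\<^sup>2)" if "f \<in> L2" for f
    proof -
      have "B0 * (LINT x|lebesgue. (f x)\<^sup>2) \<le> max 0 B0 * (LINT x|lebesgue. (f x)\<^sup>2)" by (intro mult_right_mono) auto
      then show ?thesis using B0 that by (meson order_trans)
    qed
    show "set_integrable lebesgue C (\<lambda>(x, y). K x y)" if "compact C" "C \<subseteq> {(x, y). x \<noteq> y}" for C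
      using K(1) that unfolding hormander_kernel_def by blast
    show "(\<lambda>y. K x y) \<in> borel_measurable lebesgue" "(\<lambda>y. K y x) \<in> borel_measurable lebesgue" for x
      using K(1) unfolding hormander_kernel_def by blast+
    show "\<bar>K x y\<bar> \<le> max 0 c0 / norm (x - y) ^ CARD('n)" if "x \<noteq> y" for x y
    proof -
      have "c0 / norm (x - y) ^ CARD('n) \<le> max 0 c0 / norm (x - y) ^ CARD('n)" by (intro divide_right_mono) auto
      then show ?thesis using c0 that by (meson order_trans)
    qed
    show "hormander_const1 (complementary A) K \<le> ennreal H"
      "hormander_const1 (complementary A) (\<lambda>x y. K y x) \<le> ennreal H"
      unfolding H(2)[symmetric] hormander_const_def by simp_all
    show "AE x in lebesgue. x \<notin> supp f \<longrightarrow> T f x = (LINT y|lebesgue. K x y * f y)" if "f \<in> Cc_infinity" for f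
      using K(2) that by blast
  qed (use H in auto)
  then show ?thesis by blast
qed

theorem theorem2p6:
  fixes A :: "real \<Rightarrow> real" and p0 p1 :: real
    and T :: "(real ^ 'n \<Rightarrow> real) \<Rightarrow> real ^ 'n \<Rightarrow> real"
  assumes "1 \<le> p0" and "p0 \<le> p1"
    and "young_function A" and "A \<in> class_Y p0 p1"
    and "submultiplicative A"
    and "hormander_operator (complementary A) T"
  shows "\<exists>c::real. 0 \<le> c \<and>
    (\<forall>(w :: real ^ 'n \<Rightarrow> real) (\<phi> :: real \<Rightarrow> real) (lam :: real) (f :: real ^ 'n \<Rightarrow> real).
       weight w \<longrightarrow> young_function \<phi> \<longrightarrow> 0 < lam \<longrightarrow> f \<in> Cc_infinity \<longrightarrow>
       (\<integral>\<^sup>+ x\<in>{x. T f x > lam}. ennreal (w x) \<partial>lebesgue)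
         \<le> ennreal c * kappa A \<phi> *
           (\<integral>\<^sup>+ x. ennreal (A (\<bar>f x\<bar> / lam)) * maximal \<phi> w x \<partial>lebesgue))"
proof -
  obtain K H B cK where hoe: "hoermander A T K H B cK"
    using hormander_operator_hoermander[OF assms(3,5,6)] by blast
  interpret hoermander A T K H B cK by (rule hoe)
  \<comment> \<open>The function is multiplied by \<open>\<Lambda> / lam\<close> to move the height
    \<open>lam\<close> above \<open>LM\<close>; submultiplicativity returns to
    \<open>|f| / lam\<close> at the cost of \<open>A \<Lambda>\<close>. The summand 1 keeps
    \<Lambda> positive.\<close>
  define \<Lambda> where "\<Lambda> = \<bar>LM\<bar> + 1"
  have \<Lambda>: "0 < \<Lambda>" "LM \<le> \<Lambda>" by (simp_all add: \<Lambda>_def)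
  have CF: "0 \<le> CF" by (simp add: CF_def CB_def)
  show ?thesis
  proof (intro exI[of _ "2 ^ CARD('n) * CF * A \<Lambda>"] conjI allI impI)
    show "0 \<le> 2 ^ CARD('n) * CF * A \<Lambda>" using CF A_nonneg \<Lambda> by simp
    fix w :: "real ^ 'n \<Rightarrow> real" and \<phi> :: "real \<Rightarrow> real" and lam :: real and f :: "real ^ 'n \<Rightarrow> real"
    assume w: "weight w" and \<phi>: "young_function \<phi>" and lam: "0 < lam" and f: "f \<in> Cc_infinity"
    have \<phi>': "young \<phi>" using \<phi> by (simp add: young_def)
    have cf: "continuous_on UNIV f"
      using f C_k.simps(1)[of f] unfolding Cc_infinity_def by blast
    have bf: "bounded {x. f x \<noteq> 0}"
    proof (rule bounded_subset)
      show "bounded (supp f)" using f by (auto simp: Cc_infinity_def compact_imp_bounded)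
      show "{x. f x \<noteq> 0} \<subseteq> supp f" unfolding supp_def support_on_def using closure_subset[of "{x \<in> UNIV. f x \<noteq> 0}"] by auto
    qed
    define g where "g x = \<Lambda> / lam * f x" for x
    have cg: "continuous_on UNIV g" unfolding g_def by (intro continuous_intros cf)
    have bg: "bounded {x. g x \<noteq> 0}" by (rule bounded_subset[OF bf]) (auto simp: g_def)
    have "AE x in lebesgue. T g x = \<Lambda> / lam * T f x"
      unfolding g_def by (rule T_cmult[OF continuous_cc_nice[OF cf bf]])
    then have "AE x in lebesgue. ennreal (w x) * indicator {x. T f x > lam} x \<le> ennreal (w x) * indicator {x. LM < \<bar>T g x\<bar>} x"
    proof eventually_elim
      case (elim x)
      show ?case
      proof (cases "T f x > lam")
        case True
        have "\<Lambda> / lam * lam < \<Lambda> / lam * T f x" using lam \<Lambda>(1) True by (intro mult_strict_left_mono) auto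
        then have "\<Lambda> < T g x" using elim lam by simp
        then have "LM < \<bar>T g x\<bar>" using \<Lambda>(2) by linarith
        then show ?thesis by (simp add: indicator_def)
      qed simp
    qed
    then have "(\<integral>\<^sup>+ x\<in>{x. T f x > lam}. ennreal (w x) \<partial>lebesgue) \<le> (\<integral>\<^sup>+ x\<in>{x. LM < \<bar>T g x\<bar>}. ennreal (w x) \<partial>lebesgue)"
      by (rule nn_integral_mono_AE)
    also have "\<dots> \<le> ennreal (2 ^ CARD('n) * CF) * (kappa A \<phi> * (\<integral>\<^sup>+x. ennreal (A \<bar>g x\<bar>) * maximal \<phi> w x \<partial>lebesgue))"
      by (rule global_bound[OF w \<phi>' cg bg])
    also have "\<dots> \<le> ennreal (2 ^ CARD('n) * CF) * (kappa A \<phi> * (ennreal (A \<Lambda>) * (\<integral>\<^sup>+x. ennreal (A (\<bar>f x\<bar> / lam)) * maximal \<phi> w x \<partial>lebesgue)))"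
    proof (intro mult_left_mono)
      have "(\<integral>\<^sup>+x. ennreal (A \<bar>g x\<bar>) * maximal \<phi> w x \<partial>lebesgue) \<le> (\<integral>\<^sup>+x. ennreal (A \<Lambda>) * (ennreal (A (\<bar>f x\<bar> / lam)) * maximal \<phi> w x) \<partial>lebesgue)"
      proof (rule nn_integral_mono)
        fix x
        have "\<bar>g x\<bar> = \<Lambda> * (\<bar>f x\<bar> / lam)" using \<Lambda> lam by (simp add: g_def abs_mult)
        then have "A \<bar>g x\<bar> \<le> A \<Lambda> * A (\<bar>f x\<bar> / lam)" using submult[of \<Lambda> "\<bar>f x\<bar> / lam"] \<Lambda> lam by simp
        then have "ennreal (A \<bar>g x\<bar>) \<le> ennreal (A \<Lambda>) * ennreal (A (\<bar>f x\<bar> / lam))"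
          using A_nonneg[of \<Lambda>] \<Lambda> by (simp add: ennreal_mult'[symmetric] ennreal_leI)
        then show "ennreal (A \<bar>g x\<bar>) * maximal \<phi> w x \<le> ennreal (A \<Lambda>) * (ennreal (A (\<bar>f x\<bar> / lam)) * maximal \<phi> w x)"
          unfolding mult.assoc[symmetric] by (rule mult_right_mono) simp
      qed
      also have "\<dots> \<le> ennreal (A \<Lambda>) * (\<integral>\<^sup>+x. ennreal (A (\<bar>f x\<bar> / lam)) * maximal \<phi> w x \<partial>lebesgue)"
        by (rule nn_integral_cmult_le[OF A_pos[OF \<Lambda>(1)]])
      finally show "(\<integral>\<^sup>+x. ennreal (A \<bar>g x\<bar>) * maximal \<phi> w x \<partial>lebesgue) \<le> ennreal (A \<Lambda>) * (\<integral>\<^sup>+x. ennreal (A (\<bar>f x\<bar> / lam)) * maximal \<phi> w x \<partial>lebesgue)" .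
    qed simp_all
    also have "\<dots> = ennreal (2 ^ CARD('n) * CF * A \<Lambda>) * kappa A \<phi> * (\<integral>\<^sup>+ x. ennreal (A (\<bar>f x\<bar> / lam)) * maximal \<phi> w x \<partial>lebesgue)"
    proof -
      have "0 \<le> 2 ^ CARD('n) * CF" using CF by simp
      from ennreal_mult'[OF this] have "ennreal (2 ^ CARD('n) * CF * A \<Lambda>) = ennreal (2 ^ CARD('n) * CF) * ennreal (A \<Lambda>)" .
      then show ?thesis by (simp only: mult_ac)
    qed
    finally show "(\<integral>\<^sup>+ x\<in>{x. T f x > lam}. ennreal (w x) \<partial>lebesgue)
         \<le> ennreal (2 ^ CARD('n) * CF * A \<Lambda>) * kappa A \<phi> *
           (\<integral>\<^sup>+ x. ennreal (A (\<bar>f x\<bar> / lam)) * maximal \<phi> w x \<partial>lebesgue)" .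
  qed
qed

end
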